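(* Let $n,r,t,m$ be positive integers with $mr\ge n$, and let $V$ be a bundle of rank $mr$ on $\mathbb{P}^n$ given by a general presentation of the form $$0\to V\to\mathcal{O}_{\mathbb{P}^n}^{m(t+r)}\to\mathcal{O}_{\mathbb{P}^n}(1)^{mt}\to 0.$$ Set $\alpha=\left\lceil\frac{tn}{r}\right\rceil$ and $\beta=\left\lfloor\frac{tn}{r}\right\rfloor$. If $$m\ \ge\ \max\left\{\frac{1}{4(t+r)}\binom{\alpha+n-1}{n}^2\binom{\alpha+n}{n},\ \frac{1}{4t}\binom{\beta+n-1}{n}^3\right\},$$ then $V$ has natural cohomology.
   Context: $\mathbb{P}^n$ is projective space over $\mathbb{C}$. A vector bundle $V$ on $\mathbb{P}^n$ has natural cohomology if for every integer $a$ the twist $V(a)$ has at most one nonvanishing cohomology group. "General" means: for every map in some nonempty Zariski open subset of $\operatorname{Hom}(\mathcal{O}_{\mathbb{P}^n}^{m(t+r)},\mathcal{O}_{\mathbb{P}^n}(1)^{mt})$. The condition $mr\ge n$ ensures the general such map is surjective, so that its kernel is a vector bundle. *)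

theory Defs
  imports "HOL-Analysis.Analysis" "HOL-Library.Poly_Mapping"
begin

section \<open>Polynomials, affine space and projective space over the complex numbers\<close>

text \<open>A polynomial in variables indexed by \<open>'i\<close> is a finitely supported function
  from monomials (finitely supported exponent vectors) to coefficients.\<close>

type_synonym 'i polynomial = "('i \<Rightarrow>\<^sub>0 nat) \<Rightarrow>\<^sub>0 complex"

definition eval_poly :: "'i polynomial \<Rightarrow> ('i \<Rightarrow> complex) \<Rightarrow> complex" where
  "eval_poly p x = (\<Sum>e\<in>Poly_Mapping.keys p.
     poly_mapping.lookup p e *
     (\<Prod>i\<in>Poly_Mapping.keys e. x i ^ poly_mapping.lookup e i))"

definition affine_space :: "'i set \<Rightarrow> ('i \<Rightarrow> complex) set" where
  "affine_space I = {x. \<forall>i. i \<notin> I \<longrightarrow> x i = 0}"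

text \<open>Variables outside \<open>I\<close> vanish identically on \<open>affine_space I\<close>, so it does no harm
  that they may occur in \<open>f\<close>.\<close>

definition zariski_affine :: "'i set \<Rightarrow> ('i \<Rightarrow> complex) topology" where
  "zariski_affine I = topology_generated_by
     {{x \<in> affine_space I. eval_poly f x \<noteq> 0} |f. True}"

type_synonym vec = "nat \<Rightarrow> complex"
type_synonym point = "vec set"

text \<open>Homogeneous polynomials of degree \<open>d\<close> in the coordinates \<open>x\<^sub>0, \<dots>, x\<^sub>n\<close>.\<close>

definition forms :: "nat \<Rightarrow> nat \<Rightarrow> nat polynomial set" where
  "forms n d = {p. \<forall>e\<in>Poly_Mapping.keys p.
     Poly_Mapping.keys e \<subseteq> {..n} \<and> (\<Sum>i\<in>Poly_Mapping.keys e. poly_mapping.lookup e i) = d}"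

text \<open>A point of projective space is a line in \<open>\<complex>\<^sup>n\<^sup>+\<^sup>1\<close> with the origin removed. Hence, for a
  set \<open>U\<close> of points, \<open>\<Union>U\<close> is the cone over \<open>U\<close>, i.e. its preimage in the punctured
  vector space.\<close>

definition proj_space :: "nat \<Rightarrow> point set" where
  "proj_space n =
     (\<lambda>x. {(\<lambda>i. c * x i) |c. c \<noteq> 0}) ` (affine_space {..n} - {\<lambda>_. 0})"

definition zariski_proj :: "nat \<Rightarrow> point topology" where
  "zariski_proj n = topology_generated_by
     {{L \<in> proj_space n. \<forall>x\<in>L. eval_poly f x \<noteq> 0} |f. \<exists>d. f \<in> forms n d}"


section \<open>The sheaves O(a) and maps between their direct sums\<close>

text \<open>Sections of \<open>O(a)\<close> over \<open>U\<close> are the regular functions on the cone over \<open>U\<close> that are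
  homogeneous of degree \<open>a\<close>: locally quotients of forms whose degrees differ by \<open>a\<close>.
  They are set to zero off the cone, so that equality of sections is equality of functions.\<close>

definition twist :: "nat \<Rightarrow> int \<Rightarrow> point set \<Rightarrow> (vec \<Rightarrow> complex) set" where
  "twist n a U = {s. (\<forall>x. x \<notin> \<Union>U \<longrightarrow> s x = 0) \<and>
     (\<forall>L\<in>U. \<exists>W. openin (zariski_proj n) W \<and> L \<in> W \<and> W \<subseteq> U \<and>
        (\<exists>d e. \<exists>p\<in>forms n d. \<exists>q\<in>forms n e. int d - int e = a \<and>
           (\<forall>x\<in>\<Union>W. eval_poly q x \<noteq> 0 \<and> s x = eval_poly p x / eval_poly q x)))}"

text \<open>In a section of \<open>O(a)\<^sup>N\<close>, the value at \<open>x\<close> is the vector of the \<open>N\<close> components,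
  padded by zeros.\<close>

type_synonym vsection = "vec \<Rightarrow> vec"
type_synonym vsheaf = "point set \<Rightarrow> vsection set"

definition twist_sum :: "nat \<Rightarrow> nat \<Rightarrow> int \<Rightarrow> vsheaf" where
  "twist_sum n N a U =
     {s. (\<forall>j<N. (\<lambda>x. s x j) \<in> twist n a U) \<and> (\<forall>j\<ge>N. \<forall>x. s x j = 0)}"

definition res :: "point set \<Rightarrow> vsection \<Rightarrow> vsection" where
  "res W s = (\<lambda>x j. if x \<in> \<Union>W then s x j else 0)"

text \<open>\<open>Hom(O\<^sup>A, O(1)\<^sup>B)\<close> is the space of \<open>B \<times> A\<close> matrices of linear forms, an affine space
  whose coordinate \<open>(i, j, k)\<close> is the coefficient of \<open>x\<^sub>k\<close> in the entry \<open>(i, j)\<close>. The same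
  matrix acts as the twisted map from \<open>O(a)\<^sup>A\<close> to \<open>O(a+1)\<^sup>B\<close>.\<close>

definition hom_coords :: "nat \<Rightarrow> nat \<Rightarrow> nat \<Rightarrow> (nat \<times> nat \<times> nat) set" where
  "hom_coords n A B = {..<B} \<times> {..<A} \<times> {..n}"

definition hom_apply ::
    "nat \<Rightarrow> nat \<Rightarrow> (nat \<times> nat \<times> nat \<Rightarrow> complex) \<Rightarrow> vsection \<Rightarrow> vsection" where
  "hom_apply n A \<phi> s = (\<lambda>x i. \<Sum>j<A. (\<Sum>k\<le>n. \<phi> (i, j, k) * x k) * s x j)"

text \<open>Surjectivity of the sheaf map \<open>O\<^sup>A \<rightarrow> O(1)\<^sup>B\<close>: sections lift locally.\<close>

definition hom_surjective ::
    "nat \<Rightarrow> nat \<Rightarrow> nat \<Rightarrow> (nat \<times> nat \<times> nat \<Rightarrow> complex) \<Rightarrow> bool" where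
  "hom_surjective n A B \<phi> \<longleftrightarrow>
     (\<forall>U. openin (zariski_proj n) U \<longrightarrow>
       (\<forall>s\<in>twist_sum n B 1 U. \<forall>L\<in>U. \<exists>W. openin (zariski_proj n) W \<and> L \<in> W \<and> W \<subseteq> U \<and>
          (\<exists>u\<in>twist_sum n A 0 W. hom_apply n A \<phi> u = res W s)))"

text \<open>For \<open>V\<close> the kernel of \<open>\<phi>\<close>, this is \<open>V(a)\<close>: as \<open>O(a)\<close> is locally free, twisting commutes
  with taking the kernel.\<close>

definition kernel_twist ::
    "nat \<Rightarrow> nat \<Rightarrow> (nat \<times> nat \<times> nat \<Rightarrow> complex) \<Rightarrow> int \<Rightarrow> vsheaf" where
  "kernel_twist n A \<phi> a U = {s \<in> twist_sum n A a U. hom_apply n A \<phi> s = (\<lambda>_ _. 0)}"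


section \<open>Sheaf cohomology\<close>

text \<open>Cohomology is defined as in Serre's "Faisceaux algebriques coherents": the direct limit,
  over all open covers ordered by refinement, of the Cech cohomology groups of the covers. For
  coherent sheaves on projective space it agrees with derived functor cohomology.
  A cochain assigns a section over the intersection to every list of \<open>p + 1\<close> members of the
  cover (no alternation condition), and is zero on all other lists.\<close>

definition simplices :: "point set set \<Rightarrow> nat \<Rightarrow> point set list set" where
  "simplices \<U> p = {\<sigma>. length \<sigma> = p + 1 \<and> set \<sigma> \<subseteq> \<U>}"

type_synonym cochain = "point set list \<Rightarrow> vsection"

definition zero_cochain :: cochain where
  "zero_cochain = (\<lambda>_ _ _. 0)"

definition cochains :: "vsheaf \<Rightarrow> point set set \<Rightarrow> nat \<Rightarrow> cochain set" where
  "cochains F \<U> p = {z. (\<forall>\<sigma>\<in>simplices \<U> p. z \<sigma> \<in> F (\<Inter>(set \<sigma>))) \<and>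
                        (\<forall>\<sigma>. \<sigma> \<notin> simplices \<U> p \<longrightarrow> z \<sigma> = (\<lambda>_ _. 0))}"

definition coboundary :: "point set set \<Rightarrow> nat \<Rightarrow> cochain \<Rightarrow> cochain" where
  "coboundary \<U> p z = (\<lambda>\<sigma>. if \<sigma> \<in> simplices \<U> (p + 1)
     then (\<lambda>x j. \<Sum>k\<le>p + 1. (- 1) ^ k * res (\<Inter>(set \<sigma>)) (z (take k \<sigma> @ drop (k + 1) \<sigma>)) x j)
     else (\<lambda>_ _. 0))"

definition cocycles :: "vsheaf \<Rightarrow> point set set \<Rightarrow> nat \<Rightarrow> cochain set" where
  "cocycles F \<U> p = {z \<in> cochains F \<U> p. coboundary \<U> p z = zero_cochain}"

fun coboundaries :: "vsheaf \<Rightarrow> point set set \<Rightarrow> nat \<Rightarrow> cochain set" where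
  "coboundaries F \<U> 0 = {zero_cochain}"
| "coboundaries F \<U> (Suc p) = coboundary \<U> p ` cochains F \<U> p"

definition open_cover :: "point topology \<Rightarrow> point set set \<Rightarrow> bool" where
  "open_cover X \<U> \<longleftrightarrow> (\<forall>U\<in>\<U>. openin X U) \<and> \<Union>\<U> = topspace X"

definition refines_by ::
    "(point set \<Rightarrow> point set) \<Rightarrow> point set set \<Rightarrow> point set set \<Rightarrow> bool" where
  "refines_by \<tau> \<W> \<U> \<longleftrightarrow> (\<forall>W\<in>\<W>. \<tau> W \<in> \<U> \<and> W \<subseteq> \<tau> W)"

definition pullback ::
    "(point set \<Rightarrow> point set) \<Rightarrow> point set set \<Rightarrow> nat \<Rightarrow> cochain \<Rightarrow> cochain" where
  "pullback \<tau> \<W> p z = (\<lambda>\<sigma>. if \<sigma> \<in> simplices \<W> p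
     then res (\<Inter>(set \<sigma>)) (z (map \<tau> \<sigma>)) else (\<lambda>_ _. 0))"

text \<open>Two cocycles on two covers represent the same class in the direct limit iff they become
  cohomologous on a common refinement.\<close>

definition cohomologous ::
    "point topology \<Rightarrow> vsheaf \<Rightarrow> nat \<Rightarrow>
     ((point set set \<times> cochain) \<times> (point set set \<times> cochain)) set" where
  "cohomologous X F p = {((\<U>, z), (\<U>', z')).
     open_cover X \<U> \<and> z \<in> cocycles F \<U> p \<and> open_cover X \<U>' \<and> z' \<in> cocycles F \<U>' p \<and>
     (\<exists>\<W> \<tau> \<tau>'. open_cover X \<W> \<and> refines_by \<tau> \<W> \<U> \<and> refines_by \<tau>' \<W> \<U>' \<and>
        (\<lambda>\<sigma> x j. pullback \<tau> \<W> p z \<sigma> x j - pullback \<tau>' \<W> p z' \<sigma> x j) \<in> coboundaries F \<W> p)}"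

definition cohomology ::
    "point topology \<Rightarrow> vsheaf \<Rightarrow> nat \<Rightarrow> (point set set \<times> cochain) set set" where
  "cohomology X F p =
     {(\<U>, z). open_cover X \<U> \<and> z \<in> cocycles F \<U> p} // cohomologous X F p"

text \<open>A cohomology group is nonvanishing iff it has more than one element. The argument \<open>V\<close> is
  the family of twists \<open>V(a)\<close> of a sheaf on projective \<open>n\<close>-space.\<close>

definition natural_cohomology :: "nat \<Rightarrow> (int \<Rightarrow> vsheaf) \<Rightarrow> bool" where
  "natural_cohomology n V \<longleftrightarrow>
     (\<forall>a p q. \<not> is_singleton (cohomology (zariski_proj n) (V a) p) \<and>
              \<not> is_singleton (cohomology (zariski_proj n) (V a) q) \<longrightarrow> p = q)"

end

theory Submission
  imports Defs
    "HOL-Computational_Algebra.Fraction_Field"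
    "HOL-Computational_Algebra.Fundamental_Theorem_Algebra"
    "HOL-Library.Countable_Set"
    "HOL-Library.Function_Algebras"
    "HOL-Library.Nat_Bijection"
begin

text \<open>Write \<open>S\<^sub>a\<close> for the forms of degree \<open>a\<close> and \<open>A = m (t + r)\<close>, \<open>B = m t\<close>. The long exact sequence
  of the presentation leaves only three groups of \<open>V(a)\<close> that may be nonzero: the kernel and the
  cokernel of \<open>S\<^sub>a\<^sup>A \<rightarrow> S\<^sub>a\<^sub>+\<^sub>1\<^sup>B\<close> in degrees 0 and 1, and the group of degree \<open>n\<close>, which vanishes
  for \<open>a \<ge> - n\<close>. So it suffices that all these maps have maximal rank, and this follows from
  surjectivity in degree \<open>\<alpha> - 1\<close> and injectivity in degree \<open>\<beta> - 1\<close>.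

  If the generic matrix had a kernel vector \<open>v\<close> in degree \<open>\<beta> - 1\<close>, differentiating the relation
  \<open>T v = 0\<close> along derivations of the field of rational functions in the entries would bound the
  number of independent entries that occur in it. With the leading monomials of the span of the
  components of \<open>v\<close> and the normalized matching property of monomials, this contradicts
  the lower bound for \<open>m\<close>. Surjectivity is the transposed argument.

  By the Nullstellensatz, sections over basic open sets are fractions. A covering by basic open sets
  is compared with the standard covering by their double complex, whose rows are exact by
  partitions of unity.\<close>

section \<open>Linear algebra\<close>

text \<open>Both terms of the bound on \<open>m\<close> come from one estimate. Let p, q be the
  dimensions of \<open>S\<^sub>a\<close> and \<open>S\<^sub>a\<^sub>+\<^sub>1\<close>, and l the
  dimension of the space spanned by the components of a kernel vector (by the contractions, in the
  transposed case). This space is not known in advance; its choice costs up to l(p - l) <= p^2/4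
  parameters, the source of the factor 1/4. Normalized matching is strict for 0 < l < p. Between
  integers this gains one unit, worth B in the inequality multiplied by p, or A in the transposed
  one multiplied by q. So the parameters are absorbed if p^3 <= 4 B, respectively p^2 q <= 4 A. A p
  - B q has the sign of r(a + 1) - t n, hence the roundings \<alpha> and \<beta> of t n / r. They
  differ by at most one, so a >= \<alpha> - 1 or a <= \<beta> - 1 for every integer a. On the
  geometric side, classes on arbitrary open covers must be killed, while explicit computation is
  tied to the standard covering. Finite coverings by basic open sets of positive degree mediate: any
  two covers have one as a common refinement.\<close>

lemma underdetermined_system:
  fixes M :: "'i \<Rightarrow> 'x \<Rightarrow> 'f::field"
  assumes "finite X" "finite I" "card X < card I"
  shows "\<exists>c. (\<exists>i\<in>I. c i \<noteq> 0) \<and> (\<forall>x\<in>X. (\<Sum>i\<in>I. c i * M i x) = 0)"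
  using assms
proof (induction X arbitrary: I M rule: finite_induct)
  case empty
  then have "I \<noteq> {}" by auto
  then show ?case by (intro exI[of _ "\<lambda>_. 1"]) auto
next
  case (insert x X)
  show ?case
  proof (cases "\<forall>i\<in>I. M i x = 0")
    case True
    then show ?thesis using insert.IH[of I M] insert.prems insert.hyps by force
  next
    case False
    then obtain i0 where i0: "i0 \<in> I" "M i0 x \<noteq> 0" by blast
    define I' where "I' = I - {i0}"
    have fin: "finite I'" and card: "card X < card I'"
      using insert i0 by (auto simp: I'_def card_Diff_singleton)
    define M' where "M' i y = M i y - M i x / M i0 x * M i0 y" for i y
    obtain c where c: "\<exists>i\<in>I'. c i \<noteq> 0" "\<forall>y\<in>X. (\<Sum>i\<in>I'. c i * M' i y) = 0"
      using insert.IH[OF fin card, of M'] by blast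
    define d where "d i = (if i = i0 then - (\<Sum>i\<in>I'. c i * M i x / M i0 x) else c i)" for i
    have sum: "(\<Sum>i\<in>I. d i * M i y) = (\<Sum>i\<in>I'. c i * M' i y)" for y
    proof -
      have "(\<Sum>i\<in>I. d i * M i y) = d i0 * M i0 y + (\<Sum>i\<in>I'. d i * M i y)"
        unfolding I'_def using insert.prems i0 by (simp add: sum.remove)
      also have "(\<Sum>i\<in>I'. d i * M i y) = (\<Sum>i\<in>I'. c i * M i y)"
        by (rule sum.cong) (auto simp: d_def I'_def)
      also have "d i0 * M i0 y = - (\<Sum>i\<in>I'. c i * (M i x / M i0 x * M i0 y))"
        by (simp add: d_def sum_distrib_right sum_distrib_left mult_ac)
      finally show ?thesis
        by (simp add: M'_def algebra_simps sum_subtractf)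
    qed
    have "(\<Sum>i\<in>I. d i * M i y) = 0" if "y \<in> insert x X" for y
    proof (cases "y = x")
      case True
      have "M' i x = 0" for i using i0 by (simp add: M'_def)
      then show ?thesis unfolding True sum by simp
    next
      case False
      then show ?thesis using that c unfolding sum by auto
    qed
    moreover have "\<exists>i\<in>I. d i \<noteq> 0" using c by (auto simp: d_def I'_def)
    ultimately show ?thesis by blast
  qed
qed

text \<open>The criterion behind the inversions of matrices below: a form \<open>b\<close> that is
  no combination of the rows is separated from them by a vector. The induction adds one row and
  corrects the separating vector.\<close>

lemma Fredholm_alternative:
  fixes R :: "'y \<Rightarrow> 'x \<Rightarrow> 'f::field"
  assumes "finite Y" "finite X"
  shows "(\<exists>L. \<forall>x\<in>X. b x = (\<Sum>y\<in>Y. L y * R y x)) \<or>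
    (\<exists>v. (\<forall>y\<in>Y. (\<Sum>x\<in>X. R y x * v x) = 0) \<and> (\<Sum>x\<in>X. b x * v x) \<noteq> 0)"
  using assms(1)
proof (induction Y arbitrary: b rule: finite_induct)
  case empty
  show ?case
  proof (cases "\<forall>x\<in>X. b x = 0")
    case False
    then obtain x where x: "x \<in> X" "b x \<noteq> 0" by blast
    then have "(\<Sum>x'\<in>X. b x' * (if x' = x then 1 else 0)) \<noteq> 0"
      using assms(2) by (simp add: if_distrib cong: if_cong)
    then show ?thesis by (intro disjI2 exI[of _ "\<lambda>x'. if x' = x then 1 else 0"]) auto
  qed auto
next
  case (insert y0 Y)
  define ip where "ip f v = (\<Sum>x\<in>X. f x * v x)" for f v :: "'x \<Rightarrow> 'f"
  have ip_diff: "ip (\<lambda>x. f x - s * g x) v = ip f v - s * ip g v"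
    and ip_diff': "ip f (\<lambda>x. v x - s * w x) = ip f v - s * ip f w" for f g v w s
    by (simp_all add: ip_def algebra_simps sum_subtractf sum_distrib_left)
  have lift: "\<exists>L'. \<forall>x\<in>X. b x = (\<Sum>y\<in>insert y0 Y. L' y * R y x)"
    if "\<forall>x\<in>X. b x - s * R y0 x = (\<Sum>y\<in>Y. L y * R y x)" for L s
  proof (intro exI[of _ "\<lambda>y. if y = y0 then s else L y"] ballI)
    fix x assume "x \<in> X"
    have "(\<Sum>y\<in>Y. (if y = y0 then s else L y) * R y x) = (\<Sum>y\<in>Y. L y * R y x)"
      using insert.hyps by (intro sum.cong) auto
    then show "b x = (\<Sum>y\<in>insert y0 Y. (if y = y0 then s else L y) * R y x)"
      using that \<open>x \<in> X\<close> insert.hyps by (simp add: algebra_simps)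
  qed
  show ?case
  proof (cases "\<exists>s L. \<forall>x\<in>X. b x - s * R y0 x = (\<Sum>y\<in>Y. L y * R y x)")
    case True
    then show ?thesis using lift by blast
  next
    case False
    then have no: "\<not> (\<exists>L. \<forall>x\<in>X. b x - s * R y0 x = (\<Sum>y\<in>Y. L y * R y x))" for s
      by blast
    obtain v where v: "\<forall>y\<in>Y. ip (R y) v = 0" "ip b v \<noteq> 0"
      using no[of 0] insert.IH[of b] unfolding ip_def by auto
    show ?thesis
    proof (cases "ip (R y0) v = 0")
      case True
      then show ?thesis using v unfolding ip_def by blast
    next
      case False
      \<comment> \<open>With this \<open>s\<close> the form \<open>b - s R y0\<close> kills
        \<open>v\<close>. Subtracting from \<open>v'\<close> the multiple of \<open>v\<close> that
        makes it orthogonal to \<open>R y0\<close> leaves the pairing with this form unchanged, and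
        on the result the form agrees with \<open>b\<close>.\<close>
      define s where "s = ip b v / ip (R y0) v"
      obtain v' where v': "\<forall>y\<in>Y. ip (R y) v' = 0" "ip (\<lambda>x. b x - s * R y0 x) v' \<noteq> 0"
        using no[of s] insert.IH[of "\<lambda>x. b x - s * R y0 x"] unfolding ip_def by auto
      define v'' where "v'' = (\<lambda>x. v' x - ip (R y0) v' / ip (R y0) v * v x)"
      have "ip (R y) v'' = 0" if "y \<in> insert y0 Y" for y
        using that v(1) v'(1) False unfolding v''_def ip_diff' by auto
      moreover have "ip b v'' \<noteq> 0"
        using v'(2) False unfolding v''_def ip_diff' ip_diff by (simp add: s_def mult.commute)
      ultimately show ?thesis unfolding ip_def by blast
    qed
  qed
qed

text \<open>A vector killed by all rows is zero: at its least nonzero coordinate \<open>m\<close>,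
  the row \<open>b m\<close> meets nothing but this coordinate. So for every target \<open>f\<close>
  the second case of the alternative is impossible.\<close>

lemma triangular_dual_family:
  fixes b :: "'x::linorder \<Rightarrow> 'x \<Rightarrow> 'f::field"
  assumes fin: "finite J"
    and diag: "\<And>c. c \<in> J \<Longrightarrow> b c c \<noteq> 0"
    and upper: "\<And>c e. c \<in> J \<Longrightarrow> e \<in> J \<Longrightarrow> c < e \<Longrightarrow> b c e = 0"
  shows "\<exists>L. \<forall>e\<in>J. f e = (\<Sum>c\<in>J. L c * b c e)"
proof -
  have False if v: "\<forall>c\<in>J. (\<Sum>e\<in>J. b c e * v e) = 0" "(\<Sum>e\<in>J. f e * v e) \<noteq> 0" for v
  proof -
    define K where "K = {e\<in>J. v e \<noteq> 0}"
    have K: "finite K" "K \<noteq> {}"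
      using fin that by (auto simp: K_def intro: sum.neutral)
    define m where "m = Min K"
    have m: "m \<in> J" "v m \<noteq> 0" using Min_in[OF K] by (auto simp: m_def K_def)
    have eq: "b m e * v e = (if e = m then b m m * v m else 0)" if e: "e \<in> J" for e
    proof (cases "e < m")
      case True
      then have "e \<notin> K" using K Min_le[of K e] by (auto simp: m_def)
      then show ?thesis using e True by (auto simp: K_def)
    next
      case False
      then show ?thesis using upper[OF m(1) e] by (cases "e = m") auto
    qed
    have "(\<Sum>e\<in>J. b m e * v e) = (\<Sum>e\<in>J. if e = m then b m m * v m else 0)"
      by (rule sum.cong[OF refl eq])
    then have "(\<Sum>e\<in>J. b m e * v e) = b m m * v m"
      using fin m by simp
    then show False using v m diag by auto
  qed
  then show ?thesis using Fredholm_alternative[OF fin fin, of f b] by blast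
qed

definition lincombs :: "'i set \<Rightarrow> ('i \<Rightarrow> 'x \<Rightarrow> 'f::field) \<Rightarrow> ('x \<Rightarrow> 'f) set" where
  "lincombs S g = {u. \<exists>c. u = (\<lambda>e. \<Sum>i\<in>S. c i * g i e)}"

lemma lincombsI: "u = (\<lambda>e. \<Sum>i\<in>S. c i * g i e) \<Longrightarrow> u \<in> lincombs S g"
  unfolding lincombs_def by auto

lemma lincombs_closed:
  fixes g :: "'i \<Rightarrow> 'x \<Rightarrow> 'f::field"
  shows "(\<And>k. k \<in> K \<Longrightarrow> u k \<in> lincombs S g) \<Longrightarrow> (\<lambda>e. \<Sum>k\<in>K. b k * u k e) \<in> lincombs S g"
    and "v \<in> lincombs S g \<Longrightarrow> w \<in> lincombs S g \<Longrightarrow> (\<lambda>e. v e - w e) \<in> lincombs S g"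
proof -
  assume "\<And>k. k \<in> K \<Longrightarrow> u k \<in> lincombs S g"
  then have "\<forall>k. \<exists>c. k \<in> K \<longrightarrow> u k = (\<lambda>e. \<Sum>i\<in>S. c i * g i e)"
    unfolding lincombs_def by blast
  then obtain c where c: "\<And>k. k \<in> K \<Longrightarrow> u k = (\<lambda>e. \<Sum>i\<in>S. c k i * g i e)" by metis
  have eq: "(\<Sum>k\<in>K. b k * u k e) = (\<Sum>i\<in>S. (\<Sum>k\<in>K. b k * c k i) * g i e)" for e
  proof -
    have "(\<Sum>k\<in>K. b k * u k e) = (\<Sum>k\<in>K. \<Sum>i\<in>S. b k * c k i * g i e)"
      by (rule sum.cong) (auto simp: c sum_distrib_left mult.assoc)
    also have "\<dots> = (\<Sum>i\<in>S. \<Sum>k\<in>K. b k * c k i * g i e)" by (rule sum.swap)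
    finally show ?thesis by (simp add: sum_distrib_right)
  qed
  have "(\<lambda>e. \<Sum>k\<in>K. b k * u k e) = (\<lambda>e. \<Sum>i\<in>S. (\<Sum>k\<in>K. b k * c k i) * g i e)"
    by (intro ext eq)
  then show "(\<lambda>e. \<Sum>k\<in>K. b k * u k e) \<in> lincombs S g" by (rule lincombsI)
next
  assume "v \<in> lincombs S g" "w \<in> lincombs S g"
  then obtain c c' where "v = (\<lambda>e. \<Sum>i\<in>S. c i * g i e)" "w = (\<lambda>e. \<Sum>i\<in>S. c' i * g i e)"
    unfolding lincombs_def by blast
  then have "(\<lambda>e. v e - w e) = (\<lambda>e. \<Sum>i\<in>S. (c i - c' i) * g i e)"
    by (simp add: left_diff_distrib sum_subtractf)
  then show "(\<lambda>e. v e - w e) \<in> lincombs S g" by (rule lincombsI)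
qed

lemma lincombs_mem:
  assumes "finite S" "i \<in> S"
  shows "g i \<in> lincombs S g"
  by (rule lincombsI[of _ "\<lambda>i'. if i' = i then 1 else 0"])
    (use assms in \<open>simp add: if_distrib[of "\<lambda>x. x * _"] cong: if_cong\<close>)

text \<open>For a space of polynomials, given by their coefficient functions, these are the leading
  monomials with respect to the linear order of the exponent vectors.\<close>

definition leads :: "('x::linorder \<Rightarrow> 'f::zero) set \<Rightarrow> 'x set" where
  "leads U = {e. \<exists>u\<in>U. u e \<noteq> 0 \<and> (\<forall>e'>e. u e' = 0)}"

text \<open>The reduced echelon form. Members of \<open>U\<close> leading at the elements of
  \<open>J\<close> form a triangular matrix on \<open>J\<close>; inverting it gives
  \<open>\<omega>\<close>. Since the leading index of a nonzero member lies in \<open>J\<close>, a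
  member that vanishes on \<open>J\<close> is zero, which yields the expansion. The entries of
  \<open>\<omega>\<close> off \<open>J\<close> are the \<open>card J * (card X - card J)\<close>
  parameters of the space \<open>U\<close>.\<close>

lemma reduced_basis:
  fixes g :: "'i \<Rightarrow> 'x::linorder \<Rightarrow> 'f::field"
  assumes X: "finite X" and g: "\<And>i e. i \<in> S \<Longrightarrow> e \<notin> X \<Longrightarrow> g i e = 0"
  defines "U \<equiv> lincombs S g"
  defines "J \<equiv> leads U"
  shows "J \<subseteq> X"
    and "\<exists>\<omega>. (\<forall>c\<in>J. \<omega> c \<in> U) \<and> (\<forall>c\<in>J. \<forall>e\<in>J. \<omega> c e = (if e = c then 1 else 0)) \<and>
      (\<forall>c\<in>J. \<forall>e>c. \<omega> c e = 0) \<and> (\<forall>u\<in>U. \<forall>e. u e = (\<Sum>c\<in>J. u c * \<omega> c e))"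
proof -
  have supp: "u e = 0" if "u \<in> U" "e \<notin> X" for u e
    using that g by (auto simp: U_def lincombs_def)
  have lincomb: "(\<lambda>e. \<Sum>k\<in>K. c k * u k e) \<in> U" if "\<And>k. k \<in> K \<Longrightarrow> u k \<in> U"
    for K :: "'x set" and u c
    unfolding U_def by (rule lincombs_closed(1)) (use that in \<open>simp add: U_def\<close>)
  have diff: "(\<lambda>e. u e - w e) \<in> U" if "u \<in> U" "w \<in> U" for u w
    using that unfolding U_def by (rule lincombs_closed(2))
  have JX: "J \<subseteq> X" using supp by (auto simp: J_def leads_def)
  then have finJ: "finite J" using X finite_subset by blast
  have lead: "\<exists>m\<in>J. u m \<noteq> 0 \<and> (\<forall>e>m. u e = 0)" if "u \<in> U" "u e0 \<noteq> 0" for u e0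
  proof -
    define K where "K = {e\<in>X. u e \<noteq> 0}"
    have K: "finite K" "K \<noteq> {}" using X that supp by (auto simp: K_def)
    have "u (Max K) \<noteq> 0" using Max_in[OF K] by (auto simp: K_def)
    moreover have "u e = 0" if "e > Max K" for e
      using that K supp[OF \<open>u \<in> U\<close>, of e] Max_ge[of K e] by (auto simp: K_def)
    ultimately show ?thesis using that unfolding J_def leads_def by blast
  qed
  obtain b where b: "\<And>c. c \<in> J \<Longrightarrow> b c \<in> U" "\<And>c. c \<in> J \<Longrightarrow> b c c \<noteq> 0"
    "\<And>c e. c \<in> J \<Longrightarrow> c < e \<Longrightarrow> b c e = 0"
  proof -
    have "\<forall>c. \<exists>u. c \<in> J \<longrightarrow> u \<in> U \<and> u c \<noteq> 0 \<and> (\<forall>e'>c. u e' = 0)"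
      by (auto simp: J_def leads_def)
    then show ?thesis using that by metis
  qed
  have "\<exists>L. \<forall>e\<in>J. (if e = c then 1 else 0) = (\<Sum>d\<in>J. L d * b d e)" for c
    using triangular_dual_family[of J b "\<lambda>e. if e = c then 1 else 0"] finJ b by blast
  then obtain L where L: "\<And>c e. e \<in> J \<Longrightarrow> (if e = c then 1 else 0) = (\<Sum>d\<in>J. L c d * b d e)"
    by metis
  define \<omega> where "\<omega> c e = (\<Sum>d\<in>J. L c d * b d e)" for c e
  have inU: "\<omega> c \<in> U" if "c \<in> J" for c
    unfolding \<omega>_def[abs_def] by (rule lincomb) (use b in auto)
  have delta: "\<omega> c e = (if e = c then 1 else 0)" if "c \<in> J" "e \<in> J" for c e
    using L[of e c] that by (simp add: \<omega>_def)
  have upper: "\<omega> c e = 0" if cJ: "c \<in> J" and ce: "c < e" for c e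
  proof (rule ccontr)
    assume "\<omega> c e \<noteq> 0"
    then obtain m where m: "m \<in> J" "\<omega> c m \<noteq> 0" "\<forall>e>m. \<omega> c e = 0"
      using lead[OF inU[OF cJ]] by blast
    then have "m = c" using delta[of c m] cJ by (auto split: if_splits)
    then show False using m ce \<open>\<omega> c e \<noteq> 0\<close> by auto
  qed
  have expand: "u e = (\<Sum>c\<in>J. u c * \<omega> c e)" if u: "u \<in> U" for u e
  proof (rule ccontr)
    define w where "w e = u e - (\<Sum>c\<in>J. u c * \<omega> c e)" for e
    assume "u e \<noteq> (\<Sum>c\<in>J. u c * \<omega> c e)"
    then have "w e \<noteq> 0" by (simp add: w_def)
    moreover have "w \<in> U"
      unfolding w_def[abs_def] by (intro diff u lincomb inU)
    ultimately obtain m where m: "m \<in> J" "w m \<noteq> 0" using lead by blast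
    have "(\<Sum>c\<in>J. u c * \<omega> c m) = (\<Sum>c\<in>J. if c = m then u m else 0)"
      by (rule sum.cong) (use m delta in auto)
    then show False using m finJ by (simp add: w_def)
  qed
  show "J \<subseteq> X" by (rule JX)
  show "\<exists>\<omega>. (\<forall>c\<in>J. \<omega> c \<in> U) \<and> (\<forall>c\<in>J. \<forall>e\<in>J. \<omega> c e = (if e = c then 1 else 0)) \<and>
      (\<forall>c\<in>J. \<forall>e>c. \<omega> c e = 0) \<and> (\<forall>u\<in>U. \<forall>e. u e = (\<Sum>c\<in>J. u c * \<omega> c e))"
    using inU delta upper expand by (intro exI[of _ \<omega>]) auto
qed

section \<open>Monomials\<close>

type_synonym monomial = "nat \<Rightarrow>\<^sub>0 nat"

definition xvar :: "nat \<Rightarrow> monomial" where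
  "xvar k = Poly_Mapping.single k 1"

lemma lookup_xvar [simp]: "poly_mapping.lookup (xvar k) i = (if i = k then 1 else 0)"
  by (auto simp: xvar_def lookup_single)

lemma keys_xvar [simp]: "Poly_Mapping.keys (xvar k) = {k}"
  by (simp add: xvar_def)

definition mons :: "nat \<Rightarrow> nat \<Rightarrow> monomial set" where
  "mons n d = {e. Poly_Mapping.keys e \<subseteq> {..n} \<and>
     (\<Sum>i\<in>Poly_Mapping.keys e. poly_mapping.lookup e i) = d}"

text \<open>The upper shadow of \<open>M\<close> in the divisibility order, that is, the monomials
  one degree higher in the ideal generated by \<open>M\<close>.\<close>

definition mons_upper :: "nat \<Rightarrow> monomial set \<Rightarrow> monomial set" where
  "mons_upper n M = (\<Union>k\<le>n. (\<lambda>e. e + xvar k) ` M)"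

lemma mons_iff:
  "e \<in> mons n d \<longleftrightarrow> Poly_Mapping.keys e \<subseteq> {..n} \<and> (\<Sum>i\<le>n. poly_mapping.lookup e i) = d"
proof -
  have "(\<Sum>i\<in>Poly_Mapping.keys e. poly_mapping.lookup e i) = (\<Sum>i\<le>n. poly_mapping.lookup e i)"
    if "Poly_Mapping.keys e \<subseteq> {..n}"
    by (rule sum.mono_neutral_left) (use that in \<open>auto simp: in_keys_iff\<close>)
  then show ?thesis by (auto simp: mons_def)
qed

lemma keys_add_nat [simp]:
  fixes e e' :: "'a \<Rightarrow>\<^sub>0 nat"
  shows "Poly_Mapping.keys (e + e') = Poly_Mapping.keys e \<union> Poly_Mapping.keys e'"
  by (auto simp: in_keys_iff lookup_add)

lemma mons_add:
  assumes "e \<in> mons n d" "e' \<in> mons n d'"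
  shows "e + e' \<in> mons n (d + d')"
  using assms by (auto simp: mons_iff lookup_add sum.distrib)

lemma xvar_in_mons: "k \<le> n \<Longrightarrow> xvar k \<in> mons n 1"
  by (auto simp: mons_def)

lemma mons_add_xvar: "e \<in> mons n d \<Longrightarrow> k \<le> n \<Longrightarrow> e + xvar k \<in> mons n (Suc d)"
  using mons_add[OF _ xvar_in_mons] by simp

lemma monomial_split:
  fixes e :: monomial
  assumes "poly_mapping.lookup e k > 0"
  shows "e = (e - xvar k) + xvar k"
  using assms by (intro poly_mapping_eqI) (auto simp: lookup_add lookup_minus)

lemma mons_remove_xvar:
  assumes "e \<in> mons n (Suc d)" "poly_mapping.lookup e k > 0"
  shows "e - xvar k \<in> mons n d" "k \<le> n"
proof -
  show k: "k \<le> n" using assms by (auto simp: mons_iff in_keys_iff subset_iff)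
  let ?e = "e - xvar k"
  have eq: "e = ?e + xvar k" using monomial_split[OF assms(2)] .
  have "Poly_Mapping.keys ?e \<subseteq> Poly_Mapping.keys e"
    by (auto simp: in_keys_iff lookup_minus)
  moreover have "(\<Sum>i\<le>n. poly_mapping.lookup e i) = (\<Sum>i\<le>n. poly_mapping.lookup ?e i) + 1"
    by (subst eq) (use k in \<open>simp add: lookup_add sum.distrib\<close>)
  ultimately show "?e \<in> mons n d" using assms by (auto simp: mons_iff)
qed

lemma mons_Suc_cases:
  assumes "e \<in> mons n (Suc d)"
  obtains k e' where "k \<le> n" "e' \<in> mons n d" "e = e' + xvar k"
proof -
  have "(\<Sum>i\<le>n. poly_mapping.lookup e i) \<noteq> 0" using assms by (auto simp: mons_iff)
  then obtain k where "poly_mapping.lookup e k > 0" by (metis not_gr_zero sum.neutral)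
  then show thesis using that mons_remove_xvar[OF assms] monomial_split by blast
qed

lemma mons_upper_subset: "M \<subseteq> mons n d \<Longrightarrow> mons_upper n M \<subseteq> mons n (Suc d)"
  unfolding mons_upper_def using mons_add_xvar by blast

lemma bij_betw_mons:
  "bij_betw (\<lambda>e. map (poly_mapping.lookup e) [0..<Suc n]) (mons n d)
     {l. length l = Suc n \<and> sum_list l = d}"
proof (rule bij_betwI')
  fix e e' assume e: "e \<in> mons n d" "e' \<in> mons n d"
  show "map (poly_mapping.lookup e) [0..<Suc n] = map (poly_mapping.lookup e') [0..<Suc n]
    \<longleftrightarrow> e = e'"
  proof
    assume eq: "map (poly_mapping.lookup e) [0..<Suc n] = map (poly_mapping.lookup e') [0..<Suc n]"
    show "e = e'"
    proof (rule poly_mapping_eqI)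
      fix i
      show "poly_mapping.lookup e i = poly_mapping.lookup e' i"
      proof (cases "i \<le> n")
        case True
        then show ?thesis using eq unfolding map_eq_conv by auto
      next
        case False
        then have "i \<notin> Poly_Mapping.keys e" "i \<notin> Poly_Mapping.keys e'"
          using e by (auto simp: mons_iff)
        then show ?thesis by (simp add: in_keys_iff)
      qed
    qed
  qed auto
next
  fix e assume "e \<in> mons n d"
  then show "map (poly_mapping.lookup e) [0..<Suc n] \<in> {l. length l = Suc n \<and> sum_list l = d}"
    by (auto simp: mons_iff interv_sum_list_conv_sum_set_nat atLeast0_lessThan_Suc atLeast0LessThan
      lessThan_Suc_atMost simp del: upt_Suc)
next
  fix l assume l: "l \<in> {l::nat list. length l = Suc n \<and> sum_list l = d}"
  define e where "e = Abs_poly_mapping (\<lambda>i. if i < Suc n then l ! i else 0)"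
  have look: "poly_mapping.lookup e i = (if i < Suc n then l ! i else 0)" for i
  proof -
    have "finite {i. (if i < Suc n then l ! i else 0) \<noteq> 0}"
      by (rule finite_subset[of _ "{..<Suc n}"]) auto
    then show ?thesis unfolding e_def by (subst lookup_Abs_poly_mapping) auto
  qed
  have "map (poly_mapping.lookup e) [0..<Suc n] = l"
    using l by (intro nth_equalityI) (auto simp: look simp del: upt_Suc)
  moreover have "e \<in> mons n d"
  proof -
    have "(\<Sum>i\<le>n. poly_mapping.lookup e i) = (\<Sum>i<length l. l ! i)"
      using l by (intro sum.cong) (auto simp: look)
    then show ?thesis
      using l by (auto simp: mons_iff in_keys_iff look sum_list_sum_nth atLeast0LessThan split: if_splits)
  qed
  ultimately show "\<exists>e\<in>mons n d. l = map (poly_mapping.lookup e) [0..<Suc n]" by metis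
qed

lemma card_mons: "card (mons n d) = (d + n) choose n"
proof -
  have "card (mons n d) = (d + Suc n - 1) choose d"
    using bij_betw_same_card[OF bij_betw_mons] card_length_sum_list[of "Suc n" d] by metis
  then show ?thesis using binomial_symmetric[of d "d + n"] by simp
qed

lemma finite_mons: "finite (mons n d)"
  by (rule card_ge_0_finite) (simp add: card_mons)

text \<open>Normalized matching for the poset of monomials: weighting the edge from \<open>e\<close> to
  \<open>e + x\<^sub>k\<close> by \<open>e\<^sub>k + 1\<close> makes the bipartite graph between two consecutive degrees biregular.
  Equality would force \<open>M\<close> and its complement to be closed under replacing one factor of a
  monomial by \<open>x\<^sub>0\<close>, so that both contain \<open>x\<^sub>0\<^sup>d\<close>.\<close>

lemma mons_pure_power_mem:
  assumes M: "M \<subseteq> mons n d" "M \<noteq> {}"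
    and closed: "\<And>e k. e + xvar k \<in> mons_upper n M \<Longrightarrow> k \<le> n \<Longrightarrow> e \<in> mons n d \<Longrightarrow> e \<in> M"
  shows "Poly_Mapping.single 0 d \<in> M"
proof -
  have fin: "finite M" using M finite_mons finite_subset by blast
  define m where "m = Max ((\<lambda>e. poly_mapping.lookup e 0) ` M)"
  have "m \<in> (\<lambda>e. poly_mapping.lookup e 0) ` M"
    unfolding m_def by (rule Max_in) (use M fin in auto)
  then obtain e where e: "e \<in> M" "poly_mapping.lookup e 0 = m" by blast
  have max: "poly_mapping.lookup e' 0 \<le> m" if "e' \<in> M" for e'
    using that fin by (auto simp: m_def intro: Max_ge)
  have zero: "poly_mapping.lookup e k = 0" if "k \<noteq> 0" for k
  proof (rule ccontr)
    assume "poly_mapping.lookup e k \<noteq> 0"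
    then have pos: "poly_mapping.lookup e k > 0" by simp
    have ed: "e \<in> mons n d" using e M by blast
    have dpos: "d > 0"
    proof (rule ccontr)
      assume "\<not> d > 0"
      moreover have "k \<le> n" using ed pos by (auto simp: mons_iff in_keys_iff subset_iff)
      ultimately have "poly_mapping.lookup e k = 0"
        using ed by (simp add: mons_iff)
      then show False using pos by simp
    qed
    then obtain d' where d': "d = Suc d'" using gr0_implies_Suc by blast
    \<comment> \<open>One factor \<open>x\<^sub>k\<close> is traded for \<open>x\<^sub>0\<close>.
      The product of \<open>e'\<close> with \<open>x\<^sub>k\<close> is that of \<open>e\<close>
      with \<open>x\<^sub>0\<close>, hence lies above \<open>M\<close>; closedness puts
      \<open>e'\<close> into \<open>M\<close>, against the maximality of the exponent of
      \<open>x\<^sub>0\<close> in \<open>e\<close>.\<close>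
    define e' where "e' = (e - xvar k) + xvar 0"
    have kn: "k \<le> n" and "e - xvar k \<in> mons n d'"
      using mons_remove_xvar[of e n d' k] ed pos d' by auto
    then have "e' \<in> mons n d" by (simp add: e'_def d' mons_add_xvar)
    moreover have "e' + xvar k = e + xvar 0"
      unfolding e'_def by (subst (2) monomial_split[OF pos]) (simp add: add_ac)
    then have "e' + xvar k \<in> mons_upper n M" using e by (auto simp: mons_upper_def)
    ultimately have "e' \<in> M" using closed kn by blast
    then have "poly_mapping.lookup e' 0 \<le> m" by (rule max)
    then show False using e that by (simp add: e'_def lookup_add lookup_minus)
  qed
  have "(\<Sum>i\<le>n. poly_mapping.lookup e i) = (\<Sum>i\<in>{0}. poly_mapping.lookup e i)"
    by (rule sum.mono_neutral_right) (auto simp: zero)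
  then have "poly_mapping.lookup e 0 = d" using e M by (auto simp: mons_iff)
  then have "e = Poly_Mapping.single 0 d"
    by (intro poly_mapping_eqI) (auto simp: lookup_single when_def zero)
  then show ?thesis using e by simp
qed

lemma card_mons_upper:
  assumes M: "M \<subseteq> mons n d" "M \<noteq> {}" "M \<noteq> mons n d"
  shows "(d + n + 1) * card M < (d + 1) * card (mons_upper n M)"
proof -
  define N where "N = mons_upper n M"
  have fin: "finite M" "finite N"
    using M mons_upper_subset[OF M(1)] finite_mons finite_subset unfolding N_def by blast+
  have N: "N \<subseteq> mons n (Suc d)" unfolding N_def by (rule mons_upper_subset[OF M(1)])
  define E where "E = M \<times> {..n}"
  define E' where "E' = {(f, k). f \<in> N \<and> k \<le> n \<and> poly_mapping.lookup f k > 0}"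
  have finE': "finite E'"
    by (rule finite_subset[of _ "N \<times> {..n}"]) (use fin in \<open>auto simp: E'_def\<close>)
  define g where "g = (\<lambda>(e, k). (e + xvar k, k))"
  have inj: "inj_on g E" by (auto simp: g_def inj_on_def)
  have img: "g ` E \<subseteq> E'"
    by (auto simp: g_def E_def E'_def N_def mons_upper_def lookup_add)
  have "(d + n + 1) * card M = (\<Sum>e\<in>M. \<Sum>k\<le>n. poly_mapping.lookup e k + 1)"
  proof -
    have "(\<Sum>k\<le>n. poly_mapping.lookup e k + 1) = d + n + 1" if "e \<in> M" for e
      using that M by (auto simp: mons_iff sum.distrib simp del: One_nat_def)
    then show ?thesis by simp
  qed
  also have "\<dots> = (\<Sum>(e, k)\<in>E. poly_mapping.lookup e k + 1)"
    unfolding E_def by (simp add: sum.cartesian_product)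
  also have "\<dots> = (\<Sum>(f, k)\<in>g ` E. poly_mapping.lookup f k)"
    by (subst sum.reindex[OF inj]) (auto simp: g_def lookup_add intro: sum.cong)
  also have "\<dots> < (\<Sum>(f, k)\<in>E'. poly_mapping.lookup f k)"
  proof -
    \<comment> \<open>If all edges below \<open>N\<close> started in \<open>M\<close>, no monomial
      of \<open>N\<close> would have a divisor in the complement of \<open>M\<close>. Then
      \<open>M\<close> and its complement would both satisfy the closedness condition and share the
      pure power.\<close>
    have "g ` E \<noteq> E'"
    proof
      assume eq: "g ` E = E'"
      have mem: "e \<in> M" if "e + xvar k \<in> N" "k \<le> n" for e k
      proof -
        have "(e + xvar k, k) \<in> E'" using that by (auto simp: E'_def lookup_add)
        then show ?thesis unfolding eq[symmetric] by (auto simp: g_def E_def)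
      qed
      have "Poly_Mapping.single 0 d \<in> M"
        by (rule mons_pure_power_mem[OF M(1,2)]) (use mem in \<open>auto simp: N_def\<close>)
      moreover have "Poly_Mapping.single 0 d \<in> mons n d - M"
      proof (rule mons_pure_power_mem)
        show "mons n d - M \<noteq> {}" using M by blast
        fix e k assume e: "e + xvar k \<in> mons_upper n (mons n d - M)" "k \<le> n" "e \<in> mons n d"
        then obtain e' k' where e': "e' \<in> mons n d - M" "k' \<le> n" "e + xvar k = e' + xvar k'"
          by (auto simp: mons_upper_def)
        show "e \<in> mons n d - M"
        proof (rule ccontr)
          assume "e \<notin> mons n d - M"
          then have "e \<in> M" using e by blast
          then have "e' + xvar k' \<in> N"
            unfolding e'(3)[symmetric] N_def mons_upper_def using e by blast
          then show False using mem e' by blast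
        qed
      qed auto
      ultimately show False by blast
    qed
    then obtain x where "x \<in> E' - g ` E" using img by blast
    then show ?thesis using finE' img
      by (intro sum_strict_mono2[of _ _ x]) (auto simp: E'_def)
  qed
  also have "\<dots> \<le> (\<Sum>(f, k)\<in>N \<times> {..n}. poly_mapping.lookup f k)"
    by (rule sum_mono2) (use fin in \<open>auto simp: E'_def\<close>)
  also have "\<dots> = (\<Sum>f\<in>N. \<Sum>k\<le>n. poly_mapping.lookup f k)"
    by (simp add: sum.cartesian_product)
  also have "\<dots> = (d + 1) * card N"
  proof -
    have "(\<Sum>k\<le>n. poly_mapping.lookup f k) = d + 1" if "f \<in> N" for f
      using that N by (auto simp: mons_iff)
    then show ?thesis by simp
  qed
  finally show ?thesis by (simp add: N_def)
qed

section \<open>Maximal rank of the generic matrix of linear forms\<close>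

definition derivation :: "('f::field \<Rightarrow> 'f) \<Rightarrow> bool" where
  "derivation d \<longleftrightarrow> (\<forall>a b. d (a + b) = d a + d b) \<and> (\<forall>a b. d (a * b) = d a * b + a * d b)"

lemma derivation_add: "derivation d \<Longrightarrow> d (a + b) = d a + d b"
  and derivation_mult: "derivation d \<Longrightarrow> d (a * b) = d a * b + a * d b"
  by (auto simp: derivation_def)

lemma derivation_zero [simp]: "derivation d \<Longrightarrow> d 0 = 0"
  using derivation_add[of d 0 0] by (metis add.right_neutral add_left_cancel)

lemma derivation_one [simp]: "derivation d \<Longrightarrow> d 1 = 0"
  using derivation_mult[of d 1 1] by (metis add.right_neutral add_left_cancel mult_1 mult_1_right)

lemma derivation_sum: "derivation d \<Longrightarrow> d (sum f S) = (\<Sum>x\<in>S. d (f x))"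
  by (induction S rule: infinite_finite_induct) (auto simp: derivation_add)

text \<open>Coefficients of the product of \<open>x\<^sub>k\<close> with the polynomial whose
  coefficient function is \<open>f\<close>. Plain functions are used because the coefficients range
  over an arbitrary field.\<close>

definition mulx :: "nat \<Rightarrow> (monomial \<Rightarrow> 'f::zero) \<Rightarrow> monomial \<Rightarrow> 'f" where
  "mulx k f e = (if poly_mapping.lookup e k > 0 then f (e - xvar k) else 0)"

lemma mulx_add_xvar [simp]: "mulx k f (e + xvar k) = f e"
  by (simp add: mulx_def lookup_add)

lemma mulx_sum:
  fixes f :: "'i \<Rightarrow> monomial \<Rightarrow> 'f::semiring_0"
  shows "mulx k (\<lambda>e. \<Sum>i\<in>S. c i * f i e) e' = (\<Sum>i\<in>S. c i * mulx k (f i) e')"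
  by (simp add: mulx_def)

text \<open>The tangent space argument. Let \<open>v\<close> be a kernel vector, \<open>U\<close> the row space of \<open>v\<close> and
  \<open>\<omega>\<close> its reduced basis, so that \<open>v\<^sub>j = \<Sum>\<^sub>c v\<^sub>j(c) \<omega>\<^sub>c\<close>. Differentiating \<open>T v = 0\<close> in the
  direction \<open>\<psi>\<close> of the matrix entries gives \<open>\<psi> v = - T (d v)\<close>, where \<open>d v\<close> depends linearly on
  the \<open>A |J|\<close> numbers \<open>d (v\<^sub>j(c))\<close> and the \<open>|J| (p - |J|)\<close> numbers \<open>d (\<omega>\<^sub>c(e))\<close>. As the entries are
  independent, the left hand side is arbitrary on the coordinates \<open>mons_upper n J\<close>; moreover
  the nonzero vector \<open>v\<close> itself is among the \<open>d v\<close> and is mapped to zero.\<close>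

lemma generic_kernel_bound:
  fixes y :: "nat \<times> nat \<times> nat \<Rightarrow> 'f::field" and v :: "nat \<Rightarrow> monomial \<Rightarrow> 'f"
  assumes ext: "\<And>\<psi>. \<exists>d. derivation d \<and> (\<forall>e\<in>hom_coords n A B. d (y e) = \<psi> e)"
    and supp: "\<And>j e. e \<notin> mons n a \<Longrightarrow> v j e = 0"
    and ker: "\<And>i e. i < B \<Longrightarrow> e \<in> mons n (Suc a) \<Longrightarrow>
      (\<Sum>j<A. \<Sum>k\<le>n. y (i, j, k) * mulx k (v j) e) = 0"
    and nonzero: "\<exists>j<A. \<exists>e. v j e \<noteq> 0"
  shows "\<exists>J\<subseteq>mons n a. J \<noteq> {} \<and>
    B * card (mons_upper n J) < A * card J + card J * (card (mons n a) - card J)"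
proof -
  define U where "U = lincombs {..<A} v"
  define J where "J = leads U"
  have gsupp: "v i e = 0" if "i \<in> {..<A}" "e \<notin> mons n a" for i e
    using that supp by simp
  have JX: "J \<subseteq> mons n a"
    unfolding J_def U_def by (rule reduced_basis(1)[OF finite_mons gsupp])
  have "\<exists>\<omega>. (\<forall>c\<in>J. \<omega> c \<in> U) \<and> (\<forall>c\<in>J. \<forall>e\<in>J. \<omega> c e = (if e = c then 1 else 0)) \<and>
      (\<forall>c\<in>J. \<forall>e>c. \<omega> c e = 0) \<and> (\<forall>u\<in>U. \<forall>e. u e = (\<Sum>c\<in>J. u c * \<omega> c e))"
    unfolding J_def U_def
    by (rule reduced_basis(2)[where X = "mons n a" and S = "{..<A}" and g = v, OF finite_mons gsupp])
  then obtain \<omega> where \<omega>: "(\<forall>c\<in>J. \<omega> c \<in> U) \<and>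
      (\<forall>c\<in>J. \<forall>e\<in>J. \<omega> c e = (if e = c then 1 else 0)) \<and>
      (\<forall>c\<in>J. \<forall>e>c. \<omega> c e = 0) \<and> (\<forall>u\<in>U. \<forall>e. u e = (\<Sum>c\<in>J. u c * \<omega> c e))" ..
  then have \<omega>U: "\<omega> c \<in> U" if "c \<in> J" for c using that by blast
  have delta: "\<omega> c e = (if e = c then 1 else 0)" if "c \<in> J" "e \<in> J" for c e
    using \<omega> that by blast
  have upper: "\<omega> c e = 0" if "c \<in> J" "c < e" for c e using \<omega> that by blast
  have expand: "u e = (\<Sum>c\<in>J. u c * \<omega> c e)" if "u \<in> U" for u e using \<omega> that by blast
  have vU: "v j \<in> U" if "j < A" for j
    unfolding U_def by (rule lincombs_mem) (use that in auto)
  have finJ: "finite J" using JX finite_mons finite_subset by blast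
  have "J \<noteq> {}" using nonzero expand[OF vU] by fastforce
  define N where "N = mons_upper n J"
  have N: "N \<subseteq> mons n (Suc a)" unfolding N_def by (rule mons_upper_subset[OF JX])
  then have finN: "finite N" using finite_mons finite_subset by blast
  have "\<forall>c. \<exists>g. c \<in> J \<longrightarrow> \<omega> c = (\<lambda>e. \<Sum>j<A. g j * v j e)"
    using \<omega>U unfolding U_def lincombs_def by blast
  from choice[OF this] obtain cc
    where cc: "\<And>c. c \<in> J \<Longrightarrow> \<omega> c = (\<lambda>e. \<Sum>j<A. cc c j * v j e)" by blast
  have "\<forall>e. \<exists>c k. e \<in> N \<longrightarrow> c \<in> J \<and> k \<le> n \<and> e = c + xvar k"
    by (auto simp: N_def mons_upper_def)
  from choice[OF this] obtain co where "\<forall>e. \<exists>k. e \<in> N \<longrightarrow> co e \<in> J \<and> k \<le> n \<and> e = co e + xvar k" ..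
  from choice[OF this] obtain ko where ck: "\<And>e. e \<in> N \<Longrightarrow> co e \<in> J"
    "\<And>e. e \<in> N \<Longrightarrow> ko e \<le> n" "\<And>e. e \<in> N \<Longrightarrow> e = co e + xvar (ko e)" by blast
  \<comment> \<open>The product of a variable with a member of the reduced basis, chosen to have
    leading monomial \<open>e\<close>: the order of monomials is compatible with multiplication.
    Hence the family \<open>b\<close> is triangular on \<open>N\<close>.\<close>
  define b where "b e = mulx (ko e) (\<omega> (co e))" for e
  have diag: "b e e \<noteq> 0" if "e \<in> N" for e
  proof -
    have "b e e = \<omega> (co e) (co e)"
      unfolding b_def by (subst (2) ck(3)[OF that]) (rule mulx_add_xvar)
    then show ?thesis using ck(1)[OF that] delta by simp
  qed
  have tri: "b e e' = 0" if "e \<in> N" "e < e'" for e e'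
  proof (cases "poly_mapping.lookup e' (ko e) > 0")
    case True
    then have "co e + xvar (ko e) < (e' - xvar (ko e)) + xvar (ko e)"
      using that(2) ck(3)[OF that(1)] monomial_split[OF True] by metis
    then have "co e < e' - xvar (ko e)" by (simp only: add_less_cancel_right)
    then show ?thesis unfolding b_def mulx_def using upper ck(1)[OF that(1)] by simp
  qed (simp add: b_def mulx_def)
  \<comment> \<open>Every \<open>b f\<close> is a combination of the products
    \<open>x\<^sub>k v\<^sub>j\<close>. So these products attain every unit vector on
    \<open>N\<close>, and \<open>g\<close> is the row of linear forms that does so at
    \<open>\<tau>\<close>.\<close>
  have "\<exists>g. \<forall>e\<in>N. (\<Sum>j<A. \<Sum>k\<le>n. g j k * mulx k (v j) e) = (if e = \<tau> then 1 else 0)" for \<tau>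
  proof -
    obtain L where L: "\<And>e. e \<in> N \<Longrightarrow> (if e = \<tau> then 1 else 0) = (\<Sum>f\<in>N. L f * b f e)"
      using triangular_dual_family[OF finN, of b "\<lambda>e. if e = \<tau> then 1 else 0"] diag tri by blast
    define g where "g j k = (\<Sum>f\<in>N. if ko f = k then L f * cc (co f) j else 0)" for j k
    have "(\<Sum>j<A. \<Sum>k\<le>n. g j k * mulx k (v j) e) = (if e = \<tau> then 1 else 0)" if "e \<in> N" for e
    proof -
      have "(\<Sum>j<A. \<Sum>k\<le>n. g j k * mulx k (v j) e) =
        (\<Sum>j<A. \<Sum>k\<le>n. \<Sum>f\<in>N. if ko f = k then L f * cc (co f) j * mulx k (v j) e else 0)"
        by (simp add: g_def sum_distrib_right if_distrib[of "\<lambda>x. x * _"] cong: if_cong)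
      also have "\<dots> = (\<Sum>j<A. \<Sum>f\<in>N. \<Sum>k\<le>n. if ko f = k then L f * cc (co f) j * mulx k (v j) e else 0)"
        by (rule sum.cong[OF refl sum.swap])
      also have "\<dots> = (\<Sum>j<A. \<Sum>f\<in>N. L f * (cc (co f) j * mulx (ko f) (v j) e))"
        using ck(2) by (intro sum.cong) (auto simp: mult.assoc)
      also have "\<dots> = (\<Sum>f\<in>N. L f * (\<Sum>j<A. cc (co f) j * mulx (ko f) (v j) e))"
        by (subst sum.swap) (simp add: sum_distrib_left)
      also have "\<dots> = (\<Sum>f\<in>N. L f * b f e)"
        by (rule sum.cong) (auto simp: b_def cc[OF ck(1)] mulx_sum)
      finally show ?thesis using L[OF that] by simp
    qed
    then show ?thesis by blast
  qed
  then have "\<forall>\<tau>. \<exists>g. \<forall>e\<in>N. (\<Sum>j<A. \<Sum>k\<le>n. g j k * mulx k (v j) e) = (if e = \<tau> then 1 else 0)"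
    by blast
  from choice[OF this] obtain g where g: "\<And>\<tau> e. e \<in> N \<Longrightarrow>
      (\<Sum>j<A. \<Sum>k\<le>n. g \<tau> j k * mulx k (v j) e) = (if e = \<tau> then 1 else 0)"
    by blast
  \<comment> \<open>For \<open>s = (i, \<tau>)\<close> only row \<open>i\<close> of the matrix
    moves, by minus the row found above. Differentiating \<open>T v = 0\<close> then says that
    \<open>T\<close> maps \<open>d s v\<close> to the unit vector at \<open>(i, \<tau>)\<close> on
    the coordinates \<open>N\<close>; this is \<open>dker\<close>.\<close>
  define \<psi> where "\<psi> s e = (case e of (i, j, k) \<Rightarrow> if i = fst s then - g (snd s) j k else 0)" for s and e :: "nat \<times> nat \<times> nat"
  have "\<forall>s. \<exists>d. derivation d \<and> (\<forall>e\<in>hom_coords n A B. d (y e) = \<psi> s e)"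
    using ext by blast
  from choice[OF this] obtain d where d: "\<And>s. derivation (d s)"
    and dy': "\<And>s e. e \<in> hom_coords n A B \<Longrightarrow> d s (y e) = \<psi> s e" by blast
  have dy: "d s (y (i, j, k)) = (if i = fst s then - g (snd s) j k else 0)"
    if "i < B" "j < A" "k \<le> n" for s i j k
    using dy'[of "(i, j, k)" s] that by (simp add: hom_coords_def \<psi>_def)
  have dmulx: "d s (mulx k f e) = mulx k (\<lambda>e. d s (f e)) e" for s k f e
    using d by (simp add: mulx_def)
  have dker: "(\<Sum>j<A. \<Sum>k\<le>n. y (i, j, k) * mulx k (\<lambda>e. d s (v j e)) e) =
      (if i = fst s \<and> e = snd s then 1 else 0)" if "i < B" "e \<in> N" for i e s
  proof -
    have "0 = d s (\<Sum>j<A. \<Sum>k\<le>n. y (i, j, k) * mulx k (v j) e)"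
      using ker[OF that(1)] that(2) N d by (simp add: subset_iff)
    also have "\<dots> = (\<Sum>j<A. \<Sum>k\<le>n. d s (y (i, j, k)) * mulx k (v j) e)
        + (\<Sum>j<A. \<Sum>k\<le>n. y (i, j, k) * mulx k (\<lambda>e. d s (v j e)) e)"
      using d by (simp add: derivation_sum derivation_mult dmulx sum.distrib)
    also have "(\<Sum>j<A. \<Sum>k\<le>n. d s (y (i, j, k)) * mulx k (v j) e) =
        (\<Sum>j<A. \<Sum>k\<le>n. (if i = fst s then - g (snd s) j k else 0) * mulx k (v j) e)"
      using that by (intro sum.cong) (auto simp: dy)
    also have "\<dots> = (if i = fst s then - (\<Sum>j<A. \<Sum>k\<le>n. g (snd s) j k * mulx k (v j) e) else 0)"
      by (simp add: sum_negf)
    also have "\<dots> = - (if i = fst s \<and> e = snd s then 1 else 0)"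
      using g[OF that(2)] by simp
    finally show ?thesis by (simp add: add_eq_0_iff)
  qed
  define V where "V s j e = (case s of None \<Rightarrow> v j e | Some s \<Rightarrow> d s (v j e))" for s j e
  define H where "H s c e = (case s of None \<Rightarrow> 0 | Some s \<Rightarrow> d s (\<omega> c e))" for s c e
  have V_expand: "V s j e = (\<Sum>c\<in>J. V s j c * \<omega> c e) + (\<Sum>c\<in>J. v j c * H s c e)"
    if "j < A" for s j e
  proof (cases s)
    case None
    then show ?thesis using expand[OF vU[OF that], of e] by (simp add: V_def H_def)
  next
    case (Some s')
    have "d s' (v j e) = d s' (\<Sum>c\<in>J. v j c * \<omega> c e)"
      using expand[OF vU[OF that], of e] by simp
    also have "\<dots> = (\<Sum>c\<in>J. d s' (v j c) * \<omega> c e) + (\<Sum>c\<in>J. v j c * d s' (\<omega> c e))"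
      using d by (simp add: derivation_sum derivation_mult sum.distrib)
    finally show ?thesis using Some by (simp add: V_def H_def)
  qed
  \<comment> \<open>\<open>None\<close> stands for \<open>v\<close> itself, which \<open>T\<close>
    kills. This extra member makes the inequality strict: with it there are
    \<open>B * card N + 1\<close> vectors \<open>V s\<close>, and \<open>X\<close> lists the
    coordinates that determine them.\<close>
  define I where "I = insert None (Some ` ({..<B} \<times> N))"
  define X where "X = ({..<A} \<times> J) <+> (J \<times> (mons n a - J))"
  define M where "M s x = (case x of Inl (j, c) \<Rightarrow> V s j c | Inr (c, e) \<Rightarrow> H s c e)" for s x
  have finI: "finite I" and finX: "finite X"
    using finN finJ finite_mons by (auto simp: I_def X_def)
  have cardI: "card I = B * card N + 1"
    using finN by (simp add: I_def card_image card_cartesian_product)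
  have cardX: "card X = A * card J + card J * (card (mons n a) - card J)"
    using finJ finite_mons JX
    by (simp add: X_def card_Plus card_cartesian_product card_Diff_subset)
  have "B * card N < card X"
  proof (rule ccontr)
    assume "\<not> B * card N < card X"
    then have "card X < card I" by (simp add: cardI)
    then obtain cf where cf: "\<exists>s\<in>I. cf s \<noteq> 0" "\<And>x. x \<in> X \<Longrightarrow> (\<Sum>s\<in>I. cf s * M s x) = 0"
      using underdetermined_system[OF finX finI, of M] by blast
    have V0: "(\<Sum>s\<in>I. cf s * V s j c) = 0" if "j < A" "c \<in> J" for j c
      using cf(2)[of "Inl (j, c)"] that by (simp add: X_def M_def Plus_def image_iff)
    have H0: "(\<Sum>s\<in>I. cf s * H s c e) = 0" if "c \<in> J" "e \<in> mons n a" for c e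
    proof (cases "e \<in> J")
      case True
      then have "H s c e = 0" for s
        using delta[OF that(1) True] d by (simp add: H_def split: option.split)
      then show ?thesis by simp
    next
      case False
      then show ?thesis using cf(2)[of "Inr (c, e)"] that by (simp add: X_def M_def Plus_def image_iff)
    qed
    have Vsum: "(\<Sum>s\<in>I. cf s * V s j e) = 0" if j: "j < A" for j e
    proof (cases "e \<in> mons n a")
      case False
      then have "V s j e = 0" for s
        using supp[OF False] d by (simp add: V_def split: option.split)
      then show ?thesis by simp
    next
      case True
      have "(\<Sum>s\<in>I. cf s * V s j e) =
          (\<Sum>s\<in>I. \<Sum>c\<in>J. cf s * V s j c * \<omega> c e) + (\<Sum>s\<in>I. \<Sum>c\<in>J. v j c * (cf s * H s c e))"
        by (subst V_expand[OF j])
          (simp add: distrib_left sum.distrib sum_distrib_left mult_ac)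
      also have "(\<Sum>s\<in>I. \<Sum>c\<in>J. cf s * V s j c * \<omega> c e) = (\<Sum>c\<in>J. (\<Sum>s\<in>I. cf s * V s j c) * \<omega> c e)"
        by (subst sum.swap) (simp add: sum_distrib_right)
      also have "\<dots> = 0" using V0[OF j] by simp
      also have "(\<Sum>s\<in>I. \<Sum>c\<in>J. v j c * (cf s * H s c e)) = (\<Sum>c\<in>J. v j c * (\<Sum>s\<in>I. cf s * H s c e))"
        by (subst sum.swap) (simp add: sum_distrib_left)
      also have "\<dots> = 0" using H0[OF _ True] by simp
      finally show ?thesis by simp
    qed
    \<comment> \<open>A combination whose coordinates in \<open>X\<close> vanish is zero by
      \<open>V_expand\<close>. Applying \<open>T\<close> isolates the coefficient of each
      \<open>Some (i, e)\<close>, and the remaining coefficient of \<open>None\<close> vanishes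
      since \<open>v\<close> is nonzero.\<close>
    have Tsum: "(\<Sum>s\<in>I. cf s * (\<Sum>j<A. \<Sum>k\<le>n. y (i, j, k) * mulx k (V s j) e)) = 0" for i e
    proof -
      have "(\<Sum>s\<in>I. cf s * (\<Sum>j<A. \<Sum>k\<le>n. y (i, j, k) * mulx k (V s j) e)) =
        (\<Sum>s\<in>I. \<Sum>j<A. \<Sum>k\<le>n. y (i, j, k) * (cf s * mulx k (V s j) e))"
        by (simp add: sum_distrib_left mult_ac)
      also have "\<dots> = (\<Sum>j<A. \<Sum>k\<le>n. \<Sum>s\<in>I. y (i, j, k) * (cf s * mulx k (V s j) e))"
        by (subst sum.swap, rule sum.cong[OF refl], rule sum.swap)
      also have "\<dots> = (\<Sum>j<A. \<Sum>k\<le>n. y (i, j, k) * mulx k (\<lambda>e. \<Sum>s\<in>I. cf s * V s j e) e)"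
        by (simp add: mulx_sum sum_distrib_left)
      also have "\<dots> = 0" using Vsum by (simp add: mulx_def)
      finally show ?thesis .
    qed
    have cfSome: "cf (Some (i, e)) = 0" if "i < B" "e \<in> N" for i e
    proof -
      have "(\<Sum>s\<in>I. cf s * (\<Sum>j<A. \<Sum>k\<le>n. y (i, j, k) * mulx k (V s j) e)) =
        (\<Sum>s\<in>I. if s = Some (i, e) then cf s else 0)"
      proof (rule sum.cong[OF refl])
        fix s
        show "cf s * (\<Sum>j<A. \<Sum>k\<le>n. y (i, j, k) * mulx k (V s j) e) =
          (if s = Some (i, e) then cf s else 0)"
        proof (cases s)
          case None
          then show ?thesis using ker[OF that(1)] that(2) N by (auto simp: V_def[abs_def])
        next
          case (Some s')
          then show ?thesis using dker[OF that, of s'] by (auto simp: V_def[abs_def])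
        qed
      qed
      then show ?thesis using Tsum finI that by (simp add: I_def)
    qed
    obtain j e where je: "j < A" "v j e \<noteq> 0" using nonzero by blast
    have "(\<Sum>s\<in>I. cf s * V s j e) = (\<Sum>s\<in>I. if s = None then cf None * v j e else 0)"
      by (rule sum.cong) (use cfSome in \<open>auto simp: I_def V_def\<close>)
    then have "cf None = 0" using Vsum[OF je(1)] je finI by (simp add: I_def)
    then show False using cf(1) cfSome by (auto simp: I_def)
  qed
  then show ?thesis using JX \<open>J \<noteq> {}\<close> unfolding cardX N_def by blast
qed

text \<open>The transposed argument. Here the tangent vectors \<open>d w\<close> are controlled by the space \<open>W\<close> of
  all contractions of \<open>w\<close> by linear forms: \<open>w\<close> solves the linear system that says that all
  its contractions lie in \<open>W\<close>, whose coefficients are the entries of the reduced basis of \<open>W\<close>.\<close>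

lemma generic_cokernel_bound:
  fixes y :: "nat \<times> nat \<times> nat \<Rightarrow> 'f::field" and w :: "nat \<Rightarrow> monomial \<Rightarrow> 'f"
  assumes ext: "\<And>\<psi>. \<exists>d. derivation d \<and> (\<forall>e\<in>hom_coords n A B. d (y e) = \<psi> e)"
    and coker: "\<And>j e. j < A \<Longrightarrow> e \<in> mons n a \<Longrightarrow>
      (\<Sum>i<B. \<Sum>k\<le>n. y (i, j, k) * w i (e + xvar k)) = 0"
    and nonzero: "\<exists>i<B. \<exists>e\<in>mons n (Suc a). w i e \<noteq> 0"
  shows "\<exists>J\<subseteq>mons n a. J \<noteq> {} \<and>
    A * card J < B * card (mons n (Suc a) - mons_upper n (mons n a - J))
      + card J * (card (mons n a) - card J)"
proof -
  \<comment> \<open>The contraction of \<open>w\<^sub>i\<close> by \<open>x\<^sub>k\<close>, for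
    \<open>p = (i, k)\<close>. Here \<open>w\<close> is a functional on degree \<open>Suc a\<close>,
    recorded by its values on monomials, so contraction shifts the argument.\<close>
  define wx where "wx p e = (if e \<in> mons n a then w (fst p) (e + xvar (snd p)) else 0)" for p e
  define S where "S = {..<B} \<times> {..n}"
  have finS: "finite S" by (simp add: S_def)
  define W where "W = lincombs S wx"
  define J where "J = leads W"
  have gsupp: "wx i e = 0" if "i \<in> S" "e \<notin> mons n a" for i e
    using that by (simp add: wx_def)
  have JX: "J \<subseteq> mons n a"
    unfolding J_def W_def by (rule reduced_basis(1)[OF finite_mons gsupp])
  have "\<exists>\<omega>. (\<forall>c\<in>J. \<omega> c \<in> W) \<and> (\<forall>c\<in>J. \<forall>e\<in>J. \<omega> c e = (if e = c then 1 else 0)) \<and>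
      (\<forall>c\<in>J. \<forall>e>c. \<omega> c e = 0) \<and> (\<forall>u\<in>W. \<forall>e. u e = (\<Sum>c\<in>J. u c * \<omega> c e))"
    unfolding J_def W_def
    by (rule reduced_basis(2)[where X = "mons n a" and S = "S" and g = wx, OF finite_mons gsupp])
  then obtain \<omega> where \<omega>: "(\<forall>c\<in>J. \<omega> c \<in> W) \<and>
      (\<forall>c\<in>J. \<forall>e\<in>J. \<omega> c e = (if e = c then 1 else 0)) \<and>
      (\<forall>c\<in>J. \<forall>e>c. \<omega> c e = 0) \<and> (\<forall>u\<in>W. \<forall>e. u e = (\<Sum>c\<in>J. u c * \<omega> c e))" ..
  then have \<omega>W: "\<omega> c \<in> W" if "c \<in> J" for c using that by blast
  have delta: "\<omega> c e = (if e = c then 1 else 0)" if "c \<in> J" "e \<in> J" for c e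
    using \<omega> that by blast
  have upper: "\<omega> c e = 0" if "c \<in> J" "c < e" for c e using \<omega> that by blast
  have expand: "u e = (\<Sum>c\<in>J. u c * \<omega> c e)" if "u \<in> W" for u e using \<omega> that by blast
  have wxW: "wx p \<in> W" if "p \<in> S" for p
    unfolding W_def by (rule lincombs_mem[OF finS that])
  have w_expand: "w i (e + xvar k) = (\<Sum>c\<in>J. w i (c + xvar k) * \<omega> c e)"
    if "i < B" "k \<le> n" "e \<in> mons n a" for i k e
  proof -
    have "wx (i, k) e = (\<Sum>c\<in>J. wx (i, k) c * \<omega> c e)"
      by (rule expand[OF wxW]) (use that in \<open>auto simp: S_def\<close>)
    also have "\<dots> = (\<Sum>c\<in>J. w i (c + xvar k) * \<omega> c e)"
      by (rule sum.cong) (use JX in \<open>auto simp: wx_def\<close>)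
    finally show ?thesis using that by (simp add: wx_def)
  qed
  have finJ: "finite J" using JX finite_mons finite_subset by blast
  have "J \<noteq> {}"
  proof -
    obtain i e where ie: "i < B" "e \<in> mons n (Suc a)" "w i e \<noteq> 0" using nonzero by blast
    then obtain k f where "k \<le> n" "f \<in> mons n a" "e = f + xvar k" using mons_Suc_cases by blast
    then show ?thesis using w_expand[of i k f] ie by auto
  qed
  define N where "N = mons_upper n (mons n a - J)"
  have N: "N \<subseteq> mons n (Suc a)" unfolding N_def by (rule mons_upper_subset) auto
  have "\<forall>c. \<exists>g. c \<in> J \<longrightarrow> \<omega> c = (\<lambda>e. \<Sum>p\<in>S. g p * wx p e)" using \<omega>W unfolding W_def lincombs_def by blast
  from choice[OF this] obtain g
    where "\<And>c. c \<in> J \<Longrightarrow> \<omega> c = (\<lambda>e. \<Sum>p\<in>S. g c p * wx p e)" by blast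
  then have g: "(\<Sum>i<B. \<Sum>k\<le>n. g c (i, k) * w i (e + xvar k)) = \<omega> c e"
    if "c \<in> J" "e \<in> mons n a" for c e
    using that by (simp add: S_def sum.cartesian_product wx_def split_def)
  \<comment> \<open>For \<open>s = (j, c)\<close> only column \<open>j\<close> moves, by minus the
    coefficients that express the basis member at \<open>c\<close> through the contractions. So the
    transposed matrix maps \<open>d s w\<close> to this basis member in place \<open>j\<close> and
    to zero elsewhere; this is \<open>dcoker\<close>.\<close>
  define \<psi> where "\<psi> s e = (case e of (i, j, k) \<Rightarrow> if j = fst s then - g (snd s) (i, k) else 0)" for s and e :: "nat \<times> nat \<times> nat"
  have "\<forall>s. \<exists>d. derivation d \<and> (\<forall>e\<in>hom_coords n A B. d (y e) = \<psi> s e)"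
    using ext by blast
  from choice[OF this] obtain d where d: "\<And>s. derivation (d s)"
    and dy': "\<And>s e. e \<in> hom_coords n A B \<Longrightarrow> d s (y e) = \<psi> s e" by blast
  have dy: "d s (y (i, j, k)) = (if j = fst s then - g (snd s) (i, k) else 0)"
    if "i < B" "j < A" "k \<le> n" for s i j k
    using dy'[of "(i, j, k)" s] that by (simp add: hom_coords_def \<psi>_def)
  have dcoker: "(\<Sum>i<B. \<Sum>k\<le>n. y (i, j, k) * d s (w i (e + xvar k))) =
      (if j = fst s then \<omega> (snd s) e else 0)"
    if "j < A" "e \<in> mons n a" "snd s \<in> J" for j e s
  proof -
    have "0 = d s (\<Sum>i<B. \<Sum>k\<le>n. y (i, j, k) * w i (e + xvar k))"
      using coker[OF that(1,2)] d by simp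
    also have "\<dots> = (\<Sum>i<B. \<Sum>k\<le>n. d s (y (i, j, k)) * w i (e + xvar k))
        + (\<Sum>i<B. \<Sum>k\<le>n. y (i, j, k) * d s (w i (e + xvar k)))"
      using d by (simp add: derivation_sum derivation_mult sum.distrib)
    also have "(\<Sum>i<B. \<Sum>k\<le>n. d s (y (i, j, k)) * w i (e + xvar k)) =
        (\<Sum>i<B. \<Sum>k\<le>n. (if j = fst s then - g (snd s) (i, k) else 0) * w i (e + xvar k))"
      using that by (intro sum.cong) (auto simp: dy)
    also have "\<dots> = (if j = fst s then - (\<Sum>i<B. \<Sum>k\<le>n. g (snd s) (i, k) * w i (e + xvar k)) else 0)"
      by (simp add: sum_negf)
    also have "\<dots> = - (if j = fst s then \<omega> (snd s) e else 0)"
      using g[OF that(3,2)] by simp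
    finally show ?thesis by (simp add: add_eq_0_iff)
  qed
  define V where "V s i e = (case s of None \<Rightarrow> w i e | Some s \<Rightarrow> d s (w i e))" for s i e
  define H where "H s c e = (case s of None \<Rightarrow> 0 | Some s \<Rightarrow> d s (\<omega> c e))" for s c e
  have V_expand: "V s i (e + xvar k) =
      (\<Sum>c\<in>J. V s i (c + xvar k) * \<omega> c e) + (\<Sum>c\<in>J. w i (c + xvar k) * H s c e)"
    if ike: "i < B" "k \<le> n" "e \<in> mons n a" for s i k e
  proof (cases s)
    case None
    then show ?thesis using w_expand[OF ike] by (simp add: V_def H_def)
  next
    case (Some s')
    have "d s' (w i (e + xvar k)) = d s' (\<Sum>c\<in>J. w i (c + xvar k) * \<omega> c e)"
      using w_expand[OF ike] by simp
    also have "\<dots> = (\<Sum>c\<in>J. d s' (w i (c + xvar k)) * \<omega> c e)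
        + (\<Sum>c\<in>J. w i (c + xvar k) * d s' (\<omega> c e))"
      using d by (simp add: derivation_sum derivation_mult sum.distrib)
    finally show ?thesis using Some by (simp add: V_def H_def)
  qed
  define I where "I = insert None (Some ` ({..<A} \<times> J))"
  \<comment> \<open>Coordinates of \<open>d w\<close> at multiples of monomials outside
    \<open>J\<close> are omitted: once the part from \<open>d \<omega>\<close> is zero,
    \<open>Z_expand\<close> computes them from larger coordinates.\<close>
  define X where "X = ({..<B} \<times> (mons n (Suc a) - N)) <+> (J \<times> (mons n a - J))"
  define M where "M s x = (case x of Inl (i, e) \<Rightarrow> V s i e | Inr (c, e) \<Rightarrow> H s c e)" for s x
  have finI: "finite I" and finX: "finite X"
    using finJ finite_mons by (auto simp: I_def X_def)
  have cardI: "card I = A * card J + 1"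
    using finJ by (simp add: I_def card_image card_cartesian_product)
  have cardX: "card X = B * card (mons n (Suc a) - N) + card J * (card (mons n a) - card J)"
    using finJ finite_mons JX
    by (simp add: X_def card_Plus card_cartesian_product card_Diff_subset)
  have "A * card J < card X"
  proof (rule ccontr)
    assume "\<not> A * card J < card X"
    then have "card X < card I" by (simp add: cardI)
    then obtain cf where cf: "\<exists>s\<in>I. cf s \<noteq> 0" "\<And>x. x \<in> X \<Longrightarrow> (\<Sum>s\<in>I. cf s * M s x) = 0"
      using underdetermined_system[OF finX finI, of M] by blast
    define Z where "Z i e = (\<Sum>s\<in>I. cf s * V s i e)" for i e
    have Z0: "Z i e = 0" if "i < B" "e \<in> mons n (Suc a) - N" for i e
      using cf(2)[of "Inl (i, e)"] that by (simp add: X_def M_def Z_def Plus_def image_iff)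
    have H0: "(\<Sum>s\<in>I. cf s * H s c e) = 0" if "c \<in> J" "e \<in> mons n a" for c e
    proof (cases "e \<in> J")
      case True
      then have "H s c e = 0" for s
        using delta[OF that(1) True] d by (simp add: H_def split: option.split)
      then show ?thesis by simp
    next
      case False
      then show ?thesis using cf(2)[of "Inr (c, e)"] that by (simp add: X_def M_def Plus_def image_iff)
    qed
    have Z_expand: "Z i (e + xvar k) = (\<Sum>c\<in>J. Z i (c + xvar k) * \<omega> c e)"
      if ike: "i < B" "k \<le> n" "e \<in> mons n a" for i k e
    proof -
      have "Z i (e + xvar k) = (\<Sum>s\<in>I. \<Sum>c\<in>J. cf s * V s i (c + xvar k) * \<omega> c e)
          + (\<Sum>s\<in>I. \<Sum>c\<in>J. w i (c + xvar k) * (cf s * H s c e))"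
        unfolding Z_def by (subst V_expand[OF ike])
          (simp add: distrib_left sum.distrib sum_distrib_left mult_ac)
      also have "(\<Sum>s\<in>I. \<Sum>c\<in>J. cf s * V s i (c + xvar k) * \<omega> c e) =
          (\<Sum>c\<in>J. Z i (c + xvar k) * \<omega> c e)"
        by (subst sum.swap) (simp add: sum_distrib_right Z_def)
      also have "(\<Sum>s\<in>I. \<Sum>c\<in>J. w i (c + xvar k) * (cf s * H s c e)) =
          (\<Sum>c\<in>J. w i (c + xvar k) * (\<Sum>s\<in>I. cf s * H s c e))"
        by (subst sum.swap) (simp add: sum_distrib_left)
      also have "\<dots> = 0" using H0[OF _ ike(3)] by simp
      finally show ?thesis by simp
    qed
    \<comment> \<open>Take the largest coordinate with a nonzero value. It is
      \<open>f + xvar k\<close> with \<open>f\<close> outside \<open>J\<close>, and its expansion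
      only involves \<open>c + xvar k\<close> with \<open>c\<close> in \<open>J\<close> and
      \<open>f < c\<close>. These are larger, so the value is zero.\<close>
    have Zsum: "Z i e = 0" if i: "i < B" and e: "e \<in> mons n (Suc a)" for i e
    proof (rule ccontr)
      assume "Z i e \<noteq> 0"
      define K where "K = {e\<in>mons n (Suc a). Z i e \<noteq> 0}"
      have K: "finite K" "K \<noteq> {}" using \<open>Z i e \<noteq> 0\<close> e finite_mons by (auto simp: K_def)
      have MK: "Max K \<in> mons n (Suc a)" "Z i (Max K) \<noteq> 0"
        using Max_in[OF K] by (auto simp: K_def)
      then have "Max K \<in> N" using Z0[OF i] by blast
      then obtain f k where f: "f \<in> mons n a - J" "k \<le> n" "Max K = f + xvar k"
        by (auto simp: N_def mons_upper_def)
      have z0: "Z i (c + xvar k) * \<omega> c f = 0" if c: "c \<in> J" for c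
      proof (cases "c < f")
        case True
        then show ?thesis using upper[OF c] by simp
      next
        case False
        moreover have "f \<noteq> c" using f(1) c by blast
        ultimately have "f < c" by simp
        then have "Max K < c + xvar k" unfolding f(3) by simp
        then have "c + xvar k \<notin> K" using Max_ge[OF K(1)] leD by blast
        then show ?thesis using c JX f(2) mons_add_xvar by (auto simp: K_def)
      qed
      have "(\<Sum>c\<in>J. Z i (c + xvar k) * \<omega> c f) = 0" by (intro sum.neutral ballI z0)
      then have "Z i (f + xvar k) = 0" using Z_expand[of i k f] i f by simp
      then show False using MK f by simp
    qed
    have Tsum: "(\<Sum>s\<in>I. cf s * (\<Sum>i<B. \<Sum>k\<le>n. y (i, j, k) * V s i (e + xvar k))) = 0"
      if e: "e \<in> mons n a" for j e
    proof -
      have "(\<Sum>s\<in>I. cf s * (\<Sum>i<B. \<Sum>k\<le>n. y (i, j, k) * V s i (e + xvar k))) =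
        (\<Sum>s\<in>I. \<Sum>i<B. \<Sum>k\<le>n. y (i, j, k) * (cf s * V s i (e + xvar k)))"
        by (simp add: sum_distrib_left mult_ac)
      also have "\<dots> = (\<Sum>i<B. \<Sum>k\<le>n. \<Sum>s\<in>I. y (i, j, k) * (cf s * V s i (e + xvar k)))"
        by (subst sum.swap, rule sum.cong[OF refl], rule sum.swap)
      also have "\<dots> = (\<Sum>i<B. \<Sum>k\<le>n. y (i, j, k) * Z i (e + xvar k))"
        by (simp add: Z_def sum_distrib_left)
      also have "\<dots> = 0" using Zsum mons_add_xvar[OF e] by (intro sum.neutral ballI) simp
      finally show ?thesis .
    qed
    have cfSome: "cf (Some (j, c)) = 0" if j: "j < A" and c: "c \<in> J" for j c
    proof -
      have cX: "c \<in> mons n a" using c JX by blast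
      have "(\<Sum>s\<in>I. cf s * (\<Sum>i<B. \<Sum>k\<le>n. y (i, j, k) * V s i (c + xvar k))) =
        (\<Sum>s\<in>I. if s = Some (j, c) then cf s else 0)"
      proof (rule sum.cong[OF refl])
        fix s assume s: "s \<in> I"
        show "cf s * (\<Sum>i<B. \<Sum>k\<le>n. y (i, j, k) * V s i (c + xvar k)) =
          (if s = Some (j, c) then cf s else 0)"
        proof (cases s)
          case None
          then show ?thesis using coker[OF j cX] by (auto simp: V_def[abs_def])
        next
          case (Some s')
          then have "snd s' \<in> J" using s by (auto simp: I_def)
          then show ?thesis using dcoker[OF j cX, of s'] delta[of "snd s'" c] c Some
            by (cases s') (auto simp: V_def[abs_def])
        qed
      qed
      then show ?thesis using Tsum[OF cX, of j] finI that by (simp add: I_def)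
    qed
    obtain i e where ie: "i < B" "e \<in> mons n (Suc a)" "w i e \<noteq> 0" using nonzero by blast
    have "Z i e = (\<Sum>s\<in>I. if s = None then cf None * w i e else 0)"
      unfolding Z_def by (rule sum.cong) (use cfSome in \<open>auto simp: I_def V_def\<close>)
    then have "cf None = 0" using Zsum[OF ie(1,2)] ie finI by (simp add: I_def)
    then show False using cf(1) cfSome by (auto simp: I_def)
  qed
  then show ?thesis using JX \<open>J \<noteq> {}\<close> unfolding cardX N_def by blast
qed

section \<open>The inequalities that contradict the two bounds\<close>

lemma four_mult_le_square: "4 * (l * (p - l)) \<le> (p::nat) ^ 2"
proof (cases "l \<le> p")
  case True
  then obtain k where "p = l + k" using le_Suc_ex by blast
  moreover have "4 * (int l * int k) \<le> (int l + int k) ^ 2"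
    using zero_le_power2[of "int l - int k"] by (simp add: power2_eq_square algebra_simps)
  then have "4 * (l * k) \<le> (l + k) ^ 2"
    by (metis (mono_tags) of_nat_add of_nat_le_iff of_nat_mult of_nat_numeral of_nat_power)
  ultimately show ?thesis by simp
qed auto

lemma card_mons_Suc: "Suc a * card (mons n (Suc a)) = (Suc a + n) * card (mons n a)"
proof -
  have "Suc a * ((Suc a + n) choose Suc a) = (Suc a + n) * ((a + n) choose a)"
    using binomial_absorption[of a "Suc a + n"] by simp
  moreover have "(Suc a + n) choose Suc a = (Suc a + n) choose n"
    "(a + n) choose a = (a + n) choose n"
    using binomial_symmetric[of n "Suc a + n"] binomial_symmetric[of n "a + n"] by simp_all
  ultimately show ?thesis by (simp add: card_mons)
qed

lemma mons_upper_mons: "mons_upper n (mons n a) = mons n (Suc a)"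
proof
  show "mons n (Suc a) \<subseteq> mons_upper n (mons n a)"
    by (auto simp: mons_upper_def elim!: mons_Suc_cases)
qed (simp add: mons_upper_subset)

lemma card_mons_pos: "card (mons n a) > 0"
  by (simp add: card_mons)

text \<open>Normalized matching as a comparison of densities: a proper nonempty set of monomials is
  strictly less dense than its shadow. Between integers the strictness is worth one unit.\<close>

lemma card_mons_upper_ratio:
  assumes "M \<subseteq> mons n a" "M \<noteq> {}" "M \<noteq> mons n a"
  shows "card M * card (mons n (Suc a)) < card (mons_upper n M) * card (mons n a)"
proof -
  let ?p = "card (mons n a)" and ?q = "card (mons n (Suc a))"
  have "(Suc a) * (card M * ?q) = card M * ((Suc a + n) * ?p)"
    by (metis card_mons_Suc mult.left_commute)
  also have "\<dots> = ((a + n + 1) * card M) * ?p" by (simp add: algebra_simps)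
  also have "\<dots> < ((a + 1) * card (mons_upper n M)) * ?p"
    using card_mons_upper[OF assms] card_mons_pos by simp
  also have "\<dots> = Suc a * (card (mons_upper n M) * ?p)" by (simp add: algebra_simps)
  finally show ?thesis by (simp only: mult_less_cancel1)
qed

text \<open>Multiply by p. With l and N the sizes of \<open>J\<close> and its shadow, matching gives
  \<open>B N p \<ge> B (l q + 1) \<ge> A l p + B\<close>, and the surplus \<open>B\<close> covers p
  l (p - l), which is at most p^3/4. If \<open>J\<close> contains all monomials there is no surplus,
  but then l(p - l) is zero.\<close>

lemma kernel_inequality:
  assumes J: "J \<subseteq> mons n a" "J \<noteq> {}"
    and AB: "A * card (mons n a) \<le> B * card (mons n (Suc a))"
    and big: "card (mons n a) ^ 3 \<le> 4 * B"
  shows "A * card J + card J * (card (mons n a) - card J) \<le> B * card (mons_upper n J)"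
proof (cases "J = mons n a")
  case True
  then show ?thesis using AB by (simp add: mons_upper_mons)
next
  case False
  define p q l N where "p = card (mons n a)" and "q = card (mons n (Suc a))"
    and "l = card J" and "N = card (mons_upper n J)"
  have "l * q + 1 \<le> N * p"
    using card_mons_upper_ratio[OF J False] by (simp add: p_def q_def l_def N_def)
  then have "B * (l * q + 1) \<le> B * (N * p)" by (rule mult_le_mono2)
  then have "l * (B * q) + B \<le> p * (B * N)" by (simp add: algebra_simps)
  moreover have "l * (A * p) \<le> l * (B * q)"
    using AB by (intro mult_le_mono2) (simp add: p_def q_def)
  moreover have "p * (4 * (l * (p - l))) \<le> p * p ^ 2"
    by (intro mult_le_mono2 four_mult_le_square)
  moreover have "p * p ^ 2 \<le> 4 * B" using big by (simp add: p_def power3_eq_cube power2_eq_square)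
  moreover have "p * (A * l + l * (p - l)) = l * (A * p) + p * (l * (p - l))"
    by (simp add: distrib_left mult_ac)
  ultimately have "p * (A * l + l * (p - l)) \<le> p * (B * N)" by linarith
  then show ?thesis using card_mons_pos[of n a] by (simp add: p_def l_def N_def)
qed

text \<open>Matching for the complement \<open>M\<close> of \<open>J\<close> reads
  \<open>x p + 1 \<le> l q\<close>, where \<open>x\<close> counts the monomials with no divisor in
  \<open>M\<close>. Multiplying the claim by q leaves a surplus \<open>A\<close> that covers q l (p
  - l), at most q p^2/4.\<close>

lemma cokernel_inequality:
  assumes J: "J \<subseteq> mons n a" "J \<noteq> {}"
    and AB: "B * card (mons n (Suc a)) \<le> A * card (mons n a)"
    and big: "card (mons n a) ^ 2 * card (mons n (Suc a)) \<le> 4 * A"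
  shows "B * card (mons n (Suc a) - mons_upper n (mons n a - J))
    + card J * (card (mons n a) - card J) \<le> A * card J"
proof (cases "J = mons n a")
  case True
  then show ?thesis using AB by (simp add: mons_upper_def)
next
  case False
  define M where "M = mons n a - J"
  define p q l x where "p = card (mons n a)" and "q = card (mons n (Suc a))"
    and "l = card J" and "x = card (mons n (Suc a) - mons_upper n M)"
  have M: "M \<subseteq> mons n a" "M \<noteq> {}" "M \<noteq> mons n a" using J False by (auto simp: M_def)
  have cardM: "card M + l = p"
    using card_Diff_subset[of J "mons n a"] J finite_subset[OF J(1) finite_mons]
      card_mono[OF finite_mons J(1)] by (simp add: M_def p_def l_def)
  have sub: "mons_upper n M \<subseteq> mons n (Suc a)" by (rule mons_upper_subset[OF M(1)])
  have cardx: "x + card (mons_upper n M) = q"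
    using card_Diff_subset[OF finite_subset[OF sub finite_mons] sub] card_mono[OF finite_mons sub]
    by (simp add: x_def q_def)
  have "p * q = card M * q + l * q" by (simp add: cardM[symmetric] algebra_simps)
  moreover have "p * q = x * p + card (mons_upper n M) * p"
    by (simp add: cardx[symmetric] algebra_simps)
  moreover have "card M * q + 1 \<le> card (mons_upper n M) * p"
    using card_mons_upper_ratio[OF M] by (simp add: p_def q_def)
  ultimately have "x * p + 1 \<le> l * q" by linarith
  then have "A * (x * p + 1) \<le> A * (l * q)" by (rule mult_le_mono2)
  then have "x * (A * p) + A \<le> q * (A * l)" by (simp add: algebra_simps)
  moreover have "x * (B * q) \<le> x * (A * p)"
    using AB by (intro mult_le_mono2) (simp add: p_def q_def)
  moreover have "q * (4 * (l * (p - l))) \<le> q * p ^ 2"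
    by (intro mult_le_mono2 four_mult_le_square)
  moreover have "q * p ^ 2 \<le> 4 * A" using big by (simp add: p_def q_def mult.commute)
  moreover have "q * (B * x + l * (p - l)) = x * (B * q) + q * (l * (p - l))"
    by (simp add: distrib_left mult_ac)
  ultimately have "q * (B * x + l * (p - l)) \<le> q * (A * l)" by linarith
  then show ?thesis using card_mons_pos[of n "Suc a"]
    by (simp add: p_def q_def l_def x_def M_def)
qed

section \<open>Polynomials\<close>

lemma poly_mapping_induct [case_names zero single add]:
  fixes p :: "'a \<Rightarrow>\<^sub>0 'b::comm_monoid_add"
  assumes "P 0" and "\<And>e c. P (Poly_Mapping.single e c)" and "\<And>p q. P p \<Longrightarrow> P q \<Longrightarrow> P (p + q)"
  shows "P p"
proof -
  have "P (\<Sum>e\<in>S. Poly_Mapping.single e (poly_mapping.lookup p e))" for S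
    by (induction S rule: infinite_finite_induct) (auto intro: assms)
  moreover have "(\<Sum>e\<in>Poly_Mapping.keys p. Poly_Mapping.single e (poly_mapping.lookup p e)) = p"
    by (rule poly_mapping_eqI) (auto simp: lookup_sum lookup_single when_def in_keys_iff)
  ultimately show ?thesis by metis
qed

text \<open>Keys may cancel in a sum, so sums over keys are compared on the union of the two key
  sets; terms with coefficient zero contribute nothing.\<close>

lemma sum_keys_add:
  fixes p q :: "'a \<Rightarrow>\<^sub>0 'b::comm_monoid_add" and f :: "'a \<Rightarrow> 'b \<Rightarrow> 'c::comm_monoid_add"
  assumes "\<And>e. f e 0 = 0" and "\<And>e a b. f e (a + b) = f e a + f e b"
  shows "(\<Sum>e\<in>Poly_Mapping.keys (p + q). f e (poly_mapping.lookup (p + q) e)) =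
    (\<Sum>e\<in>Poly_Mapping.keys p. f e (poly_mapping.lookup p e)) +
    (\<Sum>e\<in>Poly_Mapping.keys q. f e (poly_mapping.lookup q e))"
proof -
  define S where "S = Poly_Mapping.keys p \<union> Poly_Mapping.keys q"
  have *: "(\<Sum>e\<in>Poly_Mapping.keys r. f e (poly_mapping.lookup r e)) =
      (\<Sum>e\<in>S. f e (poly_mapping.lookup r e))" if "Poly_Mapping.keys r \<subseteq> S" for r
    by (rule sum.mono_neutral_left) (use that assms in \<open>auto simp: S_def in_keys_iff\<close>)
  have "Poly_Mapping.keys (p + q) \<subseteq> S" unfolding S_def by (rule keys_add)
  from *[OF this] *[of p] *[of q] show ?thesis
    by (simp only: lookup_add assms sum.distrib) (simp add: S_def)
qed

definition mono_eval :: "('i \<Rightarrow>\<^sub>0 nat) \<Rightarrow> ('i \<Rightarrow> complex) \<Rightarrow> complex" where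
  "mono_eval e x = (\<Prod>i\<in>Poly_Mapping.keys e. x i ^ poly_mapping.lookup e i)"

lemma mono_eval_superset:
  assumes "finite S" "Poly_Mapping.keys e \<subseteq> S"
  shows "mono_eval e x = (\<Prod>i\<in>S. x i ^ poly_mapping.lookup e i)"
  unfolding mono_eval_def by (rule prod.mono_neutral_left) (use assms in \<open>auto simp: in_keys_iff\<close>)

lemma mono_eval_zero [simp]: "mono_eval 0 x = 1"
  by (simp add: mono_eval_def)

lemma mono_eval_add: "mono_eval (e + f) x = mono_eval e x * mono_eval f x"
proof -
  let ?S = "Poly_Mapping.keys e \<union> Poly_Mapping.keys f"
  have "finite ?S" by simp
  then show ?thesis
    by (simp add: mono_eval_superset[of ?S] lookup_add power_add prod.distrib)
qed

lemma mono_eval_single: "mono_eval (Poly_Mapping.single i k) x = x i ^ k"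
  by (cases "k = 0") (auto simp: mono_eval_def)

lemma mono_eval_times: "mono_eval e (\<lambda>i. x i * y i) = mono_eval e x * mono_eval e y"
  by (simp add: mono_eval_def power_mult_distrib prod.distrib)

lemma mono_eval_scale:
  "mono_eval e (\<lambda>i. c * x i) = c ^ (\<Sum>i\<in>Poly_Mapping.keys e. poly_mapping.lookup e i) * mono_eval e x"
  by (simp add: mono_eval_def power_mult_distrib prod.distrib power_sum)

lemma eval_poly_mono: "eval_poly p x =
    (\<Sum>e\<in>Poly_Mapping.keys p. poly_mapping.lookup p e * mono_eval e x)"
  by (simp add: eval_poly_def mono_eval_def)

lemma eval_poly_zero [simp]: "eval_poly 0 x = 0"
  by (simp add: eval_poly_mono)

lemma eval_poly_single [simp]: "eval_poly (Poly_Mapping.single e c) x = c * mono_eval e x"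
  by (cases "c = 0") (auto simp: eval_poly_mono)

lemma eval_poly_one [simp]: "eval_poly 1 x = 1"
  using eval_poly_single[of 0 1] by simp

lemma eval_poly_add [simp]: "eval_poly (p + q) x = eval_poly p x + eval_poly q x"
  unfolding eval_poly_mono
  by (rule sum_keys_add[of "\<lambda>e c. c * mono_eval e x"]) (auto simp: algebra_simps)

lemma eval_poly_sum [simp]: "eval_poly (sum f S) x = (\<Sum>s\<in>S. eval_poly (f s) x)"
  by (induction S rule: infinite_finite_induct) auto

lemma eval_poly_mult [simp]: "eval_poly (p * q) x = eval_poly p x * eval_poly q x"
proof (induction p rule: poly_mapping_induct)
  case (single e c)
  show ?case
    by (induction q rule: poly_mapping_induct)
      (auto simp: mult_single mono_eval_add algebra_simps)
qed (auto simp: algebra_simps)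

lemma eval_poly_power [simp]: "eval_poly (p ^ k) x = eval_poly p x ^ k"
  by (induction k) auto

lemma eval_poly_prod [simp]: "eval_poly (prod f S) x = (\<Prod>s\<in>S. eval_poly (f s) x)"
  by (induction S rule: infinite_finite_induct) auto

lemma eval_poly_uminus [simp]: "eval_poly (- p) x = - eval_poly p x"
  using eval_poly_add[of p "- p" x] by (simp add: eq_neg_iff_add_eq_0 add.commute)

lemma eval_poly_diff [simp]: "eval_poly (p - q) x = eval_poly p x - eval_poly q x"
  using eval_poly_add[of p "- q" x] by simp

text \<open>Monomials are distinct characters of the monoid \<open>\<complex>\<^sup>I\<close>, hence linearly independent.\<close>

lemma mono_eval_independent:
  assumes "finite K" "\<And>x. (\<Sum>e\<in>K. c e * mono_eval e x) = 0" "e \<in> K"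
  shows "c e = 0"
  using assms
proof (induction K arbitrary: c e rule: finite_induct)
  case (insert e0 K)
  have zero: "c e1 = 0" if e1: "e1 \<in> K" for e1
  proof -
    obtain i where i: "poly_mapping.lookup e0 i \<noteq> poly_mapping.lookup e1 i"
      using e1 insert.hyps by (metis poly_mapping_eqI)
    define y :: "'a \<Rightarrow> complex" where "y = (\<lambda>j. if j = i then 2 else 1)"
    have y: "mono_eval e y = 2 ^ poly_mapping.lookup e i" for e :: "'a \<Rightarrow>\<^sub>0 nat"
    proof -
      have "mono_eval e y = (\<Prod>j\<in>insert i (Poly_Mapping.keys e). y j ^ poly_mapping.lookup e j)"
        by (rule mono_eval_superset) auto
      also have "\<dots> = 2 ^ poly_mapping.lookup e i * (\<Prod>j\<in>Poly_Mapping.keys e - {i}. 1)"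
        by (subst prod.insert_remove) (auto simp: y_def intro!: prod.cong)
      finally show ?thesis by simp
    qed
    have "(\<Sum>e\<in>K. (c e * (mono_eval e y - mono_eval e0 y)) * mono_eval e x) = 0" for x
    proof -
      have "(\<Sum>e\<in>insert e0 K. c e * mono_eval e (\<lambda>j. x j * y j)) -
          mono_eval e0 y * (\<Sum>e\<in>insert e0 K. c e * mono_eval e x) = 0"
        using insert.prems(1) by simp
      then show ?thesis using insert.hyps
        by (simp add: mono_eval_times sum_distrib_left sum_subtractf[symmetric] algebra_simps)
    qed
    then have "c e1 * (mono_eval e1 y - mono_eval e0 y) = 0"
      using insert.IH[of "\<lambda>e. c e * (mono_eval e y - mono_eval e0 y)", OF _ e1] by blast
    moreover have "(2::complex) ^ poly_mapping.lookup e1 i \<noteq> 2 ^ poly_mapping.lookup e0 i"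
    proof
      assume "(2::complex) ^ poly_mapping.lookup e1 i = 2 ^ poly_mapping.lookup e0 i"
      then have "norm ((2::complex) ^ poly_mapping.lookup e1 i) = norm ((2::complex) ^ poly_mapping.lookup e0 i)"
        by (rule arg_cong)
      then show False using i by (simp add: norm_power)
    qed
    ultimately show ?thesis unfolding y by simp
  qed
  have "(\<Sum>e\<in>insert e0 K. c e * mono_eval e (\<lambda>_. 1)) = c e0"
    using insert.hyps zero by (simp add: mono_eval_def)
  then have "c e0 = 0" using insert.prems(1) by metis
  then show ?case using zero insert.prems(2) by blast
qed auto

lemma eval_poly_eq_zero:
  assumes "\<And>x. eval_poly p x = 0"
  shows "p = 0"
proof (rule poly_mapping_eqI)
  fix e
  show "poly_mapping.lookup p e = poly_mapping.lookup 0 e"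
    using mono_eval_independent[OF finite_keys[of p], of "poly_mapping.lookup p" e] assms
    by (cases "e \<in> Poly_Mapping.keys p") (auto simp: eval_poly_mono in_keys_iff)
qed

lemma eval_poly_subst:
  fixes p :: "'i polynomial" and s :: "'i \<Rightarrow> 'j polynomial"
  obtains p' where "\<And>x. eval_poly p' x = eval_poly p (\<lambda>i. eval_poly (s i) x)"
proof -
  have "\<exists>p'. \<forall>x. eval_poly p' x = eval_poly p (\<lambda>i. eval_poly (s i) x)"
  proof (induction p rule: poly_mapping_induct)
    case zero
    show ?case by (intro exI[of _ 0]) simp
  next
    case (single e c)
    show ?case
      by (intro exI[of _ "Poly_Mapping.single 0 c * (\<Prod>i\<in>Poly_Mapping.keys e. s i ^ poly_mapping.lookup e i)"])
        (simp add: mono_eval_def)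
  next
    case (add p q)
    then obtain p' q' where "\<forall>x. eval_poly p' x = eval_poly p (\<lambda>i. eval_poly (s i) x)"
      "\<forall>x. eval_poly q' x = eval_poly q (\<lambda>i. eval_poly (s i) x)" by blast
    then show ?case by (intro exI[of _ "p' + q'"]) simp
  qed
  then show thesis using that by blast
qed

section \<open>Derivations of the field of rational functions\<close>

text \<open>The formal partial derivative. Where the exponent of the variable is zero, the truncated
  difference \<open>e - xvar i\<close> is harmless because the coefficient vanishes.\<close>

definition pderiv_var :: "nat \<Rightarrow> nat polynomial \<Rightarrow> nat polynomial" where
  "pderiv_var i p = (\<Sum>e\<in>Poly_Mapping.keys p.
     Poly_Mapping.single (e - xvar i) (of_nat (poly_mapping.lookup e i) * poly_mapping.lookup p e))"

lemma pderiv_var_add: "pderiv_var i (p + q) = pderiv_var i p + pderiv_var i q"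
  unfolding pderiv_var_def
  by (rule sum_keys_add[of "\<lambda>e c. Poly_Mapping.single (e - xvar i) (of_nat (poly_mapping.lookup e i) * c)"])
    (auto simp: algebra_simps single_add)

lemma pderiv_var_zero [simp]: "pderiv_var i 0 = 0"
  by (simp add: pderiv_var_def)

lemma pderiv_var_single: "pderiv_var i (Poly_Mapping.single e c) =
    Poly_Mapping.single (e - xvar i) (of_nat (poly_mapping.lookup e i) * c)"
  by (cases "c = 0") (auto simp: pderiv_var_def)

lemma monomial_add_minus_xvar:
  fixes e f :: monomial
  assumes "poly_mapping.lookup e i > 0"
  shows "(e + f) - xvar i = (e - xvar i) + f"
  using assms by (intro poly_mapping_eqI) (auto simp: lookup_add lookup_minus)

lemma pderiv_var_mult: "pderiv_var i (p * q) = pderiv_var i p * q + p * pderiv_var i q"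
proof (induction p rule: poly_mapping_induct)
  case (single e c)
  show ?case
  proof (induction q rule: poly_mapping_induct)
    case (single f d)
    have 1: "Poly_Mapping.single (e + f - xvar i) (of_nat (poly_mapping.lookup e i) * c * d) =
      Poly_Mapping.single (e - xvar i + f) (of_nat (poly_mapping.lookup e i) * c * d)"
      by (cases "poly_mapping.lookup e i = 0") (auto simp: monomial_add_minus_xvar)
    have 2: "Poly_Mapping.single (e + f - xvar i) (of_nat (poly_mapping.lookup f i) * c * d) =
      Poly_Mapping.single (e + (f - xvar i)) (of_nat (poly_mapping.lookup f i) * c * d)"
      using monomial_add_minus_xvar[of f i e]
      by (cases "poly_mapping.lookup f i = 0") (auto simp: add.commute)
    show ?case
      using 1 2 by (simp add: mult_single pderiv_var_single lookup_add distrib_right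
        distrib_left single_add mult_ac add_ac)
  qed (auto simp: pderiv_var_add algebra_simps)
qed (auto simp: pderiv_var_add algebra_simps)

definition fract_deriv :: "('a::idom \<Rightarrow> 'a) \<Rightarrow> 'a fract \<Rightarrow> 'a fract" where
  "fract_deriv d z = (let (a, b) = (SOME (a, b). b \<noteq> 0 \<and> z = Fract a b)
     in Fract (d a * b - a * d b) (b * b))"

text \<open>Independence of the representative that \<open>SOME\<close> picks: differentiating the
  relation \<open>a * b' = a' * b\<close> gives \<open>deq\<close>, by which the two quotient rules
  agree.\<close>

lemma fract_deriv_Fract:
  assumes d: "\<And>a b. d (a * b) = d a * b + a * d b" and b: "b \<noteq> 0"
  shows "fract_deriv d (Fract a b) = Fract (d a * b - a * d b) (b * b)"
proof -
  obtain a' b' where ab: "(SOME (a', b'). b' \<noteq> 0 \<and> Fract a b = Fract a' b') = (a', b')"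
    by fastforce
  have "case (SOME (a', b'). b' \<noteq> 0 \<and> Fract a b = Fract a' b') of (a', b') \<Rightarrow> b' \<noteq> 0 \<and> Fract a b = Fract a' b'"
    by (rule someI[of _ "(a, b)"]) (use b in auto)
  then have b': "b' \<noteq> 0" and eq: "a * b' = a' * b"
    using b unfolding ab by (auto simp: eq_fract)
  have deq: "d a * b' + a * d b' = d a' * b + a' * d b"
    using d[of a b'] d[of a' b] eq by simp
  have "(d a' * b' - a' * d b') * (b * b) = (d a * b - a * d b) * (b' * b')"
    using deq eq by algebra
  then show ?thesis using b b' unfolding fract_deriv_def ab by (simp add: eq_fract)
qed

lemma derivation_fract_deriv:
  assumes add: "\<And>a b. d (a + b) = d a + d b" and mult: "\<And>a b. d (a * b) = d a * b + a * d b"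
  shows "derivation (fract_deriv d)"
  unfolding derivation_def
proof (intro conjI allI)
  fix z w :: "'a fract"
  obtain a b where z: "z = Fract a b" "b \<noteq> 0" by (cases z)
  obtain a' b' where w: "w = Fract a' b'" "b' \<noteq> 0" by (cases w)
  show "fract_deriv d (z + w) = fract_deriv d z + fract_deriv d w"
    using z w by (simp add: fract_deriv_Fract[of d, OF mult] add mult eq_fract algebra_simps)
  show "fract_deriv d (z * w) = fract_deriv d z * w + z * fract_deriv d w"
    using z w by (simp add: fract_deriv_Fract[of d, OF mult] add mult eq_fract algebra_simps)
qed

text \<open>Index triples are coded as numbers, so that the entries of the generic matrix are
  variables of \<open>nat polynomial\<close>, for which monomials and partial derivatives have been
  set up.\<close>

definition var_code :: "nat \<times> nat \<times> nat \<Rightarrow> nat" where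
  "var_code e = prod_encode (fst e, prod_encode (snd e))"

lemma var_code_eq_iff [simp]: "var_code e = var_code e' \<longleftrightarrow> e = e'"
  by (auto simp: var_code_def prod_eq_iff)

definition gen_var :: "nat \<times> nat \<times> nat \<Rightarrow> nat polynomial" where
  "gen_var e = Poly_Mapping.single (xvar (var_code e)) 1"

lemma eval_gen_var [simp]: "eval_poly (gen_var e) x = x (var_code e)"
  by (simp add: gen_var_def xvar_def mono_eval_single)

abbreviation emb :: "'a::idom \<Rightarrow> 'a fract" where
  "emb a \<equiv> Fract a 1"

lemma emb_sum: "emb (sum f S) = (\<Sum>s\<in>S. emb (f s))"
proof -
  have "emb (a + b) = emb a + emb b" for a b :: 'a by simp
  then show ?thesis
    by (induction S rule: infinite_finite_induct) (auto simp: Zero_fract_def simp del: add_fract)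
qed

lemma emb_eq_iff: "emb a = emb b \<longleftrightarrow> a = b"
  by (simp add: eq_fract)

text \<open>The combination of the partial derivatives with coefficients \<open>\<psi>\<close>,
  which may be arbitrary rational functions. This is the independence of the matrix entries in the
  form assumed by the two tangent space bounds.\<close>

lemma gen_var_derivation:
  "\<exists>d. derivation d \<and> (\<forall>e\<in>hom_coords n A B. d (emb (gen_var e)) = \<psi> e)"
proof -
  define D where "D e = fract_deriv (pderiv_var (var_code e))" for e
  have D: "derivation (D e)" for e
    unfolding D_def by (rule derivation_fract_deriv) (rule pderiv_var_add, rule pderiv_var_mult)
  define d where "d z = (\<Sum>e\<in>hom_coords n A B. \<psi> e * D e z)" for z
  have "derivation d"
    unfolding derivation_def
  proof (intro conjI allI)
    fix z w
    show "d (z + w) = d z + d w"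
      unfolding d_def by (simp add: derivation_add[OF D] distrib_left sum.distrib)
    show "d (z * w) = d z * w + z * d w"
      unfolding d_def by (simp add: derivation_mult[OF D] sum_distrib_left sum_distrib_right
        sum.distrib[symmetric] algebra_simps)
  qed
  moreover have "D e (emb (gen_var e')) = (if e = e' then 1 else 0)" for e e'
  proof -
    have one: "pderiv_var (var_code e) 1 = 0"
      using pderiv_var_single[of "var_code e" 0 1] by simp
    have "pderiv_var (var_code e) (gen_var e') = (if e = e' then 1 else 0)"
      by (auto simp: gen_var_def pderiv_var_single)
    then show ?thesis
      unfolding D_def by (subst fract_deriv_Fract[OF pderiv_var_mult])
        (auto simp: one Zero_fract_def One_fract_def)
  qed
  moreover have "finite (hom_coords n A B)" by (simp add: hom_coords_def)
  ultimately have "d (emb (gen_var e)) = \<psi> e" if "e \<in> hom_coords n A B" for e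
    using that unfolding d_def by (simp add: if_distrib[of "\<lambda>x. _ * x"] cong: if_cong)
  then show ?thesis using \<open>derivation d\<close> by blast
qed

section \<open>Clearing denominators\<close>

lemma common_denominator:
  fixes f :: "'s \<Rightarrow> 'a::idom fract"
  assumes "finite S"
  shows "\<exists>q. q \<noteq> 0 \<and> (\<forall>s\<in>S. \<exists>p. f s * emb q = emb p)"
  using assms
proof (induction S rule: finite_induct)
  case empty
  show ?case by (intro exI[of _ 1]) simp
next
  case (insert s S)
  then obtain q where q: "q \<noteq> 0" "\<forall>s\<in>S. \<exists>p. f s * emb q = emb p" by blast
  obtain a b where ab: "f s = Fract a b" "b \<noteq> 0" by (cases "f s")
  have "\<exists>p. f s' * emb (q * b) = emb p" if "s' \<in> insert s S" for s'
  proof (cases "s' = s")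
    case True
    then show ?thesis using ab by (intro exI[of _ "a * q"]) (simp add: eq_fract)
  next
    case False
    then have "s' \<in> S" using that by simp
    from q(2)[rule_format, OF this] obtain p where p: "f s' * emb q = emb p" ..
    have "f s' * emb (q * b) = f s' * emb q * emb b" by (simp add: mult.assoc)
    also have "\<dots> = emb (p * b)" unfolding p by simp
    finally show ?thesis ..
  qed
  then show ?case using q ab by (intro exI[of _ "q * b"]) auto
qed

text \<open>Injectivity over the fraction field is turned into an identity \<open>L R = q\<close> in
  the ring itself. Such an identity survives evaluation, and gives injectivity at every point where
  \<open>q\<close> does not vanish.\<close>

lemma denominator_free_left_inverse:
  fixes R :: "'y \<Rightarrow> 'x \<Rightarrow> 'a::idom"
  assumes "finite Y" "finite X"
    and inj: "\<forall>v. (\<forall>y\<in>Y. (\<Sum>x\<in>X. emb (R y x) * v x) = 0) \<longrightarrow> (\<forall>x\<in>X. v x = 0)"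
  shows "\<exists>q L. q \<noteq> 0 \<and> (\<forall>x0\<in>X. \<forall>x\<in>X. (\<Sum>y\<in>Y. L x0 y * R y x) = (if x = x0 then q else 0))"
proof -
  have "\<exists>L. \<forall>x\<in>X. (if x = x0 then 1 else 0) = (\<Sum>y\<in>Y. L y * emb (R y x))" if "x0 \<in> X" for x0
  proof -
    have "False" if "\<forall>y\<in>Y. (\<Sum>x\<in>X. emb (R y x) * v x) = 0"
      "(\<Sum>x\<in>X. (if x = x0 then 1 else 0) * v x) \<noteq> 0" for v
      using inj[rule_format, of v x0] that \<open>x0 \<in> X\<close> \<open>finite X\<close>
      by (simp add: if_distrib[of "\<lambda>x. x * _"] cong: if_cong)
    then show ?thesis
      using Fredholm_alternative[OF assms(1,2), of "\<lambda>x. if x = x0 then 1 else 0" "\<lambda>y x. emb (R y x)"]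
      by blast
  qed
  then have "\<forall>x0. \<exists>L. x0 \<in> X \<longrightarrow> (\<forall>x\<in>X. (if x = x0 then 1 else 0) = (\<Sum>y\<in>Y. L y * emb (R y x)))"
    by blast
  from choice[OF this] obtain L where L: "\<And>x0 x. x0 \<in> X \<Longrightarrow> x \<in> X \<Longrightarrow>
      (if x = x0 then 1 else 0) = (\<Sum>y\<in>Y. L x0 y * emb (R y x))" by blast
  obtain q where q: "q \<noteq> 0" "\<forall>s\<in>X \<times> Y. \<exists>p. L (fst s) (snd s) * emb q = emb p"
    using common_denominator[of "X \<times> Y" "\<lambda>s. L (fst s) (snd s)"] assms by auto
  then have "\<forall>s. \<exists>p. s \<in> X \<times> Y \<longrightarrow> L (fst s) (snd s) * emb q = emb p" by blast
  from choice[OF this] obtain L' where L': "\<And>x y. x \<in> X \<Longrightarrow> y \<in> Y \<Longrightarrow> L x y * emb q = emb (L' (x, y))"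
    by force
  have "(\<Sum>y\<in>Y. L' (x0, y) * R y x) = (if x = x0 then q else 0)" if "x0 \<in> X" "x \<in> X" for x0 x
  proof -
    have "emb (\<Sum>y\<in>Y. L' (x0, y) * R y x) = (\<Sum>y\<in>Y. emb (L' (x0, y)) * emb (R y x))"
      by (simp add: emb_sum)
    also have "\<dots> = (\<Sum>y\<in>Y. L x0 y * emb (R y x)) * emb q"
      unfolding sum_distrib_right
      by (rule sum.cong) (auto simp: L'[OF that(1), symmetric] mult_ac)
    also have "\<dots> = emb (if x = x0 then q else 0)"
      unfolding L[OF that, symmetric] by (auto simp: Zero_fract_def One_fract_def)
    finally show ?thesis unfolding emb_eq_iff .
  qed
  then show ?thesis using q(1) by (intro exI[of _ q] exI[of _ "\<lambda>x y. L' (x, y)"]) auto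
qed

section \<open>Maximal rank for general matrices of linear forms\<close>

text \<open>The matrix of \<open>S\<^sub>a\<^sup>A \<rightarrow> S\<^sub>a\<^sub>+\<^sub>1\<^sup>B\<close> with respect to the monomial bases.\<close>

definition tmat :: "nat \<Rightarrow> (nat \<times> nat \<times> nat \<Rightarrow> 'f::comm_monoid_add) \<Rightarrow> nat \<times> monomial \<Rightarrow> nat \<times> monomial \<Rightarrow> 'f" where
  "tmat n y r c = (\<Sum>k\<le>n. if snd r = snd c + xvar k then y (fst r, fst c, k) else 0)"

lemma tmat_mulx:
  fixes u :: "monomial \<Rightarrow> 'f::semiring_0"
  assumes "e' \<in> mons n (Suc a)"
  shows "(\<Sum>e\<in>mons n a. tmat n y (i, e') (j, e) * u e) = (\<Sum>k\<le>n. y (i, j, k) * mulx k u e')"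
proof -
  have "(\<Sum>e\<in>mons n a. tmat n y (i, e') (j, e) * u e) =
      (\<Sum>k\<le>n. \<Sum>e\<in>mons n a. if e' = e + xvar k then y (i, j, k) * u e else 0)"
    by (subst sum.swap) (simp add: tmat_def sum_distrib_right if_distrib[of "\<lambda>x. x * _"] cong: if_cong)
  also have "\<dots> = (\<Sum>k\<le>n. y (i, j, k) * mulx k u e')"
  proof (rule sum.cong[OF refl])
    fix k
    show "(\<Sum>e\<in>mons n a. if e' = e + xvar k then y (i, j, k) * u e else 0) = y (i, j, k) * mulx k u e'"
    proof (cases "poly_mapping.lookup e' k > 0")
      case True
      have "(\<Sum>e\<in>mons n a. if e' = e + xvar k then y (i, j, k) * u e else 0) =
        (\<Sum>e\<in>mons n a. if e = e' - xvar k then y (i, j, k) * u e else 0)"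
      proof (rule sum.cong[OF refl])
        fix e
        have "e' = e + xvar k \<longleftrightarrow> e = e' - xvar k"
          using monomial_split[OF True] by (metis add_diff_cancel_right')
        then show "(if e' = e + xvar k then y (i, j, k) * u e else 0) =
          (if e = e' - xvar k then y (i, j, k) * u e else 0)" by simp
      qed
      then show ?thesis using mons_remove_xvar[OF assms True] True finite_mons by (simp add: mulx_def)
    next
      case False
      then have "e' \<noteq> e + xvar k" for e by (auto simp: lookup_add)
      then show ?thesis using False by (simp add: mulx_def)
    qed
  qed
  finally show ?thesis .
qed

lemma tmat_dual:
  fixes u :: "monomial \<Rightarrow> 'f::comm_semiring_0"
  assumes "e \<in> mons n a"
  shows "(\<Sum>e'\<in>mons n (Suc a). tmat n y (i, e') (j, e) * u e') = (\<Sum>k\<le>n. y (i, j, k) * u (e + xvar k))"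
proof -
  have "(\<Sum>e'\<in>mons n (Suc a). tmat n y (i, e') (j, e) * u e') =
      (\<Sum>k\<le>n. \<Sum>e'\<in>mons n (Suc a). if e' = e + xvar k then y (i, j, k) * u e' else 0)"
    by (subst sum.swap) (simp add: tmat_def sum_distrib_right if_distrib[of "\<lambda>x. x * _"] cong: if_cong)
  also have "\<dots> = (\<Sum>k\<le>n. y (i, j, k) * u (e + xvar k))"
    by (rule sum.cong) (use mons_add_xvar[OF assms] finite_mons in auto)
  finally show ?thesis .
qed

definition inj_degree :: "nat \<Rightarrow> nat \<Rightarrow> nat \<Rightarrow> (nat \<times> nat \<times> nat \<Rightarrow> complex) \<Rightarrow> nat \<Rightarrow> bool" where
  "inj_degree n A B \<phi> a \<longleftrightarrow> (\<forall>v. (\<forall>r\<in>{..<B} \<times> mons n (Suc a).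
     (\<Sum>c\<in>{..<A} \<times> mons n a. tmat n \<phi> r c * v c) = 0) \<longrightarrow> (\<forall>c\<in>{..<A} \<times> mons n a. v c = 0))"

definition surj_degree :: "nat \<Rightarrow> nat \<Rightarrow> nat \<Rightarrow> (nat \<times> nat \<times> nat \<Rightarrow> complex) \<Rightarrow> nat \<Rightarrow> bool" where
  "surj_degree n A B \<phi> a \<longleftrightarrow> (\<forall>w. \<exists>v. \<forall>r\<in>{..<B} \<times> mons n (Suc a).
     (\<Sum>c\<in>{..<A} \<times> mons n a. tmat n \<phi> r c * v c) = w r)"

lemma tmat_cong:
  assumes "\<And>e. e \<in> hom_coords n A B \<Longrightarrow> \<phi> e = \<phi>' e" "r \<in> {..<B} \<times> R" "c \<in> {..<A} \<times> C"
  shows "tmat n \<phi> r c = tmat n \<phi>' r c"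
  unfolding tmat_def by (rule sum.cong) (use assms in \<open>auto simp: hom_coords_def\<close>)

lemma inj_degree_cong:
  assumes "\<And>e. e \<in> hom_coords n A B \<Longrightarrow> \<phi> e = \<phi>' e"
  shows "inj_degree n A B \<phi> a = inj_degree n A B \<phi>' a"
  unfolding inj_degree_def by (simp add: tmat_cong[OF assms])

lemma surj_degree_cong:
  assumes "\<And>e. e \<in> hom_coords n A B \<Longrightarrow> \<phi> e = \<phi>' e"
  shows "surj_degree n A B \<phi> a = surj_degree n A B \<phi>' a"
  unfolding surj_degree_def by (simp add: tmat_cong[OF assms])

lemma emb_tmat: "emb (tmat n gen_var r c) = tmat n (\<lambda>e. emb (gen_var e)) r c"
  by (simp add: tmat_def emb_sum Zero_fract_def if_distrib[of emb] cong: if_cong)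

lemma eval_tmat: "eval_poly (tmat n gen_var r c) x = tmat n (\<lambda>e. x (var_code e)) r c"
  by (simp add: tmat_def if_distrib[of "\<lambda>p. eval_poly p x"] cong: if_cong)

text \<open>Independent variables as entries give an injective matrix, since a kernel vector would
  contradict \<open>kernel_inequality\<close>. The polynomial \<open>q\<close> of the resulting left
  inverse marks the special matrices to be avoided.\<close>

lemma generic_inj_degree:
  assumes AB: "A * card (mons n a) \<le> B * card (mons n (Suc a))"
    and big: "card (mons n a) ^ 3 \<le> 4 * B"
  shows "\<exists>q. q \<noteq> 0 \<and> (\<forall>x. eval_poly q x \<noteq> 0 \<longrightarrow> inj_degree n A B (\<lambda>e. x (var_code e)) a)"
proof -
  define X where "X = {..<A} \<times> mons n a"
  define Y where "Y = {..<B} \<times> mons n (Suc a)"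
  have fin: "finite X" "finite Y" using finite_mons by (auto simp: X_def Y_def)
  have inj: "v c = 0" if ker: "\<And>r. r \<in> Y \<Longrightarrow> (\<Sum>c\<in>X. emb (tmat n gen_var r c) * v c) = 0"
    and c: "c \<in> X" for v c
  proof (rule ccontr)
    assume nz: "v c \<noteq> 0"
    define v' where "v' j e = (if e \<in> mons n a then v (j, e) else 0)" for j e
    have ker': "(\<Sum>j<A. \<Sum>k\<le>n. emb (gen_var (i, j, k)) * mulx k (v' j) e') = 0"
      if "i < B" "e' \<in> mons n (Suc a)" for i e'
    proof -
      have "(\<Sum>j<A. \<Sum>k\<le>n. emb (gen_var (i, j, k)) * mulx k (v' j) e') =
        (\<Sum>j<A. \<Sum>e\<in>mons n a. emb (tmat n gen_var (i, e') (j, e)) * v (j, e))"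
        unfolding emb_tmat
      proof (rule sum.cong[OF refl])
        fix j
        show "(\<Sum>k\<le>n. emb (gen_var (i, j, k)) * mulx k (v' j) e') =
          (\<Sum>e\<in>mons n a. tmat n (\<lambda>e. emb (gen_var e)) (i, e') (j, e) * v (j, e))"
          using tmat_mulx[OF that(2), of "\<lambda>e. emb (gen_var e)" i j "v' j"] by (simp add: v'_def)
      qed
      also have "\<dots> = (\<Sum>c\<in>X. emb (tmat n gen_var (i, e') c) * v c)"
        by (simp add: X_def sum.cartesian_product split_def)
      finally show ?thesis using ker[of "(i, e')"] that by (simp add: Y_def)
    qed
    have nz': "\<exists>j<A. \<exists>e. v' j e \<noteq> 0"
      using c nz by (intro exI[of _ "fst c"]) (auto simp: v'_def X_def)
    have supp': "v' j e = 0" if "e \<notin> mons n a" for j e using that by (simp add: v'_def)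
    obtain J where J: "J \<subseteq> mons n a" "J \<noteq> {}"
      "B * card (mons_upper n J) < A * card J + card J * (card (mons n a) - card J)"
      using generic_kernel_bound[OF gen_var_derivation supp' ker' nz'] by blast
    then show False using kernel_inequality[OF J(1,2) AB big] by simp
  qed
  then have inj': "\<forall>v. (\<forall>r\<in>Y. (\<Sum>c\<in>X. emb (tmat n gen_var r c) * v c) = 0) \<longrightarrow> (\<forall>c\<in>X. v c = 0)"
    by blast
  obtain q L where q: "q \<noteq> 0" and L: "\<And>c0 c. c0 \<in> X \<Longrightarrow> c \<in> X \<Longrightarrow>
      (\<Sum>r\<in>Y. L c0 r * tmat n gen_var r c) = (if c = c0 then q else 0)"
    using denominator_free_left_inverse[OF fin(2,1) inj'] by blast
  have "inj_degree n A B (\<lambda>e. x (var_code e)) a" if x: "eval_poly q x \<noteq> 0" for x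
    unfolding inj_degree_def X_def[symmetric] Y_def[symmetric]
  proof (intro allI impI ballI)
    fix v c0
    assume ker: "\<forall>r\<in>Y. (\<Sum>c\<in>X. tmat n (\<lambda>e. x (var_code e)) r c * v c) = 0" and c0: "c0 \<in> X"
    have "0 = (\<Sum>r\<in>Y. eval_poly (L c0 r) x * (\<Sum>c\<in>X. tmat n (\<lambda>e. x (var_code e)) r c * v c))"
      using ker by simp
    also have "\<dots> = (\<Sum>c\<in>X. \<Sum>r\<in>Y. eval_poly (L c0 r) x * tmat n (\<lambda>e. x (var_code e)) r c * v c)"
      by (subst sum.swap) (simp add: sum_distrib_left mult.assoc)
    also have "\<dots> = (\<Sum>c\<in>X. eval_poly (\<Sum>r\<in>Y. L c0 r * tmat n gen_var r c) x * v c)"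
      by (simp add: eval_tmat sum_distrib_right)
    also have "\<dots> = (\<Sum>c\<in>X. if c = c0 then eval_poly q x * v c else 0)"
      by (rule sum.cong) (auto simp: L[OF c0])
    also have "\<dots> = eval_poly q x * v c0" using c0 fin by simp
    finally show "v c0 = 0" using x by simp
  qed
  then show ?thesis using q by blast
qed

text \<open>The transposed matrix is injective over the field of rational functions; transposing its
  left inverse and dividing by the value of \<open>q\<close> gives a right inverse of the
  specialized matrix.\<close>

lemma generic_surj_degree:
  assumes AB: "B * card (mons n (Suc a)) \<le> A * card (mons n a)"
    and big: "card (mons n a) ^ 2 * card (mons n (Suc a)) \<le> 4 * A"
  shows "\<exists>q. q \<noteq> 0 \<and> (\<forall>x. eval_poly q x \<noteq> 0 \<longrightarrow> surj_degree n A B (\<lambda>e. x (var_code e)) a)"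
proof -
  define X where "X = {..<A} \<times> mons n a"
  define Y where "Y = {..<B} \<times> mons n (Suc a)"
  have fin: "finite X" "finite Y" using finite_mons by (auto simp: X_def Y_def)
  have inj: "w r = 0" if ker: "\<And>c. c \<in> X \<Longrightarrow> (\<Sum>r\<in>Y. emb (tmat n gen_var r c) * w r) = 0"
    and r: "r \<in> Y" for w r
  proof (rule ccontr)
    assume nz: "w r \<noteq> 0"
    define w' where "w' i e = w (i, e)" for i e
    have ker': "(\<Sum>i<B. \<Sum>k\<le>n. emb (gen_var (i, j, k)) * w' i (e + xvar k)) = 0"
      if "j < A" "e \<in> mons n a" for j e
    proof -
      have "(\<Sum>i<B. \<Sum>k\<le>n. emb (gen_var (i, j, k)) * w' i (e + xvar k)) =
        (\<Sum>i<B. \<Sum>e'\<in>mons n (Suc a). emb (tmat n gen_var (i, e') (j, e)) * w (i, e'))"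
        unfolding emb_tmat w'_def
        by (intro sum.cong refl, rule tmat_dual[OF that(2), symmetric])
      also have "\<dots> = (\<Sum>r\<in>Y. emb (tmat n gen_var r (j, e)) * w r)"
        by (simp add: Y_def sum.cartesian_product split_def)
      finally show ?thesis using ker[of "(j, e)"] that by (simp add: X_def)
    qed
    have nz': "\<exists>i<B. \<exists>e\<in>mons n (Suc a). w' i e \<noteq> 0"
      using r nz by (intro exI[of _ "fst r"]) (auto simp: w'_def Y_def)
    obtain J where J: "J \<subseteq> mons n a" "J \<noteq> {}"
      "A * card J < B * card (mons n (Suc a) - mons_upper n (mons n a - J))
        + card J * (card (mons n a) - card J)"
      using generic_cokernel_bound[OF gen_var_derivation ker' nz'] by blast
    then show False using cokernel_inequality[OF J(1,2) AB big] by simp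
  qed
  then have inj': "\<forall>w. (\<forall>c\<in>X. (\<Sum>r\<in>Y. emb (tmat n gen_var r c) * w r) = 0) \<longrightarrow> (\<forall>r\<in>Y. w r = 0)"
    by blast
  obtain q L where q: "q \<noteq> 0" and L: "\<And>r0 r. r0 \<in> Y \<Longrightarrow> r \<in> Y \<Longrightarrow>
      (\<Sum>c\<in>X. L r0 c * tmat n gen_var r c) = (if r = r0 then q else 0)"
    using denominator_free_left_inverse[of X Y "\<lambda>c r. tmat n gen_var r c", OF fin inj'] by blast
  have "surj_degree n A B (\<lambda>e. x (var_code e)) a" if x: "eval_poly q x \<noteq> 0" for x
    unfolding surj_degree_def X_def[symmetric] Y_def[symmetric]
  proof (intro allI exI ballI)
    fix w r assume r: "r \<in> Y"
    have "(\<Sum>c\<in>X. tmat n (\<lambda>e. x (var_code e)) r c * (\<Sum>r0\<in>Y. eval_poly (L r0 c) x * w r0 / eval_poly q x))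
      = (\<Sum>r0\<in>Y. \<Sum>c\<in>X. eval_poly (L r0 c * tmat n gen_var r c) x * (w r0 / eval_poly q x))"
      by (subst sum.swap) (simp add: sum_distrib_left eval_tmat mult_ac)
    also have "\<dots> = (\<Sum>r0\<in>Y. eval_poly (\<Sum>c\<in>X. L r0 c * tmat n gen_var r c) x * (w r0 / eval_poly q x))"
      by (simp add: sum_distrib_right sum_divide_distrib)
    also have "\<dots> = (\<Sum>r0\<in>Y. if r0 = r then w r0 else 0)"
      by (rule sum.cong) (use x in \<open>auto simp: L[OF _ r]\<close>)
    also have "\<dots> = w r" using r fin by simp
    finally show "(\<Sum>c\<in>X. tmat n (\<lambda>e. x (var_code e)) r c *
        (\<Sum>r0\<in>Y. eval_poly (L r0 c) x * w r0 / eval_poly q x)) = w r" .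
  qed
  then show ?thesis using q by blast
qed

text \<open>\<open>q\<close> may contain variables that code no coordinate in \<open>I\<close>. They
  are frozen at the values of a point \<open>x0\<close> with \<open>q(x0)\<close> nonzero; the
  result is a polynomial in the coordinates \<open>I\<close> alone that is not identically
  zero.\<close>

lemma zariski_open_nonvanishing:
  fixes c :: "'i \<Rightarrow> 'k"
  assumes q: "q \<noteq> 0" and fin: "finite I" and inj: "inj_on c I"
  shows "\<exists>\<Phi>. openin (zariski_affine I) \<Phi> \<and> \<Phi> \<noteq> {} \<and>
    (\<forall>\<phi>\<in>\<Phi>. \<exists>x. eval_poly q x \<noteq> 0 \<and> (\<forall>i\<in>I. x (c i) = \<phi> i))"
proof -
  obtain x0 where x0: "eval_poly q x0 \<noteq> 0" using q eval_poly_eq_zero by blast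
  define s :: "'k \<Rightarrow> 'i polynomial" where
    "s k = (if k \<in> c ` I then Poly_Mapping.single (Poly_Mapping.single (the_inv_into I c k) 1) 1
      else Poly_Mapping.single 0 (x0 k))" for k
  obtain p where p: "\<And>x. eval_poly p x = eval_poly q (\<lambda>i. eval_poly (s i) x)"
    using eval_poly_subst by blast
  have s: "eval_poly (s (c i)) \<phi> = \<phi> i" if "i \<in> I" for i \<phi>
    using that by (simp add: s_def mono_eval_single the_inv_into_f_f[OF inj])
  have s': "eval_poly (s k) \<phi> = x0 k" if "k \<notin> c ` I" for k \<phi>
    using that by (simp add: s_def)
  define \<Phi> where "\<Phi> = {\<phi>\<in>affine_space I. eval_poly p \<phi> \<noteq> 0}"
  define \<phi>0 where "\<phi>0 i = (if i \<in> I then x0 (c i) else 0)" for i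
  have "(\<lambda>k. eval_poly (s k) \<phi>0) = x0"
  proof
    fix k
    show "eval_poly (s k) \<phi>0 = x0 k"
      using s s' by (cases "k \<in> c ` I") (auto simp: \<phi>0_def)
  qed
  then have "\<phi>0 \<in> \<Phi>" using x0 by (simp add: \<Phi>_def p affine_space_def \<phi>0_def)
  moreover have "openin (zariski_affine I) \<Phi>"
    unfolding zariski_affine_def \<Phi>_def by (rule topology_generated_by_Basis) blast
  moreover have "\<exists>x. eval_poly q x \<noteq> 0 \<and> (\<forall>i\<in>I. x (c i) = \<phi> i)" if "\<phi> \<in> \<Phi>" for \<phi>
    by (rule exI[of _ "\<lambda>k. eval_poly (s k) \<phi>"]) (use that s in \<open>simp add: \<Phi>_def p\<close>)
  ultimately show ?thesis by blast
qed

text \<open>After cancelling \<open>m\<close> and a dimension, the comparison of the two sides of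
  \<open>S\<^sub>a\<^sup>A \<rightarrow> S\<^sub>a\<^sub>+\<^sub>1\<^sup>B\<close> becomes that of
  \<open>r * (a + 1)\<close> with \<open>t * n\<close>. So \<open>a + 1 = \<alpha>\<close> is the
  first degree with room for surjectivity and \<open>a + 1 = \<beta>\<close> the last with room for
  injectivity, and the numerical hypothesis is stated for exactly these two.\<close>

lemma general_maximal_rank:
  fixes n r t m \<alpha> \<beta> :: nat
  assumes "n \<ge> 1" and "r \<ge> 1" and "t \<ge> 1" and "m \<ge> 1"
    and \<alpha>: "int \<alpha> = \<lceil>real (t * n) / real r\<rceil>"
    and \<beta>: "int \<beta> = \<lfloor>real (t * n) / real r\<rfloor>"
    and bound: "real m \<ge> max
          (1 / (4 * real (t + r)) * real ((\<alpha> + n - 1) choose n) ^ 2 * real ((\<alpha> + n) choose n))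
          (1 / (4 * real t) * real ((\<beta> + n - 1) choose n) ^ 3)"
  shows "\<alpha> \<ge> 1" and "\<beta> \<le> \<alpha>" and "\<alpha> \<le> Suc \<beta>"
    and "\<exists>\<Phi>. openin (zariski_affine (hom_coords n (m * (t + r)) (m * t))) \<Phi> \<and> \<Phi> \<noteq> {} \<and>
      (\<forall>\<phi>\<in>\<Phi>. (\<beta> \<ge> 1 \<longrightarrow> inj_degree n (m * (t + r)) (m * t) \<phi> (\<beta> - 1)) \<and>
        surj_degree n (m * (t + r)) (m * t) \<phi> (\<alpha> - 1))"
proof -
  define z where "z = real (t * n) / real r"
  have "z > 0" using assms by (simp add: z_def)
  then have "int \<alpha> > 0" unfolding \<alpha> z_def[symmetric] by simp
  then show \<alpha>1: "\<alpha> \<ge> 1" by simp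
  have "int \<beta> \<le> int \<alpha>" "int \<alpha> \<le> int \<beta> + 1"
    unfolding \<alpha> \<beta> z_def[symmetric] by linarith+
  then show "\<beta> \<le> \<alpha>" "\<alpha> \<le> Suc \<beta>" by simp_all
  have "real \<alpha> \<ge> z" "real \<beta> \<le> z"
    using \<alpha> \<beta> unfolding z_def[symmetric] by linarith+
  then have "real (t * n) \<le> real (r * \<alpha>)" "real (r * \<beta>) \<le> real (t * n)"
    using assms(2) by (auto simp: z_def field_simps)
  then have r\<alpha>: "t * n \<le> r * \<alpha>" and r\<beta>: "r * \<beta> \<le> t * n"
    by (simp_all only: of_nat_le_iff)
  define A B where "A = m * (t + r)" and "B = m * t"
  have "real ((\<alpha> + n - 1) choose n) ^ 2 * real ((\<alpha> + n) choose n) \<le> 4 * real A"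
  proof -
    have "1 / (4 * real (t + r)) * real ((\<alpha> + n - 1) choose n) ^ 2 * real ((\<alpha> + n) choose n) \<le> real m"
      using bound by simp
    then have "(4 * real (t + r)) * (1 / (4 * real (t + r)) * real ((\<alpha> + n - 1) choose n) ^ 2
        * real ((\<alpha> + n) choose n)) \<le> (4 * real (t + r)) * real m"
      by (rule mult_left_mono) simp
    then show ?thesis using assms by (simp add: A_def mult_ac)
  qed
  then have big\<alpha>: "((\<alpha> + n - 1) choose n) ^ 2 * ((\<alpha> + n) choose n) \<le> 4 * A"
    by (metis (mono_tags, lifting) of_nat_le_iff of_nat_mult of_nat_numeral of_nat_power)
  have "real ((\<beta> + n - 1) choose n) ^ 3 \<le> 4 * real B"
  proof -
    have "1 / (4 * real t) * real ((\<beta> + n - 1) choose n) ^ 3 \<le> real m"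
      using bound by simp
    then have "(4 * real t) * (1 / (4 * real t) * real ((\<beta> + n - 1) choose n) ^ 3)
      \<le> (4 * real t) * real m"
      by (rule mult_left_mono) simp
    then show ?thesis using assms by (simp add: B_def mult_ac)
  qed
  then have big\<beta>: "((\<beta> + n - 1) choose n) ^ 3 \<le> 4 * B"
    by (metis (mono_tags, lifting) of_nat_le_iff of_nat_mult of_nat_numeral of_nat_power)
  have "\<exists>q. q \<noteq> 0 \<and> (\<forall>x. eval_poly q x \<noteq> 0 \<longrightarrow> surj_degree n A B (\<lambda>e. x (var_code e)) (\<alpha> - 1))"
  proof (rule generic_surj_degree)
    have S: "Suc (\<alpha> - 1) = \<alpha>" using \<alpha>1 by simp
    have c: "card (mons n (\<alpha> - 1)) = (\<alpha> + n - 1) choose n" "card (mons n \<alpha>) = (\<alpha> + n) choose n"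
      using \<alpha>1 by (simp_all add: card_mons)
    show "card (mons n (\<alpha> - 1)) ^ 2 * card (mons n (Suc (\<alpha> - 1))) \<le> 4 * A"
      unfolding S c by (rule big\<alpha>)
    define p q where "p = card (mons n (\<alpha> - 1))" and "q = card (mons n \<alpha>)"
    have pq: "\<alpha> * q = (\<alpha> + n) * p"
      using card_mons_Suc[of "\<alpha> - 1" n] unfolding S p_def q_def .
    have "\<alpha> * (B * q) = m * t * (\<alpha> * q)" by (simp add: B_def mult_ac)
    also have "\<dots> = m * (t * \<alpha> + t * n) * p" unfolding pq by (simp add: algebra_simps)
    also have "\<dots> \<le> m * (t * \<alpha> + r * \<alpha>) * p" using r\<alpha> by (intro mult_le_mono) auto
    also have "\<dots> = \<alpha> * (A * p)" by (simp add: A_def algebra_simps)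
    finally show "B * card (mons n (Suc (\<alpha> - 1))) \<le> A * card (mons n (\<alpha> - 1))"
      unfolding S using \<alpha>1 by (simp add: p_def q_def)
  qed
  then obtain q1 where q1: "q1 \<noteq> 0"
    "\<And>x. eval_poly q1 x \<noteq> 0 \<Longrightarrow> surj_degree n A B (\<lambda>e. x (var_code e)) (\<alpha> - 1)" by blast
  have "\<exists>q. q \<noteq> 0 \<and> (\<forall>x. eval_poly q x \<noteq> 0 \<longrightarrow> inj_degree n A B (\<lambda>e. x (var_code e)) (\<beta> - 1))"
    if "\<beta> \<ge> 1"
  proof (rule generic_inj_degree)
    have S: "Suc (\<beta> - 1) = \<beta>" using that by simp
    have c: "card (mons n (\<beta> - 1)) = (\<beta> + n - 1) choose n"
      using that by (simp_all add: card_mons)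
    show "card (mons n (\<beta> - 1)) ^ 3 \<le> 4 * B" unfolding c by (rule big\<beta>)
    define p q where "p = card (mons n (\<beta> - 1))" and "q = card (mons n \<beta>)"
    have pq: "\<beta> * q = (\<beta> + n) * p"
      using card_mons_Suc[of "\<beta> - 1" n] unfolding S p_def q_def .
    have "\<beta> * (A * p) = m * (t * \<beta> + r * \<beta>) * p" by (simp add: A_def algebra_simps)
    also have "\<dots> \<le> m * (t * \<beta> + t * n) * p" using r\<beta> by (intro mult_le_mono) auto
    also have "\<dots> = m * t * (\<beta> * q)" unfolding pq by (simp add: algebra_simps)
    also have "\<dots> = \<beta> * (B * q)" by (simp add: B_def mult_ac)
    finally show "A * card (mons n (\<beta> - 1)) \<le> B * card (mons n (Suc (\<beta> - 1)))"
      unfolding S using that by (simp add: p_def q_def)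
  qed
  \<comment> \<open>For \<open>\<beta> = 0\<close> there is no degree in which injectivity is asked
    for, and the constant \<open>1\<close> serves as \<open>q\<close>.\<close>
  then have "\<exists>q. q \<noteq> 0 \<and> (\<forall>x. eval_poly q x \<noteq> 0 \<longrightarrow> \<beta> \<ge> 1 \<longrightarrow>
      inj_degree n A B (\<lambda>e. x (var_code e)) (\<beta> - 1))"
    by (cases "\<beta> \<ge> 1") (auto intro: exI[of _ 1])
  then obtain q2 where q2: "q2 \<noteq> 0"
    "\<And>x. eval_poly q2 x \<noteq> 0 \<Longrightarrow> \<beta> \<ge> 1 \<Longrightarrow> inj_degree n A B (\<lambda>e. x (var_code e)) (\<beta> - 1)" by blast
  have "q1 * q2 \<noteq> 0" using q1 q2 by simp
  moreover have "finite (hom_coords n A B)" by (simp add: hom_coords_def)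
  moreover have "inj_on var_code (hom_coords n A B)" by (auto intro: inj_onI)
  ultimately obtain \<Phi> where \<Phi>: "openin (zariski_affine (hom_coords n A B)) \<Phi>" "\<Phi> \<noteq> {}"
    "\<And>\<phi>. \<phi> \<in> \<Phi> \<Longrightarrow> \<exists>x. eval_poly (q1 * q2) x \<noteq> 0 \<and> (\<forall>i\<in>hom_coords n A B. x (var_code i) = \<phi> i)"
    using zariski_open_nonvanishing[of "q1 * q2" "hom_coords n A B" var_code] by blast
  have "(\<beta> \<ge> 1 \<longrightarrow> inj_degree n A B \<phi> (\<beta> - 1)) \<and> surj_degree n A B \<phi> (\<alpha> - 1)" if \<phi>: "\<phi> \<in> \<Phi>" for \<phi>
  proof -
    obtain x where x: "eval_poly (q1 * q2) x \<noteq> 0" "\<forall>i\<in>hom_coords n A B. x (var_code i) = \<phi> i"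
      using \<Phi>(3)[OF \<phi>] by blast
    have "inj_degree n A B (\<lambda>e. x (var_code e)) a = inj_degree n A B \<phi> a"
      "surj_degree n A B (\<lambda>e. x (var_code e)) a = surj_degree n A B \<phi> a" for a
      using x(2) by (intro inj_degree_cong surj_degree_cong; simp)+
    then show ?thesis using q1(2)[of x] q2(2)[of x] x(1) by auto
  qed
  then show "\<exists>\<Phi>. openin (zariski_affine (hom_coords n (m * (t + r)) (m * t))) \<Phi> \<and> \<Phi> \<noteq> {} \<and>
      (\<forall>\<phi>\<in>\<Phi>. (\<beta> \<ge> 1 \<longrightarrow> inj_degree n (m * (t + r)) (m * t) \<phi> (\<beta> - 1)) \<and>
        surj_degree n (m * (t + r)) (m * t) \<phi> (\<alpha> - 1))"
    using \<Phi>(1,2) unfolding A_def B_def by blast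
qed

section \<open>Homogeneous polynomials\<close>

text \<open>The degree is an integer, so that the zero polynomial is a form of every degree, in
  particular the only form of any given negative degree.\<close>

definition hforms :: "nat \<Rightarrow> int \<Rightarrow> nat polynomial set" where
  "hforms n b = {p. \<forall>e\<in>Poly_Mapping.keys p. \<exists>d. e \<in> mons n d \<and> int d = b}"

lemma forms_eq_hforms: "forms n d = hforms n (int d)"
  by (auto simp: forms_def hforms_def mons_def)

lemma hforms_zero [simp]: "0 \<in> hforms n b"
  by (simp add: hforms_def)

lemma hforms_neg: "p \<in> hforms n b \<Longrightarrow> b < 0 \<Longrightarrow> p = 0"
  by (cases "Poly_Mapping.keys p = {}") (auto simp: hforms_def)

lemma hforms_keys: "p \<in> hforms n (int d) \<Longrightarrow> e \<in> Poly_Mapping.keys p \<Longrightarrow> e \<in> mons n d"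
  by (auto simp: hforms_def)

lemma hforms_single: "e \<in> mons n d \<Longrightarrow> Poly_Mapping.single e c \<in> hforms n (int d)"
  by (auto simp: hforms_def)

lemma hforms_const [simp]: "Poly_Mapping.single 0 c \<in> hforms n 0"
  using hforms_single[of 0 n 0 c] by (simp add: mons_def)

lemma hforms_one [simp]: "1 \<in> hforms n 0"
  using hforms_const[of 1 n] by simp

lemma hforms_add: "p \<in> hforms n b \<Longrightarrow> q \<in> hforms n b \<Longrightarrow> p + q \<in> hforms n b"
  using keys_add[of p q] by (fastforce simp: hforms_def)

lemma hforms_uminus: "p \<in> hforms n b \<Longrightarrow> - p \<in> hforms n b"
  by (simp add: hforms_def in_keys_iff)

lemma hforms_sum: "(\<And>s. s \<in> S \<Longrightarrow> f s \<in> hforms n b) \<Longrightarrow> sum f S \<in> hforms n b"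
  by (induction S rule: infinite_finite_induct) (auto intro: hforms_add)

lemma hforms_mult:
  assumes "p \<in> hforms n b" "q \<in> hforms n c"
  shows "p * q \<in> hforms n (b + c)"
  unfolding hforms_def
proof (intro CollectI ballI)
  fix e assume "e \<in> Poly_Mapping.keys (p * q)"
  then obtain f g where fg: "f \<in> Poly_Mapping.keys p" "g \<in> Poly_Mapping.keys q" "e = f + g"
    using keys_mult[of p q] by blast
  obtain d d' where "f \<in> mons n d" "int d = b" "g \<in> mons n d'" "int d' = c"
    using assms fg(1,2) unfolding hforms_def by blast
  then show "\<exists>d. e \<in> mons n d \<and> int d = b + c"
    using mons_add[of f n d g d'] fg(3) by (intro exI[of _ "d + d'"]) simp
qed

lemma hforms_cmult: "p \<in> hforms n b \<Longrightarrow> Poly_Mapping.single 0 c * p \<in> hforms n b"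
  using hforms_mult[of "Poly_Mapping.single 0 c" n 0 p b] by simp

lemma hforms_power: "p \<in> hforms n b \<Longrightarrow> p ^ k \<in> hforms n (int k * b)"
  by (induction k) (auto simp: algebra_simps intro: hforms_mult)

lemma hforms_prod:
  "(\<And>s. s \<in> S \<Longrightarrow> f s \<in> hforms n (b s)) \<Longrightarrow> prod f S \<in> hforms n (sum b S)"
  by (induction S rule: infinite_finite_induct) (auto intro: hforms_mult)

definition X :: "nat \<Rightarrow> nat polynomial" where
  "X k = Poly_Mapping.single (xvar k) 1"

lemma eval_X [simp]: "eval_poly (X k) x = x k"
  by (simp add: X_def xvar_def mono_eval_single)

lemma X_in_hforms [simp]: "k \<le> n \<Longrightarrow> X k \<in> hforms n 1"
  using hforms_single[OF xvar_in_mons, of k n 1] by (simp add: X_def)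

lemma eval_poly_scale:
  assumes "p \<in> hforms n (int d)"
  shows "eval_poly p (\<lambda>i. c * x i) = c ^ d * eval_poly p x"
proof -
  have "eval_poly p (\<lambda>i. c * x i) =
      (\<Sum>e\<in>Poly_Mapping.keys p. poly_mapping.lookup p e * (c ^ d * mono_eval e x))"
    unfolding eval_poly_mono mono_eval_scale
    by (rule sum.cong) (use hforms_keys[OF assms] in \<open>auto simp: mons_def\<close>)
  then show ?thesis by (simp add: eval_poly_mono sum_distrib_left mult_ac)
qed

lemma eval_poly_cong:
  assumes "p \<in> hforms n b" "\<And>i. i \<le> n \<Longrightarrow> x i = y i"
  shows "eval_poly p x = eval_poly p y"
  unfolding eval_poly_mono mono_eval_def
  by (intro sum.cong prod.cong arg_cong2[of _ _ _ _ "(*)"] refl)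
    (use assms in \<open>auto simp: hforms_def mons_def subset_iff\<close>)

lemma eval_poly_at_zero:
  assumes "p \<in> hforms n b" "b > 0"
  shows "eval_poly p (\<lambda>_. 0) = 0"
proof -
  have "mono_eval e (\<lambda>_. 0) = 0" if "e \<in> Poly_Mapping.keys p" for e
  proof -
    have "\<exists>d. e \<in> mons n d \<and> int d = b" using assms(1) that by (simp add: hforms_def)
    then obtain d where d: "e \<in> mons n d" "int d = b" by (elim exE conjE)
    have "Poly_Mapping.keys e \<noteq> {}"
    proof
      assume "Poly_Mapping.keys e = {}"
      then have "d = 0" using d(1) by (simp add: mons_def)
      then show False using d(2) assms(2) by simp
    qed
    then obtain i where "i \<in> Poly_Mapping.keys e" by blast
    then show ?thesis unfolding mono_eval_def
      by (intro prod_zero) (auto simp: in_keys_iff intro!: bexI[of _ i])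
  qed
  then show ?thesis by (simp add: eval_poly_mono)
qed

section \<open>Parts of a polynomial cut out by sets of monomials\<close>

definition restr :: "'a set \<Rightarrow> ('a \<Rightarrow>\<^sub>0 'b::comm_monoid_add) \<Rightarrow> 'a \<Rightarrow>\<^sub>0 'b" where
  "restr T p = (\<Sum>e\<in>Poly_Mapping.keys p \<inter> T. Poly_Mapping.single e (poly_mapping.lookup p e))"

lemma lookup_restr: "poly_mapping.lookup (restr T p) e = (if e \<in> T then poly_mapping.lookup p e else 0)"
  by (auto simp: restr_def lookup_sum lookup_single when_def in_keys_iff)

lemma restr_zero [simp]: "restr T 0 = 0"
  by (simp add: restr_def)

lemma restr_add: "restr T (p + q) = restr T p + restr T q"
  by (rule poly_mapping_eqI) (simp add: lookup_restr lookup_add)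

lemma restr_sum: "restr T (sum f S) = (\<Sum>s\<in>S. restr T (f s))"
  by (induction S rule: infinite_finite_induct) (auto simp: restr_add)

lemma keys_restr: "Poly_Mapping.keys (restr T p) = Poly_Mapping.keys p \<inter> T"
  by (auto simp: in_keys_iff lookup_restr split: if_splits)

lemma restr_eq_self: "Poly_Mapping.keys p \<subseteq> T \<Longrightarrow> restr T p = p"
  by (rule poly_mapping_eqI) (auto simp: lookup_restr in_keys_iff)

lemma restr_eq_zero: "Poly_Mapping.keys p \<inter> T = {} \<Longrightarrow> restr T p = 0"
  by (rule poly_mapping_eqI) (auto simp: lookup_restr in_keys_iff)

text \<open>With \<open>q\<close> homogeneous, \<open>S\<close> the monomials of one degree and
  \<open>T\<close> those of the complementary degree: taking homogeneous components of
  \<open>c\<close> commutes with multiplication by \<open>q\<close>.\<close>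

lemma restr_mult:
  fixes c q :: "('i \<Rightarrow>\<^sub>0 nat) \<Rightarrow>\<^sub>0 complex"
  assumes "\<And>e f. f \<in> Poly_Mapping.keys q \<Longrightarrow> e + f \<in> S \<longleftrightarrow> e \<in> T"
  shows "restr S (c * q) = restr T c * q"
proof (induction c rule: poly_mapping_induct)
  case (single e a)
  have keys: "Poly_Mapping.keys (Poly_Mapping.single e a * q) \<subseteq> (\<lambda>f. e + f) ` Poly_Mapping.keys q"
    using keys_mult[of "Poly_Mapping.single e a" q] by (auto split: if_splits)
  show ?case
  proof (cases "e \<in> T")
    case True
    then have "restr T (Poly_Mapping.single e a) = Poly_Mapping.single e a"
      by (intro restr_eq_self) auto
    moreover have "restr S (Poly_Mapping.single e a * q) = Poly_Mapping.single e a * q"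
      using keys True assms by (intro restr_eq_self) blast
    ultimately show ?thesis by simp
  next
    case False
    then have "restr T (Poly_Mapping.single e a) = 0"
      by (intro restr_eq_zero) auto
    moreover have "restr S (Poly_Mapping.single e a * q) = 0"
      using keys False assms by (intro restr_eq_zero) blast
    ultimately show ?thesis by simp
  qed
qed (auto simp: restr_add algebra_simps)

subsection \<open>The action of a matrix of linear forms\<close>

definition lin :: "nat \<Rightarrow> (nat \<times> nat \<times> nat \<Rightarrow> complex) \<Rightarrow> nat \<Rightarrow> nat \<Rightarrow> nat polynomial" where
  "lin n \<phi> i j = (\<Sum>k\<le>n. Poly_Mapping.single (xvar k) (\<phi> (i, j, k)))"

definition act :: "nat \<Rightarrow> nat \<Rightarrow> (nat \<times> nat \<times> nat \<Rightarrow> complex) \<Rightarrow> (nat \<Rightarrow> nat polynomial) \<Rightarrow> nat \<Rightarrow> nat polynomial" where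
  "act n A \<phi> P i = (\<Sum>j<A. lin n \<phi> i j * P j)"

lemma eval_lin: "eval_poly (lin n \<phi> i j) x = (\<Sum>k\<le>n. \<phi> (i, j, k) * x k)"
  by (simp add: lin_def xvar_def mono_eval_single)

lemma lin_in_hforms: "lin n \<phi> i j \<in> hforms n 1"
  unfolding lin_def by (rule hforms_sum) (use hforms_single[OF xvar_in_mons] in force)

lemma act_in_hforms: "(\<And>j. P j \<in> hforms n b) \<Longrightarrow> act n A \<phi> P i \<in> hforms n (b + 1)"
  unfolding act_def by (rule hforms_sum) (metis lin_in_hforms hforms_mult add.commute)

lemma act_mult: "act n A \<phi> (\<lambda>j. q * P j) i = q * act n A \<phi> P i"
  by (simp add: act_def sum_distrib_left mult_ac)

lemma act_sum: "act n A \<phi> (\<lambda>j. \<Sum>s\<in>S. P s j) i = (\<Sum>s\<in>S. act n A \<phi> (P s) i)"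
  unfolding act_def by (subst sum.swap) (simp add: sum_distrib_left)

lemma lookup_xvar_mult:
  fixes p :: "nat polynomial"
  shows "poly_mapping.lookup (Poly_Mapping.single (xvar k) c * p) e = c * mulx k (poly_mapping.lookup p) e"
proof (induction p rule: poly_mapping_induct)
  case (single f d)
  show ?case
  proof (cases "poly_mapping.lookup e k > 0")
    case True
    have "xvar k + f = e \<longleftrightarrow> f = e - xvar k"
      using monomial_split[OF True] by (metis add.commute add_diff_cancel_right')
    then show ?thesis using True by (auto simp: mult_single lookup_single mulx_def when_def)
  next
    case False
    then have "xvar k + f \<noteq> e" by (auto simp: lookup_add)
    then show ?thesis using False by (simp add: mult_single lookup_single mulx_def)
  qed
qed (auto simp: mulx_def distrib_left lookup_add)

lemma lookup_act:
  assumes "e' \<in> mons n (Suc a)"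
  shows "poly_mapping.lookup (act n A \<phi> P i) e' =
    (\<Sum>c\<in>{..<A} \<times> mons n a. tmat n \<phi> (i, e') c * poly_mapping.lookup (P (fst c)) (snd c))"
proof -
  have "poly_mapping.lookup (act n A \<phi> P i) e' =
      (\<Sum>j<A. \<Sum>k\<le>n. \<phi> (i, j, k) * mulx k (poly_mapping.lookup (P j)) e')"
    by (simp add: act_def lin_def lookup_sum sum_distrib_right lookup_xvar_mult)
  also have "\<dots> = (\<Sum>j<A. \<Sum>e\<in>mons n a. tmat n \<phi> (i, e') (j, e) * poly_mapping.lookup (P j) e)"
    by (simp add: tmat_mulx[OF assms])
  finally show ?thesis by (simp add: sum.cartesian_product split_def)
qed

text \<open>Injectivity passes to lower degrees: multiplication by a power of
  \<open>x\<^sub>0\<close> commutes with the matrix and moves a kernel vector up to degree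
  \<open>a0\<close> without killing it.\<close>

lemma act_injective:
  assumes inj: "inj_degree n A B \<phi> a0" and "b \<le> int a0"
    and P: "\<And>j. P j \<in> hforms n b" and zero: "\<And>i. i < B \<Longrightarrow> act n A \<phi> P i = 0" and "j < A"
  shows "P j = 0"
proof (cases "b < 0")
  case True
  then show ?thesis using P hforms_neg by blast
next
  case False
  define Q where "Q j = X 0 ^ nat (int a0 - b) * P j" for j
  have Q: "Q j \<in> hforms n (int a0)" for j
    using hforms_mult[OF hforms_power[OF X_in_hforms[of 0 n]] P, of "nat (int a0 - b)"] assms(2)
    by (simp add: Q_def)
  have "act n A \<phi> Q i = 0" if "i < B" for i
    using zero[OF that] by (simp add: Q_def[abs_def] act_mult)
  then have "\<forall>r\<in>{..<B} \<times> mons n (Suc a0). (\<Sum>c\<in>{..<A} \<times> mons n a0.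
      tmat n \<phi> r c * poly_mapping.lookup (Q (fst c)) (snd c)) = 0"
    by (auto simp: lookup_act[symmetric])
  then have *: "\<forall>c\<in>{..<A} \<times> mons n a0. poly_mapping.lookup (Q (fst c)) (snd c) = 0"
    using inj[unfolded inj_degree_def, THEN spec,
        of "\<lambda>c. poly_mapping.lookup (Q (fst c)) (snd c)"] by (rule rev_mp)
  have "Q j = 0"
  proof (rule poly_mapping_eqI)
    fix e
    show "poly_mapping.lookup (Q j) e = poly_mapping.lookup 0 e"
      using * \<open>j < A\<close> hforms_keys[OF Q, of e j] by (cases "e \<in> mons n a0") (auto simp: in_keys_iff)
  qed
  moreover have "X 0 \<noteq> 0"
    by (metis X_def keys_single keys_zero insert_not_empty zero_neq_one)
  ultimately show ?thesis by (simp add: Q_def)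
qed

text \<open>Surjectivity passes to higher degrees: a monomial of the next degree is
  \<open>x\<^sub>k\<close> times one of the previous degree, and a preimage is multiplied along with
  it.\<close>

lemma act_surjective_monomial:
  assumes surj: "surj_degree n A B \<phi> a0" and "i0 < B"
  shows "e \<in> mons n (Suc (a0 + d)) \<Longrightarrow>
    \<exists>P. (\<forall>j. P j \<in> hforms n (int (a0 + d))) \<and>
      (\<forall>i<B. act n A \<phi> P i = (if i = i0 then Poly_Mapping.single e 1 else 0))"
proof (induction d arbitrary: e)
  case 0
  obtain v where v: "\<And>i e'. i < B \<Longrightarrow> e' \<in> mons n (Suc a0) \<Longrightarrow>
      (\<Sum>c\<in>{..<A} \<times> mons n a0. tmat n \<phi> (i, e') c * v c) = (if i = i0 \<and> e' = e then 1 else 0)"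
    using surj[unfolded surj_degree_def, rule_format, of "\<lambda>(i, e'). if i = i0 \<and> e' = e then 1 else 0"]
    by auto
  define P where "P j = (\<Sum>e\<in>mons n a0. Poly_Mapping.single e (v (j, e)))" for j
  have P: "P j \<in> hforms n (int a0)" for j
    unfolding P_def by (intro hforms_sum hforms_single)
  have look: "poly_mapping.lookup (P j) f = v (j, f)" if "f \<in> mons n a0" for j f
    using that finite_mons by (simp add: P_def lookup_sum lookup_single when_def)
  have "act n A \<phi> P i = (if i = i0 then Poly_Mapping.single e 1 else 0)" if "i < B" for i
  proof (rule poly_mapping_eqI)
    fix e'
    show "poly_mapping.lookup (act n A \<phi> P i) e' =
      poly_mapping.lookup (if i = i0 then Poly_Mapping.single e 1 else 0) e'"
    proof (cases "e' \<in> mons n (Suc a0)")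
      case True
      have "poly_mapping.lookup (act n A \<phi> P i) e' = (\<Sum>c\<in>{..<A} \<times> mons n a0. tmat n \<phi> (i, e') c * v c)"
        unfolding lookup_act[OF True] by (rule sum.cong) (auto simp: look)
      then show ?thesis using v[OF that True] by (auto simp: lookup_single)
    next
      case False
      have "act n A \<phi> P i \<in> hforms n (int (Suc a0))"
        using act_in_hforms[of P n "int a0" A \<phi> i] P by (simp add: add.commute)
      then have "e' \<notin> Poly_Mapping.keys (act n A \<phi> P i)" using False hforms_keys by blast
      moreover have "e \<noteq> e'" using False 0 by auto
      ultimately show ?thesis by (auto simp: in_keys_iff lookup_single)
    qed
  qed
  then show ?case using P by (intro exI[of _ P]) auto
next
  case (Suc d)
  obtain k f where kf: "k \<le> n" "f \<in> mons n (Suc (a0 + d))" "e = f + xvar k"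
    using Suc.prems mons_Suc_cases[of e n "Suc (a0 + d)"] by auto
  obtain P where P: "\<And>j. P j \<in> hforms n (int (a0 + d))"
    "\<And>i. i < B \<Longrightarrow> act n A \<phi> P i = (if i = i0 then Poly_Mapping.single f 1 else 0)"
    using Suc.IH[OF kf(2)] by blast
  have "X k * P j \<in> hforms n (int (a0 + Suc d))" for j
    using hforms_mult[OF X_in_hforms[OF kf(1)] P(1)[of j]] by (simp add: add.commute)
  moreover have "act n A \<phi> (\<lambda>j. X k * P j) i = (if i = i0 then Poly_Mapping.single e 1 else 0)"
    if "i < B" for i
    using P(2)[OF that] by (auto simp: act_mult X_def mult_single kf(3) add.commute)
  ultimately show ?case by (intro exI[of _ "\<lambda>j. X k * P j"]) auto
qed

lemma poly_mapping_expand: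
  fixes p :: "'i polynomial"
  shows "p = (\<Sum>e\<in>Poly_Mapping.keys p. Poly_Mapping.single 0 (poly_mapping.lookup p e) * Poly_Mapping.single e 1)"
  by (rule poly_mapping_eqI) (auto simp: lookup_sum mult_single lookup_single when_def in_keys_iff)

lemma act_surjective:
  assumes surj: "surj_degree n A B \<phi> a0" and "a \<ge> a0"
    and Q: "\<And>i. i < B \<Longrightarrow> Q i \<in> hforms n (int (Suc a))"
  shows "\<exists>P. (\<forall>j. P j \<in> hforms n (int a)) \<and> (\<forall>i<B. act n A \<phi> P i = Q i)"
proof -
  obtain d where a: "a = a0 + d" using \<open>a \<ge> a0\<close> le_Suc_ex by blast
  have "\<forall>s. \<exists>P. fst s < B \<and> snd s \<in> mons n (Suc a) \<longrightarrow> (\<forall>j. P j \<in> hforms n (int a)) \<and>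
      (\<forall>i<B. act n A \<phi> P i = (if i = fst s then Poly_Mapping.single (snd s) 1 else 0))"
    using act_surjective_monomial[OF surj, of _ _ d] unfolding a by blast
  from choice[OF this] obtain P where P: "\<And>i0 e j. i0 < B \<Longrightarrow> e \<in> mons n (Suc a) \<Longrightarrow> P (i0, e) j \<in> hforms n (int a)"
    "\<And>i0 e i. i0 < B \<Longrightarrow> e \<in> mons n (Suc a) \<Longrightarrow> i < B \<Longrightarrow>
      act n A \<phi> (P (i0, e)) i = (if i = i0 then Poly_Mapping.single e 1 else 0)"
    by fastforce
  define R where "R j = (\<Sum>i0<B. \<Sum>e\<in>Poly_Mapping.keys (Q i0).
      Poly_Mapping.single 0 (poly_mapping.lookup (Q i0) e) * P (i0, e) j)" for j
  have keys: "e \<in> mons n (Suc a)" if "i < B" "e \<in> Poly_Mapping.keys (Q i)" for i e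
    using Q[OF that(1)] that(2) hforms_keys by blast
  have "R j \<in> hforms n (int a)" for j
    unfolding R_def by (intro hforms_sum hforms_cmult P(1)) (auto simp: keys)
  moreover have "act n A \<phi> R i = Q i" if i: "i < B" for i
  proof -
    have "act n A \<phi> R i = (\<Sum>i0<B. \<Sum>e\<in>Poly_Mapping.keys (Q i0).
        Poly_Mapping.single 0 (poly_mapping.lookup (Q i0) e) * act n A \<phi> (P (i0, e)) i)"
      unfolding R_def[abs_def] act_sum act_mult ..
    also have "\<dots> = (\<Sum>i0<B. if i = i0 then \<Sum>e\<in>Poly_Mapping.keys (Q i0).
        Poly_Mapping.single 0 (poly_mapping.lookup (Q i0) e) * Poly_Mapping.single e 1 else 0)"
      by (rule sum.cong) (auto simp: P(2) keys i)
    also have "\<dots> = Q i" using i poly_mapping_expand[of "Q i"] by simp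
    finally show ?thesis .
  qed
  ultimately show ?thesis by blast
qed

section \<open>The Nullstellensatz\<close>

text \<open>If no power of \<open>g\<close> lies in an ideal, choose \<open>M\<close> maximal among the larger ideals with this
  property; \<open>M\<close> is prime. If no \<open>x\<^sub>i - c\<close> were in \<open>M\<close>, then for all complex \<open>c\<close> there would be
  \<open>u\<^sub>c (x\<^sub>i - c) - g\<^sup>k \<in> M\<close>. The polynomial ring has countable dimension, so some of the uncountably
  many \<open>u\<^sub>c\<close> are linearly dependent, which gives a nonzero univariate polynomial in \<open>x\<^sub>i\<close> that
  belongs to \<open>M\<close>. So \<open>M\<close> consists of polynomials vanishing at a point where \<open>g\<close> does not.\<close>

definition is_ideal :: "'a::comm_ring_1 set \<Rightarrow> bool" where
  "is_ideal I \<longleftrightarrow> 0 \<in> I \<and> (\<forall>a\<in>I. \<forall>b\<in>I. a + b \<in> I) \<and> (\<forall>a\<in>I. \<forall>r. r * a \<in> I)"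

lemma is_ideal_sum: "is_ideal I \<Longrightarrow> (\<And>s. s \<in> S \<Longrightarrow> f s \<in> I) \<Longrightarrow> sum f S \<in> I"
  by (induction S rule: infinite_finite_induct) (auto simp: is_ideal_def)

lemma is_ideal_diff: "is_ideal I \<Longrightarrow> a \<in> I \<Longrightarrow> b \<in> I \<Longrightarrow> a - b \<in> I"
  unfolding is_ideal_def by (metis add_uminus_conv_diff mult_minus1)

definition span_ideal :: "'i set \<Rightarrow> ('i \<Rightarrow> 'a::comm_ring_1) \<Rightarrow> 'a set" where
  "span_ideal I q = {p. \<exists>F c. finite F \<and> F \<subseteq> I \<and> p = (\<Sum>i\<in>F. c i * q i)}"

lemma span_ideal_mem: "i \<in> I \<Longrightarrow> q i \<in> span_ideal I q"
  unfolding span_ideal_def by (intro CollectI exI[of _ "{i}"] exI[of _ "\<lambda>_. 1"]) auto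

lemma is_ideal_span_ideal: "is_ideal (span_ideal I q)"
  unfolding is_ideal_def
proof (intro conjI ballI allI)
  show "0 \<in> span_ideal I q"
    unfolding span_ideal_def by (intro CollectI exI[of _ "{}"]) auto
next
  fix a b assume "a \<in> span_ideal I q" "b \<in> span_ideal I q"
  then obtain F c G d where F: "finite F" "F \<subseteq> I" "a = (\<Sum>i\<in>F. c i * q i)"
    and G: "finite G" "G \<subseteq> I" "b = (\<Sum>i\<in>G. d i * q i)"
    unfolding span_ideal_def by blast
  have "a = (\<Sum>i\<in>F \<union> G. (if i \<in> F then c i else 0) * q i)"
    unfolding F(3) by (rule sum.mono_neutral_cong_left) (use F G in auto)
  moreover have "b = (\<Sum>i\<in>F \<union> G. (if i \<in> G then d i else 0) * q i)"
    unfolding G(3) by (rule sum.mono_neutral_cong_left) (use F G in auto)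
  ultimately have "a + b = (\<Sum>i\<in>F \<union> G. ((if i \<in> F then c i else 0) + (if i \<in> G then d i else 0)) * q i)"
    by (simp add: distrib_right sum.distrib)
  then show "a + b \<in> span_ideal I q"
    unfolding span_ideal_def using F G
    by (intro CollectI exI[of _ "F \<union> G"] exI[of _ "\<lambda>i. (if i \<in> F then c i else 0) + (if i \<in> G then d i else 0)"])
      auto
next
  fix a r assume "a \<in> span_ideal I q"
  then obtain F c where F: "finite F" "F \<subseteq> I" "a = (\<Sum>i\<in>F. c i * q i)"
    unfolding span_ideal_def by blast
  then show "r * a \<in> span_ideal I q"
    unfolding span_ideal_def
    by (intro CollectI exI[of _ F] exI[of _ "\<lambda>i. r * c i"]) (simp add: sum_distrib_left mult.assoc)
qed

definition const :: "complex \<Rightarrow> nat polynomial" where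
  "const c = Poly_Mapping.single 0 c"

lemma eval_const [simp]: "eval_poly (const c) x = c"
  by (simp add: const_def)

lemma eval_poly_inject: "(\<And>x. eval_poly p x = eval_poly q x) \<Longrightarrow> p = q"
  using eval_poly_eq_zero[of "p - q"] by simp

text \<open>For \<open>f\<close> outside \<open>M\<close>, the ideal generated by \<open>M\<close>
  and \<open>f\<close> is larger, hence contains a power of \<open>g\<close>. So modulo
  \<open>M\<close> both factors of a product in \<open>M\<close> would divide powers of
  \<open>g\<close>, and multiplying the two relations would put a power of \<open>g\<close> into
  \<open>M\<close>.\<close>

lemma ideal_avoiding_powers_prime:
  fixes g :: "'a::comm_ring_1"
  assumes M: "is_ideal M" "\<And>N. g ^ N \<notin> M"
    and max: "\<And>I. is_ideal I \<Longrightarrow> M \<subseteq> I \<Longrightarrow> (\<And>N. g ^ N \<notin> I) \<Longrightarrow> I = M"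
  shows "\<And>f. f \<notin> M \<Longrightarrow> \<exists>u N. u * f - g ^ N \<in> M"
    and "\<And>f h. f * h \<in> M \<Longrightarrow> f \<in> M \<or> h \<in> M"
proof -
  show *: "\<exists>u N. u * f - g ^ N \<in> M" if "f \<notin> M" for f
  proof (rule ccontr)
    assume no: "\<nexists>u N. u * f - g ^ N \<in> M"
    define I where "I = {m + u * f |m u. m \<in> M}"
    have "is_ideal I"
      unfolding is_ideal_def
    proof (intro conjI ballI allI)
      show "0 \<in> I" unfolding I_def using M(1) by (auto simp: is_ideal_def intro!: exI[of _ 0])
    next
      fix a b assume "a \<in> I" "b \<in> I"
      then obtain m u m' u' where "m \<in> M" "m' \<in> M" "a = m + u * f" "b = m' + u' * f"
        unfolding I_def by blast
      then have "a + b = (m + m') + (u + u') * f" "m + m' \<in> M"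
        using M(1) by (auto simp: algebra_simps is_ideal_def)
      then show "a + b \<in> I" unfolding I_def by blast
    next
      fix a r assume "a \<in> I"
      then obtain m u where "m \<in> M" "a = m + u * f" unfolding I_def by blast
      then have "r * a = r * m + (r * u) * f" "r * m \<in> M"
        using M(1) by (auto simp: algebra_simps is_ideal_def)
      then show "r * a \<in> I" unfolding I_def by blast
    qed
    moreover have "M \<subseteq> I"
    proof
      fix m assume "m \<in> M"
      then have "m = m + 0 * f \<and> m \<in> M" by simp
      then show "m \<in> I" unfolding I_def by blast
    qed
    moreover have "g ^ N \<notin> I" for N
    proof
      assume "g ^ N \<in> I"
      then obtain m u where m: "m \<in> M" "g ^ N = m + u * f" unfolding I_def by blast
      then have "u * f - g ^ N = 0 - m" by simp
      then have "u * f - g ^ N \<in> M"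
        using is_ideal_diff[OF M(1), of 0 m] M(1) m(1) by (simp add: is_ideal_def)
      then show False using no by blast
    qed
    ultimately have "I = M" by (rule max)
    moreover have "f = 0 + 1 * f \<and> 0 \<in> M" using M(1) by (simp add: is_ideal_def)
    then have "f \<in> I" unfolding I_def by blast
    ultimately show False using that by simp
  qed
  show "f \<in> M \<or> h \<in> M" if "f * h \<in> M" for f h
  proof (rule ccontr)
    assume "\<not> (f \<in> M \<or> h \<in> M)"
    then obtain u N u' N' where u: "u * f - g ^ N \<in> M" "u' * h - g ^ N' \<in> M"
      using *[of f] *[of h] by blast
    define a b where "a = u * f - g ^ N" and "b = u' * h - g ^ N'"
    have "g ^ (N + N') = (u * u') * (f * h) - (u' * h) * a - (g ^ N) * b"
      unfolding a_def b_def by (simp add: power_add algebra_simps)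
    moreover have "(u * u') * (f * h) - (u' * h) * a - (g ^ N) * b \<in> M"
      using u that M(1) by (intro is_ideal_diff) (auto simp: is_ideal_def a_def b_def)
    ultimately show False using M(2) by metis
  qed
qed

definition upoly :: "nat \<Rightarrow> complex poly \<Rightarrow> nat polynomial" where
  "upoly i p = (\<Sum>k\<le>degree p. const (coeff p k) * X i ^ k)"

lemma eval_upoly [simp]: "eval_poly (upoly i p) x = poly p (x i)"
  by (simp add: upoly_def poly_altdef)

text \<open>A root splits off a linear factor, and primality puts it or the quotient into
  \<open>M\<close>. The descent cannot reach a nonzero constant, which would be a unit in
  \<open>M\<close>.\<close>

lemma prime_ideal_linear_factor:
  assumes M: "is_ideal M" "1 \<notin> M" and prime: "\<And>f h. f * h \<in> M \<Longrightarrow> f \<in> M \<or> h \<in> M"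
  shows "upoly i p \<in> M \<Longrightarrow> p \<noteq> 0 \<Longrightarrow> \<exists>c. X i - const c \<in> M"
proof (induction "degree p" arbitrary: p)
  case 0
  then obtain c where c: "p = [:c:]" "c \<noteq> 0" by (metis degree_eq_zeroE pCons_eq_0_iff)
  have "const (1 / c) * upoly i p = 1"
    by (rule eval_poly_inject) (use c in simp)
  then have "1 \<in> M" using M(1) 0(2) unfolding is_ideal_def by metis
  then show ?case using M(2) by simp
next
  case (Suc d)
  then have "\<not> constant (poly p)" by (simp add: constant_degree)
  then obtain z where "poly p z = 0" using fundamental_theorem_of_algebra by blast
  then obtain p' where p': "p = [:- z, 1:] * p'" by (meson dvdE poly_eq_0_iff_dvd)
  have "upoly i p = (X i - const z) * upoly i p'"
    by (rule eval_poly_inject) (simp add: p' algebra_simps)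
  then have "X i - const z \<in> M \<or> upoly i p' \<in> M" using Suc.prems prime by metis
  moreover have "p' \<noteq> 0" using p' Suc.prems by auto
  moreover have "degree p' = d"
    using Suc.hyps(2) \<open>p' \<noteq> 0\<close> unfolding p' by (subst (asm) degree_mult_eq) auto
  ultimately show ?case using Suc.hyps(1)[of p'] by blast
qed

text \<open>Pigeonhole: each complex number is labelled by a finite box of monomials containing the
  support of \<open>u c\<close>, and by \<open>N c\<close>. There are countably many labels, so one
  is shared by infinitely many numbers, more than the box has monomials. The common label also makes
  the exponents \<open>N c\<close> equal.\<close>

lemma complex_dependent_family:
  fixes u :: "complex \<Rightarrow> nat polynomial" and N :: "complex \<Rightarrow> nat"
  obtains C cf k where "finite C" "\<exists>c\<in>C. cf c \<noteq> 0" "\<And>c. c \<in> C \<Longrightarrow> N c = k"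
    "(\<Sum>c\<in>C. const (cf c) * u c) = 0"
proof -
  \<comment> \<open>Bounds the variables as well as the exponents, since infinitely many variables
    occur in the ring.\<close>
  define K where "K d = {e::monomial. Poly_Mapping.keys e \<subseteq> {..d} \<and> (\<forall>i. poly_mapping.lookup e i \<le> d)}" for d
  have "K d \<subseteq> (\<Union>s\<le>Suc d * d. mons d s)" for d
  proof
    fix e assume e: "e \<in> K d"
    have "(\<Sum>i\<le>d. poly_mapping.lookup e i) \<le> (\<Sum>i\<le>d. d)"
      using e by (intro sum_mono) (auto simp: K_def)
    then show "e \<in> (\<Union>s\<le>Suc d * d. mons d s)" using e by (auto simp: mons_iff K_def)
  qed
  then have finK: "finite (K d)" for d by (rule finite_subset) (use finite_mons in auto)
  have "\<exists>d. Poly_Mapping.keys p \<subseteq> K d" for p :: "nat polynomial"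
  proof -
    define D where "D e = Max (insert 0 (Poly_Mapping.keys e \<union> poly_mapping.lookup e ` Poly_Mapping.keys e))" for e :: monomial
    have D: "i \<le> D e" "poly_mapping.lookup e i \<le> D e" if "i \<in> Poly_Mapping.keys e" for i e
      using that unfolding D_def by (auto intro!: Max_ge)
    define m where "m = Max (insert 0 (D ` Poly_Mapping.keys p))"
    have m: "D e \<le> m" if "e \<in> Poly_Mapping.keys p" for e
      using that unfolding m_def by (auto intro!: Max_ge)
    have "e \<in> K m" if "e \<in> Poly_Mapping.keys p" for e
      unfolding K_def
    proof (intro CollectI conjI subsetI allI)
      fix i assume "i \<in> Poly_Mapping.keys e"
      then show "i \<in> {..m}" using D[of i e] m[OF that] by simp
    next
      fix i show "poly_mapping.lookup e i \<le> m"
        using D[of i e] m[OF that] by (cases "i \<in> Poly_Mapping.keys e") (auto simp: in_keys_iff)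
    qed
    then show ?thesis by blast
  qed
  then have "\<forall>c. \<exists>d. Poly_Mapping.keys (u c) \<subseteq> K d" by blast
  from choice[OF this] obtain d where d: "\<And>c. Poly_Mapping.keys (u c) \<subseteq> K (d c)" by blast
  define h where "h c = (d c, N c)" for c
  have "\<exists>s. infinite (h -` {s})"
  proof (rule ccontr)
    assume "\<nexists>s. infinite (h -` {s})"
    then have "countable (\<Union>s. h -` {s})" by (intro countable_UN) (auto intro: countable_finite)
    moreover have "(\<Union>s. h -` {s}) = UNIV" by auto
    ultimately show False using uncountable_UNIV_complex by simp
  qed
  then obtain s where s: "infinite (h -` {s})" by blast
  obtain C where C: "C \<subseteq> h -` {s}" "finite C" "card C = Suc (card (K (fst s)))"
    using infinite_arbitrarily_large[OF s] by blast
  have dC: "d c = fst s" and NC: "N c = snd s" if "c \<in> C" for c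
    using C(1) that by (auto simp: h_def)
  obtain cf where cf: "\<exists>c\<in>C. cf c \<noteq> 0"
    "\<And>e. e \<in> K (fst s) \<Longrightarrow> (\<Sum>c\<in>C. cf c * poly_mapping.lookup (u c) e) = 0"
    using underdetermined_system[OF finK C(2), of "fst s" "\<lambda>c. poly_mapping.lookup (u c)"] C(3) by auto
  have "(\<Sum>c\<in>C. const (cf c) * u c) = 0"
  proof (rule poly_mapping_eqI)
    fix e
    have l: "poly_mapping.lookup (const a * p) e = a * poly_mapping.lookup p e" for a and p :: "nat polynomial"
      by (induction p rule: poly_mapping_induct)
        (auto simp: const_def mult_single lookup_single lookup_add algebra_simps when_def)
    have "(\<Sum>c\<in>C. cf c * poly_mapping.lookup (u c) e) = 0"
    proof (cases "e \<in> K (fst s)")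
      case False
      then have "poly_mapping.lookup (u c) e = 0" if "c \<in> C" for c
        using d[of c] dC[OF that] by (auto simp: in_keys_iff)
      then show ?thesis by simp
    qed (rule cf(2))
    then show "poly_mapping.lookup (\<Sum>c\<in>C. const (cf c) * u c) e = poly_mapping.lookup 0 e"
      by (simp add: lookup_sum l)
  qed
  then show thesis using that[of C cf "snd s"] C(2) cf(1) NC by blast
qed

theorem Nullstellensatz:
  fixes q :: "'i \<Rightarrow> nat polynomial"
  assumes zeros: "\<And>x. (\<And>i. i \<in> I \<Longrightarrow> eval_poly (q i) x = 0) \<Longrightarrow> eval_poly g x = 0"
  shows "\<exists>N. g ^ N \<in> span_ideal I q"
proof (rule ccontr)
  assume "\<nexists>N. g ^ N \<in> span_ideal I q"
  then have no: "g ^ N \<notin> span_ideal I q" for N by blast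
  define \<A> where "\<A> = {J. is_ideal J \<and> span_ideal I q \<subseteq> J \<and> (\<forall>N. g ^ N \<notin> J)}"
  have "span_ideal I q \<in> \<A>" using no by (simp add: \<A>_def is_ideal_span_ideal)
  then have ne: "\<A> \<noteq> {}" by blast
  have "\<exists>M\<in>\<A>. \<forall>J\<in>\<A>. M \<subseteq> J \<longrightarrow> J = M"
  proof (rule subset_Zorn_nonempty[OF ne])
    fix \<C> assume \<C>: "\<C> \<noteq> {}" "subset.chain \<A> \<C>"
    then have sub: "\<C> \<subseteq> \<A>" and chain: "\<And>J K. J \<in> \<C> \<Longrightarrow> K \<in> \<C> \<Longrightarrow> J \<subseteq> K \<or> K \<subseteq> J"
      by (auto simp: subset_chain_def)
    have ideal: "is_ideal J" if "J \<in> \<C>" for J using sub that by (auto simp: \<A>_def)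
    have "is_ideal (\<Union>\<C>)"
      unfolding is_ideal_def
    proof (intro conjI ballI allI)
      show "0 \<in> \<Union>\<C>" using \<C>(1) ideal by (auto simp: is_ideal_def)
    next
      fix a b assume "a \<in> \<Union>\<C>" "b \<in> \<Union>\<C>"
      then obtain J K where JK: "J \<in> \<C>" "K \<in> \<C>" "a \<in> J" "b \<in> K" by blast
      then have "\<exists>L\<in>\<C>. a \<in> L \<and> b \<in> L" using chain[of J K] by blast
      then show "a + b \<in> \<Union>\<C>" using ideal unfolding is_ideal_def by blast
    next
      fix a r assume "a \<in> \<Union>\<C>"
      then show "r * a \<in> \<Union>\<C>" using ideal unfolding is_ideal_def by blast
    qed
    then show "\<Union>\<C> \<in> \<A>" using \<C>(1) sub unfolding \<A>_def by blast
  qed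
  then obtain M where "M \<in> \<A>" and maxM: "\<And>J. J \<in> \<A> \<Longrightarrow> M \<subseteq> J \<Longrightarrow> J = M" by blast
  then have M: "is_ideal M" "span_ideal I q \<subseteq> M" "\<And>N. g ^ N \<notin> M" by (auto simp: \<A>_def)
  have max: "J = M" if "is_ideal J" "M \<subseteq> J" "\<And>N. g ^ N \<notin> J" for J
    by (rule maxM) (use that M(2) in \<open>auto simp: \<A>_def\<close>)
  have inv: "\<exists>u N. u * f - g ^ N \<in> M" if "f \<notin> M" for f
    by (rule ideal_avoiding_powers_prime(1)[OF M(1,3) _ that]) (rule max)
  have prime: "f \<in> M \<or> h \<in> M" if "f * h \<in> M" for f h
    by (rule ideal_avoiding_powers_prime(2)[OF M(1,3) _ that]) (rule max)
  have one: "1 \<notin> M" using M(3)[of 0] by simp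
  have "\<exists>c. X i - const c \<in> M" for i
  proof (rule ccontr)
    assume "\<nexists>c. X i - const c \<in> M"
    then have "\<forall>c. \<exists>uN. fst uN * (X i - const c) - g ^ snd uN \<in> M" using inv by fastforce
    from choice[OF this] obtain uN where
      uN: "\<And>c. fst (uN c) * (X i - const c) - g ^ snd (uN c) \<in> M" by blast
    obtain C cf k where C: "finite C" "\<exists>c\<in>C. cf c \<noteq> 0" "\<And>c. c \<in> C \<Longrightarrow> snd (uN c) = k"
      "(\<Sum>c\<in>C. const (cf c) * fst (uN c)) = 0"
      using complex_dependent_family[of "\<lambda>c. snd (uN c)" "\<lambda>c. fst (uN c)"] by blast
    \<comment> \<open>Multiplying the relation for \<open>c\<close> by \<open>R c\<close> completes
      \<open>X i - c\<close> to the product over all of \<open>C\<close>. This common factor comes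
      with the sum of the \<open>cf c u\<^sub>c\<close>, which is zero, so that only the multiple of
      \<open>g ^ k\<close> survives.\<close>
    define R where "R c = (\<Prod>c'\<in>C - {c}. X i - const c')" for c
    have "(\<Sum>c\<in>C. const (cf c) * R c * (fst (uN c) * (X i - const c) - g ^ k)) \<in> M"
      by (rule is_ideal_sum[OF M(1)]) (use uN C(3) M(1) in \<open>force simp: is_ideal_def\<close>)
    also have "(\<Sum>c\<in>C. const (cf c) * R c * (fst (uN c) * (X i - const c) - g ^ k)) =
      (\<Sum>c\<in>C. const (cf c) * fst (uN c)) * (\<Prod>c'\<in>C. X i - const c') - g ^ k * (\<Sum>c\<in>C. const (cf c) * R c)"
    proof -
      have "const (cf c) * R c * (fst (uN c) * (X i - const c) - g ^ k) =
        const (cf c) * fst (uN c) * (\<Prod>c'\<in>C. X i - const c') - g ^ k * (const (cf c) * R c)" if "c \<in> C" for c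
        unfolding R_def prod.remove[OF C(1) that] by (simp add: algebra_simps)
      then show ?thesis
        by (simp add: sum_subtractf sum_distrib_right sum_distrib_left)
    qed
    also have "\<dots> = 0 - g ^ k * (\<Sum>c\<in>C. const (cf c) * R c)" unfolding C(4) by simp
    finally have neg: "0 - g ^ k * (\<Sum>c\<in>C. const (cf c) * R c) \<in> M" .
    have "0 \<in> M" using M(1) by (simp add: is_ideal_def)
    from is_ideal_diff[OF M(1) this neg] have "g ^ k * (\<Sum>c\<in>C. const (cf c) * R c) \<in> M" by simp
    from prime[OF this] have "(\<Sum>c\<in>C. const (cf c) * R c) \<in> M" using M(3)[of k] by blast
    \<comment> \<open>A combination of Lagrange products: at \<open>c0\<close> all summands but one
      vanish, so a nonzero coefficient \<open>cf c0\<close> shows that \<open>p\<close> is not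
      zero.\<close>
    moreover define p where "p = (\<Sum>c\<in>C. smult (cf c) (\<Prod>c'\<in>C - {c}. [:- c', 1:]))"
    have "(\<Sum>c\<in>C. const (cf c) * R c) = upoly i p"
      by (rule eval_poly_inject) (simp add: p_def R_def poly_sum poly_prod)
    moreover have "p \<noteq> 0"
    proof
      assume "p = 0"
      obtain c0 where c0: "c0 \<in> C" "cf c0 \<noteq> 0" using C(2) by blast
      have "poly p c0 = (\<Sum>c\<in>C. if c = c0 then cf c0 * (\<Prod>c'\<in>C - {c0}. c0 - c') else 0)"
        unfolding p_def poly_sum
      proof (rule sum.cong[OF refl])
        fix c assume "c \<in> C"
        show "poly (smult (cf c) (\<Prod>c'\<in>C - {c}. [:- c', 1:])) c0 =
          (if c = c0 then cf c0 * (\<Prod>c'\<in>C - {c0}. c0 - c') else 0)"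
        proof (cases "c = c0")
          case False
          then have "c0 \<in> C - {c}" using c0 by blast
          then have "(\<Prod>c'\<in>C - {c}. c0 - c') = 0" using C(1) by (intro prod_zero) auto
          then show ?thesis using False by (simp add: poly_prod)
        qed (simp add: poly_prod)
      qed
      also have "\<dots> = cf c0 * (\<Prod>c'\<in>C - {c0}. c0 - c')" using C(1) c0 by simp
      also have "\<dots> \<noteq> 0" using c0 C(1) by simp
      finally show False using \<open>p = 0\<close> by simp
    qed
    ultimately have "upoly i p \<in> M" "p \<noteq> 0" by simp_all
    then have "\<exists>c. X i - const c \<in> M"
      by (intro prime_ideal_linear_factor[OF M(1) one, of i p] prime)
    then show False using \<open>\<nexists>c. X i - const c \<in> M\<close> by blast
  qed
  then obtain x where x: "\<And>i. X i - const (x i) \<in> M" by metis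
  \<comment> \<open>Modulo \<open>M\<close> every variable is now a constant. The next steps extend
    this from variables to all polynomials: each is congruent to its value at
    \<open>x\<close>.\<close>
  have mult: "p * r - const (eval_poly (p * r) x) \<in> M"
    if "p - const (eval_poly p x) \<in> M" "r - const (eval_poly r x) \<in> M" for p r
  proof -
    have "p * r - const (eval_poly (p * r) x) =
      r * (p - const (eval_poly p x)) - (0 - const (eval_poly p x) * (r - const (eval_poly r x)))"
      by (rule eval_poly_inject) (simp add: algebra_simps)
    then show ?thesis
      using that M(1) is_ideal_diff[OF M(1)] unfolding is_ideal_def by metis
  qed
  have zero: "0 \<in> M" using M(1) by (simp add: is_ideal_def)
  have const0: "const c - const c \<in> M" for c using zero by simp
  have pow: "X i ^ k - const (eval_poly (X i ^ k) x) \<in> M" for i k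
  proof (induction k)
    case 0
    have "(1::nat polynomial) = const 1" by (simp add: const_def)
    then show ?case using zero by simp
  next
    case (Suc k)
    show ?case unfolding power_Suc by (rule mult) (use x Suc in auto)
  qed
  have prods: "(\<Prod>i\<in>S. X i ^ e i) - const (eval_poly (\<Prod>i\<in>S. X i ^ e i) x) \<in> M" if "finite S" for S e
    using that
  proof (induction S rule: finite_induct)
    case empty
    have "(1::nat polynomial) = const 1" by (simp add: const_def)
    then show ?case using zero by simp
  next
    case (insert i S)
    have "X i ^ e i * (\<Prod>i\<in>S. X i ^ e i) - const (eval_poly (X i ^ e i * (\<Prod>i\<in>S. X i ^ e i)) x) \<in> M"
      by (rule mult) (use insert pow in auto)
    then show ?case using insert.hyps by simp
  qed
  have all: "p - const (eval_poly p x) \<in> M" for p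
  proof (induction p rule: poly_mapping_induct)
    case zero
    then show ?case using const0[of 0] by (simp add: const_def)
  next
    case (single e c)
    have eq: "Poly_Mapping.single e c = const c * (\<Prod>i\<in>Poly_Mapping.keys e. X i ^ poly_mapping.lookup e i)"
      by (rule eval_poly_inject) (simp add: mono_eval_def)
    show ?case unfolding eq by (rule mult) (use const0 prods in auto)
  next
    case (add p r)
    have "p + r - const (eval_poly (p + r) x) = (p - const (eval_poly p x)) + (r - const (eval_poly r x))"
      by (rule eval_poly_inject) simp
    then show ?case using add M(1) unfolding is_ideal_def by metis
  qed
  have "eval_poly (q i) x = 0" if "i \<in> I" for i
  proof (rule ccontr)
    assume nz: "eval_poly (q i) x \<noteq> 0"
    have "q i \<in> M" using M(2) span_ideal_mem[OF that] by blast
    from is_ideal_diff[OF M(1) this all[of "q i"]] have "const (eval_poly (q i) x) \<in> M" by simp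
    then have "const (1 / eval_poly (q i) x) * const (eval_poly (q i) x) \<in> M"
      using M(1) unfolding is_ideal_def by simp
    moreover have "const (1 / eval_poly (q i) x) * const (eval_poly (q i) x) = 1"
      by (rule eval_poly_inject) (use nz in simp)
    ultimately show False using one by simp
  qed
  then have "eval_poly g x = 0" using zeros by blast
  then have "g \<in> M" using all[of g] by (simp add: const_def)
  then show False using M(3)[of 1] by simp
qed

text \<open>Taking homogeneous components of the coefficients also removes all superfluous variables.\<close>

lemma homogeneous_Nullstellensatz:
  fixes q :: "'i \<Rightarrow> nat polynomial"
  assumes q: "\<And>i. i \<in> I \<Longrightarrow> q i \<in> hforms n (int (d i))" and g: "g \<in> hforms n (int D)" and "D > 0"
    and zeros: "\<And>x. x \<in> affine_space {..n} \<Longrightarrow> x \<noteq> (\<lambda>_. 0) \<Longrightarrow>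
      (\<And>i. i \<in> I \<Longrightarrow> eval_poly (q i) x = 0) \<Longrightarrow> eval_poly g x = 0"
  shows "\<exists>N F c. finite F \<and> F \<subseteq> I \<and> g ^ N = (\<Sum>i\<in>F. c i * q i) \<and>
    (\<forall>i\<in>F. c i \<in> hforms n (int (N * D) - int (d i)))"
proof -
  have "\<exists>N. g ^ N \<in> span_ideal I q"
  proof (rule Nullstellensatz)
    fix x assume x: "\<And>i. i \<in> I \<Longrightarrow> eval_poly (q i) x = 0"
    define x' where "x' i = (if i \<le> n then x i else 0)" for i
    have eq: "eval_poly p x' = eval_poly p x" if "p \<in> hforms n b" for p b
      by (rule eval_poly_cong[OF that]) (simp add: x'_def)
    have "eval_poly g x' = 0"
    \<comment> \<open>The hypothesis says nothing about the origin, but a form of positive degree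
      vanishes there.\<close>
    proof (cases "x' = (\<lambda>_. 0)")
      case True
      then show ?thesis using eval_poly_at_zero[OF g] \<open>D > 0\<close> by simp
    next
      case False
      show ?thesis
      proof (rule zeros[OF _ False])
        show "x' \<in> affine_space {..n}" by (simp add: affine_space_def x'_def)
      qed (use x eq[OF q] in simp)
    qed
    then show "eval_poly g x = 0" using eq[OF g] by simp
  qed
  then obtain N F c where F: "finite F" "F \<subseteq> I" "g ^ N = (\<Sum>i\<in>F. c i * q i)"
    unfolding span_ideal_def by blast
  \<comment> \<open>The empty set stands for a negative complementary degree; the corresponding
    component of \<open>c i\<close> is then zero.\<close>
  define T where "T i = (if d i \<le> N * D then mons n (N * D - d i) else {})" for i
  define c' where "c' i = restr (T i) (c i)" for i
  have restr: "restr (mons n (N * D)) (c i * q i) = c' i * q i" if "i \<in> F" for i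
    unfolding c'_def
  proof (rule restr_mult)
    fix e f assume "f \<in> Poly_Mapping.keys (q i)"
    then have f: "f \<in> mons n (d i)" using q that F(2) hforms_keys by blast
    show "e + f \<in> mons n (N * D) \<longleftrightarrow> e \<in> T i"
      using f by (auto simp: mons_iff T_def lookup_add sum.distrib)
  qed
  have "g ^ N \<in> hforms n (int (N * D))" using hforms_power[OF g, of N] by simp
  then have "g ^ N = restr (mons n (N * D)) (g ^ N)"
    using hforms_keys by (intro restr_eq_self[symmetric]) blast
  also have "\<dots> = (\<Sum>i\<in>F. c' i * q i)"
    unfolding F(3) restr_sum using restr by (intro sum.cong) auto
  finally have "g ^ N = (\<Sum>i\<in>F. c' i * q i)" .
  moreover have "c' i \<in> hforms n (int (N * D) - int (d i))" for i
    unfolding hforms_def c'_def by (auto simp: keys_restr T_def of_nat_diff split: if_splits)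
  ultimately show ?thesis using F(1,2) by blast
qed

section \<open>Projective space\<close>

definition pcone :: "nat \<Rightarrow> vec set" where
  "pcone n = affine_space {..n} - {\<lambda>_. 0}"

definition line :: "vec \<Rightarrow> point" where
  "line x = {(\<lambda>i. c * x i) |c. c \<noteq> 0}"

definition Dset :: "nat \<Rightarrow> nat polynomial \<Rightarrow> point set" where
  "Dset n g = {L \<in> proj_space n. \<forall>x\<in>L. eval_poly g x \<noteq> 0}"

definition vdom :: "nat \<Rightarrow> nat polynomial \<Rightarrow> vec set" where
  "vdom n g = {x \<in> pcone n. eval_poly g x \<noteq> 0}"

lemma proj_space_eq: "proj_space n = line ` pcone n"
  by (simp add: proj_space_def line_def pcone_def)

lemma line_self: "x \<in> line x"
  unfolding line_def by (intro CollectI exI[of _ 1]) simp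

lemma line_eq:
  assumes "y \<in> line x"
  shows "line y = line x"
proof -
  obtain c where c: "c \<noteq> 0" "y = (\<lambda>i. c * x i)" using assms by (auto simp: line_def)
  show ?thesis
  proof
    show "line y \<subseteq> line x"
    proof
      fix z assume "z \<in> line y"
      then obtain d where "d \<noteq> 0" "z = (\<lambda>i. d * y i)" by (auto simp: line_def)
      then show "z \<in> line x"
        unfolding line_def using c by (intro CollectI exI[of _ "d * c"]) (simp add: mult.assoc)
    qed
    show "line x \<subseteq> line y"
    proof
      fix z assume "z \<in> line x"
      then obtain d where "d \<noteq> 0" "z = (\<lambda>i. d * x i)" by (auto simp: line_def)
      then show "z \<in> line y"
        unfolding line_def using c by (intro CollectI exI[of _ "d / c"]) simp
    qed
  qed
qed

lemma line_cone:
  assumes "x \<in> pcone n" "y \<in> line x"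
  shows "y \<in> pcone n"
proof -
  obtain c where c: "c \<noteq> 0" "y = (\<lambda>i. c * x i)" using assms by (auto simp: line_def)
  have "\<exists>i. x i \<noteq> 0" using assms(1) by (auto simp: pcone_def)
  then have "y \<noteq> (\<lambda>_. 0)" using c by (metis mult_eq_0_iff)
  then show ?thesis using assms c by (auto simp: pcone_def affine_space_def)
qed

lemma mem_Union_points:
  assumes "U \<subseteq> proj_space n"
  shows "x \<in> \<Union>U \<longleftrightarrow> x \<in> pcone n \<and> line x \<in> U"
proof
  assume "x \<in> \<Union>U"
  then obtain L where L: "L \<in> U" "x \<in> L" by blast
  then obtain y where "y \<in> pcone n" "L = line y" using assms proj_space_eq by blast
  then show "x \<in> pcone n \<and> line x \<in> U" using L line_eq line_cone by metis
qed (use line_self in blast)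

lemma line_in_Dset:
  assumes "g \<in> hforms n (int D)" "x \<in> pcone n"
  shows "line x \<in> Dset n g \<longleftrightarrow> eval_poly g x \<noteq> 0"
proof -
  have "eval_poly g y \<noteq> 0 \<longleftrightarrow> eval_poly g x \<noteq> 0" if "y \<in> line x" for y
    using that eval_poly_scale[OF assms(1)] by (auto simp: line_def)
  moreover have "line x \<in> proj_space n" using assms(2) by (simp add: proj_space_eq)
  ultimately show ?thesis unfolding Dset_def using line_self by blast
qed

lemma Dset_subset: "Dset n g \<subseteq> proj_space n"
  by (auto simp: Dset_def)

lemma Union_Dset:
  assumes "g \<in> hforms n (int D)"
  shows "\<Union>(Dset n g) = vdom n g"
proof (rule set_eqI)
  fix x
  show "x \<in> \<Union>(Dset n g) \<longleftrightarrow> x \<in> vdom n g"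
    unfolding mem_Union_points[OF Dset_subset] vdom_def using line_in_Dset[OF assms] by blast
qed

lemma Dset_mult: "Dset n (g * h) = Dset n g \<inter> Dset n h"
  by (auto simp: Dset_def)

lemma Dset_one: "Dset n 1 = proj_space n"
  by (auto simp: Dset_def)

lemma vdom_mult: "vdom n (g * h) = vdom n g \<inter> vdom n h"
  by (auto simp: vdom_def)

lemma vdom_one: "vdom n 1 = pcone n"
  by (auto simp: vdom_def)

lemma openin_Dset: "g \<in> hforms n (int D) \<Longrightarrow> openin (zariski_proj n) (Dset n g)"
  unfolding zariski_proj_def Dset_def
  by (rule topology_generated_by_Basis) (auto simp: forms_eq_hforms)

lemma topspace_zariski_proj: "topspace (zariski_proj n) = proj_space n"
proof
  show "topspace (zariski_proj n) \<subseteq> proj_space n"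
    unfolding zariski_proj_def topology_generated_by_topspace by blast
  have "openin (zariski_proj n) (Dset n 1)" by (rule openin_Dset[of _ _ 0]) simp
  then show "proj_space n \<subseteq> topspace (zariski_proj n)"
    using openin_subset Dset_one by metis
qed

lemma openin_proj_space: "openin (zariski_proj n) (proj_space n)"
  using openin_topspace[of "zariski_proj n"] by (simp add: topspace_zariski_proj)

lemma cone_nonzero_coord:
  assumes "x \<in> pcone n"
  obtains i where "i \<le> n" "x i \<noteq> 0"
proof -
  obtain i where "x i \<noteq> 0" using assms by (auto simp: pcone_def)
  then show thesis using that[of i] assms by (auto simp: pcone_def affine_space_def)
qed

text \<open>The generating sets are closed under finite intersections because forms can be
  multiplied. Multiplying by a coordinate that does not vanish at \<open>L\<close> makes the degree
  positive, as the homogeneous Nullstellensatz for \<open>h\<close> requires.\<close>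

lemma zariski_proj_basis:
  assumes "openin (zariski_proj n) W" "L \<in> W"
  obtains d h where "d > 0" "h \<in> hforms n (int d)" "L \<in> Dset n h" "Dset n h \<subseteq> W"
proof -
  have "\<exists>d h. h \<in> hforms n (int d) \<and> L \<in> Dset n h \<and> Dset n h \<subseteq> W"
    using assms(1)[unfolded zariski_proj_def openin_topology_generated_by_iff] assms(2)
  proof (induction W arbitrary: L rule: generate_topology_on.induct)
    case (Int U V)
    obtain d h where h: "h \<in> hforms n (int d)" "L \<in> Dset n h" "Dset n h \<subseteq> U"
      using Int.IH(1)[of L] Int.prems by blast
    obtain d' h' where h': "h' \<in> hforms n (int d')" "L \<in> Dset n h'" "Dset n h' \<subseteq> V"
      using Int.IH(2)[of L] Int.prems by blast
    have "h * h' \<in> hforms n (int (d + d'))" using hforms_mult[OF h(1) h'(1)] by simp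
    moreover have "L \<in> Dset n (h * h')" "Dset n (h * h') \<subseteq> U \<inter> V"
      unfolding Dset_mult using h h' by blast+
    ultimately show ?case by blast
  next
    case (UN \<K>)
    then obtain U where "U \<in> \<K>" "L \<in> U" by blast
    then obtain d h where "h \<in> hforms n (int d)" "L \<in> Dset n h" "Dset n h \<subseteq> U"
      using UN.IH by blast
    then show ?case using \<open>U \<in> \<K>\<close> by blast
  next
    case (Basis U)
    then obtain d f where "f \<in> forms n d" "U = Dset n f" unfolding Dset_def by blast
    then show ?case using Basis.prems forms_eq_hforms by blast
  qed simp
  then obtain d h where h: "h \<in> hforms n (int d)" "L \<in> Dset n h" "Dset n h \<subseteq> W" by blast
  obtain x where x: "x \<in> pcone n" "L = line x" using h(2) Dset_subset proj_space_eq by blast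
  obtain i where i: "i \<le> n" "x i \<noteq> 0" by (rule cone_nonzero_coord[OF x(1)])
  have Xi: "X i \<in> hforms n (int 1)" using i by simp
  have "L \<in> Dset n (X i)" unfolding x(2) line_in_Dset[OF Xi x(1)] using i by simp
  then have "L \<in> Dset n (h * X i)" "Dset n (h * X i) \<subseteq> W" unfolding Dset_mult using h by blast+
  moreover have "h * X i \<in> hforms n (int (d + 1))"
    using hforms_mult[OF h(1) Xi] by (simp add: add.commute)
  ultimately show thesis using that[of "d + 1"] by simp
qed

section \<open>Sections of twists over basic open sets\<close>

definition fracsec :: "nat \<Rightarrow> nat polynomial \<Rightarrow> nat \<Rightarrow> nat polynomial \<Rightarrow> vec \<Rightarrow> complex" where
  "fracsec n g k P x = (if x \<in> vdom n g then eval_poly P x / eval_poly g x ^ k else 0)"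

text \<open>The part of degree \<open>a\<close> of the localization at \<open>g\<close>, realized as
  functions that are zero off the cone over \<open>D(g)\<close>. The degree of \<open>g\<close> is
  quantified because the zero polynomial is a form of every degree.\<close>

definition sec :: "nat \<Rightarrow> int \<Rightarrow> nat polynomial \<Rightarrow> (vec \<Rightarrow> complex) set" where
  "sec n a g = {s. \<exists>k D P. g \<in> hforms n (int D) \<and> P \<in> hforms n (a + int (k * D)) \<and> s = fracsec n g k P}"

lemma hforms_degree_unique:
  assumes "g \<in> hforms n (int D)" "g \<in> hforms n (int D')" "g \<noteq> 0"
  shows "D = D'"
proof -
  obtain e where "e \<in> Poly_Mapping.keys g"
    using assms(3) by (metis in_keys_iff lookup_zero poly_mapping_eqI)
  then have "e \<in> mons n D" "e \<in> mons n D'" using assms hforms_keys by blast+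
  then show ?thesis by (auto simp: mons_iff)
qed

lemma fracsec_raise:
  assumes "g \<noteq> 0"
  shows "fracsec n g k P = fracsec n g (k + l) (P * g ^ l)"
  by (rule ext) (auto simp: fracsec_def vdom_def power_add)

text \<open>All sufficiently large exponents occur in the denominator, so that finitely many
  sections can be brought to a common one. If \<open>g = 0\<close> the only section is zero;
  otherwise the degree of \<open>g\<close> is determined.\<close>

lemma sec_rep:
  assumes "s \<in> sec n a g" and g: "g \<in> hforms n (int D)"
  obtains k0 where "\<And>k. k \<ge> k0 \<Longrightarrow> \<exists>P\<in>hforms n (a + int (k * D)). s = fracsec n g k P"
proof (cases "g = 0")
  case True
  then have "s = fracsec n g k 0" for k
    using assms(1) by (auto simp: sec_def fracsec_def vdom_def)
  then show thesis using that hforms_zero by blast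
next
  case False
  from assms(1) obtain k0 D' P where P': "g \<in> hforms n (int D')"
    "P \<in> hforms n (a + int (k0 * D'))" "s = fracsec n g k0 P"
    unfolding sec_def by blast
  have "D' = D" by (rule hforms_degree_unique[OF P'(1) g False])
  with P' have P: "P \<in> hforms n (a + int (k0 * D))" "s = fracsec n g k0 P" by simp_all
  have "\<exists>P\<in>hforms n (a + int (k * D)). s = fracsec n g k P" if "k \<ge> k0" for k
  proof -
    obtain l where l: "k = k0 + l" using \<open>k \<ge> k0\<close> le_Suc_ex by blast
    have "P * g ^ l \<in> hforms n (a + int (k * D))"
      using hforms_mult[OF P(1) hforms_power[OF g, of l]] by (simp add: l algebra_simps)
    then show ?thesis using fracsec_raise[OF False, of n k0 P l] P(2) l by metis
  qed
  then show thesis using that by blast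
qed

lemma sec_fracsec: "g \<in> hforms n (int D) \<Longrightarrow> P \<in> hforms n (a + int (k * D)) \<Longrightarrow> fracsec n g k P \<in> sec n a g"
  unfolding sec_def by blast

lemma sec_hforms: "s \<in> sec n a g \<Longrightarrow> \<exists>D. g \<in> hforms n (int D)"
  unfolding sec_def by blast

lemma sec_outside: "s \<in> sec n a g \<Longrightarrow> x \<notin> vdom n g \<Longrightarrow> s x = 0"
  by (auto simp: sec_def fracsec_def)

lemma sec_zero: "g \<in> hforms n (int D) \<Longrightarrow> (\<lambda>_. 0) \<in> sec n a g"
proof -
  assume g: "g \<in> hforms n (int D)"
  have "fracsec n g 0 0 = (\<lambda>_. 0)" by (rule ext) (simp add: fracsec_def)
  then show ?thesis using sec_fracsec[OF g, of 0 a 0] by simp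
qed

lemma sec_add:
  assumes "s \<in> sec n a g" "s' \<in> sec n a g"
  shows "(\<lambda>x. s x + s' x) \<in> sec n a g"
proof -
  obtain D where g: "g \<in> hforms n (int D)" using sec_hforms[OF assms(1)] by blast
  obtain k0 where k0: "\<And>k. k \<ge> k0 \<Longrightarrow> \<exists>P\<in>hforms n (a + int (k * D)). s = fracsec n g k P"
    using sec_rep[OF assms(1) g] by blast
  obtain k1 where k1: "\<And>k. k \<ge> k1 \<Longrightarrow> \<exists>P\<in>hforms n (a + int (k * D)). s' = fracsec n g k P"
    using sec_rep[OF assms(2) g] by blast
  define k where "k = max k0 k1"
  obtain P where P: "P \<in> hforms n (a + int (k * D))" "s = fracsec n g k P"
    using k0[of k] by (auto simp: k_def)
  obtain P' where P': "P' \<in> hforms n (a + int (k * D))" "s' = fracsec n g k P'"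
    using k1[of k] by (auto simp: k_def)
  have "(\<lambda>x. s x + s' x) = fracsec n g k (P + P')"
    by (rule ext) (simp add: P P' fracsec_def add_divide_distrib)
  then show ?thesis using sec_fracsec[OF g hforms_add[OF P(1) P'(1)]] by simp
qed

lemma sec_sum:
  assumes "g \<in> hforms n (int D)" "\<And>i. i \<in> S \<Longrightarrow> s i \<in> sec n a g"
  shows "(\<lambda>x. \<Sum>i\<in>S. s i x) \<in> sec n a g"
  using assms(2)
  by (induction S rule: infinite_finite_induct) (auto intro: sec_zero[OF assms(1)] sec_add)

lemma sec_mult:
  assumes "s \<in> sec n a g" "h \<in> hforms n b"
  shows "(\<lambda>x. eval_poly h x * s x) \<in> sec n (a + b) g"
proof -
  obtain k D P where P: "g \<in> hforms n (int D)" "P \<in> hforms n (a + int (k * D))" "s = fracsec n g k P"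
    using assms(1) unfolding sec_def by blast
  have "h * P \<in> hforms n (a + b + int (k * D))"
    using hforms_mult[OF assms(2) P(2)] by (simp add: algebra_simps)
  moreover have "(\<lambda>x. eval_poly h x * s x) = fracsec n g k (h * P)"
    by (rule ext) (simp add: P fracsec_def)
  ultimately show ?thesis using sec_fracsec[OF P(1)] by simp
qed

lemma sec_cmult: "s \<in> sec n a g \<Longrightarrow> (\<lambda>x. c * s x) \<in> sec n a g"
  using sec_mult[of s n a g "const c" 0] by (simp add: const_def)

lemma sec_diff: "s \<in> sec n a g \<Longrightarrow> s' \<in> sec n a g \<Longrightarrow> (\<lambda>x. s x - s' x) \<in> sec n a g"
  using sec_add[of s n a g "\<lambda>x. (- 1) * s' x"] sec_cmult[of s' n a g "- 1"] by simp

lemma sec_divide: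
  assumes "s \<in> sec n a g" and g: "g \<in> hforms n (int D)"
  shows "(\<lambda>x. s x / eval_poly g x ^ K) \<in> sec n (a - int (K * D)) g"
proof -
  obtain k P where P: "P \<in> hforms n (a + int (k * D))" "s = fracsec n g k P"
    using sec_rep[OF assms] by blast
  have "P \<in> hforms n (a - int (K * D) + int ((k + K) * D))"
    using P(1) by (simp add: algebra_simps)
  moreover have "(\<lambda>x. s x / eval_poly g x ^ K) = fracsec n g (k + K) P"
    by (rule ext) (simp add: P fracsec_def power_add)
  ultimately show ?thesis using sec_fracsec[OF g] by simp
qed

lemma sec_restrict:
  assumes "s \<in> sec n a g" and h: "h \<in> hforms n (int E)"
  shows "(\<lambda>x. if x \<in> vdom n (g * h) then s x else 0) \<in> sec n a (g * h)"
proof -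
  obtain k D P where P: "g \<in> hforms n (int D)" "P \<in> hforms n (a + int (k * D))" "s = fracsec n g k P"
    using assms(1) unfolding sec_def by blast
  have "P * h ^ k \<in> hforms n (a + int (k * (D + E)))"
    using hforms_mult[OF P(2) hforms_power[OF h, of k]] by (simp add: algebra_simps)
  moreover have "(\<lambda>x. if x \<in> vdom n (g * h) then s x else 0) = fracsec n (g * h) k (P * h ^ k)"
    by (rule ext) (auto simp: P fracsec_def vdom_def power_mult_distrib)
  moreover have "g * h \<in> hforms n (int (D + E))" using hforms_mult[OF P(1) h] by simp
  ultimately show ?thesis using sec_fracsec by metis
qed

text \<open>A high power of \<open>h\<close> clears the factor \<open>h\<close> from the
  denominator, so the section extends from \<open>D(gh)\<close> to \<open>D(g)\<close>. This holds
  for all large powers, which lets several sections use the same one.\<close>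

lemma sec_extend:
  assumes s: "s \<in> sec n a (g * h)" and g: "g \<in> hforms n (int D)" and h: "h \<in> hforms n (int E)"
  obtains N where "\<And>M. M \<ge> N \<Longrightarrow> (\<lambda>x. eval_poly h x ^ M * s x) \<in> sec n (a + int (M * E)) g"
proof -
  have gh: "g * h \<in> hforms n (int (D + E))" using hforms_mult[OF g h] by simp
  obtain k P where P: "P \<in> hforms n (a + int (k * (D + E)))" "s = fracsec n (g * h) k P"
    using sec_rep[OF s gh] by blast
  have "(\<lambda>x. eval_poly h x ^ M * s x) \<in> sec n (a + int (M * E)) g" if "M \<ge> Suc k" for M
  proof -
    \<comment> \<open>One factor more than the denominator has: the extension must vanish where
      \<open>h\<close> does, since sections are padded by zero there.\<close>
    obtain l where l: "M = k + Suc l" using \<open>M \<ge> Suc k\<close> by (metis add_Suc_right add_Suc le_Suc_ex)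
    have "h ^ Suc l * P \<in> hforms n (a + int (M * E) + int (k * D))"
      using hforms_mult[OF hforms_power[OF h, of "Suc l"] P(1)] by (simp add: l algebra_simps)
    moreover have "(\<lambda>x. eval_poly h x ^ M * s x) = fracsec n g k (h ^ Suc l * P)"
    proof
      fix x
      show "eval_poly h x ^ M * s x = fracsec n g k (h ^ Suc l * P) x"
        by (cases "eval_poly h x = 0")
          (auto simp: P fracsec_def vdom_def l power_mult_distrib power_add)
    qed
    ultimately show ?thesis using sec_fracsec[OF g] by metis
  qed
  then show thesis by (rule that)
qed

text \<open>Over a basic open set, the local representations of a regular function are glued by
  the Nullstellensatz.\<close>

lemma twist_Dset:
  assumes g: "g \<in> hforms n (int D)" and "D > 0"
  shows "twist n a (Dset n g) = sec n a g"
proof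
  show "sec n a g \<subseteq> twist n a (Dset n g)"
  proof
    fix s assume s: "s \<in> sec n a g"
    obtain k0 where k0: "\<And>k. k \<ge> k0 \<Longrightarrow> \<exists>P\<in>hforms n (a + int (k * D)). s = fracsec n g k P"
      using sec_rep[OF s g] by blast
    \<comment> \<open>\<open>forms\<close> has natural degrees, so the exponent is raised until the
      numerator has degree at least zero; this works because \<open>D > 0\<close>.\<close>
    define k where "k = max k0 (nat (- a))"
    obtain P where P: "P \<in> hforms n (a + int (k * D))" "s = fracsec n g k P"
      using k0[of k] by (auto simp: k_def)
    have "k \<le> k * D" using \<open>D > 0\<close> by simp
    then have "int k \<le> int (k * D)" by (simp only: of_nat_le_iff)
    then have nonneg: "a + int (k * D) \<ge> 0" by (auto simp: k_def)
    have "P \<in> forms n (nat (a + int (k * D)))" using P(1) nonneg by (simp add: forms_eq_hforms)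
    moreover have "g ^ k \<in> forms n (k * D)"
      using hforms_power[OF g, of k] by (simp add: forms_eq_hforms)
    moreover have "int (nat (a + int (k * D))) - int (k * D) = a" using nonneg by simp
    moreover have "eval_poly (g ^ k) x \<noteq> 0 \<and> s x = eval_poly P x / eval_poly (g ^ k) x"
      if "x \<in> \<Union>(Dset n g)" for x
      using that unfolding Union_Dset[OF g] by (simp add: P fracsec_def vdom_def)
    ultimately have "\<exists>d e. \<exists>p\<in>forms n d. \<exists>q\<in>forms n e. int d - int e = a \<and>
      (\<forall>x\<in>\<Union>(Dset n g). eval_poly q x \<noteq> 0 \<and> s x = eval_poly p x / eval_poly q x)" by blast
    moreover have "s x = 0" if "x \<notin> \<Union>(Dset n g)" for x
      using that sec_outside[OF s] Union_Dset[OF g] by blast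
    ultimately show "s \<in> twist n a (Dset n g)"
      unfolding twist_def using openin_Dset[OF g] by blast
  qed
  show "twist n a (Dset n g) \<subseteq> sec n a g"
  proof
    fix s assume s: "s \<in> twist n a (Dset n g)"
    have "\<exists>e p q. p \<in> hforms n (a + int e) \<and> q \<in> hforms n (int e) \<and>
        (\<forall>x\<in>vdom n g. s x * eval_poly q x = eval_poly p x) \<and> (\<forall>x\<in>L. eval_poly q x \<noteq> 0)"
      if L: "L \<in> Dset n g" for L
    proof -
      from s[unfolded twist_def, THEN CollectD, THEN conjunct2, THEN bspec, OF L]
      obtain W d e p q where W: "openin (zariski_proj n) W" "L \<in> W" "p \<in> forms n d" "q \<in> forms n e"
        "int d - int e = a" "\<forall>x\<in>\<Union>W. eval_poly q x \<noteq> 0 \<and> s x = eval_poly p x / eval_poly q x"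
        by (elim exE bexE conjE)
      obtain \<delta> h where h: "h \<in> hforms n (int \<delta>)" "L \<in> Dset n h" "Dset n h \<subseteq> W"
        by (rule zariski_proj_basis[OF W(1,2)])
      \<comment> \<open>After multiplication by \<open>h\<close>, the relation between
        \<open>s\<close>, \<open>p\<close> and \<open>q\<close> holds over all of
        \<open>D(g)\<close>: outside \<open>D(h)\<close> both sides vanish.\<close>
      have "p * h \<in> hforms n (a + int (e + \<delta>))"
        using hforms_mult[OF W(3)[unfolded forms_eq_hforms] h(1)] W(5) by (simp add: algebra_simps)
      moreover have "q * h \<in> hforms n (int (e + \<delta>))"
        using hforms_mult[OF W(4)[unfolded forms_eq_hforms] h(1)] by simp
      moreover have "s x * eval_poly (q * h) x = eval_poly (p * h) x" if "x \<in> vdom n g" for x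
      proof (cases "eval_poly h x = 0")
        case False
        then have "x \<in> vdom n h" using that by (simp add: vdom_def)
        then have "x \<in> \<Union>W" using Union_Dset[OF h(1)] h(3) by blast
        from W(6)[rule_format, OF this] show ?thesis by simp
      qed simp
      moreover have "eval_poly (q * h) x \<noteq> 0" if "x \<in> L" for x
        using W(2,6) h(2) that by (auto simp: Dset_def)
      ultimately show ?thesis
        by (intro exI[of _ "e + \<delta>"] exI[of _ "p * h"] exI[of _ "q * h"] conjI ballI) auto
    qed
    then have "\<forall>L. \<exists>e p q. L \<in> Dset n g \<longrightarrow> p \<in> hforms n (a + int e) \<and> q \<in> hforms n (int e) \<and>
        (\<forall>x\<in>vdom n g. s x * eval_poly q x = eval_poly p x) \<and> (\<forall>x\<in>L. eval_poly q x \<noteq> 0)"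
      by blast
    from choice[OF this] obtain e where "\<forall>L. \<exists>p q. L \<in> Dset n g \<longrightarrow> p \<in> hforms n (a + int (e L)) \<and>
        q \<in> hforms n (int (e L)) \<and>
        (\<forall>x\<in>vdom n g. s x * eval_poly q x = eval_poly p x) \<and> (\<forall>x\<in>L. eval_poly q x \<noteq> 0)" ..
    from choice[OF this] obtain p where "\<forall>L. \<exists>q. L \<in> Dset n g \<longrightarrow> p L \<in> hforms n (a + int (e L)) \<and>
        q \<in> hforms n (int (e L)) \<and>
        (\<forall>x\<in>vdom n g. s x * eval_poly q x = eval_poly (p L) x) \<and> (\<forall>x\<in>L. eval_poly q x \<noteq> 0)" ..
    from choice[OF this] obtain q where
      pq: "\<And>L. L \<in> Dset n g \<Longrightarrow> p L \<in> hforms n (a + int (e L))"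
        "\<And>L. L \<in> Dset n g \<Longrightarrow> q L \<in> hforms n (int (e L))"
        "\<And>L x. L \<in> Dset n g \<Longrightarrow> x \<in> vdom n g \<Longrightarrow> s x * eval_poly (q L) x = eval_poly (p L) x"
        "\<And>L x. L \<in> Dset n g \<Longrightarrow> x \<in> L \<Longrightarrow> eval_poly (q L) x \<noteq> 0"
      by blast
    have "\<exists>N F c. finite F \<and> F \<subseteq> Dset n g \<and> g ^ N = (\<Sum>i\<in>F. c i * q i) \<and>
      (\<forall>i\<in>F. c i \<in> hforms n (int (N * D) - int (e i)))"
    proof (rule homogeneous_Nullstellensatz[OF pq(2) g \<open>D > 0\<close>])
      fix x assume x: "x \<in> affine_space {..n}" "x \<noteq> (\<lambda>_. 0)"
        and zero: "\<And>L. L \<in> Dset n g \<Longrightarrow> eval_poly (q L) x = 0"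
      then have xc: "x \<in> pcone n" by (simp add: pcone_def)
      then show "eval_poly g x = 0"
        using zero[of "line x"] pq(4)[of "line x" x] line_self line_in_Dset[OF g xc] by blast
    qed
    then obtain N F c where F: "finite F" "F \<subseteq> Dset n g" "g ^ N = (\<Sum>i\<in>F. c i * q i)"
      "\<And>i. i \<in> F \<Longrightarrow> c i \<in> hforms n (int (N * D) - int (e i))" by blast
    \<comment> \<open>Multiplying the expression of \<open>g ^ N\<close> through the
      \<open>q i\<close> by \<open>s\<close> replaces each \<open>q i\<close> by \<open>p i\<close>,
      so the local numerators combine to a global one.\<close>
    define P where "P = (\<Sum>i\<in>F. c i * p i)"
    have "P \<in> hforms n (a + int (N * D))"
      unfolding P_def
    proof (rule hforms_sum)
      fix i assume i: "i \<in> F"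
      then show "c i * p i \<in> hforms n (a + int (N * D))"
        using hforms_mult[OF F(4)[OF i] pq(1)[of i]] F(2) by (auto simp: algebra_simps)
    qed
    moreover have "s = fracsec n g N P"
    proof
      fix x
      show "s x = fracsec n g N P x"
      proof (cases "x \<in> vdom n g")
        case True
        have "s x * eval_poly (g ^ N) x = (\<Sum>i\<in>F. eval_poly (c i) x * (s x * eval_poly (q i) x))"
          unfolding F(3) by (simp add: sum_distrib_left mult_ac)
        also have "\<dots> = eval_poly P x"
          unfolding P_def eval_poly_sum using pq(3)[OF _ True] F(2) by (intro sum.cong) auto
        finally show ?thesis using True by (simp add: fracsec_def vdom_def field_simps)
      next
        case False
        then have "x \<notin> \<Union>(Dset n g)" using Union_Dset[OF g] by simp
        then have "s x = 0" using s by (simp add: twist_def)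
        then show ?thesis using False by (simp add: fracsec_def)
      qed
    qed
    ultimately show "s \<in> sec n a g" using sec_fracsec[OF g] by metis
  qed
qed

section \<open>Sections of the twisted kernel over basic open sets\<close>

definition vsec :: "nat \<Rightarrow> nat \<Rightarrow> (nat \<times> nat \<times> nat \<Rightarrow> complex) \<Rightarrow> int \<Rightarrow> nat polynomial \<Rightarrow> vsection set" where
  "vsec n A \<phi> a g = {s. (\<forall>j<A. (\<lambda>x. s x j) \<in> sec n a g) \<and> (\<forall>j\<ge>A. \<forall>x. s x j = 0) \<and>
     hom_apply n A \<phi> s = (\<lambda>_ _. 0)}"

lemma kernel_twist_Dset:
  assumes "g \<in> hforms n (int D)" "D > 0"
  shows "kernel_twist n A \<phi> a (Dset n g) = vsec n A \<phi> a g"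
  unfolding kernel_twist_def twist_sum_def vsec_def twist_Dset[OF assms] by blast

lemma hom_apply_diff: "hom_apply n A \<phi> (\<lambda>x j. s x j - s' x j) =
    (\<lambda>x i. hom_apply n A \<phi> s x i - hom_apply n A \<phi> s' x i)"
  by (simp add: hom_apply_def algebra_simps sum_subtractf)

lemma hom_apply_sum: "hom_apply n A \<phi> (\<lambda>x j. \<Sum>l\<in>S. s l x j) x i = (\<Sum>l\<in>S. hom_apply n A \<phi> (s l) x i)"
  unfolding hom_apply_def by (subst sum.swap) (simp add: sum_distrib_left)

lemma hom_apply_scale: "hom_apply n A \<phi> (\<lambda>x j. c x * s x j) x i = c x * hom_apply n A \<phi> s x i"
  by (simp add: hom_apply_def sum_distrib_left mult_ac)

lemma vsec_zero: "g \<in> hforms n (int D) \<Longrightarrow> (\<lambda>_ _. 0) \<in> vsec n A \<phi> a g"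
  by (simp add: vsec_def sec_zero hom_apply_def)

lemma vsec_diff: "s \<in> vsec n A \<phi> a g \<Longrightarrow> s' \<in> vsec n A \<phi> a g \<Longrightarrow> (\<lambda>x j. s x j - s' x j) \<in> vsec n A \<phi> a g"
  by (simp add: vsec_def sec_diff hom_apply_diff)

lemma vsec_outside: "s \<in> vsec n A \<phi> a g \<Longrightarrow> x \<notin> vdom n g \<Longrightarrow> s x j = 0"
proof (cases "j < A")
  case True
  assume "s \<in> vsec n A \<phi> a g" "x \<notin> vdom n g"
  then have "(\<lambda>x. s x j) \<in> sec n a g" using True by (simp add: vsec_def)
  from sec_outside[OF this] show ?thesis using \<open>x \<notin> vdom n g\<close> by simp
qed (simp add: vsec_def)

lemma vsec_sum:
  assumes "g \<in> hforms n (int D)" "\<And>l. l \<in> S \<Longrightarrow> s l \<in> vsec n A \<phi> a g"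
  shows "(\<lambda>x j. \<Sum>l\<in>S. s l x j) \<in> vsec n A \<phi> a g"
  using assms(2) by (auto simp: vsec_def hom_apply_sum[abs_def] intro!: sec_sum[OF assms(1)] ext)

lemma vsec_cmult: "s \<in> vsec n A \<phi> a g \<Longrightarrow> (\<lambda>x j. c * s x j) \<in> vsec n A \<phi> a g"
  using hom_apply_scale[of n A \<phi> "\<lambda>_. c" s] by (auto simp: vsec_def intro!: sec_cmult ext)

lemma vsec_restrict:
  assumes "s \<in> vsec n A \<phi> a g" and "h \<in> hforms n (int E)"
  shows "(\<lambda>x j. if x \<in> vdom n (g * h) then s x j else 0) \<in> vsec n A \<phi> a (g * h)"
proof -
  have "hom_apply n A \<phi> (\<lambda>x j. if x \<in> vdom n (g * h) then s x j else 0) x i =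
      (if x \<in> vdom n (g * h) then hom_apply n A \<phi> s x i else 0)" for x i
    by (simp add: hom_apply_def)
  then show ?thesis using assms by (auto simp: vsec_def intro!: sec_restrict ext)
qed

text \<open>The terms of a partition of unity \<open>1 = \<Sum> c h\<^sup>M / g\<^sup>K\<close> multiply sections over \<open>D(g h)\<close> to
  sections over \<open>D(g)\<close>.\<close>

lemma vsec_partition_term:
  assumes s: "s \<in> vsec n A \<phi> a (g * h)" and g: "g \<in> hforms n (int D)" and h: "h \<in> hforms n (int E)"
  shows "\<exists>N. \<forall>M\<ge>N. \<forall>K. \<forall>c\<in>hforms n (int (K * D) - int (M * E)).
    (\<lambda>x j. eval_poly c x * eval_poly h x ^ M / eval_poly g x ^ K * s x j) \<in> vsec n A \<phi> a g"
proof -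
  have "\<forall>j. \<exists>N. j < A \<longrightarrow> (\<forall>M\<ge>N. (\<lambda>x. eval_poly h x ^ M * s x j) \<in> sec n (a + int (M * E)) g)"
  proof (rule allI)
    fix j
    show "\<exists>N. j < A \<longrightarrow> (\<forall>M\<ge>N. (\<lambda>x. eval_poly h x ^ M * s x j) \<in> sec n (a + int (M * E)) g)"
    proof (cases "j < A")
      case True
      then have "(\<lambda>x. s x j) \<in> sec n a (g * h)" using s by (simp add: vsec_def)
      then show ?thesis by (rule sec_extend[OF _ g h]) blast
    qed simp
  qed
  from choice[OF this] obtain N where N: "\<And>j M. j < A \<Longrightarrow> M \<ge> N j \<Longrightarrow>
      (\<lambda>x. eval_poly h x ^ M * s x j) \<in> sec n (a + int (M * E)) g" by blast
  define N0 where "N0 = Max (insert 0 (N ` {..<A}))"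
  have N0: "N j \<le> N0" if "j < A" for j using that by (auto simp: N0_def intro!: Max_ge)
  show ?thesis
  proof (intro exI[of _ N0] allI impI ballI)
    fix M K c assume M: "M \<ge> N0" and c: "c \<in> hforms n (int (K * D) - int (M * E))"
    have "(\<lambda>x. eval_poly c x * eval_poly h x ^ M / eval_poly g x ^ K * s x j) \<in> sec n a g" if "j < A" for j
    proof -
      have "(\<lambda>x. eval_poly h x ^ M * s x j) \<in> sec n (a + int (M * E)) g"
        using N[OF that] N0[OF that] M by simp
      from sec_divide[OF sec_mult[OF this c] g, of K] show ?thesis by (simp add: mult_ac)
    qed
    moreover have "hom_apply n A \<phi> (\<lambda>x j. eval_poly c x * eval_poly h x ^ M / eval_poly g x ^ K * s x j) = (\<lambda>_ _. 0)"
      by (intro ext, subst hom_apply_scale) (use s in \<open>simp add: vsec_def\<close>)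
    ultimately show "(\<lambda>x j. eval_poly c x * eval_poly h x ^ M / eval_poly g x ^ K * s x j) \<in> vsec n A \<phi> a g"
      using s by (simp add: vsec_def)
  qed
qed

section \<open>Double complexes\<close>

text \<open>The row \<open>s = 0\<close> is the complex of one covering, the column
  \<open>l = 0\<close> that of the other. All rows with \<open>s > 0\<close> and all columns with
  \<open>l > 0\<close> are exact, and of the column \<open>l = 0\<close> only exactness at
  \<open>C 0 (Suc T)\<close> is assumed. A staircase between the two edges carries it over to
  exactness of the row \<open>s = 0\<close> at \<open>C (Suc T) 0\<close>.\<close>

lemma double_complex_exact:
  fixes C :: "nat \<Rightarrow> nat \<Rightarrow> 'y::ab_group_add set" and dW dS :: "'y \<Rightarrow> 'y"
  assumes diff: "\<And>l s y z. y \<in> C l s \<Longrightarrow> z \<in> C l s \<Longrightarrow> y - z \<in> C l s"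
    and W: "\<And>l s y. y \<in> C l s \<Longrightarrow> dW y \<in> C (Suc l) s"
    and S: "\<And>l s y. y \<in> C l s \<Longrightarrow> dS y \<in> C l (Suc s)"
    and W_diff: "\<And>y z. dW (y - z) = dW y - dW z" and S_diff: "\<And>y z. dS (y - z) = dS y - dS z"
    and WW: "\<And>l s y. y \<in> C l s \<Longrightarrow> dW (dW y) = 0" and SS: "\<And>l s y. y \<in> C l s \<Longrightarrow> dS (dS y) = 0"
    and WS: "\<And>l s y. y \<in> C l s \<Longrightarrow> dW (dS y) = dS (dW y)"
    and row: "\<And>l s z. s > 0 \<Longrightarrow> z \<in> C (Suc l) s \<Longrightarrow> dW z = 0 \<Longrightarrow> \<exists>y\<in>C l s. dW y = z"
    and row0: "\<And>s z. s > 0 \<Longrightarrow> z \<in> C 0 s \<Longrightarrow> dW z = 0 \<Longrightarrow> z = 0"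
    and col: "\<And>l s z. l > 0 \<Longrightarrow> z \<in> C l (Suc s) \<Longrightarrow> dS z = 0 \<Longrightarrow> \<exists>y\<in>C l s. dS y = z"
    and col0: "\<And>l z. l > 0 \<Longrightarrow> z \<in> C l 0 \<Longrightarrow> dS z = 0 \<Longrightarrow> z = 0"
    and corner: "\<And>z. z \<in> C 0 (Suc T) \<Longrightarrow> dS z = 0 \<Longrightarrow> \<exists>y\<in>C 0 T. dS y = z"
    and T: "T > 0" and z: "z \<in> C (Suc T) 0" "dW z = 0"
  shows "\<exists>y\<in>C T 0. dW y = z"
proof -
  have d0: "dW 0 = 0" "dS 0 = 0" using W_diff[of 0 0] S_diff[of 0 0] by simp_all
  \<comment> \<open>A cocycle for both differentials has a primitive in its row that is also closed
    in the column direction. The defect \<open>dS y\<close> is again such a cocycle, one step closer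
    to the column \<open>l = 0\<close>; there \<open>row0\<close> kills it. The last correction
    below the top of the staircase uses \<open>corner\<close>.\<close>
  have claim: "\<exists>y\<in>C l s. dW y = z \<and> dS y = 0"
    if "s > 0" "l + s = Suc T" "z \<in> C (Suc l) s" "dW z = 0" "dS z = 0" for l s z
    using that
  proof (induction l arbitrary: s z)
    case 0
    obtain y where y: "y \<in> C 0 s" "dW y = z" using row[OF 0(1,3,4)] by blast
    have "dW (dS y) = 0" using WS[OF y(1)] y(2) 0 by simp
    then have "dS y = 0" using row0[OF _ S[OF y(1)]] by simp
    then show ?case using y by blast
  next
    case (Suc l)
    obtain y where y: "y \<in> C (Suc l) s" "dW y = z" using row[OF Suc.prems(1,3,4)] by blast
    have u: "dS y \<in> C (Suc l) (Suc s)" "dW (dS y) = 0" "dS (dS y) = 0"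
      using S[OF y(1)] WS[OF y(1)] SS[OF y(1)] y(2) Suc.prems by simp_all
    obtain w where w: "w \<in> C l (Suc s)" "dW w = dS y" "dS w = 0"
      using Suc.IH[OF _ _ u] Suc.prems by auto
    have "\<exists>w'\<in>C l s. dS w' = w"
    proof (cases "l = 0")
      case True
      then have "s = T" using Suc.prems by simp
      then show ?thesis using corner[of w] w True by simp
    next
      case False
      then show ?thesis using col[of l w s] w by simp
    qed
    then obtain w' where w': "w' \<in> C l s" "dS w' = w" by blast
    have "dW (y - dW w') = z" using W_diff[of y "dW w'"] WW[OF w'(1)] y(2) by simp
    moreover have "dS (y - dW w') = 0" using S_diff[of y "dW w'"] WS[OF w'(1)] w'(2) w(2) by simp
    ultimately show ?case using diff[OF y(1) W[OF w'(1)]] by blast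
  qed
  have "dS z \<in> C (Suc T) (Suc 0)" "dW (dS z) = 0" "dS (dS z) = 0"
    using S[OF z(1)] WS[OF z(1)] SS[OF z(1)] z(2) d0 by simp_all
  then obtain y1 where y1: "y1 \<in> C T (Suc 0)" "dW y1 = dS z" "dS y1 = 0"
    using claim[of "Suc 0" T "dS z"] by auto
  obtain y where y: "y \<in> C T 0" "dS y = y1" using col[OF T y1(1,3)] by blast
  have "dS (dW y - z) = 0" using S_diff[of "dW y" z] WS[OF y(1)] y(2) y1(2) by simp
  then have "dW y - z = 0" using col0[OF _ diff[OF W[OF y(1)] z(1)]] by simp
  then show ?thesis using y(1) by auto
qed

section \<open>Koszul signs\<close>

definition ksgn :: "nat \<Rightarrow> nat set \<Rightarrow> 'v::comm_ring_1" where
  "ksgn i \<rho> = (- 1) ^ card {j\<in>\<rho>. j < i}"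

text \<open>The coboundary of alternating cochains, given by their values on index sets instead of
  increasing lists. It includes the augmentation, since \<open>u {}\<close> enters for a one-element
  set.\<close>

definition bd :: "(nat set \<Rightarrow> 'v) \<Rightarrow> nat set \<Rightarrow> 'v::comm_ring_1" where
  "bd u \<rho> = (\<Sum>i\<in>\<rho>. ksgn i \<rho> * u (\<rho> - {i}))"

lemma ksgn_cases: "ksgn i \<rho> = 1 \<or> ksgn i \<rho> = - 1"
  unfolding ksgn_def by (metis neg_one_even_power neg_one_odd_power)

lemma ksgn_square [simp]: "ksgn i \<rho> * ksgn i \<rho> = 1"
  by (simp add: ksgn_def power_mult_distrib[symmetric])

lemma ksgn_insert_self: "ksgn i (insert i \<rho>) = ksgn i \<rho>"
proof -
  have "{j\<in>insert i \<rho>. j < i} = {j\<in>\<rho>. j < i}" by auto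
  then show ?thesis unfolding ksgn_def by (rule arg_cong)
qed

lemma ksgn_insert:
  assumes "finite \<rho>" "j \<notin> \<rho>" "i \<noteq> j"
  shows "ksgn i (insert j \<rho>) = (if j < i then - ksgn i \<rho> else ksgn i \<rho>)"
proof (cases "j < i")
  case True
  then have "{k\<in>insert j \<rho>. k < i} = insert j {k\<in>\<rho>. k < i}" by auto
  then show ?thesis using True assms by (simp add: ksgn_def)
next
  case False
  then have "{k\<in>insert j \<rho>. k < i} = {k\<in>\<rho>. k < i}" using assms by auto
  then have "ksgn i (insert j \<rho>) = ksgn i \<rho>" unfolding ksgn_def by (rule arg_cong)
  then show ?thesis using False by simp
qed

lemma ksgn_swap:
  assumes "finite \<rho>" "i \<in> \<rho>" "j \<in> \<rho>" "i \<noteq> j"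
  shows "(ksgn i \<rho> :: 'v::comm_ring_1) * ksgn j (\<rho> - {i}) = - (ksgn j \<rho> * ksgn i (\<rho> - {j}))"
proof -
  have i: "(ksgn i \<rho> :: 'v) = (if j < i then - ksgn i (\<rho> - {j}) else ksgn i (\<rho> - {j}))"
    using ksgn_insert[of "\<rho> - {j}" j i, where 'a = 'v] assms by (simp add: insert_absorb)
  have j: "(ksgn j \<rho> :: 'v) = (if i < j then - ksgn j (\<rho> - {i}) else ksgn j (\<rho> - {i}))"
    using ksgn_insert[of "\<rho> - {i}" i j, where 'a = 'v] assms by (simp add: insert_absorb)
  show ?thesis
    by (cases "i < j") (use assms(4) in \<open>simp_all add: i j mult.commute\<close>)
qed

lemma bd_bd:
  fixes u :: "nat set \<Rightarrow> complex"
  assumes "finite \<rho>"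
  shows "bd (bd u) \<rho> = 0"
proof -
  define F where "F i j = (if i \<noteq> j then ksgn i \<rho> * ksgn j (\<rho> - {i}) * u (\<rho> - {i} - {j}) else 0)" for i j
  have anti: "F i j = - F j i" if "i \<in> \<rho>" "j \<in> \<rho>" for i j
  proof -
    have "\<rho> - {i} - {j} = \<rho> - {j} - {i}" by auto
    then show ?thesis using ksgn_swap[OF assms that, where 'v = complex] by (auto simp: F_def)
  qed
  have "bd (bd u) \<rho> = (\<Sum>i\<in>\<rho>. \<Sum>j\<in>\<rho>. F i j)"
  proof (unfold bd_def, rule sum.cong[OF refl])
    fix i assume "i \<in> \<rho>"
    have "(\<Sum>j\<in>\<rho>. F i j) = (\<Sum>j\<in>\<rho> - {i}. F i j)"
      using assms \<open>i \<in> \<rho>\<close> by (simp add: sum.remove F_def)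
    also have "\<dots> = (\<Sum>j\<in>\<rho> - {i}. ksgn i \<rho> * (ksgn j (\<rho> - {i}) * u (\<rho> - {i} - {j})))"
      by (rule sum.cong) (auto simp: F_def)
    finally show "ksgn i \<rho> * (\<Sum>j\<in>\<rho> - {i}. ksgn j (\<rho> - {i}) * u (\<rho> - {i} - {j})) = (\<Sum>j\<in>\<rho>. F i j)"
      by (simp add: sum_distrib_left)
  qed
  moreover have "(\<Sum>i\<in>\<rho>. \<Sum>j\<in>\<rho>. F i j) = 0"
  proof -
    have "(\<Sum>i\<in>\<rho>. \<Sum>j\<in>\<rho>. F i j) = (\<Sum>i\<in>\<rho>. \<Sum>j\<in>\<rho>. - F j i)"
      by (intro sum.cong refl anti)
    also have "\<dots> = - (\<Sum>i\<in>\<rho>. \<Sum>j\<in>\<rho>. F j i)" by (simp add: sum_negf)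
    also have "(\<Sum>i\<in>\<rho>. \<Sum>j\<in>\<rho>. F j i) = (\<Sum>i\<in>\<rho>. \<Sum>j\<in>\<rho>. F i j)" by (rule sum.swap)
    finally show ?thesis by simp
  qed
  ultimately show ?thesis by simp
qed

text \<open>Terms that remove one index and insert another occur in both composites with opposite
  signs; inserting and removing the same index leaves \<open>c j (u \<rho>)\<close>. Additive maps
  \<open>c j\<close> are allowed, so that they may be projections to sets of monomials or
  multiplications by the functions of a partition of unity.\<close>

lemma koszul_homotopy:
  fixes u :: "nat set \<Rightarrow> 'v::comm_ring_1" and c :: "nat \<Rightarrow> 'v \<Rightarrow> 'v"
  assumes T: "finite T" "\<rho> \<subseteq> T"
    and add: "\<And>j a b. c j (a + b) = c j a + c j b"
  defines "h \<equiv> \<lambda>u \<rho>. \<Sum>j\<in>T - \<rho>. ksgn j \<rho> * c j (u (insert j \<rho>))"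
  shows "bd (h u) \<rho> + h (bd u) \<rho> = (\<Sum>j\<in>T. c j (u \<rho>))"
proof -
  have zero: "c j 0 = 0" for j using add[of j 0 0] by simp
  have neg: "c j (- a) = - c j a" for j a
    using add[of j a "- a"] zero by (simp add: eq_neg_iff_add_eq_0 add.commute)
  have sgn: "c j (ksgn i \<rho>' * a) = ksgn i \<rho>' * c j a" for i j \<rho>' a
    using ksgn_cases[of i \<rho>', where 'a = 'v] by (metis neg mult_minus1 mult_1)
  have csum: "c j (\<Sum>i\<in>S. f i) = (\<Sum>i\<in>S. c j (f i))" for j f and S :: "nat set"
    by (induction S rule: infinite_finite_induct) (auto simp: zero add)
  have fin: "finite \<rho>" using T finite_subset by blast
  \<comment> \<open>The mixed term, in which \<open>i\<close> is removed and \<open>j\<close>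
    inserted, in the order in which it arises from \<open>bd (h u)\<close>.\<close>
  define R where "R i j = ksgn i \<rho> * (ksgn j (\<rho> - {i}) * c j (u (insert j (\<rho> - {i}))))" for i j
  have 1: "bd (h u) \<rho> = (\<Sum>i\<in>\<rho>. c i (u \<rho>)) + (\<Sum>i\<in>\<rho>. \<Sum>j\<in>T - \<rho>. R i j)"
  proof -
    have "ksgn i \<rho> * h u (\<rho> - {i}) = c i (u \<rho>) + (\<Sum>j\<in>T - \<rho>. R i j)" if i: "i \<in> \<rho>" for i
    proof -
      have "T - (\<rho> - {i}) = insert i (T - \<rho>)" using i T by auto
      then have "h u (\<rho> - {i}) = ksgn i (\<rho> - {i}) * c i (u (insert i (\<rho> - {i})))
          + (\<Sum>j\<in>T - \<rho>. ksgn j (\<rho> - {i}) * c j (u (insert j (\<rho> - {i}))))"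
        unfolding h_def using i T by simp
      moreover have "insert i (\<rho> - {i}) = \<rho>" using i by auto
      moreover have "(ksgn i (\<rho> - {i}) :: 'v) = ksgn i \<rho>"
        using ksgn_insert_self[of i "\<rho> - {i}", where 'a = 'v] i by (simp add: insert_absorb)
      ultimately show ?thesis
        by (simp add: R_def distrib_left sum_distrib_left mult.assoc[symmetric])
    qed
    then show ?thesis unfolding bd_def by (simp add: sum.distrib)
  qed
  have 2: "h (bd u) \<rho> = (\<Sum>j\<in>T - \<rho>. c j (u \<rho>)) - (\<Sum>j\<in>T - \<rho>. \<Sum>i\<in>\<rho>. R i j)"
  proof -
    have "ksgn j \<rho> * c j (bd u (insert j \<rho>)) = c j (u \<rho>) - (\<Sum>i\<in>\<rho>. R i j)" if j: "j \<in> T - \<rho>" for j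
    proof -
      have "bd u (insert j \<rho>) = ksgn j \<rho> * u \<rho> + (\<Sum>i\<in>\<rho>. ksgn i (insert j \<rho>) * u (insert j \<rho> - {i}))"
        unfolding bd_def using j fin by (simp add: ksgn_insert_self)
      then have "ksgn j \<rho> * c j (bd u (insert j \<rho>)) = c j (u \<rho>)
          + (\<Sum>i\<in>\<rho>. ksgn j \<rho> * (ksgn i (insert j \<rho>) * c j (u (insert j \<rho> - {i}))))"
        by (simp add: add csum sgn distrib_left sum_distrib_left mult.assoc[symmetric])
      also have "(\<Sum>i\<in>\<rho>. ksgn j \<rho> * (ksgn i (insert j \<rho>) * c j (u (insert j \<rho> - {i})))) = (\<Sum>i\<in>\<rho>. - R i j)"
      proof (rule sum.cong[OF refl])
        fix i assume i: "i \<in> \<rho>"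
        then have ij: "i \<noteq> j" and set: "insert j \<rho> - {i} = insert j (\<rho> - {i})" using j by auto
        have s: "(ksgn j (\<rho> - {i}) :: 'v) = ksgn j (insert j \<rho> - {i})"
          unfolding set by (rule ksgn_insert_self[symmetric])
        have "(ksgn j (insert j \<rho>) :: 'v) * ksgn i (insert j \<rho> - {j}) =
          - (ksgn i (insert j \<rho>) * ksgn j (insert j \<rho> - {i}))"
          using i ij fin by (intro ksgn_swap) auto
        moreover have "insert j \<rho> - {j} = \<rho>" using j by auto
        ultimately have e: "(ksgn j \<rho> :: 'v) * ksgn i \<rho> = - (ksgn i (insert j \<rho>) * ksgn j (\<rho> - {i}))"
          unfolding s by (simp add: ksgn_insert_self)
        have "(ksgn j \<rho> :: 'v) * ksgn i (insert j \<rho>) = - (ksgn i \<rho> * ksgn j (\<rho> - {i}))"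
        proof -
          have "(ksgn j \<rho> :: 'v) * ksgn i (insert j \<rho>) = (ksgn j \<rho> * ksgn i \<rho>) * (ksgn i \<rho> * ksgn i (insert j \<rho>))"
            by (metis ksgn_square mult.assoc mult.left_neutral mult.commute)
          also have "\<dots> = - ((ksgn i (insert j \<rho>) * ksgn i (insert j \<rho>)) * (ksgn i \<rho> * ksgn j (\<rho> - {i})))"
            unfolding e by (simp only: mult_ac mult_minus_left mult_minus_right)
          finally show ?thesis by simp
        qed
        then show "ksgn j \<rho> * (ksgn i (insert j \<rho>) * c j (u (insert j \<rho> - {i}))) = - R i j"
          unfolding R_def set mult.assoc[symmetric] by simp
      qed
      finally show ?thesis by (simp add: sum_negf)
    qed
    then show ?thesis unfolding h_def by (simp add: sum_subtractf)
  qed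
  have "(\<Sum>j\<in>T. c j (u \<rho>)) = (\<Sum>j\<in>T - \<rho>. c j (u \<rho>)) + (\<Sum>i\<in>\<rho>. c i (u \<rho>))"
    by (rule sum.subset_diff[OF T(2,1)])
  then show ?thesis unfolding 1 2 by (subst sum.swap) simp
qed

section \<open>The standard covering\<close>

definition XR :: "nat set \<Rightarrow> nat polynomial" where
  "XR \<rho> = (\<Prod>i\<in>\<rho>. X i)"

definition box :: "nat set \<Rightarrow> nat \<Rightarrow> monomial" where
  "box \<rho> k = (\<Sum>i\<in>\<rho>. Poly_Mapping.single i k)"

lemma lookup_box: "finite \<rho> \<Longrightarrow> poly_mapping.lookup (box \<rho> k) i = (if i \<in> \<rho> then k else 0)"
  by (simp add: box_def lookup_sum lookup_single when_def)

lemma XR_in_hforms: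
  assumes "\<rho> \<subseteq> {..n}"
  shows "XR \<rho> \<in> hforms n (int (card \<rho>))"
proof -
  have "XR \<rho> \<in> hforms n (\<Sum>i\<in>\<rho>. 1)"
    unfolding XR_def by (rule hforms_prod) (use assms in auto)
  then show ?thesis by simp
qed

lemma eval_XR: "eval_poly (XR \<rho>) x = (\<Prod>i\<in>\<rho>. x i)"
  by (simp add: XR_def)

lemma XR_empty [simp]: "XR {} = 1"
  by (simp add: XR_def)

lemma XR_remove: "finite \<rho> \<Longrightarrow> i \<in> \<rho> \<Longrightarrow> XR \<rho> = XR (\<rho> - {i}) * X i"
  by (simp add: XR_def prod.remove[of \<rho> i] mult.commute)

lemma XR_insert: "finite \<rho> \<Longrightarrow> i \<notin> \<rho> \<Longrightarrow> XR (insert i \<rho>) = XR \<rho> * X i"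
  by (simp add: XR_def mult.commute)

lemma XR_nonzero: "finite \<rho> \<Longrightarrow> XR \<rho> \<noteq> 0"
  using eval_XR[of \<rho> "\<lambda>_. 1"] by auto

lemma XR_power:
  assumes "finite \<rho>"
  shows "XR \<rho> ^ k = Poly_Mapping.single (box \<rho> k) 1"
proof (rule eval_poly_inject)
  fix x :: vec
  have "mono_eval (box \<rho> k) x = (\<Prod>i\<in>\<rho>. x i ^ poly_mapping.lookup (box \<rho> k) i)"
    by (rule mono_eval_superset) (use assms in \<open>auto simp: in_keys_iff lookup_box split: if_splits\<close>)
  then show "eval_poly (XR \<rho> ^ k) x = eval_poly (Poly_Mapping.single (box \<rho> k) 1) x"
    using assms by (simp add: eval_XR lookup_box prod_power_distrib)
qed

lemma mem_vdom_XR: "finite \<rho> \<Longrightarrow> x \<in> vdom n (XR \<rho>) \<longleftrightarrow> x \<in> pcone n \<and> (\<forall>i\<in>\<rho>. x i \<noteq> 0)"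
  by (auto simp: vdom_def eval_XR)

lemma keys_mult_XR_power:
  assumes "finite \<rho>" "e \<in> Poly_Mapping.keys (p * XR \<rho> ^ k)" "i \<in> \<rho>"
  shows "poly_mapping.lookup e i \<ge> k"
proof -
  obtain f where "e = f + box \<rho> k"
    using assms(2) keys_mult[of p "XR \<rho> ^ k"] unfolding XR_power[OF assms(1)] by auto
  then show ?thesis using assms by (simp add: lookup_add lookup_box)
qed

lemma divide_XR_power:
  assumes \<rho>: "\<rho> \<subseteq> {..n}" and p: "p \<in> hforms n b"
    and keys: "\<And>e i. e \<in> Poly_Mapping.keys p \<Longrightarrow> i \<in> \<rho> \<Longrightarrow> poly_mapping.lookup e i \<ge> k"
  obtains q where "q \<in> hforms n (b - int (k * card \<rho>))" "p = q * XR \<rho> ^ k"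
proof -
  have fin: "finite \<rho>" using \<rho> finite_subset by blast
  define q where "q = (\<Sum>e\<in>Poly_Mapping.keys p. Poly_Mapping.single (e - box \<rho> k) (poly_mapping.lookup p e))"
  have split: "(e - box \<rho> k) + box \<rho> k = e" if "e \<in> Poly_Mapping.keys p" for e
    by (rule poly_mapping_eqI) (use keys[OF that] fin in \<open>auto simp: lookup_add lookup_minus lookup_box\<close>)
  have "q * XR \<rho> ^ k = (\<Sum>e\<in>Poly_Mapping.keys p. Poly_Mapping.single e (poly_mapping.lookup p e))"
    unfolding q_def XR_power[OF fin] sum_distrib_right by (rule sum.cong) (auto simp: mult_single split)
  also have "\<dots> = p"
    by (rule poly_mapping_eqI) (auto simp: lookup_sum lookup_single when_def in_keys_iff)
  finally have "p = q * XR \<rho> ^ k" ..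
  moreover have "q \<in> hforms n (b - int (k * card \<rho>))"
    unfolding q_def
  proof (rule hforms_sum)
    fix e assume e: "e \<in> Poly_Mapping.keys p"
    have "\<exists>d. e \<in> mons n d \<and> int d = b" using p e by (simp add: hforms_def)
    then obtain d where d: "e \<in> mons n d" "int d = b" by blast
    have "(\<Sum>i\<le>n. poly_mapping.lookup e i) =
        (\<Sum>i\<le>n. poly_mapping.lookup (e - box \<rho> k) i) + (\<Sum>i\<le>n. poly_mapping.lookup (box \<rho> k) i)"
      by (subst split[OF e, symmetric]) (simp add: lookup_add sum.distrib)
    also have "(\<Sum>i\<le>n. poly_mapping.lookup (box \<rho> k) i) = (\<Sum>i\<in>\<rho>. k)"
      by (rule sum.mono_neutral_cong_right) (use \<rho> fin in \<open>auto simp: lookup_box\<close>)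
    finally have s: "(\<Sum>i\<le>n. poly_mapping.lookup e i) = (\<Sum>i\<le>n. poly_mapping.lookup (e - box \<rho> k) i) + k * card \<rho>"
      by (simp add: mult.commute)
    have "Poly_Mapping.keys (e - box \<rho> k) \<subseteq> {..n}"
      using d(1) by (auto simp: mons_iff in_keys_iff lookup_minus subset_iff)
    then have "e - box \<rho> k \<in> mons n (d - k * card \<rho>)" "k * card \<rho> \<le> d"
      using d(1) s by (auto simp: mons_iff)
    then show "Poly_Mapping.single (e - box \<rho> k) (poly_mapping.lookup p e) \<in> hforms n (b - int (k * card \<rho>))"
      using hforms_single[of "e - box \<rho> k" n "d - k * card \<rho>"] d(2) by (simp add: of_nat_diff)
  qed
  ultimately show thesis using that by blast
qed

lemma eval_bd: "eval_poly (bd u \<rho>) x = bd (\<lambda>\<rho>. eval_poly (u \<rho>) x) \<rho>"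
proof -
  have "eval_poly (ksgn i \<rho>) x = ksgn i \<rho>" for i
    by (simp add: ksgn_def)
  then show ?thesis by (simp add: bd_def)
qed

lemma keys_ksgn: "Poly_Mapping.keys (ksgn j \<rho> * p) = Poly_Mapping.keys (p :: nat polynomial)"
proof -
  have "Poly_Mapping.keys (- p) = Poly_Mapping.keys p" by (simp add: set_eq_iff in_keys_iff)
  moreover have "ksgn j \<rho> * p = p \<or> ksgn j \<rho> * p = - p"
    using ksgn_cases[of j \<rho>, where 'a = "nat polynomial"] by (metis mult_minus1 mult_1)
  ultimately show ?thesis by metis
qed

lemma bd_hforms:
  assumes "\<And>i. i \<in> \<rho> \<Longrightarrow> u (\<rho> - {i}) \<in> hforms n b"
  shows "bd u \<rho> \<in> hforms n b"
  unfolding bd_def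
proof (rule hforms_sum)
  fix i assume "i \<in> \<rho>"
  then show "ksgn i \<rho> * u (\<rho> - {i}) \<in> hforms n b"
    using assms ksgn_cases[of i \<rho>, where 'a = "nat polynomial"]
    by (metis hforms_uminus mult_minus1 mult_1)
qed

lemma uniform_bound:
  assumes "finite S" "\<And>s. s \<in> S \<Longrightarrow> \<exists>N::nat. \<forall>M\<ge>N. P s M"
  obtains N where "\<And>s M. s \<in> S \<Longrightarrow> M \<ge> N \<Longrightarrow> P s M"
proof -
  have "\<forall>s. \<exists>N. s \<in> S \<longrightarrow> (\<forall>M\<ge>N. P s M)" using assms(2) by blast
  from choice[OF this] obtain N where N: "\<And>s M. s \<in> S \<Longrightarrow> M \<ge> N s \<Longrightarrow> P s M" by blast
  have "P s M" if "s \<in> S" "M \<ge> Max (insert 0 (N ` S))" for s M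
    using that assms(1) by (intro N) auto
  then show thesis by (rule that)
qed

text \<open>With the common denominator \<open>(x\<^sub>0 \<dots> x\<^sub>n)\<^sup>k\<close>, sections over \<open>D(x\<^sub>\<rho>)\<close> are polynomials in which all
  exponents outside \<open>\<rho>\<close> are at least \<open>k\<close>. The contracting homotopy splits a polynomial
  according to the first exponent that is at least \<open>k\<close>.\<close>

lemma standard_exact:
  fixes u :: "nat set \<Rightarrow> vec \<Rightarrow> complex"
  assumes u: "\<And>\<rho>. \<rho> \<subseteq> {..n} \<Longrightarrow> card \<rho> = Suc T \<Longrightarrow> u \<rho> \<in> sec n a (XR \<rho>)"
    and cocycle: "\<And>\<rho> x. \<rho> \<subseteq> {..n} \<Longrightarrow> card \<rho> = Suc (Suc T) \<Longrightarrow> x \<in> vdom n (XR \<rho>) \<Longrightarrow>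
      bd (\<lambda>\<rho>. u \<rho> x) \<rho> = 0"
    and range: "Suc T \<le> n \<or> a \<ge> - int n"
  shows "\<exists>y. (\<forall>\<rho>. \<rho> \<subseteq> {..n} \<and> card \<rho> = T \<longrightarrow> y \<rho> \<in> sec n a (XR \<rho>)) \<and>
    (\<forall>\<rho> x. \<rho> \<subseteq> {..n} \<and> card \<rho> = Suc T \<and> x \<in> vdom n (XR \<rho>) \<longrightarrow> bd (\<lambda>\<rho>. y \<rho> x) \<rho> = u \<rho> x)"
proof -
  define \<R> where "\<R> = {\<rho>. \<rho> \<subseteq> {..n} \<and> card \<rho> = Suc T}"
  have fin\<R>: "finite \<R>" unfolding \<R>_def by (rule finite_subset[of _ "Pow {..n}"]) auto
  have fin: "finite \<rho>" if "\<rho> \<subseteq> {..n}" for \<rho> :: "nat set" using that finite_subset by blast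
  have "\<exists>N. \<forall>k\<ge>N. \<exists>P\<in>hforms n (a + int (k * Suc T)). u \<rho> = fracsec n (XR \<rho>) k P" if "\<rho> \<in> \<R>" for \<rho>
  proof -
    have "u \<rho> \<in> sec n a (XR \<rho>)" "XR \<rho> \<in> hforms n (int (Suc T))"
      using that u XR_in_hforms[of \<rho> n] by (auto simp: \<R>_def)
    then show ?thesis by (rule sec_rep) blast
  qed
  then obtain k where k: "\<And>\<rho>. \<rho> \<in> \<R> \<Longrightarrow> \<exists>P\<in>hforms n (a + int (k * Suc T)). u \<rho> = fracsec n (XR \<rho>) k P"
    using uniform_bound[OF fin\<R>, of "\<lambda>\<rho> k. \<exists>P\<in>hforms n (a + int (k * Suc T)). u \<rho> = fracsec n (XR \<rho>) k P"]
    by (metis order_refl)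
  then have "\<forall>\<rho>. \<exists>P. \<rho> \<in> \<R> \<longrightarrow> P \<in> hforms n (a + int (k * Suc T)) \<and> u \<rho> = fracsec n (XR \<rho>) k P" by blast
  from choice[OF this] obtain P where P: "\<And>\<rho>. \<rho> \<in> \<R> \<Longrightarrow> P \<rho> \<in> hforms n (a + int (k * Suc T))"
    "\<And>\<rho>. \<rho> \<in> \<R> \<Longrightarrow> u \<rho> = fracsec n (XR \<rho>) k (P \<rho>)" by blast
  define co where "co \<rho> = {..n} - \<rho>" for \<rho>
  \<comment> \<open>The numerator of \<open>u \<rho>\<close> after expansion to the common
    denominator, the \<open>k\<close>-th power of the product of all coordinates.\<close>
  define Pt where "Pt \<rho> = P \<rho> * XR (co \<rho>) ^ k" for \<rho>
  define b where "b = a + int (k * Suc n)"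
  have card_co: "card (co \<rho>) + card \<rho> = Suc n" if "\<rho> \<subseteq> {..n}" for \<rho>
    using card_Diff_subset[OF fin[OF that] that] card_mono[OF finite_atMost that] by (simp add: co_def)
  have XR_co: "XR \<rho> * XR (co \<rho>) = XR {..n}" if "\<rho> \<subseteq> {..n}" for \<rho>
    using prod.subset_diff[OF that, of X] by (simp add: XR_def co_def mult.commute)
  have Pt: "Pt \<rho> \<in> hforms n b" if "\<rho> \<in> \<R>" for \<rho>
  proof -
    have \<rho>: "\<rho> \<subseteq> {..n}" "card \<rho> = Suc T" using that by (auto simp: \<R>_def)
    have "XR (co \<rho>) \<in> hforms n (int (card (co \<rho>)))" by (rule XR_in_hforms) (auto simp: co_def)
    from hforms_mult[OF P(1)[OF that] hforms_power[OF this, of k]]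
    have "Pt \<rho> \<in> hforms n (a + int (k * (card (co \<rho>) + Suc T)))"
      by (simp add: Pt_def algebra_simps)
    moreover have "card (co \<rho>) + Suc T = Suc n" using card_co[OF \<rho>(1)] \<rho>(2) by simp
    ultimately show ?thesis by (simp only: b_def)
  qed
  have evalPt: "eval_poly (Pt \<rho>) x = u \<rho> x * eval_poly (XR {..n}) x ^ k"
    if "\<rho> \<in> \<R>" "x \<in> vdom n (XR {..n})" for \<rho> x
  proof -
    have \<rho>: "\<rho> \<subseteq> {..n}" using that by (auto simp: \<R>_def)
    have "x \<in> vdom n (XR \<rho>)" using that(2) unfolding XR_co[OF \<rho>, symmetric] vdom_mult by blast
    then show ?thesis
      unfolding XR_co[OF \<rho>, symmetric] P(2)[OF that(1)] Pt_def
      by (simp add: fracsec_def vdom_def power_mult_distrib)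
  qed
  have bdPt: "bd Pt \<tau> = 0" if \<tau>: "\<tau> \<subseteq> {..n}" "card \<tau> = Suc (Suc T)" for \<tau>
  proof -
    have mem: "\<tau> - {i} \<in> \<R>" if "i \<in> \<tau>" for i
      using that \<tau> fin[OF \<tau>(1)] by (auto simp: \<R>_def)
    \<comment> \<open>The cocycle condition is known only where the coordinates in
      \<open>\<tau>\<close> are nonzero. The factor vanishes at the remaining points, so that the
      product is zero everywhere, and it can be cancelled as a nonzero polynomial.\<close>
    have "bd Pt \<tau> * XR {..n} = 0"
    proof (rule eval_poly_eq_zero)
      fix x :: vec
      define x' where "x' i = (if i \<le> n then x i else 0)" for i
      have "bd Pt \<tau> \<in> hforms n b" by (rule bd_hforms) (rule Pt[OF mem])
      then have "eval_poly (bd Pt \<tau>) x = eval_poly (bd Pt \<tau>) x'"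
        by (rule eval_poly_cong) (auto simp: x'_def)
      moreover have "eval_poly (XR {..n}) x = eval_poly (XR {..n}) x'"
        by (simp add: eval_XR x'_def)
      moreover have "eval_poly (bd Pt \<tau>) x' * eval_poly (XR {..n}) x' = 0"
      proof (cases "eval_poly (XR {..n}) x' = 0")
        case False
        then have nz: "x' i \<noteq> 0" if "i \<le> n" for i using that by (auto simp: eval_XR)
        then have "x' \<in> pcone n" by (auto simp: pcone_def affine_space_def x'_def fun_eq_iff)
        then have dom: "x' \<in> vdom n (XR {..n})" "x' \<in> vdom n (XR \<tau>)"
          using nz \<tau> fin by (auto simp: mem_vdom_XR)
        have "eval_poly (bd Pt \<tau>) x' = bd (\<lambda>\<rho>. u \<rho> x') \<tau> * eval_poly (XR {..n}) x' ^ k"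
          unfolding eval_bd unfolding bd_def sum_distrib_right
          by (rule sum.cong) (simp_all add: evalPt[OF mem dom(1)] mult.assoc)
        then show ?thesis using cocycle[OF \<tau> dom(2)] by simp
      qed simp
      ultimately show "eval_poly (bd Pt \<tau> * XR {..n}) x = 0" by simp
    qed
    then show ?thesis using XR_nonzero[of "{..n}"] by simp
  qed
  define Z where "Z j = {e::monomial. poly_mapping.lookup e j \<ge> k \<and> (\<forall>i<j. poly_mapping.lookup e i < k)}" for j
  have decomp: "(\<Sum>j\<le>n. restr (Z j) (Pt \<rho>)) = Pt \<rho>" if \<rho>: "\<rho> \<in> \<R>" for \<rho>
  proof (rule poly_mapping_eqI)
    fix e
    show "poly_mapping.lookup (\<Sum>j\<le>n. restr (Z j) (Pt \<rho>)) e = poly_mapping.lookup (Pt \<rho>) e"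
    proof (cases "e \<in> Poly_Mapping.keys (Pt \<rho>)")
      case False
      then show ?thesis
        by (auto simp: lookup_sum lookup_restr in_keys_iff intro!: sum.neutral)
    next
      case True
      have "\<exists>i\<le>n. poly_mapping.lookup e i \<ge> k"
      proof (cases "Suc T \<le> n")
        case True
        then have "co \<rho> \<noteq> {}" using card_co[of \<rho>] \<rho> by (auto simp: \<R>_def)
        then obtain i where "i \<in> co \<rho>" by blast
        then show ?thesis
          using keys_mult_XR_power[of "co \<rho>" e "P \<rho>" k i] \<open>e \<in> Poly_Mapping.keys (Pt \<rho>)\<close>
          by (auto simp: Pt_def co_def)
      next
        case False
        \<comment> \<open>Now \<open>\<rho>\<close> contains all indices and divisibility gives
          nothing. If all exponents were at most \<open>k - 1\<close>, the degree
          \<open>a + (n + 1) k\<close> would be at most \<open>(n + 1) (k - 1)\<close>, whence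
          \<open>a \<le> - n - 1\<close>.\<close>
        then have a: "a \<ge> - int n" using range by blast
        show ?thesis
        proof (rule ccontr)
          assume no: "\<not> (\<exists>i\<le>n. poly_mapping.lookup e i \<ge> k)"
          then have small: "poly_mapping.lookup e i < k" if "i \<le> n" for i using that by (meson not_le)
          then have "k > 0" by fastforce
          have "\<exists>d. e \<in> mons n d \<and> int d = b"
            using Pt[OF \<rho>] \<open>e \<in> Poly_Mapping.keys (Pt \<rho>)\<close> by (simp add: hforms_def)
          then have "int (\<Sum>i\<le>n. poly_mapping.lookup e i) = b" by (auto simp: mons_iff)
          moreover have "(\<Sum>i\<le>n. poly_mapping.lookup e i) \<le> (\<Sum>i\<le>n. k - 1)"
            by (rule sum_mono) (use small in force)
          then have "int (\<Sum>i\<le>n. poly_mapping.lookup e i) \<le> int (Suc n * (k - 1))"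
            by (simp only: of_nat_le_iff) simp
          moreover have "int (Suc n * (k - 1)) = int (Suc n) * (int k - 1)"
            using \<open>k > 0\<close> by (cases k) (simp_all add: algebra_simps)
          moreover have "b = a + int (Suc n) * int k" by (simp add: b_def algebra_simps)
          ultimately have "a \<le> - int (Suc n)" by (simp add: algebra_simps)
          then show False using a by simp
        qed
      qed
      then obtain i0 where i0: "i0 \<le> n" "poly_mapping.lookup e i0 \<ge> k" by blast
      define j0 where "j0 = (LEAST i. poly_mapping.lookup e i \<ge> k)"
      have j0: "poly_mapping.lookup e j0 \<ge> k" "j0 \<le> n" "\<And>i. i < j0 \<Longrightarrow> poly_mapping.lookup e i < k"
        unfolding j0_def using i0 LeastI[of "\<lambda>i. poly_mapping.lookup e i \<ge> k", OF i0(2)]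
          Least_le[of "\<lambda>i. poly_mapping.lookup e i \<ge> k", OF i0(2)] not_less_Least not_le by force+
      have "e \<in> Z j \<longleftrightarrow> j = j0" for j
      proof (cases j j0 rule: linorder_cases)
        case less
        then show ?thesis using j0(3)[of j] by (simp add: Z_def)
      next
        case equal
        then show ?thesis using j0 by (simp add: Z_def)
      next
        case greater
        then have "\<not> (\<forall>i<j. poly_mapping.lookup e i < k)" using j0(1) by (meson not_le)
        then show ?thesis using greater by (simp add: Z_def)
      qed
      then show ?thesis using j0(2) by (simp add: lookup_sum lookup_restr)
    qed
  qed
  define h where "h v \<rho> = (\<Sum>j\<in>{..n} - \<rho>. ksgn j \<rho> * restr (Z j) (v (insert j \<rho>)))"
    for v :: "nat set \<Rightarrow> nat polynomial" and \<rho>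
  have hom: "bd (h Pt) \<rho> = Pt \<rho>" if \<rho>: "\<rho> \<in> \<R>" for \<rho>
  proof -
    have \<rho>': "\<rho> \<subseteq> {..n}" "card \<rho> = Suc T" using \<rho> by (auto simp: \<R>_def)
    have "bd (h Pt) \<rho> + h (bd Pt) \<rho> = (\<Sum>j\<le>n. restr (Z j) (Pt \<rho>))"
      unfolding h_def[abs_def] by (rule koszul_homotopy[OF finite_atMost \<rho>'(1)]) (rule restr_add)
    moreover have "bd Pt (insert j \<rho>) = 0" if "j \<in> {..n} - \<rho>" for j
      by (rule bdPt) (use that \<rho>' fin[OF \<rho>'(1)] in auto)
    then have "h (bd Pt) \<rho> = 0" by (simp add: h_def)
    ultimately show ?thesis using decomp[OF \<rho>] by simp
  qed
  have hPt: "\<exists>q. q \<in> hforms n (a + int (k * T)) \<and> h Pt \<rho> = q * XR (co \<rho>) ^ k"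
    if \<rho>: "\<rho> \<subseteq> {..n}" "card \<rho> = T" for \<rho>
  proof -
    have mem: "insert j \<rho> \<in> \<R>" if "j \<in> {..n} - \<rho>" for j
      using that \<rho> fin[OF \<rho>(1)] by (auto simp: \<R>_def)
    have term_keys: "Poly_Mapping.keys (ksgn j \<rho> * restr (Z j) (Pt (insert j \<rho>))) \<subseteq>
      Poly_Mapping.keys (Pt (insert j \<rho>)) \<inter> Z j" for j
      unfolding keys_ksgn keys_restr ..
    have "h Pt \<rho> \<in> hforms n b"
      unfolding h_def
    proof (rule hforms_sum)
      fix j assume "j \<in> {..n} - \<rho>"
      from Pt[OF mem[OF this]] term_keys[of j]
      show "ksgn j \<rho> * restr (Z j) (Pt (insert j \<rho>)) \<in> hforms n b" unfolding hforms_def by blast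
    qed
    \<comment> \<open>Removing \<open>j\<close> from the index set asks for one more large exponent,
      that of \<open>x\<^sub>j\<close>; the projection to \<open>Z j\<close> provides it. The other
      exponents outside \<open>\<rho>\<close> are large already in
      \<open>Pt (insert j \<rho>)\<close>.\<close>
    moreover have "poly_mapping.lookup e i \<ge> k" if e: "e \<in> Poly_Mapping.keys (h Pt \<rho>)" and i: "i \<in> co \<rho>" for e i
    proof -
      have "poly_mapping.lookup (h Pt \<rho>) e \<noteq> 0" using e by (simp add: in_keys_iff)
      then obtain j where j: "j \<in> {..n} - \<rho>"
        "poly_mapping.lookup (ksgn j \<rho> * restr (Z j) (Pt (insert j \<rho>))) e \<noteq> 0"
        unfolding h_def lookup_sum by (meson sum.neutral)
      then have "e \<in> Poly_Mapping.keys (Pt (insert j \<rho>))" "e \<in> Z j"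
        using term_keys[of j] by (auto simp: in_keys_iff)
      then show ?thesis
        using keys_mult_XR_power[of "co (insert j \<rho>)" e "P (insert j \<rho>)" k i] i
        by (cases "i = j") (auto simp: Z_def Pt_def co_def)
    qed
    moreover have "co \<rho> \<subseteq> {..n}" by (auto simp: co_def)
    ultimately obtain q where q: "q \<in> hforms n (b - int (k * card (co \<rho>)))" "h Pt \<rho> = q * XR (co \<rho>) ^ k"
      using divide_XR_power[of "co \<rho>" n "h Pt \<rho>" b k] by blast
    have "b - int (k * card (co \<rho>)) = a + int (k * (card (co \<rho>) + T)) - int (k * card (co \<rho>))"
      using card_co[OF \<rho>(1)] \<rho>(2) by (simp only: b_def)
    then have "b - int (k * card (co \<rho>)) = a + int (k * T)" by (simp add: distrib_left)
    then show ?thesis using q by auto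
  qed
  then have "\<forall>\<rho>. \<exists>q. \<rho> \<subseteq> {..n} \<and> card \<rho> = T \<longrightarrow> q \<in> hforms n (a + int (k * T)) \<and> h Pt \<rho> = q * XR (co \<rho>) ^ k"
    by blast
  from choice[OF this] obtain q where q: "\<And>\<rho>. \<rho> \<subseteq> {..n} \<Longrightarrow> card \<rho> = T \<Longrightarrow> q \<rho> \<in> hforms n (a + int (k * T))"
    "\<And>\<rho>. \<rho> \<subseteq> {..n} \<Longrightarrow> card \<rho> = T \<Longrightarrow> h Pt \<rho> = q \<rho> * XR (co \<rho>) ^ k" by blast
  define y where "y \<rho> = fracsec n (XR \<rho>) k (q \<rho>)" for \<rho>
  have "y \<rho> \<in> sec n a (XR \<rho>)" if \<rho>: "\<rho> \<subseteq> {..n}" "card \<rho> = T" for \<rho>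
    unfolding y_def by (rule sec_fracsec[of _ _ T]) (use q(1)[OF \<rho>] XR_in_hforms[OF \<rho>(1)] \<rho>(2) in auto)
  moreover have "bd (\<lambda>\<rho>. y \<rho> x) \<rho> = u \<rho> x"
    if \<rho>: "\<rho> \<subseteq> {..n}" "card \<rho> = Suc T" and x: "x \<in> vdom n (XR \<rho>)" for \<rho> x
  proof -
    have mem: "\<rho> \<in> \<R>" using \<rho> by (simp add: \<R>_def)
    have sub: "\<rho> - {i} \<subseteq> {..n}" "card (\<rho> - {i}) = T" if "i \<in> \<rho>" for i
      using that \<rho> fin[OF \<rho>(1)] by auto
    have co: "XR (co (\<rho> - {i})) = XR (co \<rho>) * X i" if "i \<in> \<rho>" for i
    proof -
      have "co (\<rho> - {i}) = insert i (co \<rho>)" using that \<rho>(1) by (auto simp: co_def)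
      then show ?thesis using XR_insert[of "co \<rho>" i] that by (simp add: co_def)
    qed
    have "(\<Sum>i\<in>\<rho>. ksgn i \<rho> * (q (\<rho> - {i}) * X i ^ k)) * XR (co \<rho>) ^ k = bd (h Pt) \<rho>"
      unfolding bd_def sum_distrib_right
      by (rule sum.cong) (auto simp: q(2)[OF sub] co power_mult_distrib mult_ac)
    also have "\<dots> = P \<rho> * XR (co \<rho>) ^ k" unfolding hom[OF mem] Pt_def ..
    finally have PE: "(\<Sum>i\<in>\<rho>. ksgn i \<rho> * (q (\<rho> - {i}) * X i ^ k)) = P \<rho>"
      using XR_nonzero[of "co \<rho>"] by (simp add: co_def)
    have "eval_poly (P \<rho>) x = (\<Sum>i\<in>\<rho>. ksgn i \<rho> * (eval_poly (q (\<rho> - {i})) x * x i ^ k))"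
      unfolding PE[symmetric] by (simp add: ksgn_def)
    moreover have "y (\<rho> - {i}) x = eval_poly (q (\<rho> - {i})) x * x i ^ k / eval_poly (XR \<rho>) x ^ k"
      if "i \<in> \<rho>" for i
    proof -
      have "eval_poly (XR \<rho>) x = eval_poly (XR (\<rho> - {i})) x * x i"
        using XR_remove[OF fin[OF \<rho>(1)] that] by simp
      moreover have "x \<in> vdom n (XR (\<rho> - {i}))" "x i \<noteq> 0"
        using x that fin[OF \<rho>(1)] by (auto simp: mem_vdom_XR)
      ultimately show ?thesis by (simp add: y_def fracsec_def power_mult_distrib)
    qed
    ultimately show ?thesis
      using x by (simp add: bd_def P(2)[OF mem] fracsec_def sum_divide_distrib)
  qed
  ultimately show ?thesis by (intro exI[of _ y]) blast
qed

section \<open>Lifting sections along the matrix\<close>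

lemma sec_lift_local:
  assumes surj: "surj_degree n A B \<phi> a0" and l: "l \<le> n" and h: "h \<in> hforms n (int d)"
    and w: "\<And>i. i < B \<Longrightarrow> w i \<in> sec n (a + 1) (h * X l)"
  shows "\<exists>w'. (\<forall>j. w' j \<in> sec n a (h * X l)) \<and>
    (\<forall>i<B. \<forall>x\<in>vdom n (h * X l). (\<Sum>j<A. eval_poly (lin n \<phi> i j) x * w' j x) = w i x)"
proof -
  define g where "g = h * X l"
  \<comment> \<open>The matrix maps \<open>S\<^sub>a\<close> with \<open>a = a0\<close> onto degree
    \<open>Suc a0\<close>, which contains the multiples of basis vectors by
    \<open>x\<^sub>l ^ M\<close>. Dividing their preimages by this power lifts the basis vectors
    over \<open>D(x\<^sub>l)\<close>; the factor \<open>h ^ M\<close> only expands the fraction to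
    the denominator \<open>g ^ M\<close>.\<close>
  define M where "M = Suc a0"
  have "\<exists>P. (\<forall>j. P j \<in> hforms n (int a0)) \<and> (\<forall>i<B. act n A \<phi> P i = (if i = b then X l ^ M else 0))" for b
  proof (rule act_surjective[OF surj order_refl])
    fix i
    have "X l ^ M \<in> hforms n (int M * 1)" by (rule hforms_power) (use l in auto)
    then show "(if i = b then X l ^ M else 0) \<in> hforms n (int (Suc a0))" by (simp add: M_def)
  qed
  then have "\<forall>b. \<exists>P. (\<forall>j. P j \<in> hforms n (int a0)) \<and>
      (\<forall>i<B. act n A \<phi> P i = (if i = b then X l ^ M else 0))" by blast
  from choice[OF this] obtain P where P: "\<And>b j. P b j \<in> hforms n (int a0)"
    "\<And>b i. i < B \<Longrightarrow> act n A \<phi> (P b) i = (if i = b then X l ^ M else 0)" by blast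
  define w' where "w' j x = (\<Sum>b<B. eval_poly (P b j * h ^ M) x * w b x / eval_poly (g) x ^ M)" for j x
  have g: "g \<in> hforms n (int (Suc d))"
    using hforms_mult[OF h X_in_hforms[OF l]] by (simp add: g_def add.commute)
  have "w' j \<in> sec n a (g)" for j
    unfolding w'_def
  proof (rule sec_sum[OF g])
    fix b assume "b \<in> {..<B}"
    then have "w b \<in> sec n (a + 1) (g)" using w by (simp add: g_def)
    from sec_divide[OF sec_mult[OF this hforms_mult[OF P(1)[of b j] hforms_power[OF h, of M]]] g, of M]
    have "(\<lambda>x. eval_poly (P b j * h ^ M) x * w b x / eval_poly (g) x ^ M)
      \<in> sec n (a + 1 + (int a0 + int M * int d) - int (M * Suc d)) (g)" .
    moreover have "a + 1 + (int a0 + int M * int d) - int (M * Suc d) = a"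
      by (simp add: M_def algebra_simps)
    ultimately show "(\<lambda>x. eval_poly (P b j * h ^ M) x * w b x / eval_poly (g) x ^ M) \<in> sec n a (g)"
      by metis
  qed
  moreover have "(\<Sum>j<A. eval_poly (lin n \<phi> i j) x * w' j x) = w i x" if "i < B" "x \<in> vdom n (g)" for i x
  proof -
    define r where "r = eval_poly (h) x ^ M"
    have R: "eval_poly (g) x ^ M = r * x l ^ M"
      by (simp add: g_def r_def power_mult_distrib)
    have nz: "x l \<noteq> 0" "r \<noteq> 0"
      using that(2) unfolding r_def g_def by (auto simp: vdom_def)
    have "(\<Sum>j<A. eval_poly (lin n \<phi> i j) x * w' j x) =
      (\<Sum>j<A. \<Sum>b<B. eval_poly (lin n \<phi> i j * P b j) x * (w b x / x l ^ M))"
      unfolding w'_def R sum_distrib_left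
    proof (intro sum.cong refl)
      have "eval_poly (h ^ M) x = r" by (simp add: r_def)
      then show "eval_poly (lin n \<phi> i j) x * (eval_poly (P b j * h ^ M) x * w b x / (r * x l ^ M))
          = eval_poly (lin n \<phi> i j * P b j) x * (w b x / x l ^ M)" for j b
        using nz by (simp del: eval_poly_power)
    qed
    also have "\<dots> = (\<Sum>b<B. eval_poly (act n A \<phi> (P b) i) x * (w b x / x l ^ M))"
      by (subst sum.swap) (simp add: act_def sum_distrib_right sum_divide_distrib)
    also have "\<dots> = (\<Sum>b<B. if b = i then w i x else 0)"
      by (rule sum.cong) (use nz P(2)[OF that(1)] in auto)
    finally show ?thesis using that(1) by simp
  qed
  ultimately show ?thesis unfolding g_def by (intro exI[of _ w']) blast
qed

text \<open>For nonempty \<open>\<rho>\<close> some coordinate is invertible, and surjectivity in a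
  single degree already lifts all sections. For empty \<open>\<rho>\<close> sections are
  polynomials, and lifting is surjectivity in degree \<open>a\<close> itself, or trivial if forms of
  degree \<open>a + 1\<close> are zero.\<close>

lemma sec_lift:
  assumes surj: "surj_degree n A B \<phi> a0" and \<rho>: "\<rho> \<subseteq> {..n}"
    and w: "\<And>i. i < B \<Longrightarrow> w i \<in> sec n (a + 1) (XR \<rho>)"
    and low: "\<rho> \<noteq> {} \<or> a \<ge> int a0 \<or> a + 1 < 0"
  shows "\<exists>w'. (\<forall>j. w' j \<in> sec n a (XR \<rho>)) \<and>
    (\<forall>i<B. \<forall>x\<in>vdom n (XR \<rho>). (\<Sum>j<A. eval_poly (lin n \<phi> i j) x * w' j x) = w i x)"
proof (cases "\<rho> = {}")
  case True
  have one: "1 \<in> hforms n (int 0)" by simp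
  have "\<exists>Q. Q \<in> hforms n (a + 1) \<and> (\<forall>x\<in>pcone n. w i x = eval_poly Q x)" if i: "i < B" for i
  proof -
    have "w i \<in> sec n (a + 1) 1" using w[OF i] True by simp
    then obtain k P where "P \<in> hforms n (a + 1 + int (k * 0))" "w i = fracsec n 1 k P"
      using sec_rep[OF _ one] by blast
    then show ?thesis by (intro exI[of _ P]) (simp add: fracsec_def vdom_one)
  qed
  then have "\<forall>i. \<exists>Q. i < B \<longrightarrow> Q \<in> hforms n (a + 1) \<and> (\<forall>x\<in>pcone n. w i x = eval_poly Q x)" by blast
  from choice[OF this] obtain Q where Q: "\<And>i. i < B \<Longrightarrow> Q i \<in> hforms n (a + 1)"
    "\<And>i x. i < B \<Longrightarrow> x \<in> pcone n \<Longrightarrow> w i x = eval_poly (Q i) x" by blast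
  have "\<exists>P. (\<forall>j. P j \<in> hforms n a) \<and> (\<forall>i<B. act n A \<phi> P i = Q i)"
  proof (cases "a + 1 < 0")
    case True
    then have "Q i = 0" if "i < B" for i using Q(1)[OF that] hforms_neg by blast
    then show ?thesis by (intro exI[of _ "\<lambda>_. 0"]) (simp add: act_def)
  next
    case False
    then have a: "a \<ge> int a0" using low \<open>\<rho> = {}\<close> by simp
    have "\<exists>P. (\<forall>j. P j \<in> hforms n (int (nat a))) \<and> (\<forall>i<B. act n A \<phi> P i = Q i)"
      by (rule act_surjective[OF surj]) (use a Q(1) in \<open>auto simp: add.commute\<close>)
    then show ?thesis using a by simp
  qed
  then obtain P where P: "\<And>j. P j \<in> hforms n a" "\<And>i. i < B \<Longrightarrow> act n A \<phi> P i = Q i" by blast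
  have "fracsec n 1 0 (P j) \<in> sec n a (XR \<rho>)" for j
    using sec_fracsec[OF one, of "P j" a 0] P(1)[of j] True by simp
  moreover have "(\<Sum>j<A. eval_poly (lin n \<phi> i j) x * fracsec n 1 0 (P j) x) = w i x"
    if "i < B" "x \<in> vdom n (XR \<rho>)" for i x
  proof -
    have x: "x \<in> pcone n" using that(2) by (simp add: vdom_def)
    have "(\<Sum>j<A. eval_poly (lin n \<phi> i j) x * fracsec n 1 0 (P j) x) = eval_poly (act n A \<phi> P i) x"
      by (simp add: act_def fracsec_def vdom_one x)
    then show ?thesis using P(2)[OF that(1)] Q(2)[OF that(1) x] by simp
  qed
  ultimately show ?thesis by (intro exI[of _ "\<lambda>j. fracsec n 1 0 (P j)"]) blast
next
  case False
  then obtain l where l: "l \<in> \<rho>" by blast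
  have fin: "finite \<rho>" using \<rho> finite_subset by blast
  have "\<rho> - {l} \<subseteq> {..n}" "l \<le> n" using \<rho> l by auto
  from sec_lift_local[OF surj this(2) XR_in_hforms[OF this(1)]] w
  show ?thesis unfolding XR_remove[OF fin l] by blast
qed

lemma hom_apply_lin: "hom_apply n A \<phi> s x i = (\<Sum>j<A. eval_poly (lin n \<phi> i j) x * s x j)"
  by (simp add: hom_apply_def eval_lin)

lemma sum_bd:
  "(\<Sum>j\<in>S. c j * bd (\<lambda>\<rho>. y j \<rho>) \<rho>) = bd (\<lambda>\<rho>. \<Sum>j\<in>S. c j * y j \<rho>) \<rho>"
proof -
  have "(\<Sum>j\<in>S. c j * bd (\<lambda>\<rho>. y j \<rho>) \<rho>) = (\<Sum>i\<in>\<rho>. \<Sum>j\<in>S. ksgn i \<rho> * (c j * y j (\<rho> - {i})))"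
    unfolding bd_def by (subst sum.swap) (simp add: sum_distrib_left mult_ac)
  then show ?thesis by (simp add: bd_def sum_distrib_left)
qed

lemma bd_cong: "(\<And>i. i \<in> \<rho> \<Longrightarrow> u (\<rho> - {i}) = v (\<rho> - {i})) \<Longrightarrow> bd u \<rho> = bd v \<rho>"
  unfolding bd_def by (rule sum.cong) auto

lemma bd_diff: "bd (\<lambda>\<rho>. u \<rho> - v \<rho>) \<rho> = bd u \<rho> - bd v \<rho>"
  by (simp add: bd_def right_diff_distrib sum_subtractf)

text \<open>The long exact sequence of \<open>0 \<rightarrow> V \<rightarrow> O\<^sup>A \<rightarrow> O(1)\<^sup>B \<rightarrow> 0\<close> as a diagram chase.\<close>

lemma kernel_standard_exact:
  fixes z :: "nat set \<Rightarrow> vsection"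
  assumes supp: "\<And>i j k. i \<ge> B \<Longrightarrow> \<phi> (i, j, k) = 0"
    and surj: "surj_degree n A B \<phi> a0"
    and z: "\<And>\<rho>. \<rho> \<subseteq> {..n} \<Longrightarrow> card \<rho> = Suc T \<Longrightarrow> z \<rho> \<in> vsec n A \<phi> a (XR \<rho>)"
    and cocycle: "\<And>\<rho> x j. \<rho> \<subseteq> {..n} \<Longrightarrow> card \<rho> = Suc (Suc T) \<Longrightarrow> x \<in> vdom n (XR \<rho>) \<Longrightarrow>
      bd (\<lambda>\<rho>. z \<rho> x j) \<rho> = 0"
    and range: "Suc T \<le> n \<or> a \<ge> - int n" and "T > 0"
    and low: "T \<ge> 2 \<or> a \<ge> int a0 \<or> a + 1 < 0"
  shows "\<exists>y. (\<forall>\<rho>. \<rho> \<subseteq> {..n} \<and> card \<rho> = T \<longrightarrow> y \<rho> \<in> vsec n A \<phi> a (XR \<rho>)) \<and>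
    (\<forall>\<rho> x j. \<rho> \<subseteq> {..n} \<and> card \<rho> = Suc T \<and> x \<in> vdom n (XR \<rho>) \<longrightarrow> bd (\<lambda>\<rho>. y \<rho> x j) \<rho> = z \<rho> x j)"
proof -
  obtain T' where T': "T = Suc T'" using \<open>T > 0\<close> gr0_implies_Suc by blast
  have fin: "finite \<rho>" if "\<rho> \<subseteq> {..n}" for \<rho> :: "nat set" using that finite_subset by blast
  have sub: "\<rho> - {i} \<subseteq> {..n}" "card (\<rho> - {i}) = d" "\<And>x. x \<in> vdom n (XR \<rho>) \<Longrightarrow> x \<in> vdom n (XR (\<rho> - {i}))"
    if "\<rho> \<subseteq> {..n}" "card \<rho> = Suc d" "i \<in> \<rho>" for \<rho> i d
    using that fin[OF that(1)] by (auto simp: mem_vdom_XR)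
  have "\<forall>j. \<exists>y. j < A \<longrightarrow> (\<forall>\<rho>. \<rho> \<subseteq> {..n} \<and> card \<rho> = T \<longrightarrow> y \<rho> \<in> sec n a (XR \<rho>)) \<and>
    (\<forall>\<rho> x. \<rho> \<subseteq> {..n} \<and> card \<rho> = Suc T \<and> x \<in> vdom n (XR \<rho>) \<longrightarrow> bd (\<lambda>\<rho>. y \<rho> x) \<rho> = z \<rho> x j)"
  proof (rule allI)
    fix j
    have "\<exists>y. (\<forall>\<rho>. \<rho> \<subseteq> {..n} \<and> card \<rho> = T \<longrightarrow> y \<rho> \<in> sec n a (XR \<rho>)) \<and>
      (\<forall>\<rho> x. \<rho> \<subseteq> {..n} \<and> card \<rho> = Suc T \<and> x \<in> vdom n (XR \<rho>) \<longrightarrow> bd (\<lambda>\<rho>. y \<rho> x) \<rho> = z \<rho> x j)"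
      if "j < A"
      by (rule standard_exact[OF _ cocycle range]) (use z that in \<open>auto simp: vsec_def\<close>)
    then show "\<exists>y. j < A \<longrightarrow> (\<forall>\<rho>. \<rho> \<subseteq> {..n} \<and> card \<rho> = T \<longrightarrow> y \<rho> \<in> sec n a (XR \<rho>)) \<and>
      (\<forall>\<rho> x. \<rho> \<subseteq> {..n} \<and> card \<rho> = Suc T \<and> x \<in> vdom n (XR \<rho>) \<longrightarrow> bd (\<lambda>\<rho>. y \<rho> x) \<rho> = z \<rho> x j)"
      by blast
  qed
  from choice[OF this] obtain y0 where
    Y0: "\<forall>j. j < A \<longrightarrow> (\<forall>\<rho>. \<rho> \<subseteq> {..n} \<and> card \<rho> = T \<longrightarrow> y0 j \<rho> \<in> sec n a (XR \<rho>)) \<and>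
    (\<forall>\<rho> x. \<rho> \<subseteq> {..n} \<and> card \<rho> = Suc T \<and> x \<in> vdom n (XR \<rho>) \<longrightarrow> bd (\<lambda>\<rho>. y0 j \<rho> x) \<rho> = z \<rho> x j)" ..
  have y0: "y0 j \<rho> \<in> sec n a (XR \<rho>)" if "j < A" "\<rho> \<subseteq> {..n}" "card \<rho> = T" for j \<rho>
    using Y0[rule_format, OF that(1), THEN conjunct1] that(2,3) by simp
  have bdy0: "bd (\<lambda>\<rho>. y0 j \<rho> x) \<rho> = z \<rho> x j"
    if "j < A" "\<rho> \<subseteq> {..n}" "card \<rho> = Suc T" "x \<in> vdom n (XR \<rho>)" for j \<rho> x
    using Y0[rule_format, OF that(1), THEN conjunct2] that(2-4) by simp
  \<comment> \<open>The componentwise primitives \<open>y0\<close> need not lie in the kernel. Their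
    image \<open>v\<close> measures the defect, and it is a cocycle of \<open>O(a+1)\<close> in each
    of its components.\<close>
  define v where "v i \<rho> x = (\<Sum>j<A. eval_poly (lin n \<phi> i j) x * y0 j \<rho> x)" for i \<rho> x
  have v: "v i \<rho> \<in> sec n (a + 1) (XR \<rho>)" if "\<rho> \<subseteq> {..n}" "card \<rho> = T" for i \<rho>
    unfolding v_def by (rule sec_sum[OF XR_in_hforms[OF that(1)]])
      (use that y0 in \<open>auto intro!: sec_mult lin_in_hforms\<close>)
  have bdv: "bd (\<lambda>\<rho>. v i \<rho> x) \<rho> = 0" if \<rho>: "\<rho> \<subseteq> {..n}" "card \<rho> = Suc T" and x: "x \<in> vdom n (XR \<rho>)" for i \<rho> x
  proof -
    have "bd (\<lambda>\<rho>. v i \<rho> x) \<rho> = (\<Sum>j<A. eval_poly (lin n \<phi> i j) x * bd (\<lambda>\<rho>. y0 j \<rho> x) \<rho>)"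
      unfolding v_def by (rule sum_bd[symmetric])
    also have "\<dots> = hom_apply n A \<phi> (z \<rho>) x i"
      unfolding hom_apply_lin by (rule sum.cong) (auto simp: bdy0[OF _ \<rho> x])
    also have "\<dots> = 0" using z[OF \<rho>] by (simp add: vsec_def)
    finally show ?thesis .
  qed
  have "\<exists>w. (\<forall>\<rho>. \<rho> \<subseteq> {..n} \<and> card \<rho> = T' \<longrightarrow> w \<rho> \<in> sec n (a + 1) (XR \<rho>)) \<and>
      (\<forall>\<rho> x. \<rho> \<subseteq> {..n} \<and> card \<rho> = Suc T' \<and> x \<in> vdom n (XR \<rho>) \<longrightarrow> bd (\<lambda>\<rho>. w \<rho> x) \<rho> = v i \<rho> x)" for i
    by (rule standard_exact) (use v bdv range in \<open>auto simp: T'\<close>)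
  then have "\<forall>i. \<exists>w. (\<forall>\<rho>. \<rho> \<subseteq> {..n} \<and> card \<rho> = T' \<longrightarrow> w \<rho> \<in> sec n (a + 1) (XR \<rho>)) \<and>
      (\<forall>\<rho> x. \<rho> \<subseteq> {..n} \<and> card \<rho> = Suc T' \<and> x \<in> vdom n (XR \<rho>) \<longrightarrow> bd (\<lambda>\<rho>. w \<rho> x) \<rho> = v i \<rho> x)" by blast
  from choice[OF this] obtain w where
    W: "\<forall>i. (\<forall>\<rho>. \<rho> \<subseteq> {..n} \<and> card \<rho> = T' \<longrightarrow> w i \<rho> \<in> sec n (a + 1) (XR \<rho>)) \<and>
      (\<forall>\<rho> x. \<rho> \<subseteq> {..n} \<and> card \<rho> = Suc T' \<and> x \<in> vdom n (XR \<rho>) \<longrightarrow> bd (\<lambda>\<rho>. w i \<rho> x) \<rho> = v i \<rho> x)" ..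
  have w: "w i \<rho> \<in> sec n (a + 1) (XR \<rho>)" if "\<rho> \<subseteq> {..n}" "card \<rho> = T'" for i \<rho>
    using W[THEN spec, of i, THEN conjunct1] that by simp
  have bdw: "bd (\<lambda>\<rho>. w i \<rho> x) \<rho> = v i \<rho> x"
    if "\<rho> \<subseteq> {..n}" "card \<rho> = Suc T'" "x \<in> vdom n (XR \<rho>)" for i \<rho> x
    using W[THEN spec, of i, THEN conjunct2] that by simp
  \<comment> \<open>If \<open>T = 1\<close> then \<open>\<rho>\<close> is empty and
    \<open>w i \<rho>\<close> is a global section, so lifting depends on \<open>low\<close>. In
    higher degrees \<open>\<rho>\<close> is nonempty and lifting is local.\<close>
  have "\<forall>\<rho>. \<exists>w'. \<rho> \<subseteq> {..n} \<and> card \<rho> = T' \<longrightarrow> (\<forall>j. w' j \<in> sec n a (XR \<rho>)) \<and>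
    (\<forall>i<B. \<forall>x\<in>vdom n (XR \<rho>). (\<Sum>j<A. eval_poly (lin n \<phi> i j) x * w' j x) = w i \<rho> x)"
  proof (rule allI)
    fix \<rho>
    have "\<exists>w'. (\<forall>j. w' j \<in> sec n a (XR \<rho>)) \<and>
      (\<forall>i<B. \<forall>x\<in>vdom n (XR \<rho>). (\<Sum>j<A. eval_poly (lin n \<phi> i j) x * w' j x) = w i \<rho> x)"
      if "\<rho> \<subseteq> {..n}" "card \<rho> = T'"
      by (rule sec_lift[OF surj that(1)]) (use w that low T' in auto)
    then show "\<exists>w'. \<rho> \<subseteq> {..n} \<and> card \<rho> = T' \<longrightarrow> (\<forall>j. w' j \<in> sec n a (XR \<rho>)) \<and>
      (\<forall>i<B. \<forall>x\<in>vdom n (XR \<rho>). (\<Sum>j<A. eval_poly (lin n \<phi> i j) x * w' j x) = w i \<rho> x)" by blast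
  qed
  from choice[OF this] obtain w' where
    W': "\<forall>\<rho>. \<rho> \<subseteq> {..n} \<and> card \<rho> = T' \<longrightarrow> (\<forall>j. w' \<rho> j \<in> sec n a (XR \<rho>)) \<and>
    (\<forall>i<B. \<forall>x\<in>vdom n (XR \<rho>). (\<Sum>j<A. eval_poly (lin n \<phi> i j) x * w' \<rho> j x) = w i \<rho> x)" ..
  have w': "w' \<rho> j \<in> sec n a (XR \<rho>)" if "\<rho> \<subseteq> {..n}" "card \<rho> = T'" for \<rho> j
    using W' that by simp
  have w'w: "(\<Sum>j<A. eval_poly (lin n \<phi> i j) x * w' \<rho> j x) = w i \<rho> x"
    if "\<rho> \<subseteq> {..n}" "card \<rho> = T'" "i < B" "x \<in> vdom n (XR \<rho>)" for \<rho> i x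
    using W' that by simp
  \<comment> \<open>Subtracting this coboundary from \<open>y0\<close> moves the primitive into the
    kernel and leaves its own coboundary unchanged. Off the domain the value is zero, as for every
    section.\<close>
  define dw where "dw \<rho> j x = (if x \<in> vdom n (XR \<rho>) then bd (\<lambda>\<rho>. w' \<rho> j x) \<rho> else 0)" for \<rho> j x
  have dw: "dw \<rho> j \<in> sec n a (XR \<rho>)" if \<rho>: "\<rho> \<subseteq> {..n}" "card \<rho> = T" for \<rho> j
  proof -
    have "(\<lambda>x. \<Sum>i\<in>\<rho>. ksgn i \<rho> * (if x \<in> vdom n (XR \<rho>) then w' (\<rho> - {i}) j x else 0)) \<in> sec n a (XR \<rho>)"
    proof (rule sec_sum[OF XR_in_hforms[OF \<rho>(1)]])
      fix i assume i: "i \<in> \<rho>"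
      have "X i \<in> hforms n (int 1)" using i \<rho> by auto
      from sec_restrict[OF w'[OF sub(1,2)[OF \<rho>(1) _ i]] this]
      show "(\<lambda>x. ksgn i \<rho> * (if x \<in> vdom n (XR \<rho>) then w' (\<rho> - {i}) j x else 0)) \<in> sec n a (XR \<rho>)"
        unfolding XR_remove[OF fin[OF \<rho>(1)] i, symmetric] using \<rho> T' by (intro sec_cmult) auto
    qed
    moreover have "dw \<rho> j = (\<lambda>x. \<Sum>i\<in>\<rho>. ksgn i \<rho> * (if x \<in> vdom n (XR \<rho>) then w' (\<rho> - {i}) j x else 0))"
      by (rule ext) (simp add: dw_def bd_def)
    ultimately show ?thesis by simp
  qed
  define y where "y \<rho> x j = (if j < A then y0 j \<rho> x - dw \<rho> j x else 0)" for \<rho> x j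
  have "y \<rho> \<in> vsec n A \<phi> a (XR \<rho>)" if \<rho>: "\<rho> \<subseteq> {..n}" "card \<rho> = T" for \<rho>
    unfolding vsec_def
  proof (intro CollectI conjI allI impI ext)
    fix j assume "j < A"
    then show "(\<lambda>x. y \<rho> x j) \<in> sec n a (XR \<rho>)"
      using sec_diff[OF y0[OF _ \<rho>] dw[OF \<rho>], of j j] by (simp add: y_def)
  next
    fix x i
    show "hom_apply n A \<phi> (y \<rho>) x i = 0"
    proof (cases "i < B \<and> x \<in> vdom n (XR \<rho>)")
      case True
      have "hom_apply n A \<phi> (y \<rho>) x i = v i \<rho> x - (\<Sum>j<A. eval_poly (lin n \<phi> i j) x * bd (\<lambda>\<rho>. w' \<rho> j x) \<rho>)"
        using True by (simp add: hom_apply_lin y_def v_def dw_def right_diff_distrib sum_subtractf)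
      also have "(\<Sum>j<A. eval_poly (lin n \<phi> i j) x * bd (\<lambda>\<rho>. w' \<rho> j x) \<rho>) =
          bd (\<lambda>\<rho>. \<Sum>j<A. eval_poly (lin n \<phi> i j) x * w' \<rho> j x) \<rho>"
        by (rule sum_bd)
      also have "\<dots> = bd (\<lambda>\<rho>. w i \<rho> x) \<rho>"
        by (rule bd_cong, rule w'w) (use True sub[OF \<rho>(1), of T'] \<rho>(2) T' in auto)
      also have "\<dots> = v i \<rho> x" by (rule bdw) (use \<rho> T' True in auto)
      finally show ?thesis by simp
    next
      case False
      then consider "i \<ge> B" | "x \<notin> vdom n (XR \<rho>)" by linarith
      then show ?thesis
      proof cases
        case 1
        then show ?thesis by (simp add: hom_apply_def supp)
      next
        case 2
        then have "y \<rho> x j = 0" for j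
          using sec_outside[OF y0[OF _ \<rho>] 2, of j] by (auto simp: y_def dw_def)
        then show ?thesis by (simp add: hom_apply_def)
      qed
    qed
  qed (simp add: y_def)
  moreover have "bd (\<lambda>\<rho>. y \<rho> x j) \<rho> = z \<rho> x j"
    if \<rho>: "\<rho> \<subseteq> {..n}" "card \<rho> = Suc T" and x: "x \<in> vdom n (XR \<rho>)" for \<rho> x j
  proof (cases "j < A")
    case True
    have "bd (\<lambda>\<rho>. y \<rho> x j) \<rho> = bd (\<lambda>\<rho>. y0 j \<rho> x - bd (\<lambda>\<rho>. w' \<rho> j x) \<rho>) \<rho>"
      by (rule bd_cong) (use True sub(3)[OF \<rho> _ x] in \<open>simp add: y_def dw_def\<close>)
    also have "\<dots> = z \<rho> x j"
      unfolding bd_diff bdy0[OF True \<rho> x] bd_bd[OF fin[OF \<rho>(1)]] by simp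
    finally show ?thesis .
  next
    case False
    then show ?thesis using z[OF \<rho>] by (simp add: y_def bd_def vsec_def)
  qed
  ultimately show ?thesis by (intro exI[of _ y]) blast
qed

section \<open>The Cech double complex of a covering and the standard covering\<close>

definition del :: "nat \<Rightarrow> 'a list \<Rightarrow> 'a list" where
  "del k \<sigma> = take k \<sigma> @ drop (k + 1) \<sigma>"

definition lbd :: "('a list \<Rightarrow> complex) \<Rightarrow> 'a list \<Rightarrow> complex" where
  "lbd u \<sigma> = (\<Sum>k<length \<sigma>. (- 1) ^ k * u (del k \<sigma>))"

lemma del_0 [simp]: "del 0 (w # \<sigma>) = \<sigma>"
  and del_Suc [simp]: "del (Suc k) (w # \<sigma>) = w # del k \<sigma>"
  by (simp_all add: del_def)

lemma length_del: "k < length \<sigma> \<Longrightarrow> length (del k \<sigma>) = length \<sigma> - 1"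
  by (simp add: del_def)

lemma set_del: "set (del k \<sigma>) \<subseteq> set \<sigma>"
  unfolding del_def using set_take_subset set_drop_subset by fastforce

text \<open>Separates removal of the head from removal of a later entry. This recursion gives
  \<open>lbd_lbd\<close> by induction and is the identity behind the contraction of the
  rows.\<close>

lemma lbd_Cons: "lbd u (w # \<sigma>) = u \<sigma> - lbd (\<lambda>\<tau>. u (w # \<tau>)) \<sigma>"
  unfolding lbd_def length_Cons sum.lessThan_Suc_shift by (simp add: sum_negf)

lemma lbd_diff: "lbd (\<lambda>\<tau>. u \<tau> - v \<tau>) \<sigma> = lbd u \<sigma> - lbd v \<sigma>"
  by (simp add: lbd_def right_diff_distrib sum_subtractf)

lemma lbd_lbd: "lbd (lbd u) \<sigma> = 0"
proof (induction \<sigma> arbitrary: u)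
  case Nil
  then show ?case by (simp add: lbd_def)
next
  case (Cons w \<sigma>)
  have "lbd (lbd u) (w # \<sigma>) = lbd u \<sigma> - lbd (\<lambda>\<tau>. u \<tau> - lbd (\<lambda>\<tau>. u (w # \<tau>)) \<tau>) \<sigma>"
    unfolding lbd_Cons ..
  then show ?case using Cons.IH[of "\<lambda>\<tau>. u (w # \<tau>)"] by (simp add: lbd_diff)
qed

lemma sum_lbd: "(\<Sum>w\<in>S. c w * lbd (u w) \<sigma>) = lbd (\<lambda>\<tau>. \<Sum>w\<in>S. c w * u w \<tau>) \<sigma>"
proof -
  have "(\<Sum>w\<in>S. c w * lbd (u w) \<sigma>) = (\<Sum>k<length \<sigma>. \<Sum>w\<in>S. (- 1) ^ k * (c w * u w (del k \<sigma>)))"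
    unfolding lbd_def by (subst sum.swap) (simp add: sum_distrib_left mult_ac)
  then show ?thesis by (simp add: lbd_def sum_distrib_left)
qed

lemma lbd_cong: "(\<And>k. k < length \<sigma> \<Longrightarrow> u (del k \<sigma>) = v (del k \<sigma>)) \<Longrightarrow> lbd u \<sigma> = lbd v \<sigma>"
  unfolding lbd_def by (rule sum.cong) auto

lemma lbd_bd: "lbd (\<lambda>\<tau>. bd (u \<tau>) \<rho>) \<sigma> = bd (\<lambda>\<rho>. lbd (\<lambda>\<tau>. u \<tau> \<rho>) \<sigma>) \<rho>"
proof -
  have "lbd (\<lambda>\<tau>. bd (u \<tau>) \<rho>) \<sigma> = (\<Sum>k<length \<sigma>. \<Sum>i\<in>\<rho>. (- 1) ^ k * (ksgn i \<rho> * u (del k \<sigma>) (\<rho> - {i})))"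
    by (simp add: lbd_def bd_def sum_distrib_left)
  also have "\<dots> = (\<Sum>i\<in>\<rho>. \<Sum>k<length \<sigma>. (- 1) ^ k * (ksgn i \<rho> * u (del k \<sigma>) (\<rho> - {i})))"
    by (rule sum.swap)
  finally show ?thesis by (simp add: lbd_def bd_def sum_distrib_left mult_ac)
qed

section \<open>The double complex of a finite basic covering\<close>

type_synonym bicochain = "point set list \<Rightarrow> nat set \<Rightarrow> vsection"

text \<open>The members of \<open>\<W>\<close> serve here as labels of the polynomials
  \<open>f W\<close>; that \<open>W\<close> is the set \<open>D(f W)\<close> is assumed only when
  cochains on open sets are compared. Positive degrees make products of the \<open>f W\<close>
  eligible for the homogeneous Nullstellensatz.\<close>

locale basic_covering =
  fixes n A :: nat and \<phi> :: "nat \<times> nat \<times> nat \<Rightarrow> complex" and a :: int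
    and \<W> :: "point set set" and f :: "point set \<Rightarrow> nat polynomial" and dg :: "point set \<Rightarrow> nat"
  assumes finite_cover: "finite \<W>"
    and f: "\<And>W. W \<in> \<W> \<Longrightarrow> f W \<in> hforms n (int (dg W))"
    and dg: "\<And>W. W \<in> \<W> \<Longrightarrow> dg W > 0"
    and cover: "\<And>x. x \<in> pcone n \<Longrightarrow> \<exists>W\<in>\<W>. eval_poly (f W) x \<noteq> 0"
begin

definition G :: "point set list \<Rightarrow> nat set \<Rightarrow> nat polynomial" where
  "G \<sigma> \<rho> = prod_list (map f \<sigma>) * XR \<rho>"

definition dgs :: "point set list \<Rightarrow> nat" where
  "dgs \<sigma> = sum_list (map dg \<sigma>)"

definition valid :: "point set list \<Rightarrow> nat set \<Rightarrow> bool" where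
  "valid \<sigma> \<rho> \<longleftrightarrow> set \<sigma> \<subseteq> \<W> \<and> \<rho> \<subseteq> {..n}"

text \<open>Lists for the given covering, index sets for the standard one: the definition of
  cohomology prescribes cochains without alternation, while the Koszul homotopy works with sets.
  Both directions are augmented by length and size zero, so Cech degree \<open>p\<close> is found at
  \<open>l = p + 1\<close>.\<close>

definition C :: "nat \<Rightarrow> nat \<Rightarrow> bicochain set" where
  "C l s = {Y. \<forall>\<sigma> \<rho>. if valid \<sigma> \<rho> \<and> length \<sigma> = l \<and> card \<rho> = s then Y \<sigma> \<rho> \<in> vsec n A \<phi> a (G \<sigma> \<rho>)
     else Y \<sigma> \<rho> = (\<lambda>_ _. 0)}"

definition dW :: "bicochain \<Rightarrow> bicochain" where
  "dW Y \<sigma> \<rho> x j = (if valid \<sigma> \<rho> \<and> x \<in> vdom n (G \<sigma> \<rho>) then lbd (\<lambda>\<tau>. Y \<tau> \<rho> x j) \<sigma> else 0)"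

definition dS :: "bicochain \<Rightarrow> bicochain" where
  "dS Y \<sigma> \<rho> x j = (if valid \<sigma> \<rho> \<and> x \<in> vdom n (G \<sigma> \<rho>) then bd (\<lambda>\<rho>'. Y \<sigma> \<rho>' x j) \<rho> else 0)"

lemma valid_finite: "valid \<sigma> \<rho> \<Longrightarrow> finite \<rho>"
  unfolding valid_def using finite_subset by blast

lemma prod_list_hforms: "set \<sigma> \<subseteq> \<W> \<Longrightarrow> prod_list (map f \<sigma>) \<in> hforms n (int (dgs \<sigma>))"
  by (induction \<sigma>) (auto simp: dgs_def intro!: hforms_mult f)

lemma G_hforms: "valid \<sigma> \<rho> \<Longrightarrow> G \<sigma> \<rho> \<in> hforms n (int (dgs \<sigma> + card \<rho>))"
  unfolding G_def valid_def using hforms_mult[OF prod_list_hforms XR_in_hforms] by simp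

lemma mem_vdom_G: "finite \<rho> \<Longrightarrow> x \<in> vdom n (G \<sigma> \<rho>) \<longleftrightarrow>
    x \<in> pcone n \<and> (\<forall>W\<in>set \<sigma>. eval_poly (f W) x \<noteq> 0) \<and> (\<forall>i\<in>\<rho>. x i \<noteq> 0)"
proof (induction \<sigma>)
  case Nil
  then show ?case by (simp add: G_def mem_vdom_XR)
next
  case (Cons W \<sigma>)
  have "G (W # \<sigma>) \<rho> = f W * G \<sigma> \<rho>" by (simp add: G_def mult.assoc)
  then show ?case using Cons by (auto simp: vdom_mult vdom_def)
qed

lemma G_Cons: "G (W # \<sigma>) \<rho> = G \<sigma> \<rho> * f W"
  by (simp add: G_def mult_ac)

lemma G_insert: "finite \<rho> \<Longrightarrow> i \<notin> \<rho> \<Longrightarrow> G \<sigma> (insert i \<rho>) = G \<sigma> \<rho> * X i"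
  by (simp add: G_def XR_insert mult_ac)

lemma G_del: "k < length \<sigma> \<Longrightarrow> G \<sigma> \<rho> = G (del k \<sigma>) \<rho> * f (\<sigma> ! k)"
  unfolding G_def del_def by (subst id_take_nth_drop[of k \<sigma>]) (auto simp: mult_ac)

lemma G_remove: "finite \<rho> \<Longrightarrow> i \<in> \<rho> \<Longrightarrow> G \<sigma> \<rho> = G \<sigma> (\<rho> - {i}) * X i"
  by (simp add: G_def XR_remove[of \<rho> i] mult_ac)

lemma valid_del: "valid \<sigma> \<rho> \<Longrightarrow> valid (del k \<sigma>) \<rho>"
  using set_del[of k \<sigma>] by (auto simp: valid_def)

lemma valid_remove: "valid \<sigma> \<rho> \<Longrightarrow> valid \<sigma> (\<rho> - {i})"
  by (auto simp: valid_def)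

lemma vdom_del: "valid \<sigma> \<rho> \<Longrightarrow> x \<in> vdom n (G \<sigma> \<rho>) \<Longrightarrow> x \<in> vdom n (G (del k \<sigma>) \<rho>)"
  using mem_vdom_G[OF valid_finite] set_del[of k \<sigma>] by blast

lemma vdom_remove: "valid \<sigma> \<rho> \<Longrightarrow> x \<in> vdom n (G \<sigma> \<rho>) \<Longrightarrow> x \<in> vdom n (G \<sigma> (\<rho> - {i}))"
  using mem_vdom_G[OF valid_finite] by (simp add: mem_vdom_G valid_finite)

lemma C_mem: "Y \<in> C l s \<Longrightarrow> valid \<sigma> \<rho> \<Longrightarrow> length \<sigma> = l \<Longrightarrow> card \<rho> = s \<Longrightarrow> Y \<sigma> \<rho> \<in> vsec n A \<phi> a (G \<sigma> \<rho>)"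
  unfolding C_def by (drule CollectD, drule spec[of _ \<sigma>], drule spec[of _ \<rho>]) simp

lemma C_zero: "Y \<in> C l s \<Longrightarrow> \<not> (valid \<sigma> \<rho> \<and> length \<sigma> = l \<and> card \<rho> = s) \<Longrightarrow> Y \<sigma> \<rho> x j = 0"
  unfolding C_def by (drule CollectD, drule spec[of _ \<sigma>], drule spec[of _ \<rho>]) simp

lemma C_I:
  assumes "\<And>\<sigma> \<rho>. valid \<sigma> \<rho> \<Longrightarrow> length \<sigma> = l \<Longrightarrow> card \<rho> = s \<Longrightarrow> Y \<sigma> \<rho> \<in> vsec n A \<phi> a (G \<sigma> \<rho>)"
    and "\<And>\<sigma> \<rho> x j. \<not> (valid \<sigma> \<rho> \<and> length \<sigma> = l \<and> card \<rho> = s) \<Longrightarrow> Y \<sigma> \<rho> x j = 0"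
  shows "Y \<in> C l s"
  unfolding C_def by (intro CollectI allI) (use assms in \<open>auto intro!: ext\<close>)

lemma C_outside: "Y \<in> C l s \<Longrightarrow> finite \<rho> \<Longrightarrow> x \<notin> vdom n (G \<sigma> \<rho>) \<Longrightarrow> Y \<sigma> \<rho> x j = 0"
  using C_mem[of Y l s \<sigma> \<rho>] C_zero[of Y l s \<sigma> \<rho>] vsec_outside by blast

lemma C_diff: "Y \<in> C l s \<Longrightarrow> Z \<in> C l s \<Longrightarrow> Y - Z \<in> C l s"
proof (rule C_I)
  fix \<sigma> \<rho> assume Y: "Y \<in> C l s" "Z \<in> C l s" and v: "valid \<sigma> \<rho>" "length \<sigma> = l" "card \<rho> = s"
  have "(Y - Z) \<sigma> \<rho> = (\<lambda>x j. Y \<sigma> \<rho> x j - Z \<sigma> \<rho> x j)" by (intro ext) simp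
  then show "(Y - Z) \<sigma> \<rho> \<in> vsec n A \<phi> a (G \<sigma> \<rho>)"
    using vsec_diff[OF C_mem[OF Y(1) v] C_mem[OF Y(2) v]] by simp
qed (simp add: C_zero)

lemma dW_C:
  assumes Y: "Y \<in> C l s"
  shows "dW Y \<in> C (Suc l) s"
proof (rule C_I)
  fix \<sigma> \<rho> assume v: "valid \<sigma> \<rho>" "length \<sigma> = Suc l" "card \<rho> = s"
  have "(\<lambda>x j. \<Sum>k<length \<sigma>. (- 1) ^ k * (if x \<in> vdom n (G \<sigma> \<rho>) then Y (del k \<sigma>) \<rho> x j else 0))
      \<in> vsec n A \<phi> a (G \<sigma> \<rho>)"
  proof (rule vsec_sum[OF G_hforms[OF v(1)]], rule vsec_cmult)
    fix k assume "k \<in> {..<length \<sigma>}"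
    then have k: "k < length \<sigma>" by simp
    have "\<sigma> ! k \<in> \<W>" using k v(1) nth_mem by (auto simp: valid_def)
    moreover have "Y (del k \<sigma>) \<rho> \<in> vsec n A \<phi> a (G (del k \<sigma>) \<rho>)"
      by (rule C_mem[OF Y valid_del[OF v(1)]]) (use k v length_del[OF k] in auto)
    ultimately show "(\<lambda>x j. if x \<in> vdom n (G \<sigma> \<rho>) then Y (del k \<sigma>) \<rho> x j else 0) \<in> vsec n A \<phi> a (G \<sigma> \<rho>)"
      unfolding G_del[OF k] using vsec_restrict[OF _ f] by blast
  qed
  moreover have "dW Y \<sigma> \<rho> = (\<lambda>x j. \<Sum>k<length \<sigma>. (- 1) ^ k * (if x \<in> vdom n (G \<sigma> \<rho>) then Y (del k \<sigma>) \<rho> x j else 0))"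
    by (intro ext) (simp add: dW_def lbd_def v(1))
  ultimately show "dW Y \<sigma> \<rho> \<in> vsec n A \<phi> a (G \<sigma> \<rho>)" by simp
next
  fix \<sigma> \<rho> x j assume no: "\<not> (valid \<sigma> \<rho> \<and> length \<sigma> = Suc l \<and> card \<rho> = s)"
  have "Y (del k \<sigma>) \<rho> x j = 0" if "valid \<sigma> \<rho>" "k < length \<sigma>" for k
    by (rule C_zero[OF Y]) (use no that length_del[of k \<sigma>] in auto)
  then show "dW Y \<sigma> \<rho> x j = 0" by (simp add: dW_def lbd_def)
qed

lemma dS_C:
  assumes Y: "Y \<in> C l s"
  shows "dS Y \<in> C l (Suc s)"
proof (rule C_I)
  fix \<sigma> \<rho> assume v: "valid \<sigma> \<rho>" "length \<sigma> = l" "card \<rho> = Suc s"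
  note fin = valid_finite[OF v(1)]
  have "(\<lambda>x j. \<Sum>i\<in>\<rho>. ksgn i \<rho> * (if x \<in> vdom n (G \<sigma> \<rho>) then Y \<sigma> (\<rho> - {i}) x j else 0))
      \<in> vsec n A \<phi> a (G \<sigma> \<rho>)"
  proof (rule vsec_sum[OF G_hforms[OF v(1)]], rule vsec_cmult)
    fix i assume i: "i \<in> \<rho>"
    then have "X i \<in> hforms n (int 1)" using v(1) by (auto simp: valid_def)
    moreover have "Y \<sigma> (\<rho> - {i}) \<in> vsec n A \<phi> a (G \<sigma> (\<rho> - {i}))"
      by (rule C_mem[OF Y valid_remove[OF v(1)]]) (use i v fin in auto)
    ultimately show "(\<lambda>x j. if x \<in> vdom n (G \<sigma> \<rho>) then Y \<sigma> (\<rho> - {i}) x j else 0) \<in> vsec n A \<phi> a (G \<sigma> \<rho>)"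
      unfolding G_remove[OF fin i] using vsec_restrict by blast
  qed
  moreover have "dS Y \<sigma> \<rho> = (\<lambda>x j. \<Sum>i\<in>\<rho>. ksgn i \<rho> * (if x \<in> vdom n (G \<sigma> \<rho>) then Y \<sigma> (\<rho> - {i}) x j else 0))"
    by (intro ext) (simp add: dS_def bd_def v(1))
  ultimately show "dS Y \<sigma> \<rho> \<in> vsec n A \<phi> a (G \<sigma> \<rho>)" by simp
next
  fix \<sigma> \<rho> x j assume no: "\<not> (valid \<sigma> \<rho> \<and> length \<sigma> = l \<and> card \<rho> = Suc s)"
  have "Y \<sigma> (\<rho> - {i}) x j = 0" if "valid \<sigma> \<rho>" "i \<in> \<rho>" for i
    by (rule C_zero[OF Y]) (use no that card_Suc_Diff1[OF valid_finite[OF that(1)] that(2)] in auto)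
  then show "dS Y \<sigma> \<rho> x j = 0" by (simp add: dS_def bd_def)
qed

lemma dW_diff: "dW (Y - Z) = dW Y - dW Z"
  by (intro ext) (simp add: dW_def lbd_diff)

lemma dS_diff: "dS (Y - Z) = dS Y - dS Z"
  by (intro ext) (simp add: dS_def bd_diff)

lemma dW_dW: "dW (dW Y) = 0"
proof (intro ext)
  fix \<sigma> \<rho> x j
  show "dW (dW Y) \<sigma> \<rho> x j = 0 \<sigma> \<rho> x j"
  proof (cases "valid \<sigma> \<rho> \<and> x \<in> vdom n (G \<sigma> \<rho>)")
    case True
    then have "dW (dW Y) \<sigma> \<rho> x j = lbd (lbd (\<lambda>\<tau>. Y \<tau> \<rho> x j)) \<sigma>"
      unfolding dW_def[of "dW Y"] using valid_del vdom_del by (auto simp: dW_def intro: lbd_cong)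
    then show ?thesis by (simp add: lbd_lbd)
  next
    case False
    then show ?thesis by (auto simp: dW_def)
  qed
qed

lemma dS_dS: "dS (dS Y) = 0"
proof (intro ext)
  fix \<sigma> \<rho> x j
  show "dS (dS Y) \<sigma> \<rho> x j = 0 \<sigma> \<rho> x j"
  proof (cases "valid \<sigma> \<rho> \<and> x \<in> vdom n (G \<sigma> \<rho>)")
    case True
    then have "dS (dS Y) \<sigma> \<rho> x j = bd (bd (\<lambda>\<rho>. Y \<sigma> \<rho> x j)) \<rho>"
      unfolding dS_def[of "dS Y"] using valid_remove vdom_remove by (auto simp: dS_def intro: bd_cong)
    moreover have "finite \<rho>" using True valid_finite by blast
    ultimately show ?thesis by (simp add: bd_bd)
  next
    case False
    then show ?thesis by (auto simp: dS_def)
  qed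
qed

lemma dW_dS: "dW (dS Y) = dS (dW Y)"
proof (intro ext)
  fix \<sigma> \<rho> x j
  show "dW (dS Y) \<sigma> \<rho> x j = dS (dW Y) \<sigma> \<rho> x j"
  proof (cases "valid \<sigma> \<rho> \<and> x \<in> vdom n (G \<sigma> \<rho>)")
    case True
    then have "dW (dS Y) \<sigma> \<rho> x j = lbd (\<lambda>\<tau>. bd (\<lambda>\<rho>. Y \<tau> \<rho> x j) \<rho>) \<sigma>"
      unfolding dW_def[of "dS Y"] using valid_del vdom_del by (auto simp: dS_def intro: lbd_cong)
    also have "\<dots> = bd (\<lambda>\<rho>. lbd (\<lambda>\<tau>. Y \<tau> \<rho> x j) \<sigma>) \<rho>" by (rule lbd_bd)
    also have "\<dots> = dS (dW Y) \<sigma> \<rho> x j"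
      unfolding dS_def[of "dW Y"] using True valid_remove vdom_remove by (auto simp: dW_def intro: bd_cong)
    finally show ?thesis .
  next
    case False
    then show ?thesis by (auto simp: dW_def dS_def)
  qed
qed

section \<open>Exactness of the rows and columns\<close>

lemma finite_lists: "finite {\<sigma>. set \<sigma> \<subseteq> \<W> \<and> length \<sigma> = l}"
  by (rule finite_lists_length_eq[OF finite_cover])

lemma row_injective:
  assumes z: "z \<in> C 0 s" "dW z = 0"
  shows "z = 0"
proof (intro ext)
  fix \<sigma> \<rho> x j
  show "z \<sigma> \<rho> x j = 0 \<sigma> \<rho> x j"
  proof (cases "valid \<sigma> \<rho> \<and> length \<sigma> = 0 \<and> card \<rho> = s \<and> x \<in> vdom n (G \<sigma> \<rho>)")
    case True
    then have fin: "finite \<rho>" and \<sigma>: "\<sigma> = []" using valid_finite by auto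
    then obtain W where W: "W \<in> \<W>" "eval_poly (f W) x \<noteq> 0" using True cover mem_vdom_G by blast
    have "valid [W] \<rho>" "x \<in> vdom n (G [W] \<rho>)"
      using True W \<sigma> fin by (auto simp: valid_def mem_vdom_G)
    then have "dW z [W] \<rho> x j = z [] \<rho> x j" by (simp add: dW_def lbd_def)
    then show ?thesis using z(2) \<sigma> by simp
  next
    case False
    then show ?thesis using C_zero[OF z(1), of \<sigma> \<rho> x j] C_outside[OF z(1), of \<rho> x \<sigma> j] valid_finite by auto
  qed
qed

lemma column_injective:
  assumes z: "z \<in> C l 0" "dS z = 0"
  shows "z = 0"
proof (intro ext)
  fix \<sigma> \<rho> x j
  show "z \<sigma> \<rho> x j = 0 \<sigma> \<rho> x j"
  proof (cases "valid \<sigma> \<rho> \<and> length \<sigma> = l \<and> card \<rho> = 0 \<and> x \<in> vdom n (G \<sigma> \<rho>)")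
    case True
    then have fin: "finite \<rho>" and \<rho>: "\<rho> = {}" using valid_finite by auto
    have "x \<in> pcone n" using True by (simp add: vdom_def)
    then obtain i where i: "i \<le> n" "x i \<noteq> 0" by (rule cone_nonzero_coord)
    have "valid \<sigma> {i}" "x \<in> vdom n (G \<sigma> {i})"
      using True i \<rho> by (auto simp: valid_def mem_vdom_G)
    moreover have "{j\<in>{i}. j < i} = {}" by auto
    then have "ksgn i {i} = (1::complex)" by (simp only: ksgn_def card.empty power_0)
    ultimately have "dS z \<sigma> {i} x j = z \<sigma> {} x j" by (simp add: dS_def bd_def)
    then show ?thesis using z(2) \<rho> by simp
  next
    case False
    then show ?thesis using C_zero[OF z(1), of \<sigma> \<rho> x j] C_outside[OF z(1), of \<rho> x \<sigma> j] valid_finite by auto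
  qed
qed

text \<open>With a partition of unity \<open>e\<close> the primitive is
  \<open>\<Sum> e W * z (W # \<tau>)\<close>, because the cocycle condition at
  \<open>W # \<sigma>\<close> expresses \<open>z \<sigma>\<close> through \<open>z (W # _)\<close>.
  The Nullstellensatz for \<open>XR \<rho>\<close> supplies the partition; its degree is positive
  since \<open>s > 0\<close>.\<close>

lemma row_exact:
  assumes "s > 0" and z: "z \<in> C (Suc l) s" "dW z = 0"
  shows "\<exists>y\<in>C l s. dW y = z"
proof -
  define S where "S = \<W> \<times> {\<tau>. set \<tau> \<subseteq> \<W> \<and> length \<tau> = l} \<times> {\<rho>. \<rho> \<subseteq> {..n} \<and> card \<rho> = s}"
  have "finite {\<rho>. \<rho> \<subseteq> {..n} \<and> card \<rho> = s}" by (rule finite_subset[of _ "Pow {..n}"]) auto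
  then have finS: "finite S" unfolding S_def using finite_cover finite_lists by blast
  \<comment> \<open>The partition of unity is built from \<open>M\<close>-th powers, so its
    \<open>K\<close> and \<open>c\<close> are known only after \<open>M\<close>. Hence
    \<open>M\<close> is chosen first, large enough for all members, lists and index sets and for
    every later \<open>K\<close> and \<open>c\<close>.\<close>
  define P where "P = (\<lambda>(W, \<tau>, \<rho>) M. \<forall>K. \<forall>c\<in>hforms n (int (K * (dgs \<tau> + card \<rho>)) - int (M * dg W)).
    (\<lambda>x j. eval_poly c x * eval_poly (f W) x ^ M / eval_poly (G \<tau> \<rho>) x ^ K * z (W # \<tau>) \<rho> x j)
      \<in> vsec n A \<phi> a (G \<tau> \<rho>))"
  have "\<exists>N. \<forall>M\<ge>N. P p M" if p: "p \<in> S" for p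
  proof -
    obtain W \<tau> \<rho> where p': "p = (W, \<tau>, \<rho>)" by (cases p)
    then have v: "W \<in> \<W>" "valid \<tau> \<rho>" "valid (W # \<tau>) \<rho>" "length \<tau> = l" "card \<rho> = s"
      using p by (auto simp: S_def valid_def)
    have "z (W # \<tau>) \<rho> \<in> vsec n A \<phi> a (G \<tau> \<rho> * f W)"
      using C_mem[OF z(1) v(3)] v(4,5) by (simp add: G_Cons)
    from vsec_partition_term[OF this G_hforms[OF v(2)] f[OF v(1)]]
    show ?thesis unfolding P_def p' by simp
  qed
  then obtain M0 where M0: "\<And>p M. p \<in> S \<Longrightarrow> M \<ge> M0 \<Longrightarrow> P p M"
    using uniform_bound[OF finS, of P] by blast
  define M where "M = Suc M0"
  have "\<exists>K c. XR \<rho> ^ K = (\<Sum>W\<in>\<W>. c W * f W ^ M) \<and> (\<forall>W\<in>\<W>. c W \<in> hforms n (int (K * s) - int (M * dg W)))"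
    if \<rho>: "\<rho> \<subseteq> {..n}" "card \<rho> = s" for \<rho>
  proof -
    have "\<exists>K F c. finite F \<and> F \<subseteq> \<W> \<and> XR \<rho> ^ K = (\<Sum>W\<in>F. c W * f W ^ M) \<and>
      (\<forall>W\<in>F. c W \<in> hforms n (int (K * s) - int (M * dg W)))"
    proof (rule homogeneous_Nullstellensatz[where d = "\<lambda>W. M * dg W"])
      show "f W ^ M \<in> hforms n (int (M * dg W))" if "W \<in> \<W>" for W
        using hforms_power[OF f[OF that], of M] by simp
      show "XR \<rho> \<in> hforms n (int s)" using XR_in_hforms[OF \<rho>(1)] \<rho>(2) by simp
      fix x assume "x \<in> affine_space {..n}" "x \<noteq> (\<lambda>_. 0)"
        and zero: "\<And>W. W \<in> \<W> \<Longrightarrow> eval_poly (f W ^ M) x = 0"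
      then have "x \<in> pcone n" by (simp add: pcone_def)
      then show "eval_poly (XR \<rho>) x = 0" using cover zero by fastforce
    qed (rule assms(1))
    then obtain K F c where F: "finite F" "F \<subseteq> \<W>" "XR \<rho> ^ K = (\<Sum>W\<in>F. c W * f W ^ M)"
      "\<And>W. W \<in> F \<Longrightarrow> c W \<in> hforms n (int (K * s) - int (M * dg W))" by blast
    have "XR \<rho> ^ K = (\<Sum>W\<in>\<W>. (if W \<in> F then c W else 0) * f W ^ M)"
      unfolding F(3) by (rule sum.mono_neutral_cong_left) (use F finite_cover in auto)
    then show ?thesis using F(4)
      by (intro exI[of _ K] exI[of _ "\<lambda>W. if W \<in> F then c W else 0"]) auto
  qed
  then have "\<forall>\<rho>. \<exists>K c. \<rho> \<subseteq> {..n} \<and> card \<rho> = s \<longrightarrow> XR \<rho> ^ K = (\<Sum>W\<in>\<W>. c W * f W ^ M) \<and>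
      (\<forall>W\<in>\<W>. c W \<in> hforms n (int (K * s) - int (M * dg W)))" by blast
  from choice[OF this] obtain K where "\<forall>\<rho>. \<exists>c. \<rho> \<subseteq> {..n} \<and> card \<rho> = s \<longrightarrow>
      XR \<rho> ^ K \<rho> = (\<Sum>W\<in>\<W>. c W * f W ^ M) \<and>
      (\<forall>W\<in>\<W>. c W \<in> hforms n (int (K \<rho> * s) - int (M * dg W)))" ..
  from choice[OF this] obtain c where
    c: "\<And>\<rho>. \<rho> \<subseteq> {..n} \<Longrightarrow> card \<rho> = s \<Longrightarrow> XR \<rho> ^ K \<rho> = (\<Sum>W\<in>\<W>. c \<rho> W * f W ^ M)"
      "\<And>\<rho> W. \<rho> \<subseteq> {..n} \<Longrightarrow> card \<rho> = s \<Longrightarrow> W \<in> \<W> \<Longrightarrow> c \<rho> W \<in> hforms n (int (K \<rho> * s) - int (M * dg W))"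
    by blast
  define e where "e \<rho> W x = eval_poly (c \<rho> W) x * eval_poly (f W) x ^ M / eval_poly (XR \<rho>) x ^ K \<rho>" for \<rho> W x
  have e_sum: "(\<Sum>W\<in>\<W>. e \<rho> W x) = 1" if "\<rho> \<subseteq> {..n}" "card \<rho> = s" "\<forall>i\<in>\<rho>. x i \<noteq> 0" for \<rho> x
  proof -
    have "eval_poly (XR \<rho>) x \<noteq> 0" using that finite_subset[OF that(1)] by (simp add: eval_XR)
    moreover have "(\<Sum>W\<in>\<W>. e \<rho> W x) = eval_poly (XR \<rho> ^ K \<rho>) x / eval_poly (XR \<rho>) x ^ K \<rho>"
      unfolding c(1)[OF that(1,2)] by (simp add: e_def sum_divide_distrib)
    ultimately show ?thesis by simp
  qed
  define y where "y \<tau> \<rho> x j = (if valid \<tau> \<rho> \<and> length \<tau> = l \<and> card \<rho> = s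
    then \<Sum>W\<in>\<W>. e \<rho> W x * z (W # \<tau>) \<rho> x j else 0)" for \<tau> \<rho> x j
  have y: "y \<in> C l s"
  proof (rule C_I)
    fix \<tau> \<rho> assume v: "valid \<tau> \<rho>" "length \<tau> = l" "card \<rho> = s"
    then have \<rho>: "\<rho> \<subseteq> {..n}" and \<tau>: "set \<tau> \<subseteq> \<W>" by (auto simp: valid_def)
    have "(\<lambda>x j. \<Sum>W\<in>\<W>. e \<rho> W x * z (W # \<tau>) \<rho> x j) \<in> vsec n A \<phi> a (G \<tau> \<rho>)"
    proof (rule vsec_sum[OF G_hforms[OF v(1)]])
      fix W assume W: "W \<in> \<W>"
      \<comment> \<open>The partition has powers of \<open>XR \<rho>\<close> as denominators.
        Expanding by \<open>p\<close> gives powers of \<open>G \<tau> \<rho>\<close>; where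
        \<open>p\<close> vanishes the section is zero anyway.\<close>
      define p where "p = prod_list (map f \<tau>)"
      have "p ^ K \<rho> * c \<rho> W \<in> hforms n (int (K \<rho> * (dgs \<tau> + card \<rho>)) - int (M * dg W))"
        using hforms_mult[OF hforms_power[OF prod_list_hforms[OF \<tau>], of "K \<rho>"] c(2)[OF \<rho> v(3) W]] v(3)
        by (simp add: p_def algebra_simps)
      note mem = this
      have "P (W, \<tau>, \<rho>) M" by (rule M0) (use W v \<rho> \<tau> in \<open>auto simp: S_def M_def\<close>)
      from this[unfolded P_def prod.case, THEN spec, THEN bspec, OF mem]
      have "(\<lambda>x j. eval_poly (p ^ K \<rho> * c \<rho> W) x * eval_poly (f W) x ^ M /
          eval_poly (G \<tau> \<rho>) x ^ K \<rho> * z (W # \<tau>) \<rho> x j) \<in> vsec n A \<phi> a (G \<tau> \<rho>)" .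
      moreover have "eval_poly (p ^ K \<rho> * c \<rho> W) x * eval_poly (f W) x ^ M / eval_poly (G \<tau> \<rho>) x ^ K \<rho> *
          z (W # \<tau>) \<rho> x j = e \<rho> W x * z (W # \<tau>) \<rho> x j" for x j
      proof (cases "eval_poly p x = 0")
        case True
        then have "x \<notin> vdom n (G (W # \<tau>) \<rho>)" by (simp add: vdom_def G_def p_def)
        then show ?thesis using C_outside[OF z(1) valid_finite[OF v(1)]] by simp
      next
        case False
        then show ?thesis by (simp add: e_def G_def p_def power_mult_distrib)
      qed
      ultimately show "(\<lambda>x j. e \<rho> W x * z (W # \<tau>) \<rho> x j) \<in> vsec n A \<phi> a (G \<tau> \<rho>)" by simp
    qed
    moreover have "y \<tau> \<rho> = (\<lambda>x j. \<Sum>W\<in>\<W>. e \<rho> W x * z (W # \<tau>) \<rho> x j)"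
      by (intro ext) (simp add: y_def v)
    ultimately show "y \<tau> \<rho> \<in> vsec n A \<phi> a (G \<tau> \<rho>)" by simp
  qed (auto simp: y_def)
  have "dW y = z"
  proof (intro ext)
    fix \<sigma> \<rho> x j
    show "dW y \<sigma> \<rho> x j = z \<sigma> \<rho> x j"
    proof (cases "valid \<sigma> \<rho> \<and> length \<sigma> = Suc l \<and> card \<rho> = s \<and> x \<in> vdom n (G \<sigma> \<rho>)")
      case False
      have "dW y \<sigma> \<rho> x j = 0"
        using False C_zero[OF dW_C[OF y], of \<sigma> \<rho> x j] by (auto simp: dW_def)
      moreover have "z \<sigma> \<rho> x j = 0"
        using False C_zero[OF z(1), of \<sigma> \<rho> x j] C_outside[OF z(1), of \<rho> x \<sigma> j] valid_finite by auto
      ultimately show ?thesis by simp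
    next
      case True
      then have \<rho>: "\<rho> \<subseteq> {..n}" "card \<rho> = s" and fin: "finite \<rho>" and x: "x \<in> vdom n (G \<sigma> \<rho>)"
        using valid_finite by (auto simp: valid_def)
      have "dW y \<sigma> \<rho> x j = lbd (\<lambda>\<tau>. \<Sum>W\<in>\<W>. e \<rho> W x * z (W # \<tau>) \<rho> x j) \<sigma>"
      proof -
        have "y (del k \<sigma>) \<rho> x j = (\<Sum>W\<in>\<W>. e \<rho> W x * z (W # del k \<sigma>) \<rho> x j)"
          if "k < length \<sigma>" for k
          using True valid_del[of \<sigma> \<rho> k] length_del[OF that] by (simp add: y_def)
        then show ?thesis using True by (auto simp: dW_def intro!: lbd_cong)
      qed
      also have "\<dots> = (\<Sum>W\<in>\<W>. e \<rho> W x * lbd (\<lambda>\<tau>. z (W # \<tau>) \<rho> x j) \<sigma>)"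
        by (rule sum_lbd[symmetric])
      also have "\<dots> = (\<Sum>W\<in>\<W>. e \<rho> W x * z \<sigma> \<rho> x j)"
      proof (rule sum.cong[OF refl])
        fix W assume W: "W \<in> \<W>"
        show "e \<rho> W x * lbd (\<lambda>\<tau>. z (W # \<tau>) \<rho> x j) \<sigma> = e \<rho> W x * z \<sigma> \<rho> x j"
        proof (cases "eval_poly (f W) x = 0")
          case True
          then show ?thesis by (simp add: e_def M_def)
        next
          case False
          then have "valid (W # \<sigma>) \<rho>" "x \<in> vdom n (G (W # \<sigma>) \<rho>)"
            using True W x fin by (auto simp: valid_def mem_vdom_G)
          then have "dW z (W # \<sigma>) \<rho> x j = z \<sigma> \<rho> x j - lbd (\<lambda>\<tau>. z (W # \<tau>) \<rho> x j) \<sigma>"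
            by (simp add: dW_def lbd_Cons)
          then show ?thesis using z(2) by simp
        qed
      qed
      also have "\<dots> = z \<sigma> \<rho> x j"
        using e_sum[OF \<rho>, of x] x fin by (simp add: sum_distrib_right[symmetric] mem_vdom_G)
      finally show ?thesis .
    qed
  qed
  then show ?thesis using y by blast
qed

text \<open>As for the rows, with the coordinates in place of the \<open>f W\<close>. They have no
  common zero on the cone, and the product of the \<open>f W\<close> over a nonempty list has
  positive degree.\<close>

lemma column_exact:
  assumes "l > 0" and z: "z \<in> C l (Suc s)" "dS z = 0"
  shows "\<exists>y\<in>C l s. dS y = z"
proof -
  define S where "S = {..n} \<times> {\<tau>. set \<tau> \<subseteq> \<W> \<and> length \<tau> = l} \<times> {\<rho>. \<rho> \<subseteq> {..n} \<and> card \<rho> = s}"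
  have "finite {\<rho>. \<rho> \<subseteq> {..n} \<and> card \<rho> = s}" by (rule finite_subset[of _ "Pow {..n}"]) auto
  then have finS: "finite S" unfolding S_def using finite_lists by blast
  define P where "P = (\<lambda>(i, \<tau>, \<rho>) M. i \<notin> \<rho> \<longrightarrow> (\<forall>K. \<forall>c\<in>hforms n (int (K * (dgs \<tau> + card \<rho>)) - int M).
    (\<lambda>x j. eval_poly c x * x i ^ M / eval_poly (G \<tau> \<rho>) x ^ K * z \<tau> (insert i \<rho>) x j)
      \<in> vsec n A \<phi> a (G \<tau> \<rho>)))"
  have "\<exists>N. \<forall>M\<ge>N. P p M" if p: "p \<in> S" for p
  proof -
    obtain i \<tau> \<rho> where p': "p = (i, \<tau>, \<rho>)" by (cases p)
    then have v: "i \<le> n" "valid \<tau> \<rho>" "valid \<tau> (insert i \<rho>)" "length \<tau> = l" "card \<rho> = s"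
      using p by (auto simp: S_def valid_def)
    show ?thesis
    proof (cases "i \<in> \<rho>")
      case False
      have "z \<tau> (insert i \<rho>) \<in> vsec n A \<phi> a (G \<tau> \<rho> * X i)"
        using C_mem[OF z(1) v(3)] v(4,5) False valid_finite[OF v(2)] by (simp add: G_insert)
      from vsec_partition_term[OF this G_hforms[OF v(2)], of 1]
      show ?thesis unfolding P_def p' using v(1) False by simp
    qed (simp add: P_def p')
  qed
  then obtain M0 where M0: "\<And>p M. p \<in> S \<Longrightarrow> M \<ge> M0 \<Longrightarrow> P p M"
    using uniform_bound[OF finS, of P] by blast
  define M where "M = Suc M0"
  define g where "g \<tau> = prod_list (map f \<tau>)" for \<tau>
  have "\<exists>K c. g \<tau> ^ K = (\<Sum>i\<le>n. c i * X i ^ M) \<and> (\<forall>i\<le>n. c i \<in> hforms n (int (K * dgs \<tau>) - int M))"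
    if \<tau>: "set \<tau> \<subseteq> \<W>" "length \<tau> = l" for \<tau>
  proof -
    obtain W \<tau>' where "\<tau> = W # \<tau>'" using \<tau>(2) assms(1) by (cases \<tau>) auto
    then have pos: "dgs \<tau> > 0" using dg[of W] \<tau>(1) by (simp add: dgs_def)
    have "\<exists>K F c. finite F \<and> F \<subseteq> {..n} \<and> g \<tau> ^ K = (\<Sum>i\<in>F. c i * X i ^ M) \<and>
      (\<forall>i\<in>F. c i \<in> hforms n (int (K * dgs \<tau>) - int M))"
    proof (rule homogeneous_Nullstellensatz[where d = "\<lambda>_. M"])
      show "X i ^ M \<in> hforms n (int M)" if "i \<in> {..n}" for i
        using hforms_power[OF X_in_hforms[of i n], of M] that by simp
      show "g \<tau> \<in> hforms n (int (dgs \<tau>))" unfolding g_def by (rule prod_list_hforms[OF \<tau>(1)])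
      fix x assume "x \<in> affine_space {..n}" "x \<noteq> (\<lambda>_. 0)"
        and zero: "\<And>i. i \<in> {..n} \<Longrightarrow> eval_poly (X i ^ M) x = 0"
      then have "x \<in> pcone n" by (simp add: pcone_def)
      then obtain i where "i \<le> n" "x i \<noteq> 0" by (rule cone_nonzero_coord)
      then show "eval_poly (g \<tau>) x = 0" using zero[of i] by simp
    qed (rule pos)
    then obtain K F c where F: "finite F" "F \<subseteq> {..n}" "g \<tau> ^ K = (\<Sum>i\<in>F. c i * X i ^ M)"
      "\<And>i. i \<in> F \<Longrightarrow> c i \<in> hforms n (int (K * dgs \<tau>) - int M)" by blast
    have "g \<tau> ^ K = (\<Sum>i\<le>n. (if i \<in> F then c i else 0) * X i ^ M)"
      unfolding F(3) by (rule sum.mono_neutral_cong_left) (use F in auto)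
    then show ?thesis using F(4)
      by (intro exI[of _ K] exI[of _ "\<lambda>i. if i \<in> F then c i else 0"]) auto
  qed
  then have "\<forall>\<tau>. \<exists>K c. set \<tau> \<subseteq> \<W> \<and> length \<tau> = l \<longrightarrow> g \<tau> ^ K = (\<Sum>i\<le>n. c i * X i ^ M) \<and>
      (\<forall>i\<le>n. c i \<in> hforms n (int (K * dgs \<tau>) - int M))" by blast
  from choice[OF this] obtain K where "\<forall>\<tau>. \<exists>c. set \<tau> \<subseteq> \<W> \<and> length \<tau> = l \<longrightarrow>
      g \<tau> ^ K \<tau> = (\<Sum>i\<le>n. c i * X i ^ M) \<and> (\<forall>i\<le>n. c i \<in> hforms n (int (K \<tau> * dgs \<tau>) - int M))" ..
  from choice[OF this] obtain c where
    c: "\<And>\<tau>. set \<tau> \<subseteq> \<W> \<Longrightarrow> length \<tau> = l \<Longrightarrow> g \<tau> ^ K \<tau> = (\<Sum>i\<le>n. c \<tau> i * X i ^ M)"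
      "\<And>\<tau> i. set \<tau> \<subseteq> \<W> \<Longrightarrow> length \<tau> = l \<Longrightarrow> i \<le> n \<Longrightarrow> c \<tau> i \<in> hforms n (int (K \<tau> * dgs \<tau>) - int M)"
    by blast
  define e where "e \<tau> i x = eval_poly (c \<tau> i) x * x i ^ M / eval_poly (g \<tau>) x ^ K \<tau>" for \<tau> i x
  have e_sum: "(\<Sum>i\<le>n. e \<tau> i x) = 1" if "set \<tau> \<subseteq> \<W>" "length \<tau> = l" "eval_poly (g \<tau>) x \<noteq> 0" for \<tau> x
  proof -
    have "(\<Sum>i\<le>n. e \<tau> i x) = eval_poly (g \<tau> ^ K \<tau>) x / eval_poly (g \<tau>) x ^ K \<tau>"
      unfolding c(1)[OF that(1,2)] by (simp add: e_def sum_divide_distrib)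
    then show ?thesis using that(3) by simp
  qed
  define y where "y \<tau> \<rho> x j = (if valid \<tau> \<rho> \<and> length \<tau> = l \<and> card \<rho> = s
    then \<Sum>i\<in>{..n} - \<rho>. ksgn i \<rho> * (e \<tau> i x * z \<tau> (insert i \<rho>) x j) else 0)" for \<tau> \<rho> x j
  have y: "y \<in> C l s"
  proof (rule C_I)
    fix \<tau> \<rho> assume v: "valid \<tau> \<rho>" "length \<tau> = l" "card \<rho> = s"
    then have \<rho>: "\<rho> \<subseteq> {..n}" and \<tau>: "set \<tau> \<subseteq> \<W>" by (auto simp: valid_def)
    note fin = valid_finite[OF v(1)]
    have "(\<lambda>x j. \<Sum>i\<in>{..n} - \<rho>. ksgn i \<rho> * (e \<tau> i x * z \<tau> (insert i \<rho>) x j)) \<in> vsec n A \<phi> a (G \<tau> \<rho>)"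
    proof (rule vsec_sum[OF G_hforms[OF v(1)]], rule vsec_cmult)
      fix i assume i: "i \<in> {..n} - \<rho>"
      have "XR \<rho> ^ K \<tau> * c \<tau> i \<in> hforms n (int (K \<tau> * (dgs \<tau> + card \<rho>)) - int M)"
        using hforms_mult[OF hforms_power[OF XR_in_hforms[OF \<rho>], of "K \<tau>"] c(2)[OF \<tau> v(2), of i]] i
        by (simp add: algebra_simps)
      note mem = this
      have "P (i, \<tau>, \<rho>) M" by (rule M0) (use i v \<rho> \<tau> in \<open>auto simp: S_def M_def\<close>)
      moreover have "i \<notin> \<rho>" using i by simp
      ultimately have "(\<lambda>x j. eval_poly (XR \<rho> ^ K \<tau> * c \<tau> i) x * x i ^ M /
          eval_poly (G \<tau> \<rho>) x ^ K \<tau> * z \<tau> (insert i \<rho>) x j) \<in> vsec n A \<phi> a (G \<tau> \<rho>)"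
        unfolding P_def prod.case using mem by blast
      moreover have "eval_poly (XR \<rho> ^ K \<tau> * c \<tau> i) x * x i ^ M / eval_poly (G \<tau> \<rho>) x ^ K \<tau> *
          z \<tau> (insert i \<rho>) x j = e \<tau> i x * z \<tau> (insert i \<rho>) x j" for x j
      proof (cases "eval_poly (XR \<rho>) x = 0")
        case True
        then have "x \<notin> vdom n (G \<tau> (insert i \<rho>))" using i fin by (simp add: vdom_def G_insert, simp add: G_def)
        then show ?thesis using C_outside[OF z(1), of "insert i \<rho>" x \<tau> j] fin by simp
      next
        case False
        then show ?thesis by (simp add: e_def G_def g_def power_mult_distrib)
      qed
      ultimately show "(\<lambda>x j. e \<tau> i x * z \<tau> (insert i \<rho>) x j) \<in> vsec n A \<phi> a (G \<tau> \<rho>)" by simp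
    qed
    moreover have "y \<tau> \<rho> = (\<lambda>x j. \<Sum>i\<in>{..n} - \<rho>. ksgn i \<rho> * (e \<tau> i x * z \<tau> (insert i \<rho>) x j))"
      by (intro ext) (simp add: y_def v)
    ultimately show "y \<tau> \<rho> \<in> vsec n A \<phi> a (G \<tau> \<rho>)" by simp
  qed (auto simp: y_def)
  have "dS y = z"
  proof (intro ext)
    fix \<sigma> \<rho> x j
    show "dS y \<sigma> \<rho> x j = z \<sigma> \<rho> x j"
    proof (cases "valid \<sigma> \<rho> \<and> length \<sigma> = l \<and> card \<rho> = Suc s \<and> x \<in> vdom n (G \<sigma> \<rho>)")
      case False
      have "dS y \<sigma> \<rho> x j = 0"
        using False C_zero[OF dS_C[OF y], of \<sigma> \<rho> x j] by (auto simp: dS_def)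
      moreover have "z \<sigma> \<rho> x j = 0"
        using False C_zero[OF z(1), of \<sigma> \<rho> x j] C_outside[OF z(1), of \<rho> x \<sigma> j] valid_finite by auto
      ultimately show ?thesis by simp
    next
      case True
      then have v: "valid \<sigma> \<rho>" "length \<sigma> = l" "card \<rho> = Suc s" and x: "x \<in> vdom n (G \<sigma> \<rho>)" by auto
      then have \<rho>: "\<rho> \<subseteq> {..n}" and \<sigma>: "set \<sigma> \<subseteq> \<W>" by (auto simp: valid_def)
      note fin = valid_finite[OF v(1)]
      define u where "u \<rho> = z \<sigma> \<rho> x j" for \<rho>
      \<comment> \<open>At a fixed point \<open>x\<close> the homotopy is purely numerical: the maps
        \<open>c i\<close> are multiplications by the values of the partition of unity, which add up
        to one.\<close>
      define h where "h v \<rho> = (\<Sum>i\<in>{..n} - \<rho>. ksgn i \<rho> * (e \<sigma> i x * v (insert i \<rho>)))" for v \<rho>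
      have "bd (h u) \<rho> + h (bd u) \<rho> = (\<Sum>i\<le>n. e \<sigma> i x * u \<rho>)"
        unfolding h_def[abs_def]
        by (rule koszul_homotopy[OF finite_atMost \<rho>, of "\<lambda>i b. e \<sigma> i x * b"]) (rule distrib_left)
      moreover have "e \<sigma> i x * bd u (insert i \<rho>) = 0" if i: "i \<in> {..n} - \<rho>" for i
      proof (cases "x i = 0")
        case True
        then show ?thesis by (simp add: e_def M_def)
      next
        case False
        then have "valid \<sigma> (insert i \<rho>)" "x \<in> vdom n (G \<sigma> (insert i \<rho>))"
          using v(1) x i fin by (auto simp: valid_def mem_vdom_G)
        then have "bd u (insert i \<rho>) = dS z \<sigma> (insert i \<rho>) x j" by (simp add: dS_def u_def[abs_def])
        then show ?thesis using z(2) by simp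
      qed
      then have "h (bd u) \<rho> = 0"
        unfolding h_def by (intro sum.neutral ballI) (metis mult_zero_right)
      moreover have "(\<Sum>i\<le>n. e \<sigma> i x * u \<rho>) = u \<rho>"
        using e_sum[OF \<sigma> v(2), of x] x by (simp add: sum_distrib_right[symmetric] vdom_def G_def g_def)
      moreover have "dS y \<sigma> \<rho> x j = bd (h u) \<rho>"
      proof -
        have "dS y \<sigma> \<rho> x j = bd (\<lambda>\<rho>. y \<sigma> \<rho> x j) \<rho>" using v(1) x by (simp add: dS_def)
        also have "\<dots> = bd (h u) \<rho>"
          by (rule bd_cong) (use v fin in \<open>simp add: y_def h_def u_def valid_remove\<close>)
        finally show ?thesis .
      qed
      ultimately show ?thesis by (simp add: u_def)
    qed
  qed
  then show ?thesis using y by blast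
qed

text \<open>The column \<open>l = 0\<close> is the standard complex of the kernel. For
  \<open>T > n\<close> there are no sets of \<open>Suc T\<close> coordinates, and the cochain is
  zero.\<close>

lemma corner_exact:
  assumes supp: "\<And>i j k. i \<ge> B \<Longrightarrow> \<phi> (i, j, k) = 0" and surj: "surj_degree n A B \<phi> a0"
    and range: "Suc T \<le> n \<or> a \<ge> - int n \<or> T > n" and "T > 0" and low: "T \<ge> 2 \<or> a \<ge> int a0 \<or> a + 1 < 0"
    and z: "z \<in> C 0 (Suc T)" "dS z = 0"
  shows "\<exists>y\<in>C 0 T. dS y = z"
proof (cases "T > n")
  case True
  have "card \<rho> \<noteq> Suc T" if "\<rho> \<subseteq> {..n}" for \<rho> :: "nat set"
    using card_mono[OF finite_atMost that] True by simp
  then have "z = 0" using C_zero[OF z(1)] by (intro ext) (auto simp: valid_def)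
  moreover have "0 \<in> C 0 T"
    by (intro C_I) (auto simp: zero_fun_def intro!: vsec_zero G_hforms)
  moreover have "dS 0 = 0" using dS_diff[of 0 0] by simp
  ultimately show ?thesis by auto
next
  case False
  then have range': "Suc T \<le> n \<or> a \<ge> - int n" using range by simp
  have G0: "G [] \<rho> = XR \<rho>" for \<rho> by (simp add: G_def)
  have v0: "valid [] \<rho> \<longleftrightarrow> \<rho> \<subseteq> {..n}" for \<rho> by (simp add: valid_def)
  have "\<exists>y. (\<forall>\<rho>. \<rho> \<subseteq> {..n} \<and> card \<rho> = T \<longrightarrow> y \<rho> \<in> vsec n A \<phi> a (XR \<rho>)) \<and>
    (\<forall>\<rho> x j. \<rho> \<subseteq> {..n} \<and> card \<rho> = Suc T \<and> x \<in> vdom n (XR \<rho>) \<longrightarrow> bd (\<lambda>\<rho>. y \<rho> x j) \<rho> = z [] \<rho> x j)"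
  proof (rule kernel_standard_exact[OF supp surj _ _ range' assms(4) low])
    fix \<rho> assume "\<rho> \<subseteq> {..n}" "card \<rho> = Suc T"
    then show "z [] \<rho> \<in> vsec n A \<phi> a (XR \<rho>)" using C_mem[OF z(1), of "[]" \<rho>] by (simp add: G0 v0)
  next
    fix \<rho> x j assume "\<rho> \<subseteq> {..n}" "x \<in> vdom n (XR \<rho>)"
    then have "dS z [] \<rho> x j = bd (\<lambda>\<rho>. z [] \<rho> x j) \<rho>" by (simp add: dS_def G0 v0)
    then show "bd (\<lambda>\<rho>. z [] \<rho> x j) \<rho> = 0" using z(2) by simp
  qed
  then obtain y where y': "(\<forall>\<rho>. \<rho> \<subseteq> {..n} \<and> card \<rho> = T \<longrightarrow> y \<rho> \<in> vsec n A \<phi> a (XR \<rho>)) \<and>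
    (\<forall>\<rho> x j. \<rho> \<subseteq> {..n} \<and> card \<rho> = Suc T \<and> x \<in> vdom n (XR \<rho>) \<longrightarrow> bd (\<lambda>\<rho>. y \<rho> x j) \<rho> = z [] \<rho> x j)" ..
  have y: "y \<rho> \<in> vsec n A \<phi> a (XR \<rho>)" if "\<rho> \<subseteq> {..n}" "card \<rho> = T" for \<rho>
    using y'[THEN conjunct1] that by simp
  have bdy: "bd (\<lambda>\<rho>. y \<rho> x j) \<rho> = z [] \<rho> x j"
    if "\<rho> \<subseteq> {..n}" "card \<rho> = Suc T" "x \<in> vdom n (XR \<rho>)" for \<rho> x j
    using y'[THEN conjunct2] that by simp
  define Y :: bicochain where "Y \<sigma> \<rho> = (if \<sigma> = [] \<and> \<rho> \<subseteq> {..n} \<and> card \<rho> = T then y \<rho> else (\<lambda>_ _. 0))" for \<sigma> \<rho>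
  have Y: "Y \<in> C 0 T"
    by (rule C_I) (use y in \<open>auto simp: Y_def v0 G0\<close>)
  have "dS Y = z"
  proof (intro ext)
    fix \<sigma> \<rho> x j
    show "dS Y \<sigma> \<rho> x j = z \<sigma> \<rho> x j"
    proof (cases "valid \<sigma> \<rho> \<and> length \<sigma> = 0 \<and> card \<rho> = Suc T \<and> x \<in> vdom n (G \<sigma> \<rho>)")
      case False
      have "dS Y \<sigma> \<rho> x j = 0"
      proof (cases "valid \<sigma> \<rho> \<and> length \<sigma> = 0 \<and> card \<rho> = Suc T")
        case True
        then show ?thesis using False by (auto simp: dS_def)
      qed (rule C_zero[OF dS_C[OF Y]])
      moreover have "z \<sigma> \<rho> x j = 0"
        using False C_zero[OF z(1), of \<sigma> \<rho> x j] C_outside[OF z(1), of \<rho> x \<sigma> j] valid_finite by auto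
      ultimately show ?thesis by simp
    next
      case True
      then have \<sigma>: "\<sigma> = []" and \<rho>: "\<rho> \<subseteq> {..n}" "card \<rho> = Suc T" and x: "x \<in> vdom n (XR \<rho>)"
        by (auto simp: v0 G0)
      have "dS Y \<sigma> \<rho> x j = bd (\<lambda>\<rho>. Y \<sigma> \<rho> x j) \<rho>" using True by (auto simp: dS_def)
      also have "\<dots> = bd (\<lambda>\<rho>. y \<rho> x j) \<rho>"
        by (rule bd_cong) (use \<rho> \<sigma> finite_subset[OF \<rho>(1)] in \<open>auto simp: Y_def\<close>)
      finally show ?thesis using bdy[OF \<rho> x] \<sigma> by simp
    qed
  qed
  then show ?thesis using Y by blast
qed

lemma covering_exact:
  assumes "\<And>i j k. i \<ge> B \<Longrightarrow> \<phi> (i, j, k) = 0" and "surj_degree n A B \<phi> a0"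
    and "Suc T \<le> n \<or> a \<ge> - int n \<or> T > n" and "T > 0" and "T \<ge> 2 \<or> a \<ge> int a0 \<or> a + 1 < 0"
    and "z \<in> C (Suc T) 0" and "dW z = 0"
  shows "\<exists>y\<in>C T 0. dW y = z"
proof (rule double_complex_exact[where C = C and dW = dW and dS = dS])
  show "\<exists>y\<in>C 0 T. dS y = z" if "z \<in> C 0 (Suc T)" "dS z = 0" for z
    by (rule corner_exact[OF assms(1-5) that])
  show "\<exists>y\<in>C l s. dW y = z" if "0 < s" "z \<in> C (Suc l) s" "dW z = 0" for l s z
    by (rule row_exact[OF that])
  show "z = 0" if "z \<in> C 0 s" "dW z = 0" for s z by (rule row_injective[OF that])
  show "\<exists>y\<in>C l s. dS y = z" if "0 < l" "z \<in> C l (Suc s)" "dS z = 0" for l s z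
    by (rule column_exact[OF that])
  show "z = 0" if "z \<in> C l 0" "dS z = 0" for l z by (rule column_injective[OF that])
qed (simp_all add: C_diff dW_C dS_C dW_diff dS_diff dW_dW dS_dS dW_dS assms)

end

section \<open>Local surjectivity\<close>

lemma twist_restrict:
  assumes s: "s \<in> twist n a U" and W': "openin (zariski_proj n) W'" "W' \<subseteq> U"
  shows "(\<lambda>x. if x \<in> \<Union>W' then s x else 0) \<in> twist n a W'"
  unfolding twist_def
proof (intro CollectI conjI allI impI ballI)
  fix L assume L: "L \<in> W'"
  then have "L \<in> U" using W' by blast
  from s[unfolded twist_def, THEN CollectD, THEN conjunct2, THEN bspec, OF this]
  obtain W d e p q where W: "openin (zariski_proj n) W" "L \<in> W" "p \<in> forms n d" "q \<in> forms n e"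
    "int d - int e = a" "\<forall>x\<in>\<Union>W. eval_poly q x \<noteq> 0 \<and> s x = eval_poly p x / eval_poly q x"
    by (elim exE bexE conjE)
  show "\<exists>W. openin (zariski_proj n) W \<and> L \<in> W \<and> W \<subseteq> W' \<and>
    (\<exists>d e. \<exists>p\<in>forms n d. \<exists>q\<in>forms n e. int d - int e = a \<and>
      (\<forall>x\<in>\<Union>W. eval_poly q x \<noteq> 0 \<and> (if x \<in> \<Union>W' then s x else 0) = eval_poly p x / eval_poly q x))"
  proof (intro exI conjI bexI)
    show "openin (zariski_proj n) (W \<inter> W')" using W(1) W'(1) by blast
    show "\<forall>x\<in>\<Union>(W \<inter> W'). eval_poly q x \<noteq> 0 \<and>
      (if x \<in> \<Union>W' then s x else 0) = eval_poly p x / eval_poly q x"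
    proof (intro ballI)
      fix x assume "x \<in> \<Union>(W \<inter> W')"
      then have "x \<in> \<Union>W" "x \<in> \<Union>W'" by blast+
      then show "eval_poly q x \<noteq> 0 \<and> (if x \<in> \<Union>W' then s x else 0) = eval_poly p x / eval_poly q x"
        using W(6)[rule_format, OF \<open>x \<in> \<Union>W\<close>] by (simp del: Union_iff)
    qed
  qed (use L W in auto)
qed (simp del: Union_iff)

text \<open>Every point has a neighbourhood of the form \<open>D(h * x\<^sub>l)\<close> inside the
  given set, where surjectivity in one degree lifts sections. \<open>supp\<close> concerns the
  components from \<open>B\<close> on, which \<open>hom_apply\<close> also computes and which must
  vanish as those of \<open>s\<close> do.\<close>

lemma hom_surjective_if_surj_degree:
  assumes supp: "\<And>i j k. i \<ge> B \<Longrightarrow> \<phi> (i, j, k) = 0" and surj: "surj_degree n A B \<phi> a0"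
  shows "hom_surjective n A B \<phi>"
  unfolding hom_surjective_def
proof (intro allI impI ballI)
  fix U s L
  assume U: "openin (zariski_proj n) U" and s: "s \<in> twist_sum n B 1 U" and L: "L \<in> U"
  obtain d h where h: "d > 0" "h \<in> hforms n (int d)" "L \<in> Dset n h" "Dset n h \<subseteq> U"
    by (rule zariski_proj_basis[OF U L])
  obtain x0 where x0: "x0 \<in> pcone n" "L = line x0" using h(3) Dset_subset proj_space_eq by blast
  obtain l where l: "l \<le> n" "x0 l \<noteq> 0" by (rule cone_nonzero_coord[OF x0(1)])
  have Xl: "X l \<in> hforms n (int 1)" using l by simp
  define g where "g = h * X l"
  have g: "g \<in> hforms n (int (Suc d))"
    using hforms_mult[OF h(2) Xl] by (simp add: g_def add.commute)
  have W: "openin (zariski_proj n) (Dset n g)" "L \<in> Dset n g" "Dset n g \<subseteq> U"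
    using openin_Dset[OF g] h(3,4) line_in_Dset[OF Xl x0(1)] l x0(2) by (auto simp: g_def Dset_mult)
  define w where "w i x = (if x \<in> \<Union>(Dset n g) then s x i else 0)" for i x
  have w: "w i \<in> sec n (0 + 1) (h * X l)" if "i < B" for i
  proof -
    have "(\<lambda>x. s x i) \<in> twist n 1 U" using s that by (simp add: twist_sum_def)
    from twist_restrict[OF this W(1,3)] have "w i \<in> twist n 1 (Dset n g)" by (simp only: w_def[abs_def])
    then show ?thesis using twist_Dset[OF g] by (simp add: g_def)
  qed
  have "\<exists>w'. (\<forall>j. w' j \<in> sec n 0 (h * X l)) \<and>
      (\<forall>i<B. \<forall>x\<in>vdom n (h * X l). (\<Sum>j<A. eval_poly (lin n \<phi> i j) x * w' j x) = w i x)"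
    by (rule sec_lift_local[OF surj l(1) h(2)]) (rule w)
  then obtain w' where
    w'': "(\<forall>j. w' j \<in> sec n 0 (h * X l)) \<and>
      (\<forall>i<B. \<forall>x\<in>vdom n (h * X l). (\<Sum>j<A. eval_poly (lin n \<phi> i j) x * w' j x) = w i x)" ..
  have w': "w' j \<in> sec n 0 g"
    "i < B \<Longrightarrow> x \<in> vdom n g \<Longrightarrow> (\<Sum>j<A. eval_poly (lin n \<phi> i j) x * w' j x) = w i x" for i j x
    using w'' unfolding g_def by simp_all
  define u :: vsection where "u x j = (if j < A then w' j x else 0)" for x j
  have "u \<in> twist_sum n A 0 (Dset n g)"
    using w'(1) twist_Dset[OF g] by (simp add: twist_sum_def u_def)
  moreover have "hom_apply n A \<phi> u = res (Dset n g) s"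
  proof (intro ext)
    fix x i
    show "hom_apply n A \<phi> u x i = res (Dset n g) s x i"
    proof (cases "i < B \<and> x \<in> vdom n g")
      case True
      then have "hom_apply n A \<phi> u x i = w i x" using w'(2) by (simp add: hom_apply_lin u_def)
      then show ?thesis using True Union_Dset[OF g] by (simp add: w_def res_def)
    next
      case False
      then consider "i \<ge> B" | "x \<notin> vdom n g" by linarith
      then show ?thesis
      proof cases
        case 1
        then have "s x i = 0" using s by (simp add: twist_sum_def)
        then show ?thesis using 1 by (simp add: hom_apply_def supp res_def)
      next
        case 2
        then have "u x j = 0" for j using sec_outside[OF w'(1)] by (simp add: u_def)
        then show ?thesis using 2 Union_Dset[OF g] by (simp add: hom_apply_def res_def)
      qed
    qed
  qed
  ultimately show "\<exists>W. openin (zariski_proj n) W \<and> L \<in> W \<and> W \<subseteq> U \<and>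
    (\<exists>u\<in>twist_sum n A 0 W. hom_apply n A \<phi> u = res W s)" using W by blast
qed

section \<open>Cech cohomology of the kernel\<close>

lemma kernel_twist_restrict:
  assumes "s \<in> kernel_twist n A \<phi> a U" "openin (zariski_proj n) W" "W \<subseteq> U"
  shows "res W s \<in> kernel_twist n A \<phi> a W"
proof -
  have "hom_apply n A \<phi> (res W s) x i = (if x \<in> \<Union>W then hom_apply n A \<phi> s x i else 0)" for x i
    by (simp add: hom_apply_def res_def)
  then have "hom_apply n A \<phi> (res W s) = (\<lambda>_ _. 0)"
    using assms(1) by (intro ext) (simp add: kernel_twist_def del: Union_iff)
  then show ?thesis
    using assms twist_restrict[OF _ assms(2,3)]
    by (simp add: kernel_twist_def twist_sum_def res_def del: Union_iff)
qed

text \<open>Even the zero section must be written locally as a quotient whose degrees differ by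
  \<open>a\<close>. For negative \<open>a\<close> this takes a nonvanishing denominator of large
  degree, a power of \<open>h\<close>.\<close>

lemma zero_in_kernel_twist: "(\<lambda>_ _. 0) \<in> kernel_twist n A \<phi> a (proj_space n)"
proof -
  have "(\<lambda>_. 0) \<in> twist n a (proj_space n)"
    unfolding twist_def
  proof (intro CollectI conjI ballI)
    fix L assume "L \<in> proj_space n"
    obtain d h where h: "d > 0" "h \<in> hforms n (int d)" "L \<in> Dset n h" "Dset n h \<subseteq> proj_space n"
      by (rule zariski_proj_basis[OF openin_proj_space \<open>L \<in> proj_space n\<close>])
    define k where "k = nat (- a)"
    have "k \<le> k * d" using h(1) by simp
    then have "int k \<le> int (k * d)" by (simp only: of_nat_le_iff)
    moreover have "- a \<le> int k" by (simp add: k_def)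
    ultimately have "a + int (k * d) \<ge> 0" by linarith
    then have "int (nat (a + int (k * d))) - int (k * d) = a" by simp
    moreover have "h ^ k \<in> forms n (k * d)"
      using hforms_power[OF h(2), of k] by (simp add: forms_eq_hforms)
    moreover have "0 \<in> forms n (nat (a + int (k * d)))" by (simp add: forms_eq_hforms)
    moreover have "\<forall>x\<in>\<Union>(Dset n h). eval_poly (h ^ k) x \<noteq> 0 \<and> (0::complex) = eval_poly 0 x / eval_poly (h ^ k) x"
      unfolding Union_Dset[OF h(2)] by (simp add: vdom_def)
    ultimately show "\<exists>W. openin (zariski_proj n) W \<and> L \<in> W \<and> W \<subseteq> proj_space n \<and>
      (\<exists>d e. \<exists>p\<in>forms n d. \<exists>q\<in>forms n e. int d - int e = a \<and>
        (\<forall>x\<in>\<Union>W. eval_poly q x \<noteq> 0 \<and> 0 = eval_poly p x / eval_poly q x))"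
      using openin_Dset[OF h(2)] h(3,4) by blast
  qed simp
  then show ?thesis by (simp add: kernel_twist_def twist_sum_def hom_apply_def)
qed

text \<open>Quasi-compactness by the Nullstellensatz: a power of each coordinate is a combination of
  finitely many forms from \<open>H\<close>, so where the coordinate is nonzero one of these is.
  Both covers are refined at once, because two classes are compared on a single covering.\<close>

lemma common_basic_refinement:
  assumes U: "open_cover (zariski_proj n) \<U>" and U': "open_cover (zariski_proj n) \<U>'"
  obtains \<W> f dg \<tau> \<tau>' where "basic_covering n \<W> f dg" "\<And>W. W \<in> \<W> \<Longrightarrow> W = Dset n (f W)"
    "open_cover (zariski_proj n) \<W>" "refines_by \<tau> \<W> \<U>" "refines_by \<tau>' \<W> \<U>'"
proof -
  define H where "H = {h. (\<exists>d>0. h \<in> hforms n (int d)) \<and> (\<exists>V\<in>\<U>. Dset n h \<subseteq> V) \<and> (\<exists>V\<in>\<U>'. Dset n h \<subseteq> V)}"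
  have Hx: "\<exists>h\<in>H. eval_poly h x \<noteq> 0" if x: "x \<in> pcone n" for x
  proof -
    have "line x \<in> proj_space n" using x by (simp add: proj_space_eq)
    then obtain V V' where V: "V \<in> \<U>" "V' \<in> \<U>'" "line x \<in> V \<inter> V'"
      using U U' unfolding open_cover_def topspace_zariski_proj by blast
    then have "openin (zariski_proj n) (V \<inter> V')" using U U' by (auto simp: open_cover_def)
    then obtain d h where h: "d > 0" "h \<in> hforms n (int d)" "line x \<in> Dset n h" "Dset n h \<subseteq> V \<inter> V'"
      using zariski_proj_basis V(3) by blast
    then have "h \<in> H" using V unfolding H_def by blast
    then show ?thesis using line_in_Dset[OF h(2) x] h(3) by blast
  qed
  have "\<forall>h. \<exists>d. h \<in> H \<longrightarrow> d > 0 \<and> h \<in> hforms n (int d)" unfolding H_def by blast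
  from choice[OF this] obtain \<delta> where \<delta>: "\<And>h. h \<in> H \<Longrightarrow> \<delta> h > 0 \<and> h \<in> hforms n (int (\<delta> h))" by blast
  have "\<exists>F. finite F \<and> F \<subseteq> H \<and> (\<forall>x. x l \<noteq> 0 \<longrightarrow> (\<exists>h\<in>F. eval_poly h x \<noteq> 0))" if l: "l \<le> n" for l
  proof -
    have "\<exists>N F c. finite F \<and> F \<subseteq> H \<and> X l ^ N = (\<Sum>h\<in>F. c h * h) \<and>
      (\<forall>h\<in>F. c h \<in> hforms n (int (N * 1) - int (\<delta> h)))"
    proof (rule homogeneous_Nullstellensatz[where q = "\<lambda>h. h"])
      fix x assume "x \<in> affine_space {..n}" "x \<noteq> (\<lambda>_. 0)"
        and zero: "\<And>h. h \<in> H \<Longrightarrow> eval_poly h x = 0"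
      then have "x \<in> pcone n" by (simp add: pcone_def)
      then show "eval_poly (X l) x = 0" using Hx[of x] zero by blast
    qed (use \<delta> l in auto)
    then obtain N F c where F: "finite F" "F \<subseteq> H" "X l ^ N = (\<Sum>h\<in>F. c h * h)" by blast
    have "\<exists>h\<in>F. eval_poly h x \<noteq> 0" if "x l \<noteq> 0" for x
    proof (rule ccontr)
      assume no: "\<not> (\<exists>h\<in>F. eval_poly h x \<noteq> 0)"
      have "eval_poly (X l ^ N) x = (\<Sum>h\<in>F. eval_poly (c h) x * eval_poly h x)" unfolding F(3) by simp
      also have "\<dots> = 0" using no by (intro sum.neutral) auto
      finally show False using that by simp
    qed
    then show ?thesis using F by blast
  qed
  then have "\<forall>l\<in>{..n}. \<exists>F. finite F \<and> F \<subseteq> H \<and> (\<forall>x. x l \<noteq> 0 \<longrightarrow> (\<exists>h\<in>F. eval_poly h x \<noteq> 0))" by simp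
  from bchoice[OF this] obtain F where
    F': "\<forall>l\<in>{..n}. finite (F l) \<and> F l \<subseteq> H \<and> (\<forall>x. x l \<noteq> 0 \<longrightarrow> (\<exists>h\<in>F l. eval_poly h x \<noteq> 0))" ..
  have F: "finite (F l)" "F l \<subseteq> H" "x l \<noteq> 0 \<Longrightarrow> \<exists>h\<in>F l. eval_poly h x \<noteq> 0" if "l \<le> n" for l x
    using F'[THEN bspec, of l] that by auto
  define F' where "F' = (\<Union>l\<le>n. F l)"
  have F': "finite F'" "F' \<subseteq> H" using F(1,2) by (auto simp: F'_def)
  have F'x: "\<exists>h\<in>F'. eval_poly h x \<noteq> 0" if x: "x \<in> pcone n" for x
  proof -
    obtain l where l: "l \<le> n" "x l \<noteq> 0" by (rule cone_nonzero_coord[OF x])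
    then show ?thesis using F(3)[of l x] l by (auto simp: F'_def)
  qed
  define \<W> where "\<W> = Dset n ` F'"
  have "\<forall>W. \<exists>h. W \<in> \<W> \<longrightarrow> h \<in> F' \<and> W = Dset n h" by (auto simp: \<W>_def)
  from choice[OF this] obtain f where f: "\<And>W. W \<in> \<W> \<Longrightarrow> f W \<in> F'" "\<And>W. W \<in> \<W> \<Longrightarrow> W = Dset n (f W)" by blast
  have fH: "f W \<in> H" if "W \<in> \<W>" for W using f(1)[OF that] F'(2) by blast
  have f\<delta>: "f W \<in> hforms n (int (\<delta> (f W)))" "\<delta> (f W) > 0" if "W \<in> \<W>" for W
    using \<delta>[OF fH[OF that]] by auto
  have cov: "\<exists>W\<in>\<W>. eval_poly (f W) x \<noteq> 0" if x: "x \<in> pcone n" for x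
  proof -
    obtain h where h: "h \<in> F'" "eval_poly h x \<noteq> 0" using F'x[OF x] by blast
    then have hH: "h \<in> hforms n (int (\<delta> h))" using \<delta> F'(2) by blast
    define W where "W = Dset n h"
    have W: "W \<in> \<W>" using h by (simp add: W_def \<W>_def)
    have "line x \<in> W" unfolding W_def line_in_Dset[OF hH x] by (rule h(2))
    then have "line x \<in> Dset n (f W)" using f(2)[OF W] by simp
    then show ?thesis using W line_in_Dset[OF f\<delta>(1)[OF W] x] by blast
  qed
  have "basic_covering n \<W> f (\<lambda>W. \<delta> (f W))"
    by unfold_locales (use F'(1) f\<delta> cov in \<open>auto simp: \<W>_def\<close>)
  moreover have "open_cover (zariski_proj n) \<W>"
    unfolding open_cover_def topspace_zariski_proj
  proof
    show "\<forall>W\<in>\<W>. openin (zariski_proj n) W" using openin_Dset f\<delta>(1) f(2) by metis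
    show "\<Union>\<W> = proj_space n"
    proof
      show "\<Union>\<W> \<subseteq> proj_space n" using Dset_subset by (auto simp: \<W>_def)
      show "proj_space n \<subseteq> \<Union>\<W>"
      proof
        fix L assume "L \<in> proj_space n"
        then obtain x where x: "x \<in> pcone n" "L = line x" by (auto simp: proj_space_eq)
        then obtain W where W: "W \<in> \<W>" "eval_poly (f W) x \<noteq> 0" using cov by blast
        then have "L \<in> W" using line_in_Dset[OF f\<delta>(1)[OF W(1)] x(1)] f(2)[OF W(1)] x(2) by simp
        then show "L \<in> \<Union>\<W>" using W(1) by blast
      qed
    qed
  qed
  moreover have "\<forall>W\<in>\<W>. \<exists>V. V \<in> \<U> \<and> W \<subseteq> V"
  proof
    fix W assume W: "W \<in> \<W>"
    then show "\<exists>V. V \<in> \<U> \<and> W \<subseteq> V" using fH[OF W] f(2)[OF W] unfolding H_def by auto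
  qed
  from bchoice[OF this] obtain \<tau> where "\<forall>W\<in>\<W>. \<tau> W \<in> \<U> \<and> W \<subseteq> \<tau> W" ..
  then have "refines_by \<tau> \<W> \<U>" by (simp add: refines_by_def)
  moreover have "\<forall>W\<in>\<W>. \<exists>V. V \<in> \<U>' \<and> W \<subseteq> V"
  proof
    fix W assume W: "W \<in> \<W>"
    then show "\<exists>V. V \<in> \<U>' \<and> W \<subseteq> V" using fH[OF W] f(2)[OF W] unfolding H_def by auto
  qed
  from bchoice[OF this] obtain \<tau>' where "\<forall>W\<in>\<W>. \<tau>' W \<in> \<U>' \<and> W \<subseteq> \<tau>' W" ..
  then have "refines_by \<tau>' \<W> \<U>'" by (simp add: refines_by_def)
  ultimately show thesis using that f(2) by blast
qed

lemma coboundary_eq: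
  assumes "\<sigma> \<in> simplices \<U> (p + 1)"
  shows "coboundary \<U> p z \<sigma> x j =
    (\<Sum>k<length \<sigma>. (- 1) ^ k * (if x \<in> \<Union>(\<Inter>(set \<sigma>)) then z (del k \<sigma>) x j else 0))"
proof -
  have "{..<length \<sigma>} = {..p + 1}" using assms by (auto simp: simplices_def)
  then show ?thesis using assms by (simp add: coboundary_def res_def del_def del: Union_iff)
qed

lemma pullback_cocycle:
  assumes z: "z \<in> cocycles (kernel_twist n A \<phi> a) \<U> p"
    and ref: "refines_by \<tau> \<W> \<U>" and cov: "open_cover (zariski_proj n) \<W>"
  shows "pullback \<tau> \<W> p z \<in> cocycles (kernel_twist n A \<phi> a) \<W> p"
proof -
  have map: "map \<tau> \<sigma> \<in> simplices \<U> q" "\<Inter>(set \<sigma>) \<subseteq> \<Inter>(set (map \<tau> \<sigma>))"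
    if "\<sigma> \<in> simplices \<W> q" for \<sigma> q
    using that ref by (auto simp: simplices_def refines_by_def)
  have op: "openin (zariski_proj n) (\<Inter>(set \<sigma>))" if "\<sigma> \<in> simplices \<W> q" for \<sigma> q
  proof -
    have "set \<sigma> \<noteq> {}" "\<And>W. W \<in> set \<sigma> \<Longrightarrow> openin (zariski_proj n) W"
      using that cov by (auto simp: simplices_def open_cover_def)
    then show ?thesis by (intro openin_Inter) auto
  qed
  have zc: "z \<sigma> \<in> kernel_twist n A \<phi> a (\<Inter>(set \<sigma>))" if "\<sigma> \<in> simplices \<U> p" for \<sigma>
    using z that by (auto simp: cocycles_def cochains_def)
  have "pullback \<tau> \<W> p z \<in> cochains (kernel_twist n A \<phi> a) \<W> p"
    unfolding cochains_def
  proof (intro CollectI conjI ballI allI impI)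
    fix \<sigma> assume \<sigma>: "\<sigma> \<in> simplices \<W> p"
    from kernel_twist_restrict[OF zc[OF map(1)[OF \<sigma>]] op[OF \<sigma>] map(2)[OF \<sigma>]]
    show "pullback \<tau> \<W> p z \<sigma> \<in> kernel_twist n A \<phi> a (\<Inter>(set \<sigma>))" using \<sigma> by (simp add: pullback_def)
  qed (simp add: pullback_def)
  moreover have "coboundary \<W> p (pullback \<tau> \<W> p z) = zero_cochain"
  proof (intro ext)
    fix \<sigma> x j
    show "coboundary \<W> p (pullback \<tau> \<W> p z) \<sigma> x j = zero_cochain \<sigma> x j"
    proof (cases "\<sigma> \<in> simplices \<W> (p + 1) \<and> x \<in> \<Union>(\<Inter>(set \<sigma>))")
      case False
      then show ?thesis
      proof (cases "\<sigma> \<in> simplices \<W> (p + 1)")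
        case True
        then show ?thesis using False by (simp add: coboundary_eq zero_cochain_def del: Union_iff)
      qed (simp add: coboundary_def zero_cochain_def)
    next
      case True
      then have \<sigma>: "\<sigma> \<in> simplices \<W> (p + 1)" and x: "x \<in> \<Union>(\<Inter>(set \<sigma>))" by auto
      have x': "x \<in> \<Union>(\<Inter>(set (map \<tau> \<sigma>)))" using map(2)[OF \<sigma>] x by blast
      have "pullback \<tau> \<W> p z (del k \<sigma>) x j = z (del k (map \<tau> \<sigma>)) x j" if k: "k < length \<sigma>" for k
      proof -
        have "del k \<sigma> \<in> simplices \<W> p"
          using \<sigma> set_del[of k \<sigma>] length_del[OF k] by (auto simp: simplices_def)
        moreover have "x \<in> \<Union>(\<Inter>(set (del k \<sigma>)))" using x set_del[of k \<sigma>] by blast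
        moreover have "map \<tau> (del k \<sigma>) = del k (map \<tau> \<sigma>)" by (simp add: del_def take_map drop_map)
        ultimately show ?thesis by (simp add: pullback_def res_def del: Union_iff)
      qed
      then have "coboundary \<W> p (pullback \<tau> \<W> p z) \<sigma> x j = coboundary \<U> p z (map \<tau> \<sigma>) x j"
        unfolding coboundary_eq[OF \<sigma>] coboundary_eq[OF map(1)[OF \<sigma>]]
        using x x' by (simp del: Union_iff set_map)
      then show ?thesis using z by (simp add: cocycles_def zero_cochain_def)
    qed
  qed
  ultimately show ?thesis by (simp add: cocycles_def)
qed

section \<open>Cech cochains as the row \<open>s = 0\<close> of the double complex\<close>

context basic_covering
begin

definition bicochain_of :: "cochain \<Rightarrow> bicochain" where
  "bicochain_of z \<sigma> \<rho> = (if \<rho> = {} then z \<sigma> else (\<lambda>_ _. 0))"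

context
  assumes W_Dset: "\<And>W. W \<in> \<W> \<Longrightarrow> W = Dset n (f W)"
begin

lemma Inter_simplex:
  assumes "set \<sigma> \<subseteq> \<W>" "\<sigma> \<noteq> []"
  shows "\<Inter>(set \<sigma>) = Dset n (G \<sigma> {})"
  using assms
proof (induction \<sigma>)
  case (Cons W \<sigma>)
  have W: "W = Dset n (f W)" using Cons.prems by (intro W_Dset) simp
  show ?case
  proof (cases "\<sigma> = []")
    case True
    then show ?thesis using W by (simp add: G_def)
  next
    case False
    then have "\<Inter>(set (W # \<sigma>)) = Dset n (f W) \<inter> Dset n (G \<sigma> {})" using Cons W by simp
    also have "\<dots> = Dset n (G (W # \<sigma>) {})" unfolding G_Cons Dset_mult by blast
    finally show ?thesis .
  qed
qed simp

lemma dgs_pos: "set \<sigma> \<subseteq> \<W> \<Longrightarrow> \<sigma> \<noteq> [] \<Longrightarrow> dgs \<sigma> > 0"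
  by (cases \<sigma>) (auto simp: dgs_def dg)

lemma kernel_simplex:
  assumes "set \<sigma> \<subseteq> \<W>" "\<sigma> \<noteq> []"
  shows "kernel_twist n A \<phi> a (\<Inter>(set \<sigma>)) = vsec n A \<phi> a (G \<sigma> {})"
    and "\<Union>(\<Inter>(set \<sigma>)) = vdom n (G \<sigma> {})"
proof -
  have g: "G \<sigma> {} \<in> hforms n (int (dgs \<sigma>))" using G_hforms[of \<sigma> "{}"] assms by (simp add: valid_def)
  show "kernel_twist n A \<phi> a (\<Inter>(set \<sigma>)) = vsec n A \<phi> a (G \<sigma> {})"
    unfolding Inter_simplex[OF assms] by (rule kernel_twist_Dset[OF g dgs_pos[OF assms]])
  show "\<Union>(\<Inter>(set \<sigma>)) = vdom n (G \<sigma> {})"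
    unfolding Inter_simplex[OF assms] by (rule Union_Dset[OF g])
qed

lemma coboundary_dW:
  assumes "\<sigma> \<in> simplices \<W> (p + 1)"
  shows "coboundary \<W> p z \<sigma> x j = dW (bicochain_of z) \<sigma> {} x j"
proof -
  have \<sigma>: "set \<sigma> \<subseteq> \<W>" "\<sigma> \<noteq> []" using assms by (auto simp: simplices_def)
  have v: "valid \<sigma> {}" using \<sigma>(1) by (simp add: valid_def)
  show ?thesis
    unfolding coboundary_eq[OF assms] dW_def kernel_simplex(2)[OF \<sigma>] using v
    by (simp add: lbd_def bicochain_of_def)
qed

lemma bicochain_of_C:
  assumes "z \<in> cochains (kernel_twist n A \<phi> a) \<W> p"
  shows "bicochain_of z \<in> C (Suc p) 0"
proof (rule C_I)
  fix \<sigma> \<rho> assume v: "valid \<sigma> \<rho>" "length \<sigma> = Suc p" "card \<rho> = 0"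
  then have \<rho>: "\<rho> = {}" using valid_finite by auto
  have \<sigma>: "set \<sigma> \<subseteq> \<W>" "\<sigma> \<noteq> []" using v by (auto simp: valid_def)
  then have "z \<sigma> \<in> kernel_twist n A \<phi> a (\<Inter>(set \<sigma>))"
    using assms v(2) by (auto simp: cochains_def simplices_def)
  then show "bicochain_of z \<sigma> \<rho> \<in> vsec n A \<phi> a (G \<sigma> \<rho>)"
    using kernel_simplex(1)[OF \<sigma>] by (simp add: \<rho> bicochain_of_def)
next
  fix \<sigma> \<rho> x j assume "\<not> (valid \<sigma> \<rho> \<and> length \<sigma> = Suc p \<and> card \<rho> = 0)"
  then have "\<rho> = {} \<Longrightarrow> \<sigma> \<notin> simplices \<W> p" by (auto simp: valid_def simplices_def)
  then show "bicochain_of z \<sigma> \<rho> x j = 0" using assms by (auto simp: bicochain_of_def cochains_def)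
qed

lemma bicochain_of_cocycle:
  assumes "z \<in> cocycles (kernel_twist n A \<phi> a) \<W> p"
  shows "dW (bicochain_of z) = 0"
proof (intro ext)
  fix \<sigma> \<rho> x j
  have z: "bicochain_of z \<in> C (Suc p) 0" using assms bicochain_of_C by (simp add: cocycles_def)
  show "dW (bicochain_of z) \<sigma> \<rho> x j = 0 \<sigma> \<rho> x j"
  proof (cases "valid \<sigma> \<rho> \<and> length \<sigma> = Suc (Suc p) \<and> card \<rho> = 0")
    case True
    then have "\<rho> = {}" "\<sigma> \<in> simplices \<W> (p + 1)" using valid_finite by (auto simp: valid_def simplices_def)
    then have "dW (bicochain_of z) \<sigma> \<rho> x j = coboundary \<W> p z \<sigma> x j" using coboundary_dW by simp
    then show ?thesis using assms by (simp add: cocycles_def zero_cochain_def)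
  next
    case False
    then show ?thesis using C_zero[OF dW_C[OF z]] by simp
  qed
qed

text \<open>\<open>covering_exact\<close> with \<open>T = p\<close>: a \<open>p\<close>-cochain has
  lists of length \<open>p + 1\<close>, and its primitive found in \<open>C p 0\<close> is a cochain
  of degree \<open>p - 1\<close>.\<close>

lemma cocycle_is_coboundary:
  assumes "\<And>i j k. i \<ge> B \<Longrightarrow> \<phi> (i, j, k) = 0" and "surj_degree n A B \<phi> a0"
    and "Suc p \<le> n \<or> a \<ge> - int n \<or> p > n" and "p > 0" and "p \<ge> 2 \<or> a \<ge> int a0 \<or> a + 1 < 0"
    and z: "z \<in> cocycles (kernel_twist n A \<phi> a) \<W> p"
  shows "z \<in> coboundaries (kernel_twist n A \<phi> a) \<W> p"
proof -
  have zc: "z \<in> cochains (kernel_twist n A \<phi> a) \<W> p" using z by (simp add: cocycles_def)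
  have "\<exists>y\<in>C p 0. dW y = bicochain_of z"
    by (rule covering_exact[OF assms(1-5) bicochain_of_C[OF zc] bicochain_of_cocycle[OF z]])
  then obtain y where y: "y \<in> C p 0" "dW y = bicochain_of z" by blast
  obtain p' where p': "p = Suc p'" using assms(4) gr0_implies_Suc by blast
  define y' :: cochain where "y' \<sigma> = y \<sigma> {}" for \<sigma>
  have "bicochain_of y' = y"
  proof (intro ext)
    fix \<sigma> \<rho> x j
    show "bicochain_of y' \<sigma> \<rho> x j = y \<sigma> \<rho> x j"
    proof (cases "\<rho> = {}")
      case False
      then have "\<not> (valid \<sigma> \<rho> \<and> length \<sigma> = p \<and> card \<rho> = 0)" using valid_finite by auto
      then show ?thesis using C_zero[OF y(1)] False by (simp add: bicochain_of_def)
    qed (simp add: bicochain_of_def y'_def)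
  qed
  have "y' \<in> cochains (kernel_twist n A \<phi> a) \<W> p'"
    unfolding cochains_def
  proof (intro CollectI conjI ballI allI impI)
    fix \<sigma> assume "\<sigma> \<in> simplices \<W> p'"
    then have \<sigma>: "set \<sigma> \<subseteq> \<W>" "\<sigma> \<noteq> []" "length \<sigma> = p" by (auto simp: simplices_def p')
    then show "y' \<sigma> \<in> kernel_twist n A \<phi> a (\<Inter>(set \<sigma>))"
      unfolding kernel_simplex(1)[OF \<sigma>(1,2)] y'_def
      using C_mem[OF y(1), of \<sigma> "{}"] by (simp add: valid_def)
  next
    fix \<sigma> assume no: "\<sigma> \<notin> simplices \<W> p'"
    show "y' \<sigma> = (\<lambda>_ _. 0)"
      by (intro ext) (use no C_zero[OF y(1), of \<sigma> "{}"] in \<open>auto simp: y'_def valid_def simplices_def p'\<close>)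
  qed
  moreover have "z = coboundary \<W> p' y'"
  proof (intro ext)
    fix \<sigma> x j
    show "z \<sigma> x j = coboundary \<W> p' y' \<sigma> x j"
    proof (cases "\<sigma> \<in> simplices \<W> (p' + 1)")
      case True
      have "coboundary \<W> p' y' \<sigma> x j = bicochain_of z \<sigma> {} x j"
        unfolding coboundary_dW[OF True] \<open>bicochain_of y' = y\<close> y(2) ..
      then show ?thesis by (simp add: bicochain_of_def)
    next
      case False
      then show ?thesis using zc by (simp add: coboundary_def cochains_def p')
    qed
  qed
  ultimately show ?thesis by (auto simp: p')
qed

text \<open>A global section of the kernel is a kernel vector of polynomials, by the exactness of the
  augmented standard complex of \<open>O(a)\<close>.\<close>

lemma cocycle_zero:
  assumes "n \<ge> 1" and inj: "a < 0 \<or> a \<le> int b0 \<and> inj_degree n A B \<phi> b0"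
    and z: "z \<in> cocycles (kernel_twist n A \<phi> a) \<W> 0"
  shows "z = zero_cochain"
proof -
  define Z where "Z = bicochain_of z"
  have Z: "Z \<in> C (Suc 0) 0" "dW Z = 0"
    using bicochain_of_C[of z 0] bicochain_of_cocycle[OF z] z by (simp_all add: Z_def cocycles_def)
  have d0: "dS 0 = 0" using dS_diff[of 0 0] by simp
  have "dW (dS Z) = 0" using Z(2) d0 by (simp add: dW_dS)
  \<comment> \<open>Row exactness at \<open>s = 1\<close> transfers the cocycle to the standard
    covering: \<open>b\<close> consists of sections over the sets \<open>D(x\<^sub>l)\<close>, and
    \<open>dSb\<close> says that they agree on overlaps.\<close>
  then obtain b where b: "b \<in> C 0 (Suc 0)" "dW b = dS Z"
    using row_exact[OF _ dS_C[OF Z(1)]] by auto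
  have "dW (dS b) = 0" using b(2) dS_dS by (simp add: dW_dS)
  then have dSb: "dS b = 0" using row_injective[OF dS_C[OF b(1)]] by blast
  have G0: "G [] \<rho> = XR \<rho>" for \<rho> by (simp add: G_def)
  have v0: "valid [] \<rho> \<longleftrightarrow> \<rho> \<subseteq> {..n}" for \<rho> by (simp add: valid_def)
  have bmem: "b [] \<rho> \<in> vsec n A \<phi> a (XR \<rho>)" if "\<rho> \<subseteq> {..n}" "card \<rho> = Suc 0" for \<rho>
    using C_mem[OF b(1), of "[]" \<rho>] that by (simp add: G0 v0)
  have single: "{l} \<subseteq> {..n}" "card {l} = Suc 0" if "l \<le> n" for l using that by auto
  have sgn: "ksgn l {l} = (1::complex)" for l
  proof -
    have "{j\<in>{l}. j < l} = {}" by auto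
    then show ?thesis by (simp only: ksgn_def card.empty power_0)
  qed
  have "\<exists>P. P \<in> hforms n a \<and> (\<forall>l\<le>n. \<forall>x\<in>vdom n (X l). b [] {l} x j = eval_poly P x)" if j: "j < A" for j
  proof -
    \<comment> \<open>Here \<open>T = 0\<close>, so the primitive lives on the empty index set.
      There \<open>XR\<close> is \<open>1\<close>, and the section is a polynomial of degree
      \<open>a\<close>.\<close>
    have "\<exists>y. (\<forall>\<rho>. \<rho> \<subseteq> {..n} \<and> card \<rho> = 0 \<longrightarrow> y \<rho> \<in> sec n a (XR \<rho>)) \<and>
      (\<forall>\<rho> x. \<rho> \<subseteq> {..n} \<and> card \<rho> = Suc 0 \<and> x \<in> vdom n (XR \<rho>) \<longrightarrow> bd (\<lambda>\<rho>. y \<rho> x) \<rho> = b [] \<rho> x j)"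
    proof (rule standard_exact)
      show "(\<lambda>x. b [] \<rho> x j) \<in> sec n a (XR \<rho>)" if "\<rho> \<subseteq> {..n}" "card \<rho> = Suc 0" for \<rho>
        using bmem[OF that] j by (simp add: vsec_def)
      fix \<rho> x assume "\<rho> \<subseteq> {..n}" "x \<in> vdom n (XR \<rho>)"
      then have "dS b [] \<rho> x j = bd (\<lambda>\<rho>. b [] \<rho> x j) \<rho>" by (simp add: dS_def G0 v0)
      then show "bd (\<lambda>\<rho>. b [] \<rho> x j) \<rho> = 0" using dSb by simp
    qed (use assms(1) in simp)
    then obtain y where y: "(\<forall>\<rho>. \<rho> \<subseteq> {..n} \<and> card \<rho> = 0 \<longrightarrow> y \<rho> \<in> sec n a (XR \<rho>)) \<and>
      (\<forall>\<rho> x. \<rho> \<subseteq> {..n} \<and> card \<rho> = Suc 0 \<and> x \<in> vdom n (XR \<rho>) \<longrightarrow> bd (\<lambda>\<rho>. y \<rho> x) \<rho> = b [] \<rho> x j)" ..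
    have "y {} \<in> sec n a 1" using y[THEN conjunct1, rule_format, of "{}"] by simp
    moreover have one: "1 \<in> hforms n (int 0)" by simp
    ultimately obtain k P where P: "P \<in> hforms n (a + int (k * 0))" "y {} = fracsec n 1 k P"
      using sec_rep[OF _ one] by blast
    have "b [] {l} x j = eval_poly P x" if "l \<le> n" "x \<in> vdom n (X l)" for l x
    proof -
      have "b [] {l} x j = bd (\<lambda>\<rho>. y \<rho> x) {l}"
        using y[THEN conjunct2, rule_format, of "{l}" x] that by (simp add: XR_def)
      also have "\<dots> = y {} x" by (simp add: bd_def sgn)
      also have "\<dots> = eval_poly P x" using that(2) by (simp add: P(2) fracsec_def vdom_def)
      finally show ?thesis .
    qed
    then show ?thesis using P(1) by (intro exI[of _ P]) simp
  qed
  then have "\<forall>j. \<exists>P. P \<in> hforms n a \<and> (j < A \<longrightarrow> (\<forall>l\<le>n. \<forall>x\<in>vdom n (X l). b [] {l} x j = eval_poly P x))"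
    using hforms_zero by blast
  from choice[OF this] obtain P where P: "\<And>j. P j \<in> hforms n a"
    "\<And>j l x. j < A \<Longrightarrow> l \<le> n \<Longrightarrow> x \<in> vdom n (X l) \<Longrightarrow> b [] {l} x j = eval_poly (P j) x" by blast
  have act0: "act n A \<phi> P i = 0" for i
  proof -
    \<comment> \<open>The relation is known only where \<open>x\<^sub>0\<close> is nonzero; the
      factor takes care of the other points and is cancelled afterwards.\<close>
    have "act n A \<phi> P i * X 0 = 0"
    proof (rule eval_poly_eq_zero)
      fix x :: vec
      define x' where "x' i = (if i \<le> n then x i else 0)" for i
      have "act n A \<phi> P i * X 0 \<in> hforms n (a + 1 + 1)"
        by (intro hforms_mult act_in_hforms P(1) X_in_hforms) simp
      then have "eval_poly (act n A \<phi> P i * X 0) x = eval_poly (act n A \<phi> P i * X 0) x'"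
        by (rule eval_poly_cong) (simp add: x'_def)
      also have "\<dots> = 0"
      proof (cases "x' 0 = 0")
        case False
        then have x': "x' \<in> pcone n" by (auto simp: pcone_def affine_space_def x'_def fun_eq_iff)
        then have dom: "x' \<in> vdom n (X 0)" using False by (simp add: vdom_def)
        have "eval_poly (act n A \<phi> P i) x' = (\<Sum>j<A. eval_poly (lin n \<phi> i j) x' * b [] {0} x' j)"
          unfolding act_def eval_poly_sum eval_poly_mult
          by (rule sum.cong) (use P(2)[OF _ _ dom] in auto)
        also have "\<dots> = hom_apply n A \<phi> (b [] {0}) x' i" by (simp add: hom_apply_lin)
        also have "\<dots> = 0" using bmem[OF single[of 0]] by (simp add: vsec_def)
        finally show ?thesis by simp
      qed simp
      finally show "eval_poly (act n A \<phi> P i * X 0) x = 0" .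
    qed
    moreover have "X 0 \<noteq> 0" using eval_X[of 0 "\<lambda>_. 1"] by (metis eval_poly_zero zero_neq_one)
    ultimately show ?thesis by simp
  qed
  have P0: "P j = 0" if "j < A" for j
    using inj hforms_neg[OF P(1)] act_injective[OF _ _ P(1) act0 that] by blast
  have "b = 0"
  proof (intro ext)
    fix \<sigma> \<rho> x j
    show "b \<sigma> \<rho> x j = 0 \<sigma> \<rho> x j"
    proof (cases "\<sigma> = [] \<and> \<rho> \<subseteq> {..n} \<and> card \<rho> = Suc 0")
      case False
      then show ?thesis using C_zero[OF b(1), of \<sigma> \<rho> x j] by (auto simp: valid_def)
    next
      case True
      then obtain l where l: "\<rho> = {l}" "l \<le> n" by (auto simp: card_Suc_eq)
      note mem = bmem[OF single[OF l(2)]]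
      show ?thesis
      proof (cases "j < A \<and> x \<in> vdom n (X l)")
        case True
        then show ?thesis using P(2)[of j l x] P0[of j] l \<open>\<sigma> = [] \<and> \<rho> \<subseteq> {..n} \<and> card \<rho> = Suc 0\<close> by simp
      next
        case False
        then show ?thesis using mem vsec_outside[OF mem, of x j] l \<open>\<sigma> = [] \<and> \<rho> \<subseteq> {..n} \<and> card \<rho> = Suc 0\<close>
          by (auto simp: vsec_def XR_def)
      qed
    qed
  qed
  then have "dS Z = 0" using b(2) dW_diff[of 0 0] by simp
  then have "Z = 0" using column_injective[OF Z(1)] by blast
  show ?thesis
  proof (intro ext)
    fix \<sigma> x j
    have "z \<sigma> x j = Z \<sigma> {} x j" by (simp add: Z_def bicochain_of_def)
    then show "z \<sigma> x j = zero_cochain \<sigma> x j" using \<open>Z = 0\<close> by (simp add: zero_cochain_def)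
  qed
qed

end

end

section \<open>Vanishing in the limit over all covers\<close>

lemma cochain_diff_cocycle:
  assumes bc: "basic_covering n \<W> f dg" and WD: "\<And>W. W \<in> \<W> \<Longrightarrow> W = Dset n (f W)"
    and z: "z \<in> cocycles (kernel_twist n A \<phi> a) \<W> p" "z' \<in> cocycles (kernel_twist n A \<phi> a) \<W> p"
  shows "(\<lambda>\<sigma> x j. z \<sigma> x j - z' \<sigma> x j) \<in> cocycles (kernel_twist n A \<phi> a) \<W> p"
proof -
  interpret basic_covering n A \<phi> a \<W> f dg by (rule bc)
  have "(\<lambda>\<sigma> x j. z \<sigma> x j - z' \<sigma> x j) \<in> cochains (kernel_twist n A \<phi> a) \<W> p"
    unfolding cochains_def
  proof (intro CollectI conjI ballI allI impI)
    fix \<sigma> assume \<sigma>: "\<sigma> \<in> simplices \<W> p"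
    then have s: "set \<sigma> \<subseteq> \<W>" "\<sigma> \<noteq> []" by (auto simp: simplices_def)
    show "(\<lambda>x j. z \<sigma> x j - z' \<sigma> x j) \<in> kernel_twist n A \<phi> a (\<Inter>(set \<sigma>))"
      using z \<sigma> unfolding kernel_simplex(1)[OF WD s, symmetric]
      by (auto simp: cocycles_def cochains_def kernel_simplex(1)[OF WD s] intro!: vsec_diff)
  qed (use z in \<open>auto simp: cocycles_def cochains_def\<close>)
  moreover have "coboundary \<W> p (\<lambda>\<sigma> x j. z \<sigma> x j - z' \<sigma> x j) = zero_cochain"
  proof (intro ext)
    fix \<sigma> x j
    have "coboundary \<W> p (\<lambda>\<sigma> x j. z \<sigma> x j - z' \<sigma> x j) \<sigma> x j =
      coboundary \<W> p z \<sigma> x j - coboundary \<W> p z' \<sigma> x j"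
    proof (cases "\<sigma> \<in> simplices \<W> (p + 1)")
      case True
      show ?thesis unfolding coboundary_eq[OF True] sum_subtractf[symmetric]
        by (rule sum.cong) (auto simp: algebra_simps)
    qed (simp add: coboundary_def)
    then show "coboundary \<W> p (\<lambda>\<sigma> x j. z \<sigma> x j - z' \<sigma> x j) \<sigma> x j = zero_cochain \<sigma> x j"
      using z by (simp add: cocycles_def zero_cochain_def)
  qed
  ultimately show ?thesis by (simp add: cocycles_def)
qed

text \<open>The difference of two cocycles, pulled back to a common basic refinement, is a
  coboundary there by assumption. So any two representatives are related and each class is the whole
  set \<open>S\<close>, which the zero cochain on the trivial cover shows to be nonempty.\<close>

lemma cohomology_vanishes:
  assumes exact: "\<And>\<W> f dg z. basic_covering n \<W> f dg \<Longrightarrow> (\<And>W. W \<in> \<W> \<Longrightarrow> W = Dset n (f W)) \<Longrightarrow>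
    z \<in> cocycles (kernel_twist n A \<phi> a) \<W> p \<Longrightarrow> z \<in> coboundaries (kernel_twist n A \<phi> a) \<W> p"
  shows "is_singleton (cohomology (zariski_proj n) (kernel_twist n A \<phi> a) p)"
proof -
  let ?X = "zariski_proj n" and ?F = "kernel_twist n A \<phi> a"
  define S where "S = {(\<U>, z). open_cover ?X \<U> \<and> z \<in> cocycles ?F \<U> p}"
  have related: "(c, c') \<in> cohomologous ?X ?F p" if "c \<in> S" "c' \<in> S" for c c'
  proof -
    obtain \<U> z \<U>' z' where c: "c = (\<U>, z)" "c' = (\<U>', z')" by (cases c, cases c')
    then have U: "open_cover ?X \<U>" "z \<in> cocycles ?F \<U> p" "open_cover ?X \<U>'" "z' \<in> cocycles ?F \<U>' p"
      using that by (auto simp: S_def)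
    obtain \<W> f dg \<tau> \<tau>' where W: "basic_covering n \<W> f dg" "\<And>W. W \<in> \<W> \<Longrightarrow> W = Dset n (f W)"
      "open_cover ?X \<W>" "refines_by \<tau> \<W> \<U>" "refines_by \<tau>' \<W> \<U>'"
      by (rule common_basic_refinement[OF U(1,3)]) blast
    have "(\<lambda>\<sigma> x j. pullback \<tau> \<W> p z \<sigma> x j - pullback \<tau>' \<W> p z' \<sigma> x j) \<in> coboundaries ?F \<W> p"
      by (intro exact[OF W(1,2)] cochain_diff_cocycle[OF W(1,2)]
        pullback_cocycle[OF U(2) W(4,3)] pullback_cocycle[OF U(4) W(5,3)])
    then show ?thesis using U W(3-5) unfolding cohomologous_def c by blast
  qed
  have cov: "open_cover ?X {proj_space n}"
    using openin_proj_space[of n] by (simp add: open_cover_def topspace_zariski_proj)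
  have "zero_cochain \<in> cocycles ?F {proj_space n} p"
    unfolding cocycles_def cochains_def
  proof (intro CollectI conjI ballI allI impI ext)
    fix \<sigma> assume "\<sigma> \<in> simplices {proj_space n} p"
    then have "\<sigma> \<noteq> []" "set \<sigma> \<subseteq> {proj_space n}" by (auto simp: simplices_def)
    then have "set \<sigma> = {proj_space n}" by (cases \<sigma>) auto
    then have "\<Inter>(set \<sigma>) = proj_space n" by simp
    then show "zero_cochain \<sigma> \<in> ?F (\<Inter>(set \<sigma>))"
      using zero_in_kernel_twist[of n A \<phi> a] by (simp add: zero_cochain_def)
  qed (auto simp: zero_cochain_def coboundary_def res_def)
  then have ne: "({proj_space n}, zero_cochain) \<in> S" using cov by (simp add: S_def)
  have "cohomologous ?X ?F p `` {c} = S" if "c \<in> S" for c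
  proof
    show "cohomologous ?X ?F p `` {c} \<subseteq> S" by (auto simp: cohomologous_def S_def)
    show "S \<subseteq> cohomologous ?X ?F p `` {c}" using related[OF that] by blast
  qed
  then have "cohomology ?X ?F p = {S}"
    using ne unfolding cohomology_def S_def[symmetric] quotient_def by blast
  then show ?thesis by (simp add: is_singleton_def)
qed

theorem theorem2p11:
  fixes n r t m \<alpha> \<beta> :: nat
  assumes "n \<ge> 1" and "r \<ge> 1" and "t \<ge> 1" and "m \<ge> 1"
    and "m * r \<ge> n"
    and "int \<alpha> = \<lceil>real (t * n) / real r\<rceil>"
    and "int \<beta> = \<lfloor>real (t * n) / real r\<rfloor>"
    and "real m \<ge> max
          (1 / (4 * real (t + r)) * real ((\<alpha> + n - 1) choose n) ^ 2 * real ((\<alpha> + n) choose n))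
          (1 / (4 * real t) * real ((\<beta> + n - 1) choose n) ^ 3)"
  shows "\<exists>\<Phi>. openin (zariski_affine (hom_coords n (m * (t + r)) (m * t))) \<Phi> \<and> \<Phi> \<noteq> {} \<and>
          (\<forall>\<phi>\<in>\<Phi>. hom_surjective n (m * (t + r)) (m * t) \<phi> \<and>
                 natural_cohomology n (kernel_twist n (m * (t + r)) \<phi>))"
proof -
  define A B where "A = m * (t + r)" and "B = m * t"
  note rank = general_maximal_rank[OF assms(1-4,6-8)]
  from rank(4) obtain \<Phi> where \<Phi>: "openin (zariski_affine (hom_coords n A B)) \<Phi>" "\<Phi> \<noteq> {}"
    "\<And>\<phi>. \<phi> \<in> \<Phi> \<Longrightarrow> (\<beta> \<ge> 1 \<longrightarrow> inj_degree n A B \<phi> (\<beta> - 1)) \<and> surj_degree n A B \<phi> (\<alpha> - 1)"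
    unfolding A_def B_def by blast
  have "hom_surjective n A B \<phi> \<and> natural_cohomology n (kernel_twist n A \<phi>)" if \<phi>: "\<phi> \<in> \<Phi>" for \<phi>
  proof
    have "topspace (zariski_affine (hom_coords n A B)) \<subseteq> affine_space (hom_coords n A B)"
      unfolding zariski_affine_def topology_generated_by_topspace by blast
    then have "\<phi> \<in> affine_space (hom_coords n A B)" using openin_subset[OF \<Phi>(1)] \<phi> by blast
    \<comment> \<open>Membership in the affine space makes all coordinates outside
      \<open>hom_coords\<close> zero, in particular the rows from \<open>B\<close> on.\<close>
    then have supp: "\<phi> (i, j, k) = 0" if "i \<ge> B" for i j k
      using that by (auto simp: affine_space_def hom_coords_def)
    have surj: "surj_degree n A B \<phi> (\<alpha> - 1)" and inj: "\<beta> \<ge> 1 \<Longrightarrow> inj_degree n A B \<phi> (\<beta> - 1)"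
      using \<Phi>(3)[OF \<phi>] by auto
    show "hom_surjective n A B \<phi>" by (rule hom_surjective_if_surj_degree[OF supp surj])
    \<comment> \<open>The one degree left to \<open>V(a)\<close>: 0 if the matrix is onto in degree
      \<open>a\<close>, 1 in the middle range, and \<open>n\<close> once the top cohomology of
      \<open>O(a)\<close> can be nonzero.\<close>
    define d where "d a = (if a \<ge> int (\<alpha> - 1) then 0 else if a \<ge> - int n then 1 else n)" for a :: int
    have "is_singleton (cohomology (zariski_proj n) (kernel_twist n A \<phi> a) p)" if p: "p \<noteq> d a" for a p
    proof (rule cohomology_vanishes)
      fix \<W> f dg z
      assume bc: "basic_covering n \<W> f dg" and WD: "\<And>W. W \<in> \<W> \<Longrightarrow> W = Dset n (f W)"
        and z: "z \<in> cocycles (kernel_twist n A \<phi> a) \<W> p"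
      interpret basic_covering n A \<phi> a \<W> f dg by (rule bc)
      show "z \<in> coboundaries (kernel_twist n A \<phi> a) \<W> p"
      proof (cases "p = 0")
        case True
        then have a: "a < int (\<alpha> - 1)" using p by (auto simp: d_def split: if_splits)
        \<comment> \<open>If \<open>a\<close> is not negative, then
          \<open>a \<le> \<alpha> - 2 \<le> \<beta> - 1\<close>, so injectivity in degree
          \<open>\<beta> - 1\<close> reaches down to \<open>a\<close>.\<close>
        have "a < 0 \<or> a \<le> int (\<beta> - 1) \<and> inj_degree n A B \<phi> (\<beta> - 1)"
        proof (cases "a < 0")
          case False
          then have "\<beta> \<ge> 1" "a \<le> int (\<beta> - 1)" using a rank(1,3) by auto
          then show ?thesis using inj by blast
        qed simp
        from cocycle_zero[OF WD assms(1) this] z show ?thesis using True by simp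
      next
        case False
        \<comment> \<open>In degree 1 there are two cases: either
          \<open>a \<ge> \<alpha> - 1\<close>, where global sections of \<open>O(a+1)\<close> lift,
          or \<open>a < - n\<close>, where they are zero. In degree \<open>n\<close> what remains is
          \<open>a \<ge> - n\<close>.\<close>
        show ?thesis
          by (rule cocycle_is_coboundary[OF WD supp surj _ _ _ z])
            (use False p assms(1) in \<open>auto simp: d_def split: if_splits\<close>)
      qed
    qed
    then show "natural_cohomology n (kernel_twist n A \<phi>)"
      unfolding natural_cohomology_def by metis
  qed
  then show ?thesis using \<Phi>(1,2) unfolding A_def B_def by blast
qed

end
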